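(* Let $\{\Sigma_t\}_{t\ge1}$ be the Hoffman--Meeks one-parameter deformation family of the Costa surface. Then $\operatorname{index}(\Sigma_t)\geq 4$ for every $t\ge 1$.
   Context: $\{\Sigma_t\}_{t\geq1}$ denotes the one-parameter family of complete embedded minimal surfaces in $\mathbb{R}^3$ of finite total curvature, genus one and three ends, containing the Costa surface $\Sigma_1$ (constructed by Hoffman--Meeks; see Costa, Invent. Math. 105 (1991)). By Costa's classification every complete embedded minimal surface in $\mathbb{R}^3$ of finite total curvature with genus one and three ends is a member of this family. For each $t$, $\Sigma_t$ is conformally equivalent to $\mathbb{C}/L(it)\setminus\{\pi(0),\pi(1/2),\pi(it/2)\}$, where $L(it)=\{m+int: m,n\in\mathbb{Z}\}$ and $\pi:\mathbb{C}\to\mathbb{C}/L(it)$ is the projection. The surface may be positioned so that the reflections $\tau_1(x_1,x_2,x_3)=(-x_1,x_2,x_3)$ and $\tau_2(x_1,x_2,x_3)=(x_1,-x_2,x_3)$ preserve $\Sigma_t$ and act on the torus as the reflections of the $x$ and $y$ coordinate, respectively, through the center of the lattice, where $z=x+iy$ is the coordinate of $\mathbb{C}$. The Morse index $\operatorname{index}(\Sigma)$ of a complete two-sided minimal surface $\Sigma$ with Gauss curvature $\kappa$ is the limit, over an exhaustion by relatively compact domains, of the number of negative Dirichlet eigenvalues of $-\Delta+2\kappa$ (counted with multiplicity); equivalently, the maximal dimension of a subspace of $C_c^\infty(\Sigma)$ on which $Q(\phi,\phi)=\int_\Sigma|\nabla\phi|^2+2\kappa\phi^2$ is negative definite. *)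

theory Defs
  imports "HOL-Analysis.Analysis"
begin

section \<open>Smooth maps on open subsets of the plane\<close>

definition pd :: "complex \<Rightarrow> (complex \<Rightarrow> 'b::real_normed_vector) \<Rightarrow> complex \<Rightarrow> 'b" where
  "pd v f z = frechet_derivative f (at z) v"

fun Ck_on :: "nat \<Rightarrow> complex set \<Rightarrow> (complex \<Rightarrow> 'b::real_normed_vector) \<Rightarrow> bool" where
  "Ck_on 0 S f \<longleftrightarrow> continuous_on S f"
| "Ck_on (Suc k) S f \<longleftrightarrow> (\<forall>z\<in>S. f differentiable at z) \<and> (\<forall>v. Ck_on k S (pd v f))"

definition smooth_on :: "complex set \<Rightarrow> (complex \<Rightarrow> 'b::real_normed_vector) \<Rightarrow> bool" where
  "smooth_on S f \<longleftrightarrow> (\<forall>k. Ck_on k S f)"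


section \<open>Classical local geometry of a parametrised surface\<close>

text \<open>Coordinates on the parameter domain are \<open>z = x + \<i> y\<close>, so \<open>pd 1\<close> and \<open>pd \<i>\<close> are the
  partial derivatives in \<open>x\<close> and \<open>y\<close>.\<close>

definition ffE :: "(complex \<Rightarrow> real^3) \<Rightarrow> complex \<Rightarrow> real" where
  "ffE X z = pd 1 X z \<bullet> pd 1 X z"

definition ffF :: "(complex \<Rightarrow> real^3) \<Rightarrow> complex \<Rightarrow> real" where
  "ffF X z = pd 1 X z \<bullet> pd \<i> X z"

definition ffG :: "(complex \<Rightarrow> real^3) \<Rightarrow> complex \<Rightarrow> real" where
  "ffG X z = pd \<i> X z \<bullet> pd \<i> X z"

definition ff_det :: "(complex \<Rightarrow> real^3) \<Rightarrow> complex \<Rightarrow> real" where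
  "ff_det X z = ffE X z * ffG X z - (ffF X z)\<^sup>2"

definition unit_normal :: "(complex \<Rightarrow> real^3) \<Rightarrow> complex \<Rightarrow> real^3" where
  "unit_normal X z = sgn (cross3 (pd 1 X z) (pd \<i> X z))"

definition sfL :: "(complex \<Rightarrow> real^3) \<Rightarrow> complex \<Rightarrow> real" where
  "sfL X z = pd 1 (pd 1 X) z \<bullet> unit_normal X z"

definition sfM :: "(complex \<Rightarrow> real^3) \<Rightarrow> complex \<Rightarrow> real" where
  "sfM X z = pd \<i> (pd 1 X) z \<bullet> unit_normal X z"

definition sfN :: "(complex \<Rightarrow> real^3) \<Rightarrow> complex \<Rightarrow> real" where
  "sfN X z = pd \<i> (pd \<i> X) z \<bullet> unit_normal X z"

definition mean_curvature :: "(complex \<Rightarrow> real^3) \<Rightarrow> complex \<Rightarrow> real" where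
  "mean_curvature X z =
     (sfL X z * ffG X z - 2 * sfM X z * ffF X z + sfN X z * ffE X z) / (2 * ff_det X z)"

definition gauss_curvature :: "(complex \<Rightarrow> real^3) \<Rightarrow> complex \<Rightarrow> real" where
  "gauss_curvature X z = (sfL X z * sfN X z - (sfM X z)\<^sup>2) / ff_det X z"

definition area_density :: "(complex \<Rightarrow> real^3) \<Rightarrow> complex \<Rightarrow> real" where
  "area_density X z = sqrt (ff_det X z)"

text \<open>Squared length, in the metric induced by \<open>X\<close>, of the gradient of \<open>\<phi>\<close>.\<close>

definition grad_sq :: "(complex \<Rightarrow> real^3) \<Rightarrow> (complex \<Rightarrow> real) \<Rightarrow> complex \<Rightarrow> real" where
  "grad_sq X \<phi> z =
     (ffG X z * (pd 1 \<phi> z)\<^sup>2 - 2 * ffF X z * pd 1 \<phi> z * pd \<i> \<phi> z + ffE X z * (pd \<i> \<phi> z)\<^sup>2)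
       / ff_det X z"


section \<open>The three-punctured rectangular torus\<close>

text \<open>Maps and functions on \<open>\<complex>/L(it) - {\<pi>(0), \<pi>(1/2), \<pi>(it/2)}\<close> are represented by their lifts
  to the plane, whose values at the lifted punctures are irrelevant.\<close>

definition lattice :: "real \<Rightarrow> complex set" where
  "lattice t = {of_int m + of_int n * (\<i> * of_real t) | m n :: int. True}"

definition punctured_plane :: "real \<Rightarrow> complex set" where
  "punctured_plane t =
     {z. \<forall>a\<in>{0, 1/2, \<i> * of_real t / 2}. z - a \<notin> lattice t}"

definition fund_domain :: "real \<Rightarrow> complex set" where
  "fund_domain t = {z. 0 \<le> Re z \<and> Re z < 1 \<and> 0 \<le> Im z \<and> Im z < t}"

definition lattice_translates :: "real \<Rightarrow> complex set \<Rightarrow> complex set" where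
  "lattice_translates t K = {z + l | z l. z \<in> K \<and> l \<in> lattice t}"


section \<open>Complete embedded minimal surfaces on the three-punctured torus\<close>

definition conformal_minimal_immersion :: "real \<Rightarrow> (complex \<Rightarrow> real^3) \<Rightarrow> bool" where
  "conformal_minimal_immersion t X \<longleftrightarrow>
     smooth_on (punctured_plane t) X \<and>
     (\<forall>z\<in>punctured_plane t.
        ff_det X z > 0 \<and> ffE X z = ffG X z \<and> ffF X z = 0 \<and> mean_curvature X z = 0)"

text \<open>The first clause says that \<open>X\<close> descends to an injective map on the quotient, the second
  that the descended map is a homeomorphism onto its image.\<close>

definition embedded :: "real \<Rightarrow> (complex \<Rightarrow> real^3) \<Rightarrow> bool" where
  "embedded t X \<longleftrightarrow>
     (\<forall>z\<in>punctured_plane t. \<forall>w\<in>punctured_plane t. X z = X w \<longleftrightarrow> z - w \<in> lattice t) \<and>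
     quotient_map (top_of_set (punctured_plane t)) (top_of_set (X ` punctured_plane t)) X"

text \<open>Completeness in the form: every divergent path has infinite length.  Compact subsets of
  the punctured torus are exactly the projections of compact subsets of the punctured plane.\<close>

definition divergent_path :: "real \<Rightarrow> (real \<Rightarrow> complex) \<Rightarrow> bool" where
  "divergent_path t \<gamma> \<longleftrightarrow>
     \<gamma> C1_differentiable_on {0..} \<and> \<gamma> ` {0..} \<subseteq> punctured_plane t \<and>
     (\<forall>K. compact K \<and> K \<subseteq> punctured_plane t \<longrightarrow>
        (\<forall>\<^sub>F s in at_top. \<gamma> s \<notin> lattice_translates t K))"

definition complete_surface :: "real \<Rightarrow> (complex \<Rightarrow> real^3) \<Rightarrow> bool" where
  "complete_surface t X \<longleftrightarrow>
     (\<forall>\<gamma>. divergent_path t \<gamma> \<longrightarrow>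
        (\<integral>\<^sup>+s\<in>{0..}. ennreal (norm (vector_derivative (X \<circ> \<gamma>) (at s))) \<partial>lborel) = \<infinity>)"

definition finite_total_curvature :: "real \<Rightarrow> (complex \<Rightarrow> real^3) \<Rightarrow> bool" where
  "finite_total_curvature t X \<longleftrightarrow>
     set_integrable lborel (fund_domain t) (\<lambda>z. gauss_curvature X z * area_density X z)"

definition \<tau>1 :: "real^3 \<Rightarrow> real^3" where
  "\<tau>1 p = vector [- p$1, p$2, p$3]"

definition \<tau>2 :: "real^3 \<Rightarrow> real^3" where
  "\<tau>2 p = vector [p$1, - p$2, p$3]"

text \<open>After a rigid motion \<open>R\<close>, the reflections \<open>\<tau>1\<close>, \<open>\<tau>2\<close> induce on the torus the reflections
  of the \<open>x\<close> and \<open>y\<close> coordinate through the centre \<open>(1 + it)/2\<close> of the period rectangle.\<close>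

definition reflection_symmetric :: "real \<Rightarrow> (complex \<Rightarrow> real^3) \<Rightarrow> bool" where
  "reflection_symmetric t X \<longleftrightarrow>
     (\<exists>R. (\<forall>p q. dist (R p) (R q) = dist p q) \<and>
        (\<forall>z\<in>punctured_plane t.
           R (X (1 - cnj z)) = \<tau>1 (R (X z)) \<and>
           R (X (cnj z + \<i> * of_real t)) = \<tau>2 (R (X z))))"

text \<open>\<open>X\<close> is a conformal parametrisation of the member of conformal type \<open>t\<close> of the
  Hoffman--Meeks deformation family.  The family is described, through Costa's classification, as
  the complete embedded minimal surfaces of finite total curvature, genus one and three ends.
  Genus and number of ends are those of the parameter domain.\<close>

definition hoffman_meeks_surface :: "real \<Rightarrow> (complex \<Rightarrow> real^3) \<Rightarrow> bool" where
  "hoffman_meeks_surface t X \<longleftrightarrow>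
     conformal_minimal_immersion t X \<and> embedded t X \<and> complete_surface t X \<and>
     finite_total_curvature t X \<and> reflection_symmetric t X"


section \<open>Morse index\<close>

text \<open>Compactly supported smooth functions on the punctured torus, lifted to the plane and
  extended by zero to the lifted punctures.\<close>

definition test_functions :: "real \<Rightarrow> (complex \<Rightarrow> real) set" where
  "test_functions t =
     {\<phi>. smooth_on UNIV \<phi> \<and> (\<forall>z. \<forall>l\<in>lattice t. \<phi> (z + l) = \<phi> z) \<and>
         (\<exists>K. compact K \<and> K \<subseteq> punctured_plane t \<and>
              (\<forall>z. z \<notin> lattice_translates t K \<longrightarrow> \<phi> z = 0))}"

definition index_form :: "real \<Rightarrow> (complex \<Rightarrow> real^3) \<Rightarrow> (complex \<Rightarrow> real) \<Rightarrow> real" where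
  "index_form t X \<phi> =
     (LINT z:fund_domain t|lborel.
        (grad_sq X \<phi> z + 2 * gauss_curvature X z * (\<phi> z)\<^sup>2) * area_density X z)"

text \<open>The functions \<open>\<phi> 0, \<dots>, \<phi> (n - 1)\<close> form a basis of an \<open>n\<close>-dimensional subspace on which the
  index form is negative definite; linear independence is implied, as the form vanishes at 0.\<close>

definition negative_definite_basis ::
    "real \<Rightarrow> (complex \<Rightarrow> real^3) \<Rightarrow> nat \<Rightarrow> (nat \<Rightarrow> complex \<Rightarrow> real) \<Rightarrow> bool" where
  "negative_definite_basis t X n \<phi> \<longleftrightarrow>
     (\<forall>i<n. \<phi> i \<in> test_functions t) \<and>
     (\<forall>c :: nat \<Rightarrow> real. (\<exists>i<n. c i \<noteq> 0) \<longrightarrow> index_form t X (\<lambda>z. \<Sum>i<n. c i * \<phi> i z) < 0)"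

definition morse_index :: "real \<Rightarrow> (complex \<Rightarrow> real^3) \<Rightarrow> enat" where
  "morse_index t X = Sup {enat n | n. \<exists>\<phi>. negative_definite_basis t X n \<phi>}"

end

(* The ends are controlled by Osserman's lemma: the differential phi of the immersion has a pole of
order at least two at every puncture. Hence a holomorphic one-form h dz with poles of order at most
two there has, through the metric, a dual tangent field whose Euclidean components xi_1, xi_2, xi_3
are bounded. They satisfy sum_j xi_j J xi_j = 0 for the Jacobi operator J, and points have capacity
zero, so cutting off near the punctures makes sum_j Q(xi_j) as small as we like. If the xi_j are
Q-orthogonal to a family of negative directions and are not all Jacobi fields, a perturbation of one
of them by J xi_j is a further negative direction; they are all Jacobi fields only if h is an
imaginary multiple of phi_3.
   Sort functions by their parity under the two reflections. A member of the family imposes at most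
one condition on the three-dimensional space of symmetric forms with double poles at two punctures,
and none if it has one particular mixed parity; so in a maximal family three members avoid that
parity. Exchanging the reflections gives the same for the other mixed parity. With fewer than four
members, all of them are therefore even-even or odd-odd. An odd-odd member can be turned into a
member of mixed parity by a sign change along the fixed lines, which costs no energy. If all are
even-even, the odd forms with simple poles satisfy every orthogonality condition. *)
theory Submission
 imports Defs "HOL-Complex_Analysis.Complex_Analysis" "HOL-Real_Asymp.Real_Asymp"
begin

section \<open>Smooth functions on plane domains\<close>

text \<open>Completeness by itself gives only a zero of \<open>1 / f\<close> at a puncture. The two
  reflections compose to z -> -z about the puncture, under which \<open>\<phi> 1\<close> and
  \<open>\<phi> 2\<close> are even and \<open>\<phi> 3\<close> is odd; so \<open>1 / f\<close> is
  even and its zero is double. This is why forms with double poles have bounded dual fields. The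
  parity bookkeeping rests on one table: for a form of parity (p, q) the field xi_j has parity
  \<open>(p * sgn1 j, q * sgn2 j)\<close>, that is (p, q), (-p, -q), (-p, q). Each class is met by
  at most one component, and (p, -q) by none. For p = q this is the exempt mixed class; for (1, -1)
  it is the even-even class. A form in the kernel is a multiple of \<open>\<phi> 3\<close>. An even
  form cannot be one unless it vanishes. Odd forms can, hence two of them are used, with different
  pairs of poles, so that they cannot both be proportional to \<open>\<phi> 3\<close>. Only the sum
  of the cut-off energies of the xi_j is small; that each of them is non-negative for a maximal
  family makes every single one small.\<close>

lemma pd_eqI: "(f has_derivative D) (at z) ==> pd v f z = D v"
 unfolding pd_def using frechet_derivative_at by metis

lemma differentiable_has_pd:
 "f differentiable (at z) ==> (f has_derivative (%v. pd v f z)) (at z)"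
 unfolding pd_def using frechet_derivative_works by (metis eta_contract_eq)

lemma differentiable_cong_open:
 assumes "open S" "z \<in> S" "\<And>x. x \<in> S ==> f x = g x" "f differentiable (at z)"
 shows "g differentiable (at z)"
 using assms unfolding differentiable_def by (metis has_derivative_transform_within_open)

lemma pd_cong_open:
 assumes "open S" "z \<in> S" "\<And>x. x \<in> S ==> f x = g x"
 shows "pd v f z = pd v g z"
proof -
 have "(f has_derivative D) (at z) \<longleftrightarrow> (g has_derivative D) (at z)" for D
  using has_derivative_transform_within_open[of f D z UNIV S g]
   has_derivative_transform_within_open[of g D z UNIV S f] assms by fastforce
 then show ?thesis unfolding pd_def frechet_derivative_def by simp
qed

text \<open>The differentiation rules determine \<open>pd v\<close> of a compound function only on
  \<open>S\<close>. Every closure property below therefore replaces \<open>pd v\<close> by the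
  expression from the rule through this congruence; openness of \<open>S\<close> makes the
  derivatives agree as well.\<close>

lemma Ck_on_cong:
 assumes "open S" "\<And>x. x \<in> S ==> f x = g x" "Ck_on k S f"
 shows "Ck_on k S g"
 using assms(2,3)
proof (induction k arbitrary: f g)
 case 0
 then show ?case by (simp cong: continuous_on_cong)
next
 case (Suc k)
 have "Ck_on k S (pd v g)" for v
  using Suc.IH[of "pd v f" "pd v g"] Suc.prems pd_cong_open[OF assms(1) _ Suc.prems(1)] by auto
 moreover have "g differentiable (at z)" if "z \<in> S" for z
  using differentiable_cong_open[OF assms(1) that Suc.prems(1)] Suc.prems(2) that by simp
 ultimately show ?case by simp
qed

lemma Ck_on_SucD: "Ck_on (Suc k) S f ==> Ck_on k S f"
proof (induction k arbitrary: f)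
 case 0
 then show ?case
  by (auto intro!: differentiable_imp_continuous_on
    simp: differentiable_on_def differentiable_at_withinI)
next
 case (Suc k)
 then show ?case by (metis Ck_on.simps(2))
qed

lemma Ck_on_subset: "Ck_on k S f ==> T \<subseteq> S ==> Ck_on k T f"
 by (induction k arbitrary: f) (auto intro: continuous_on_subset)

lemma Ck_on_const: "Ck_on k S (%z. c)"
proof (induction k arbitrary: c)
 case (Suc k)
 have "pd v (%z. c) = (%z. 0)" for v
  by (rule ext, rule pd_eqI[of _ "%v. 0"]) simp
 then show ?case using Suc by auto
qed simp

lemma Ck_on_linear:
 assumes "open S" "bounded_linear L" "Ck_on k S f"
 shows "Ck_on k S (%z. L (f z))"
 using assms(3)
proof (induction k arbitrary: f)
 case 0
 then show ?case using assms(2) by (simp add: bounded_linear.continuous_on)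
next
 case (Suc k)
 have d: "((%z. L (f z)) has_derivative (%v. L (pd v f z))) (at z)" if "z \<in> S" for z
  using that Suc.prems by (intro bounded_linear.has_derivative[OF assms(2)] differentiable_has_pd) auto
 have "Ck_on k S (pd v (%z. L (f z)))" for v
  by (rule Ck_on_cong[OF assms(1), of "%z. L (pd v f z)"])
   (use pd_eqI[OF d] Suc in auto)
 then show ?case using d unfolding Ck_on.simps differentiable_def by blast
qed

lemma Ck_on_bilinear:
 assumes "open S" "bounded_bilinear B" "Ck_on k S f" "Ck_on k S g"
 shows "Ck_on k S (%z. B (f z) (g z))"
 using assms(3,4)
proof (induction k arbitrary: f g)
 case 0
 then show ?case using assms(2) by (simp add: bounded_bilinear.continuous_on)
next
 case (Suc k)
 have add: "Ck_on k S (%z. a z + b z)" if "Ck_on k S a" "Ck_on k S b"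
  for a b :: "complex => 'c" and k using that
 proof (induction k arbitrary: a b)
  case 0
  then show ?case by (simp add: continuous_on_add)
 next
  case (Suc k)
  have d: "((%z. a z + b z) has_derivative (%v. pd v a z + pd v b z)) (at z)" if "z \<in> S" for z
   using that Suc.prems by (intro has_derivative_add differentiable_has_pd) auto
  have "Ck_on k S (pd v (%z. a z + b z))" for v
   by (rule Ck_on_cong[OF assms(1), of "%z. pd v a z + pd v b z"])
    (use pd_eqI[OF d] Suc in auto)
  then show ?case using d unfolding Ck_on.simps differentiable_def by blast
 qed
 have d: "((%z. B (f z) (g z)) has_derivative (%v. B (f z) (pd v g z) + B (pd v f z) (g z))) (at z)"
  if "z \<in> S" for z
  using that Suc.prems by (intro bounded_bilinear.FDERIV[OF assms(2)] differentiable_has_pd) auto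
 have k: "Ck_on k S f" "Ck_on k S g" using Suc.prems Ck_on_SucD by blast+
 have "Ck_on k S (pd v (%z. B (f z) (g z)))" for v
  by (rule Ck_on_cong[OF assms(1), of "%z. B (f z) (pd v g z) + B (pd v f z) (g z)"])
   (use pd_eqI[OF d] Suc.prems k in \<open>auto intro!: add Suc.IH\<close>)
 then show ?case using d unfolding Ck_on.simps differentiable_def by blast
qed

lemma Ck_on_add:
 assumes "open S" "Ck_on k S f" "Ck_on k S g"
 shows "Ck_on k S (%z. f z + g z)"
 using assms(2,3)
proof (induction k arbitrary: f g)
 case 0
 then show ?case by (simp add: continuous_on_add)
next
 case (Suc k)
 have d: "((%z. f z + g z) has_derivative (%v. pd v f z + pd v g z)) (at z)" if "z \<in> S" for z
  using that Suc.prems by (intro has_derivative_add differentiable_has_pd) auto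
 have "Ck_on k S (pd v (%z. f z + g z))" for v
  by (rule Ck_on_cong[OF assms(1), of "%z. pd v f z + pd v g z"])
   (use pd_eqI[OF d] Suc in auto)
 then show ?case using d unfolding Ck_on.simps differentiable_def by blast
qed

lemma Ck_on_inverse:
 fixes f :: "complex => 'a::real_normed_field"
 assumes "open S" "\<And>z. z \<in> S ==> f z \<noteq> 0" "Ck_on k S f"
 shows "Ck_on k S (%z. inverse (f z))"
 using assms(3)
proof (induction k)
 case 0
 then show ?case using assms(2) by (simp add: continuous_on_inverse)
next
 case (Suc k)
 have d: "((%z. inverse (f z)) has_derivative (%v. - (inverse (f z) * pd v f z * inverse (f z)))) (at z)"
  if "z \<in> S" for z
  using that Suc.prems assms(2) by (intro Deriv.has_derivative_inverse differentiable_has_pd) auto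
 have k: "Ck_on k S (%z. inverse (f z))" using Suc Ck_on_SucD by blast
 have "Ck_on k S (pd v (%z. inverse (f z)))" for v
  by (rule Ck_on_cong[OF assms(1), of "%z. - (inverse (f z) * pd v f z * inverse (f z))"])
   (use pd_eqI[OF d] Suc.prems k assms(1) in
    \<open>auto intro!: Ck_on_bilinear[OF _ bounded_bilinear_mult]
      Ck_on_linear[OF _ bounded_linear_minus[OF bounded_linear_ident]]\<close>)
 then show ?case using d unfolding Ck_on.simps differentiable_def by blast
qed

lemma Ck_on_holomorphic:
 assumes "open S" "f holomorphic_on S"
 shows "Ck_on k S f"
 using assms(2)
proof (induction k arbitrary: f)
 case 0
 then show ?case by (simp add: holomorphic_on_imp_continuous_on)
next
 case (Suc k)
 have d: "(f has_derivative (%v. deriv f z * v)) (at z)" if "z \<in> S" for z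
  using that Suc.prems assms(1) holomorphic_derivI has_field_derivative_imp_has_derivative by metis
 have "Ck_on k S (pd v f)" for v
  by (rule Ck_on_cong[OF assms(1), of "%z. deriv f z * v"])
   (use pd_eqI[OF d] Suc in
    \<open>auto intro!: Ck_on_linear[OF assms(1) bounded_linear_mult_left] holomorphic_deriv assms(1)\<close>)
 then show ?case using d unfolding Ck_on.simps differentiable_def by blast
qed

text \<open>The whole sequence of successive derivatives of the outer function is given at once, so
  that the induction on \<open>k\<close> may move along \<open>n\<close>.\<close>

lemma Ck_on_compose_real:
 fixes f :: "complex => real" and \<theta> :: "nat => real => real"
 assumes "open S" "\<And>n x. (\<theta> n has_real_derivative \<theta> (Suc n) x) (at x)" "Ck_on k S f"
 shows "Ck_on k S (%z. \<theta> n (f z))"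
 using assms(3)
proof (induction k arbitrary: n)
 case 0
 have "isCont (\<theta> n) x" for x using assms(2) DERIV_isCont by blast
 then have "continuous_on UNIV (\<theta> n)" by (simp add: continuous_at_imp_continuous_on)
 then show ?case using 0 continuous_on_compose2[of UNIV "\<theta> n" S f] by simp
next
 case (Suc k)
 have d: "((%z. \<theta> n (f z)) has_derivative (%v. pd v f z * \<theta> (Suc n) (f z))) (at z)" if "z \<in> S" for z
 proof -
  have "(f has_derivative (%v. pd v f z)) (at z)" "(\<theta> n has_derivative (%h. \<theta> (Suc n) (f z) * h)) (at (f z))"
   using that Suc.prems assms(2)[of n "f z"] differentiable_has_pd by (auto simp: has_field_derivative_def)
  from has_derivative_compose[OF this] show ?thesis by (simp add: mult.commute)
 qed
 have k: "Ck_on k S (%z. \<theta> m (f z))" for m using Suc Ck_on_SucD by blast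
 have "Ck_on k S (pd v (%z. \<theta> n (f z)))" for v
  by (rule Ck_on_cong[OF assms(1), of "%z. pd v f z * \<theta> (Suc n) (f z)"])
   (use pd_eqI[OF d] Suc.prems k assms(1) in
    \<open>auto intro!: Ck_on_bilinear[OF _ bounded_bilinear_mult]\<close>)
 then show ?case using d unfolding Ck_on.simps differentiable_def by blast
qed

lemma Ck_on_open_Un: "Ck_on k S f ==> Ck_on k T f ==> open S ==> open T ==> Ck_on k (S \<union> T) f"
 by (induction k arbitrary: f) (auto intro: continuous_on_open_Un)

section \<open>Closure properties of smooth functions\<close>

lemma smooth_on_cong:
 "open S ==> (\<And>x. x \<in> S ==> f x = g x) ==> smooth_on S f ==> smooth_on S g"
 unfolding smooth_on_def using Ck_on_cong by blast

lemma smooth_on_subset: "smooth_on S f ==> T \<subseteq> S ==> smooth_on T f"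
 unfolding smooth_on_def using Ck_on_subset by blast

lemma smooth_on_open_Un:
 "smooth_on S f ==> smooth_on T f ==> open S ==> open T ==> smooth_on (S \<union> T) f"
 unfolding smooth_on_def using Ck_on_open_Un by blast

lemma smooth_on_continuous: "smooth_on S f ==> continuous_on S f"
 unfolding smooth_on_def by (metis Ck_on.simps(1))

lemma smooth_on_differentiable: "smooth_on S f ==> z \<in> S ==> f differentiable (at z)"
 unfolding smooth_on_def by (metis Ck_on.simps(2))

lemma smooth_on_pd: "smooth_on S f ==> smooth_on S (pd v f)"
 unfolding smooth_on_def by (metis Ck_on.simps(2))

lemma smooth_on_has_derivative:
 "smooth_on S f ==> z \<in> S ==> (f has_derivative (%v. pd v f z)) (at z)"
 using smooth_on_differentiable differentiable_has_pd by blast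

named_theorems smooth_intros

lemma smooth_on_const [smooth_intros]: "smooth_on S (%z. c)"
 unfolding smooth_on_def using Ck_on_const by blast

lemma smooth_on_linear:
 "bounded_linear L ==> open S ==> smooth_on S f ==> smooth_on S (%z. L (f z))"
 unfolding smooth_on_def using Ck_on_linear by blast

lemmas smooth_on_Re [smooth_intros] = smooth_on_linear[OF bounded_linear_Re]
 and smooth_on_Im [smooth_intros] = smooth_on_linear[OF bounded_linear_Im]
 and smooth_on_cnj [smooth_intros] = smooth_on_linear[OF bounded_linear_cnj]
 and smooth_on_of_real [smooth_intros] = smooth_on_linear[OF bounded_linear_of_real]
 and smooth_on_minus [smooth_intros] = smooth_on_linear[OF bounded_linear_minus[OF bounded_linear_ident]]

lemma smooth_on_add [smooth_intros]:
 "open S ==> smooth_on S f ==> smooth_on S g ==> smooth_on S (%z. f z + g z)"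
 unfolding smooth_on_def using Ck_on_add by blast

lemma smooth_on_mult [smooth_intros]:
 fixes f g :: "complex => 'a::real_normed_algebra"
 shows "open S ==> smooth_on S f ==> smooth_on S g ==> smooth_on S (%z. f z * g z)"
 unfolding smooth_on_def using Ck_on_bilinear[OF _ bounded_bilinear_mult] by blast

lemma smooth_on_diff [smooth_intros]:
 "open S ==> smooth_on S f ==> smooth_on S g ==> smooth_on S (%z. f z - g z)"
 using smooth_on_add[OF _ _ smooth_on_minus, of S f g] by simp

lemma smooth_on_inverse [smooth_intros]:
 fixes f :: "complex => 'a::real_normed_field"
 shows "open S ==> (\<And>z. z \<in> S ==> f z \<noteq> 0) ==> smooth_on S f ==> smooth_on S (%z. inverse (f z))"
 unfolding smooth_on_def using Ck_on_inverse by blast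

lemma smooth_on_divide [smooth_intros]:
 fixes f :: "complex => 'a::real_normed_field"
 shows "open S ==> (\<And>z. z \<in> S ==> g z \<noteq> 0) ==> smooth_on S f ==> smooth_on S g ==>
  smooth_on S (%z. f z / g z)"
 unfolding divide_inverse by (intro smooth_intros)

lemma smooth_on_power [smooth_intros]:
 fixes f :: "complex => 'a::real_normed_field"
 shows "open S ==> smooth_on S f ==> smooth_on S (%z. f z ^ n)"
 by (induction n) (auto intro!: smooth_intros)

lemma smooth_on_sum [smooth_intros]:
 "open S ==> (\<And>i. i \<in> I ==> smooth_on S (f i)) ==> smooth_on S (%z. \<Sum>i\<in>I. f i z)"
 by (induction I rule: infinite_finite_induct) (auto intro!: smooth_intros)

lemma smooth_on_prod [smooth_intros]:
 fixes f :: "'i => complex => 'a::real_normed_field"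
 shows "open S ==> (\<And>i. i \<in> I ==> smooth_on S (f i)) ==> smooth_on S (%z. \<Prod>i\<in>I. f i z)"
 by (induction I rule: infinite_finite_induct) (auto intro!: smooth_intros)

lemma smooth_on_holomorphic: "open S ==> f holomorphic_on S ==> smooth_on S f"
 unfolding smooth_on_def using Ck_on_holomorphic by blast

lemma smooth_on_ident [smooth_intros]: "open S ==> smooth_on S (%z. z)"
 by (intro smooth_on_holomorphic) auto

lemma smooth_on_compose_real:
 fixes f :: "complex => real" and \<theta> :: "nat => real => real"
 assumes "\<And>n x. (\<theta> n has_real_derivative \<theta> (Suc n) x) (at x)" "open S" "smooth_on S f"
 shows "smooth_on S (%z. \<theta> n (f z))"
 using assms unfolding smooth_on_def using Ck_on_compose_real by blast

lemma smooth_on_exp [smooth_intros]: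
 fixes f :: "complex => real"
 shows "open S ==> smooth_on S f ==> smooth_on S (%z. exp (f z))"
 by (rule smooth_on_compose_real[of "%_. exp"]) (auto intro: DERIV_exp)

lemma smooth_on_sin [smooth_intros]:
 fixes f :: "complex => real"
 assumes "open S" "smooth_on S f"
 shows "smooth_on S (%z. sin (f z))"
proof -
 \<comment> \<open>Each derivative of the sine is a shift by a quarter period, which gives the
   derivative sequence in closed form.\<close>
 have "((%x::real. sin (x + real n * (pi/2))) has_real_derivative sin (x + real (Suc n) * (pi/2))) (at x)" for n x
 proof -
  have "x + real (Suc n) * (pi/2) = (x + real n * (pi/2)) + pi/2" by (simp add: algebra_simps)
  then have "sin (x + real (Suc n) * (pi/2)) = cos (x + real n * (pi/2))" by (simp only: sin_add) simp
  then show ?thesis by (auto intro!: derivative_eq_intros)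
 qed
 from smooth_on_compose_real[of "%n x. sin (x + real n * (pi/2))", OF this assms, of 0]
 show ?thesis by simp
qed

text \<open>Two applications of the mean value theorem: first along \<open>v\<close> to the
  increment in direction \<open>w\<close>, then along \<open>w\<close> to \<open>pd v f\<close>. The
  left-hand side is symmetric in \<open>v\<close> and \<open>w\<close>, so the same number is
  expressed by either mixed derivative.\<close>

lemma second_difference:
 fixes f :: "complex => real"
 assumes "smooth_on (ball z r) f" "norm v = 1" "norm w = 1" "0 < h" "2 * h < r"
 shows "\<exists>s t. 0 < s \<and> s < h \<and> 0 < t \<and> t < h \<and>
  f (z + h *\<^sub>R v + h *\<^sub>R w) - f (z + h *\<^sub>R v) - f (z + h *\<^sub>R w) + f z
   = h\<^sup>2 * pd w (pd v f) (z + s *\<^sub>R v + t *\<^sub>R w)"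
proof -
 have line: "((%s. F (a + s *\<^sub>R u)) has_real_derivative pd u F (a + s *\<^sub>R u)) (at s)"
  if F: "smooth_on (ball z r) F" and a: "a + s *\<^sub>R u \<in> ball z r"
  for F :: "complex => real" and a u :: complex and s :: real
 proof -
  have "((%s. a + s *\<^sub>R u) has_derivative (%h. h *\<^sub>R u)) (at s)"
   by (auto intro!: derivative_eq_intros)
  from has_derivative_compose[OF this smooth_on_has_derivative[OF F a]]
  have *: "((%s. F (a + s *\<^sub>R u)) has_derivative (%h. pd (h *\<^sub>R u) F (a + s *\<^sub>R u))) (at s)" .
  have "linear (%v. pd v F (a + s *\<^sub>R u))"
   using smooth_on_has_derivative[OF F a] has_derivative_linear by blast
  then have "pd (h *\<^sub>R u) F (a + s *\<^sub>R u) = h *\<^sub>R pd u F (a + s *\<^sub>R u)" for h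
   by (rule linear_cmul)
  then show ?thesis using * by (simp add: has_field_derivative_def mult.commute[of _ "pd u F _"])
 qed
 have inb: "z + a *\<^sub>R v + b *\<^sub>R w \<in> ball z r" if "0 \<le> a" "a \<le> h" "0 \<le> b" "b \<le> h" for a b
 proof -
  have "norm (a *\<^sub>R v + b *\<^sub>R w) \<le> a + b"
   using norm_triangle_ineq[of "a *\<^sub>R v" "b *\<^sub>R w"] assms(2,3) that by simp
  then have "norm (- (a *\<^sub>R v + b *\<^sub>R w)) < r" unfolding norm_minus_cancel using that assms by linarith
  then show ?thesis by (simp add: dist_norm)
 qed
 define p where "p = (%s. f (z + h *\<^sub>R w + s *\<^sub>R v) - f (z + s *\<^sub>R v))"
 have "(p has_real_derivative pd v f (z + h *\<^sub>R w + s *\<^sub>R v) - pd v f (z + s *\<^sub>R v)) (at s)"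
  if "0 \<le> s" "s \<le> h" for s
  unfolding p_def using inb[of s h] inb[of s 0] that assms
  by (intro derivative_intros line) (auto simp: algebra_simps)
 then obtain s where s: "0 < s" "s < h"
  "p h - p 0 = h * (pd v f (z + h *\<^sub>R w + s *\<^sub>R v) - pd v f (z + s *\<^sub>R v))"
  using MVT2[OF assms(4), of p "%s. pd v f (z + h *\<^sub>R w + s *\<^sub>R v) - pd v f (z + s *\<^sub>R v)"] by auto
 have "((%t. pd v f ((z + s *\<^sub>R v) + t *\<^sub>R w)) has_real_derivative pd w (pd v f) ((z + s *\<^sub>R v) + t *\<^sub>R w)) (at t)"
  if "0 \<le> t" "t \<le> h" for t
  using inb[of s t] that s assms by (intro line smooth_on_pd) auto
 then obtain t where t: "0 < t" "t < h"
  "pd v f ((z + s *\<^sub>R v) + h *\<^sub>R w) - pd v f ((z + s *\<^sub>R v) + 0 *\<^sub>R w)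
   = h * pd w (pd v f) ((z + s *\<^sub>R v) + t *\<^sub>R w)"
  using MVT2[OF assms(4), of "%t. pd v f ((z + s *\<^sub>R v) + t *\<^sub>R w)"
    "%t. pd w (pd v f) ((z + s *\<^sub>R v) + t *\<^sub>R w)"] by auto
 have "p h - p 0 = h\<^sup>2 * pd w (pd v f) ((z + s *\<^sub>R v) + t *\<^sub>R w)"
  using s(3) t(3) by (simp add: algebra_simps power2_eq_square)
 then show ?thesis using s t by (intro exI[of _ s] exI[of _ t]) (simp add: p_def algebra_simps)
qed

lemma pd_symmetric_real:
 fixes f :: "complex => real"
 assumes "open S" "smooth_on S f" "z \<in> S"
 shows "pd 1 (pd \<i> f) z = pd \<i> (pd 1 f) z"
proof -
 obtain r where r: "r > 0" "ball z r \<subseteq> S" using assms openE by blast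
 have f: "smooth_on (ball z r) f" using assms(2) r smooth_on_subset by blast
 let ?A = "pd 1 (pd \<i> f)" and ?B = "pd \<i> (pd 1 f)"
 have cont: "isCont F z" if "smooth_on (ball z r) F" for F :: "complex => real"
  using smooth_on_continuous[OF that] r by (simp add: continuous_on_eq_continuous_at)
 have "\<bar>?A z - ?B z\<bar> \<le> e" if e: "e > 0" for e
 proof -
  obtain d1 where d1: "d1 > 0" "\<And>x. dist x z < d1 ==> \<bar>?A x - ?A z\<bar> < e/2"
   using cont[OF smooth_on_pd[OF smooth_on_pd[OF f]], of 1 \<i>] e
   unfolding continuous_at_eps_delta dist_real_def by (metis half_gt_zero)
  obtain d2 where d2: "d2 > 0" "\<And>x. dist x z < d2 ==> \<bar>?B x - ?B z\<bar> < e/2"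
   using cont[OF smooth_on_pd[OF smooth_on_pd[OF f]], of \<i> 1] e
   unfolding continuous_at_eps_delta dist_real_def by (metis half_gt_zero)
  \<comment> \<open>All points of the square with side \<open>h\<close> lie within
    \<open>2 * h\<close> of \<open>z\<close>; division by three keeps \<open>2 * h\<close> below all
    three radii.\<close>
  define h where "h = Min {r, d1, d2} / 3"
  have h: "0 < h" "2 * h < r" "2 * h < d1" "2 * h < d2" using r d1 d2 by (auto simp: h_def)
  obtain s t where st: "0 < s" "s < h" "0 < t" "t < h"
   "f (z + h *\<^sub>R 1 + h *\<^sub>R \<i>) - f (z + h *\<^sub>R 1) - f (z + h *\<^sub>R \<i>) + f z = h\<^sup>2 * ?B (z + s *\<^sub>R 1 + t *\<^sub>R \<i>)"
   using second_difference[OF f, of 1 \<i> h] h by auto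
  obtain s' t' where st': "0 < s'" "s' < h" "0 < t'" "t' < h"
   "f (z + h *\<^sub>R \<i> + h *\<^sub>R 1) - f (z + h *\<^sub>R \<i>) - f (z + h *\<^sub>R 1) + f z = h\<^sup>2 * ?A (z + s' *\<^sub>R \<i> + t' *\<^sub>R 1)"
   using second_difference[OF f, of \<i> 1 h] h by auto
  have eq: "?A (z + s' *\<^sub>R \<i> + t' *\<^sub>R 1) = ?B (z + s *\<^sub>R 1 + t *\<^sub>R \<i>)"
   using st(5) st'(5) h by (simp add: algebra_simps)
  have "norm (s' *\<^sub>R \<i> + t' *\<^sub>R 1) < 2 * h" "norm (s *\<^sub>R 1 + t *\<^sub>R \<i>) < 2 * h"
   using norm_triangle_ineq[of "s' *\<^sub>R \<i>" "t' *\<^sub>R 1"] norm_triangle_ineq[of "s *\<^sub>R 1" "t *\<^sub>R \<i>"] st st' by auto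
  then have "\<bar>?A (z + s' *\<^sub>R \<i> + t' *\<^sub>R 1) - ?A z\<bar> < e/2" "\<bar>?B (z + s *\<^sub>R 1 + t *\<^sub>R \<i>) - ?B z\<bar> < e/2"
   using h by (intro d1(2) d2(2); simp add: dist_norm add.assoc)+
  then show ?thesis unfolding eq by linarith
 qed
 then have "\<bar>?A z - ?B z\<bar> \<le> 0" by (rule field_le_epsilon) auto
 then show ?thesis by simp
qed

lemma pd_linear:
 "bounded_linear L ==> f differentiable (at z) ==> pd v (%z. L (f z)) z = L (pd v f z)"
 by (rule pd_eqI[OF bounded_linear.has_derivative[OF _ differentiable_has_pd]])

lemma pd_symmetric:
 fixes f :: "complex => 'a::euclidean_space"
 assumes "open S" "smooth_on S f" "z \<in> S"
 shows "pd 1 (pd \<i> f) z = pd \<i> (pd 1 f) z"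
proof (rule euclidean_eqI)
 fix b :: 'a
 note L = bounded_linear_inner_left[of b]
 have *: "pd v (pd w f) z \<bullet> b = pd v (pd w (%z. f z \<bullet> b)) z" for v w
  using pd_linear[OF L smooth_on_differentiable[OF smooth_on_pd[OF assms(2)] assms(3)]]
   pd_cong_open[OF assms(1,3), of "pd w (%z. f z \<bullet> b)" "%z. pd w f z \<bullet> b"]
   pd_linear[OF L smooth_on_differentiable[OF assms(2)]] by metis
 show "pd 1 (pd \<i> f) z \<bullet> b = pd \<i> (pd 1 f) z \<bullet> b"
  unfolding * using assms by (intro pd_symmetric_real smooth_on_linear[OF L])
qed

subsection \<open>Wirtinger derivatives\<close>

text \<open>\<open>A\<close> and \<open>B\<close> are the derivatives of \<open>F\<close> with
  respect to z and cnj z. As a relation, it lets the calculus rules compute both coefficients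
  simultaneously.\<close>

definition wirt :: "(complex => complex) => complex => complex => complex => bool" where
 "wirt F A B z \<longleftrightarrow> (F has_derivative (%v. A * v + B * cnj v)) (at z)"

definition lap :: "(complex => 'b::real_normed_vector) => complex => 'b" where
 "lap f z = pd 1 (pd 1 f) z + pd \<i> (pd \<i> f) z"

lemma wirt_pd: "wirt F A B z ==> pd v F z = A * v + B * cnj v"
 unfolding wirt_def by (rule pd_eqI)

lemma wirt_add: "wirt F A B z ==> wirt G A' B' z ==> wirt (%z. F z + G z) (A + A') (B + B') z"
 unfolding wirt_def by (drule (1) has_derivative_add) (simp add: algebra_simps)

lemma wirt_diff: "wirt F A B z ==> wirt G A' B' z ==> wirt (%z. F z - G z) (A - A') (B - B') z"
 unfolding wirt_def by (drule (1) has_derivative_diff) (simp add: algebra_simps)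

lemma wirt_mult:
 "wirt F A B z ==> wirt G A' B' z ==>
 wirt (%z. F z * G z) (A * G z + F z * A') (B * G z + F z * B') z"
 unfolding wirt_def by (drule (1) has_derivative_mult) (simp add: algebra_simps)

lemma wirt_const: "wirt (%z. c) 0 0 z"
 unfolding wirt_def by simp

lemma wirt_cnj: "wirt F A B z ==> wirt (%z. cnj (F z)) (cnj B) (cnj A) z"
 unfolding wirt_def by (drule has_derivative_cnj) (simp add: algebra_simps)

lemma wirt_holomorphic: "(F has_field_derivative A) (at z) ==> wirt F A 0 z"
 unfolding wirt_def has_field_derivative_def by simp

lemma wirt_inverse:
 "wirt F A B z ==> F z \<noteq> 0 ==>
 wirt (%z. inverse (F z)) (- A * inverse (F z) ^ 2) (- B * inverse (F z) ^ 2) z"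
 unfolding wirt_def by (drule (1) Deriv.has_derivative_inverse) (simp add: algebra_simps power2_eq_square)

lemma wirt_sum: "(\<And>i. i \<in> I ==> wirt (F i) (A i) (B i) z) ==>
 wirt (%z. \<Sum>i\<in>I. F i z) (\<Sum>i\<in>I. A i) (\<Sum>i\<in>I. B i) z"
 by (induction I rule: infinite_finite_induct) (auto intro!: wirt_const wirt_add)

lemma wirt_cong_open:
 "open S ==> z \<in> S ==> (\<And>x. x \<in> S ==> F x = G x) ==> wirt F A B z ==> wirt G A B z"
 unfolding wirt_def by (rule has_derivative_transform_within_open)

lemma wirt_unique:
 assumes "wirt F A B z" "wirt F A' B' z" shows "A = A'" "B = B'"
proof -
 have "A + B = A' + B'" "A - B = A' - B'"
  using wirt_pd[OF assms(1), of 1] wirt_pd[OF assms(2), of 1]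
   wirt_pd[OF assms(1), of \<i>] wirt_pd[OF assms(2), of \<i>] by (auto simp: complex_eq_iff)
 then show "A = A'" "B = B'" by (auto simp: complex_eq_iff)
qed

text \<open>The Laplacian is four times the mixed Wirtinger derivative: in the sum of the two
  directional equations the mixed partial derivatives cancel, because they commute.\<close>

lemma lap_eq_wirt:
 assumes S: "open S" "z \<in> S" and F: "smooth_on S F"
  and FW: "\<And>w. w \<in> S ==> wirt F (A w) (B w) w" and BW: "wirt B B1 B2 z"
 shows "lap F z = 4 * B1"
proof -
 have B: "B w = (pd 1 F w + \<i> * pd \<i> F w) / 2" if "w \<in> S" for w
  using wirt_pd[OF FW[OF that]] by (auto simp: algebra_simps)
 have d: "(pd v F has_derivative (%u. pd u (pd v F) z)) (at z)" for v
  using smooth_on_has_derivative[OF smooth_on_pd[OF F]] S by blast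
 have "((%w. (pd 1 F w + \<i> * pd \<i> F w) / 2) has_derivative
   (%u. (pd u (pd 1 F) z + \<i> * pd u (pd \<i> F) z) / 2)) (at z)"
  by (auto intro!: derivative_eq_intros d)
 from pd_eqI[OF this] wirt_pd[OF wirt_cong_open[OF S B BW]]
 have e: "(pd u (pd 1 F) z + \<i> * pd u (pd \<i> F) z) / 2 = B1 * u + B2 * cnj u" for u by auto
 have 1: "pd 1 (pd 1 F) z + \<i> * pd \<i> (pd 1 F) z = 2 * (B1 + B2)"
  using e[of 1] unfolding pd_symmetric[OF S(1) F S(2)] by (simp add: field_simps)
 have "pd \<i> (pd 1 F) z + \<i> * pd \<i> (pd \<i> F) z = 2 * \<i> * (B1 - B2)"
  using e[of \<i>] by (simp add: field_simps)
 then have 2: "- \<i> * pd \<i> (pd 1 F) z + pd \<i> (pd \<i> F) z = 2 * (B1 - B2)"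
  by (auto simp: complex_eq_iff)
 have key: "a + d = 4 * B1"
  if "a + \<i> * c = 2 * (B1 + B2)" "- \<i> * c + d = 2 * (B1 - B2)" for a c d :: complex
 proof -
  have "a + d = (a + \<i> * c) + (- \<i> * c + d)" by simp
  then show ?thesis unfolding that by (simp add: algebra_simps)
 qed
 show ?thesis unfolding lap_def by (rule key[OF 1 2])
qed

subsection \<open>Cutoff functions\<close>

text \<open>The flat function exp(-1/x), times powers of 1/x so that the family is closed under
  differentiation.\<close>

definition flat_exp :: "nat => real => real" where
 "flat_exp n x = (if x > 0 then exp (- inverse x) * inverse x ^ n else 0)"

lemma flat_exp_tendsto_0: "(flat_exp n \<longlongrightarrow> 0) (at_right 0)"
proof -
 have "((%x::real. inverse x ^ n / exp (inverse x)) \<longlongrightarrow> 0) (at_right 0)"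
  by (rule filterlim_compose[OF tendsto_power_div_exp_0 filterlim_inverse_at_top_right])
 then show ?thesis
  by (rule Lim_transform_eventually)
   (auto simp: eventually_at_filter flat_exp_def exp_minus field_simps)
qed

lemma flat_exp_has_derivative:
 "(flat_exp n has_real_derivative flat_exp (n + 2) x - real n * flat_exp (n + 1) x) (at x)"
proof (cases x "0::real" rule: linorder_cases)
 case less
 have "((%x. 0) has_real_derivative 0) (at x)" by simp
 then have "(flat_exp n has_real_derivative 0) (at x)"
  by (rule DERIV_cong_ev[THEN iffD1, rotated -1])
   (use less in \<open>auto simp: flat_exp_def intro: eventually_mono[OF eventually_nhds_in_open[of "{..<0}"]]\<close>)
 then show ?thesis using less by (simp add: flat_exp_def)
next
 case greater
 have "((%x. exp (- inverse x) * inverse x ^ n) has_real_derivative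
   flat_exp (n + 2) x - real n * flat_exp (n + 1) x) (at x)"
 proof -
  have i: "(inverse has_real_derivative - (inverse x * inverse x)) (at x)"
   using DERIV_inverse'[OF DERIV_ident, of x] greater by (simp add: )
  have 1: "((%x. inverse x ^ n) has_real_derivative - real n * inverse x ^ (n + 1)) (at x)"
   using DERIV_power[OF i, of n] by (cases n) (simp_all add: algebra_simps)
  have 2: "((%x. exp (- inverse x)) has_real_derivative exp (- inverse x) * inverse x ^ 2) (at x)"
   using DERIV_fun_exp[OF DERIV_minus[OF i]] by (simp add: power2_eq_square)
  show ?thesis
   by (rule DERIV_cong[OF DERIV_mult[OF 2 1]])
    (use greater in \<open>simp add: flat_exp_def power_add algebra_simps power2_eq_square\<close>)
 qed
 then show ?thesis
  by (rule DERIV_cong_ev[THEN iffD1, rotated -1])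
   (use greater in \<open>auto simp: flat_exp_def intro: eventually_mono[OF eventually_nhds_in_open[of "{0<..}"]]\<close>)
next
 case equal
 have "((%h. (flat_exp n (0 + h) - flat_exp n 0) / h) \<longlongrightarrow> 0) (at 0)"
  unfolding filterlim_at_split
 proof
  show "((%h. (flat_exp n (0 + h) - flat_exp n 0) / h) \<longlongrightarrow> 0) (at_left 0)"
   by (rule Lim_transform_eventually[OF tendsto_const]) (auto simp: eventually_at_filter flat_exp_def)
  \<comment> \<open>Dividing by \<open>h\<close> raises the exponent by one, so the difference
    quotient is again a member of the family.\<close>
  show "((%h. (flat_exp n (0 + h) - flat_exp n 0) / h) \<longlongrightarrow> 0) (at_right 0)"
   by (rule Lim_transform_eventually[OF flat_exp_tendsto_0[of "Suc n"]])
    (auto simp: eventually_at_filter flat_exp_def divide_inverse)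
 qed
 then show ?thesis using equal by (simp add: DERIV_def flat_exp_def)
qed

lemma smooth_on_flat_exp [smooth_intros]:
 fixes f :: "complex => real"
 assumes "open S" "smooth_on S f"
 shows "smooth_on S (%z. flat_exp n (f z))"
proof -
 have "Ck_on k S (%z. flat_exp n (f z))" for k n
 proof (induction k arbitrary: n)
  case 0
  have "continuous_on UNIV (flat_exp n)"
   using flat_exp_has_derivative DERIV_isCont by (metis continuous_at_imp_continuous_on)
  then show ?case using smooth_on_continuous[OF assms(2)] continuous_on_compose2[of UNIV "flat_exp n" S f] by simp
 next
  case (Suc k)
  have d: "((%z. flat_exp n (f z)) has_derivative
    (%v. (flat_exp (n + 2) (f z) - real n * flat_exp (n + 1) (f z)) * pd v f z)) (at z)" if "z \<in> S" for z
   using has_derivative_compose[OF smooth_on_has_derivative[OF assms(2) that]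
     flat_exp_has_derivative[unfolded has_field_derivative_def]] by simp
  have f: "Ck_on k S (pd v f)" for v using smooth_on_pd[OF assms(2)] by (auto simp: smooth_on_def)
  have k: "Ck_on k S (%z. (flat_exp (n + 2) (f z) + (- real n) * flat_exp (n + 1) (f z)) * pd v f z)" for v
   by (intro Ck_on_bilinear[OF assms(1) bounded_bilinear_mult] Ck_on_add Ck_on_const Suc.IH f assms(1))
  have "Ck_on k S (pd v (%z. flat_exp n (f z)))" for v
   by (rule Ck_on_cong[OF assms(1) _ k[of v]]) (simp add: pd_eqI[OF d])
  then show ?case using d unfolding Ck_on.simps differentiable_def by blast
 qed
 then show ?thesis by (simp add: smooth_on_def)
qed

text \<open>The transition runs from 1 to 4 because \<open>log_cutoff\<close> superposes the
  rescalings by \<open>4 ^ k\<close>, whose transition intervals then have disjoint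
  interiors.\<close>

definition cutoff :: "real => real" where
 "cutoff s = flat_exp 0 (s - 1) / (flat_exp 0 (s - 1) + flat_exp 0 (4 - s))"

lemma cutoff_denom_pos: "flat_exp 0 (s - 1) + flat_exp 0 (4 - s) > 0"
 by (auto simp: flat_exp_def add_pos_pos)

lemma smooth_on_cutoff [smooth_intros]:
 "open S ==> smooth_on S f ==> smooth_on S (%z. cutoff (f z))"
 unfolding cutoff_def by (intro smooth_intros) (use cutoff_denom_pos less_irrefl in \<open>metis | assumption\<close>)+

lemma cutoff_range: "0 \<le> cutoff s" "cutoff s \<le> 1"
 using cutoff_denom_pos[of s] by (auto simp: cutoff_def flat_exp_def field_simps)

lemma cutoff_0: "s \<le> 1 ==> cutoff s = 0"
 and cutoff_1: "s \<ge> 4 ==> cutoff s = 1"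
 by (auto simp: cutoff_def flat_exp_def)

lemma cutoff_derivative_bounded:
 obtains dc C where "\<And>s. (cutoff has_real_derivative dc s) (at s)" "\<And>s. \<bar>dc s\<bar> \<le> C"
  "\<And>s. s \<le> 1 \<or> s \<ge> 4 ==> dc s = 0"
proof -
 define D where "D = (%s. flat_exp 0 (s - 1) + flat_exp 0 (4 - s))"
 define dc where "dc = (%s. (flat_exp 2 (s - 1) * D s - flat_exp 0 (s - 1) * (flat_exp 2 (s - 1) - flat_exp 2 (4 - s))) / (D s)\<^sup>2)"
 have D: "D s \<noteq> 0" for s using cutoff_denom_pos[of s] by (simp add: D_def)
 have fe: "((%s. flat_exp 0 (g s)) has_real_derivative flat_exp 2 (g s) * g') (at s)"
  if "(g has_real_derivative g') (at s)" for g g' s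
  using DERIV_chain2[OF flat_exp_has_derivative[of 0 "g s"] that] by (simp add: numeral_2_eq_2)
 have 1: "(cutoff has_real_derivative dc s) (at s)" for s
  using D[of s] unfolding cutoff_def[abs_def] dc_def D_def
  by (auto intro!: derivative_eq_intros fe simp: power2_eq_square)
 have 0: "dc s = 0" if "s \<le> 1 \<or> s \<ge> 4" for s
  using that by (auto simp: dc_def D_def flat_exp_def)
 have c: "continuous_on UNIV (flat_exp n)" for n
  using flat_exp_has_derivative DERIV_isCont by (metis continuous_at_imp_continuous_on)
 have "continuous_on {1..4} dc"
  unfolding dc_def using D unfolding D_def
  by (intro continuous_intros continuous_on_compose2[OF c]) auto
 then have "bounded (dc ` {1..4})" by (intro compact_imp_bounded compact_continuous_image) auto
 then obtain C where C: "\<forall>s\<in>{1..4}. \<bar>dc s\<bar> \<le> C" unfolding bounded_iff by auto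
 have "\<bar>dc s\<bar> \<le> max C 0" for s
 proof (cases "s \<in> {1..4}")
  case True
  then show ?thesis using C by (simp add: le_max_iff_disj)
 next
  case False
  then show ?thesis using 0[of s] by auto
 qed
 with 1 0 show ?thesis using that by blast
qed

section \<open>Integration over the period rectangle\<close>

lemma measurable_Complex [measurable]:
 "(%p. Complex (fst p) (snd p)) \<in> borel_measurable (borel \<Otimes>\<^sub>M borel)"
 unfolding borel_prod
 by (intro borel_measurable_continuous_onI) (auto simp: Complex_eq intro!: continuous_intros)

lemma lborel_complex:
 "(lborel :: complex measure) = distr (lborel \<Otimes>\<^sub>M lborel) borel (%p. Complex (fst p) (snd p))"
proof (rule lborel_eqI)
 fix l u :: complex
 assume le: "\<And>b. b \<in> Basis ==> l \<bullet> b \<le> u \<bullet> b"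
 then have le': "Re l \<le> Re u" "Im l \<le> Im u"
  using le[of 1] le[of \<i>] by (auto simp: Basis_complex_def inner_complex_def)
 have "(%p. Complex (fst p) (snd p)) -` box l u \<inter> space (lborel \<Otimes>\<^sub>M lborel)
   = {Re l<..<Re u} \<times> {Im l<..<Im u}"
  by (auto simp: box_def Basis_complex_def inner_complex_def space_pair_measure)
 then show "emeasure (distr (lborel \<Otimes>\<^sub>M lborel) borel (%p. Complex (fst p) (snd p))) (box l u)
   = (\<Prod>b\<in>Basis. (u - l) \<bullet> b)"
  using le' by (simp add: emeasure_distr lborel.emeasure_pair_measure_Times Basis_complex_def
    inner_complex_def ennreal_mult')
qed simp

lemma integral_complex_iterated:
 fixes F :: "complex => real"
 assumes "integrable lborel F"
 shows "integral\<^sup>L lborel F = (LINT x|lborel. LINT y|lborel. F (Complex x y))"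
  and "integral\<^sup>L lborel F = (LINT y|lborel. LINT x|lborel. F (Complex x y))"
proof -
 have [measurable]: "F \<in> borel_measurable borel" using borel_measurable_integrable[OF assms] by simp
 have i: "integrable (lborel \<Otimes>\<^sub>M lborel) (%p. F (Complex (fst p) (snd p)))"
  using assms unfolding lborel_complex by (subst (asm) integrable_distr_eq) auto
 have "integral\<^sup>L lborel F = (LINT p|(lborel \<Otimes>\<^sub>M lborel). F (Complex (fst p) (snd p)))"
  using assms by (subst lborel_complex, subst integral_distr) auto
 then show "integral\<^sup>L lborel F = (LINT x|lborel. LINT y|lborel. F (Complex x y))"
  and "integral\<^sup>L lborel F = (LINT y|lborel. LINT x|lborel. F (Complex x y))"
  using lborel_pair.integral_fst'[OF i] lborel_pair.integral_snd[of "%x y. F (Complex x y)"] i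
  by (auto simp: case_prod_unfold)
qed

section \<open>Integrals of periodic functions over the period rectangle\<close>

lemma fund_domain_measurable [measurable]: "fund_domain t \<in> sets borel"
 unfolding fund_domain_def by measurable

lemma indicator_fund_domain:
 "indicator (fund_domain t) (Complex x y) = (indicator {0..<1} x * indicator {0..<t} y :: real)"
 by (auto simp: fund_domain_def indicator_def)

lemma set_integrable_fund_domain:
 fixes F :: "complex => real"
 assumes "continuous_on UNIV F"
 shows "set_integrable lborel (fund_domain t) F"
proof -
 have "set_integrable lborel (cbox 0 (Complex 1 t)) F"
  unfolding set_integrable_def
  by (rule borel_integrable_compact) (auto intro: continuous_on_subset[OF assms])
 then show ?thesis
  by (rule set_integrable_subset)
   (auto simp: fund_domain_def cbox_def Basis_complex_def inner_complex_def)
qed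

definition fint :: "real => (complex => real) => real" where
 "fint t F = (LINT z:fund_domain t|lborel. F z)"

lemma set_integral_Ico:
 fixes f :: "real => real"
 shows "(LINT x:{a..<b}|lborel. f x) = (LINT x:{a..b}|lborel. f x)"
 by (rule set_integral_discrete_difference[of "{b}"]) auto

lemma fint_iterated:
 fixes F :: "complex => real"
 assumes "continuous_on UNIV F"
 shows "fint t F = (LINT x:{0..1}|lborel. LINT y:{0..t}|lborel. F (Complex x y))"
  and "fint t F = (LINT y:{0..t}|lborel. LINT x:{0..1}|lborel. F (Complex x y))"
proof -
 note i = set_integrable_fund_domain[OF assms, of t, unfolded set_integrable_def]
 show "fint t F = (LINT x:{0..1}|lborel. LINT y:{0..t}|lborel. F (Complex x y))"
  unfolding fint_def set_lebesgue_integral_def integral_complex_iterated(1)[OF i] indicator_fund_domain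
  unfolding set_lebesgue_integral_def[symmetric] set_integral_Ico[symmetric]
  by (simp add: set_lebesgue_integral_def mult.assoc)
 show "fint t F = (LINT y:{0..t}|lborel. LINT x:{0..1}|lborel. F (Complex x y))"
  unfolding fint_def set_lebesgue_integral_def integral_complex_iterated(2)[OF i] indicator_fund_domain
  unfolding set_lebesgue_integral_def[symmetric] set_integral_Ico[symmetric]
  by (simp add: set_lebesgue_integral_def mult.assoc
    mult.left_commute[of "indicator {0..<1} _" "indicator {0..<t} _"])
qed

lemma fint_reflect:
 fixes F :: "complex => real"
 assumes F: "continuous_on UNIV F" and per: "\<And>z. F (z + 1) = F z" "\<And>z. F (z + \<i> * of_real t) = F z"
 shows "fint t (%z. F (- cnj z)) = fint t F" "fint t (%z. F (cnj z)) = fint t F"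
proof -
 have c: "continuous_on UNIV (%z. F (- cnj z))" "continuous_on UNIV (%z. F (cnj z))"
  by (auto intro!: continuous_intros continuous_on_compose2[OF F])
 have *: "(LINT x:{0..T}|lborel. G (- x)) = (LINT x:{0..T}|lborel. G x)"
  if "\<And>x. G (x + T) = G x" for G :: "real => real" and T
 proof -
  \<comment> \<open>The substitution x -> T - x turns G(-x) into G(x - T), which is G(x) by
    periodicity.\<close>
  have "(LINT x:{0..T}|lborel. G (- x)) = (LINT x|lborel. indicator {0..T} (T + (- 1) * x) * G (- (T + (- 1) * x)))"
   unfolding set_lebesgue_integral_def
   by (subst lborel_integral_real_affine[where t = T and c = "-1"]) auto
  also have "\<dots> = (LINT x:{0..T}|lborel. G x)"
   unfolding set_lebesgue_integral_def
  proof (intro Bochner_Integration.integral_cong)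
   show "indicator {0..T} (T + (- 1) * x) * G (- (T + (- 1) * x)) = indicator {0..T} x *\<^sub>R G x" for x
    using that[of "x - T"] by (auto simp: indicator_def algebra_simps)
  qed simp
  finally show ?thesis .
 qed
 show "fint t (%z. F (- cnj z)) = fint t F"
 proof -
  have "(LINT x:{0..1}|lborel. F (- cnj (Complex x y))) = (LINT x:{0..1}|lborel. F (Complex x y))" for y
   using *[of "%x. F (Complex x y)" 1] per(1)[of "Complex _ y"]
   by (simp add: complex_eq_iff Complex_eq algebra_simps)
  then show ?thesis unfolding fint_iterated(2)[OF F] fint_iterated(2)[OF c(1)] by simp
 qed
 show "fint t (%z. F (cnj z)) = fint t F"
 proof -
  have "(LINT y:{0..t}|lborel. F (cnj (Complex x y))) = (LINT y:{0..t}|lborel. F (Complex x y))" for x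
   using *[of "%y. F (Complex x y)" t] per(2)[of "Complex x _"]
   by (simp add: complex_eq_iff Complex_eq algebra_simps)
  then show ?thesis unfolding fint_iterated(1)[OF F] fint_iterated(1)[OF c(2)] by simp
 qed
qed

text \<open>Integrating first in the direction of the derivative, the fundamental theorem of
  calculus leaves values at opposite sides of the rectangle, which coincide. This is integration by
  parts on the torus.\<close>

lemma fint_pd_periodic:
 fixes W :: "complex => real"
 assumes W: "\<And>z. W differentiable (at z)" "continuous_on UNIV (pd v W)"
  and v: "v = 1 \<and> (\<forall>z. W (z + 1) = W z) \<or> v = \<i> \<and> (\<forall>z. W (z + \<i> * of_real t) = W z)" and t: "t \<ge> 0"
 shows "fint t (pd v W) = 0"
proof -
 have ftc: "(LINT s:{0..T}|lborel. pd u W (a + s *\<^sub>R u)) = W (a + T *\<^sub>R u) - W a"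
  if "continuous_on UNIV (pd u W)" "0 \<le> T" for T :: real and a u :: complex
 proof -
  have d: "((%s. W (a + s *\<^sub>R u)) has_vector_derivative pd u W (a + s *\<^sub>R u)) (at s within {0..T})" for s
  proof -
   have 1: "((%s. a + s *\<^sub>R u) has_derivative (%h. h *\<^sub>R u)) (at s)"
    by (auto intro!: derivative_eq_intros)
   have 2: "(W has_derivative (%v. pd v W (a + s *\<^sub>R u))) (at (a + s *\<^sub>R u))"
    using W(1) differentiable_has_pd by blast
   have "pd (h *\<^sub>R u) W (a + s *\<^sub>R u) = h *\<^sub>R pd u W (a + s *\<^sub>R u)" for h
    using has_derivative_linear[OF 2] by (rule linear_cmul)
   then show ?thesis using has_derivative_compose[OF 1 2]
    unfolding has_vector_derivative_def by (simp add: has_derivative_at_withinI)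
  qed
  have "continuous_on {0..T} (%s. pd u W (a + s *\<^sub>R u))"
   by (intro continuous_on_compose2[OF that(1)] continuous_intros) auto
  from integral_FTC_Icc[OF that(2) d this] show ?thesis
   by (simp add: set_lebesgue_integral_def)
 qed
 from v show ?thesis
 proof
  assume v: "v = 1 \<and> (\<forall>z. W (z + 1) = W z)"
  have "(LINT x:{0..1}|lborel. pd v W (Complex x y)) = 0" for y
  proof -
   have "Complex x y = \<i> * of_real y + x *\<^sub>R 1" for x by (simp add: complex_eq_iff)
   then show ?thesis using ftc[of 1 1 "\<i> * of_real y"] W(2) v by simp
  qed
  then show ?thesis unfolding fint_iterated(2)[OF W(2)] by (simp add: set_lebesgue_integral_def)
 next
  assume v: "v = \<i> \<and> (\<forall>z. W (z + \<i> * of_real t) = W z)"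
  have "(LINT y:{0..t}|lborel. pd v W (Complex x y)) = 0" for x
  proof -
   have "Complex x y = of_real x + y *\<^sub>R \<i>" for y by (simp add: complex_eq_iff)
   then show ?thesis using ftc[of \<i> t "of_real x"] W(2) v t by (simp add: scaleR_conv_of_real mult.commute)
  qed
  then show ?thesis unfolding fint_iterated(1)[OF W(2)] by (simp add: set_lebesgue_integral_def)
 qed
qed

lemma fint_add:
 "continuous_on UNIV F ==> continuous_on UNIV G ==> fint t (%z. F z + G z) = fint t F + fint t G"
 unfolding fint_def by (intro set_integral_add set_integrable_fund_domain)

lemma fint_cmult: "fint t (%z. c * F z) = c * fint t F"
 unfolding fint_def by simp

lemma fint_mono:
 "continuous_on UNIV F ==> continuous_on UNIV G ==> (\<And>z. F z \<le> G z) ==> fint t F \<le> fint t G"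
 unfolding fint_def by (intro set_integral_mono set_integrable_fund_domain)

lemma fint_sum:
 "(\<And>i. i \<in> I ==> continuous_on UNIV (F i)) ==> fint t (%z. \<Sum>i\<in>I. F i z) = (\<Sum>i\<in>I. fint t (F i))"
proof (induction I rule: infinite_finite_induct)
 case (insert i I)
 then show ?case using fint_add[of "F i" "%z. \<Sum>i\<in>I. F i z" t] by (auto intro!: continuous_intros)
qed (simp_all add: fint_def)

lemma fint_eq_0_D:
 assumes F: "continuous_on UNIV F" "\<And>z. F z \<ge> 0" and 0: "fint t F = 0"
  and z: "0 < Re z" "Re z < 1" "0 < Im z" "Im z < t"
 shows "F z = 0"
proof (rule ccontr)
 assume "F z \<noteq> 0"
 then have Fz: "F z > 0" using F(2)[of z] by simp
 let ?B = "box 0 (Complex 1 t)"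
 have B: "z \<in> ?B" "?B \<subseteq> fund_domain t"
  using z by (auto simp: box_def fund_domain_def Basis_complex_def inner_complex_def)
 have op: "open (?B \<inter> F -` {F z / 2<..})"
  using F(1) by (intro open_Int open_vimage) auto
 have "z \<in> ?B \<inter> F -` {F z / 2<..}" using B Fz by auto
 then have "?B \<inter> F -` {F z / 2<..} \<noteq> {}" by blast
 with op have "emeasure lborel (?B \<inter> F -` {F z / 2<..}) \<noteq> 0"
  using open_not_negligible[of "?B \<inter> F -` {F z / 2<..}"]
  by (auto simp: negligible_iff_null_sets null_sets_def null_sets_completion_iff)
 moreover have "AE w in lborel. indicator (fund_domain t) w *\<^sub>R F w = 0"
  using 0 F(2) set_integrable_fund_domain[OF F(1), of t]
  unfolding fint_def set_lebesgue_integral_def set_integrable_def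
  by (subst (asm) integral_nonneg_eq_0_iff_AE) auto
 then have "AE w in lborel. w \<notin> ?B \<inter> F -` {F z / 2<..}"
  by (rule AE_mp) (use B Fz in \<open>auto intro!: AE_I2 simp: indicator_def split: if_splits\<close>)
 then have "emeasure lborel (?B \<inter> F -` {F z / 2<..}) = 0"
  using AE_iff_null_sets[of "?B \<inter> F -` {F z / 2<..}" lborel] op by (simp add: null_sets_def borel_open)
 ultimately show False by simp
qed

subsection \<open>Areas of holomorphic images\<close>

definition vec_to_complex :: "real^2 => complex" where
 "vec_to_complex v = Complex (v $ 1) (v $ 2)"

definition complex_to_vec :: "complex => real^2" where
 "complex_to_vec z = vector [Re z, Im z]"

lemma vec_complex_inverse [simp]:
 "vec_to_complex (complex_to_vec z) = z" "complex_to_vec (vec_to_complex v) = v"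
 by (auto simp: vec_to_complex_def complex_to_vec_def vec_eq_iff forall_2 complex_eq_iff)

lemma bounded_linear_vec_to_complex: "bounded_linear vec_to_complex"
 and bounded_linear_complex_to_vec: "bounded_linear complex_to_vec"
 by (rule linear_conv_bounded_linear[THEN iffD1],
   rule linearI; simp add: vec_to_complex_def complex_to_vec_def vec_eq_iff forall_2 complex_eq_iff)+

lemma continuous_vec_to_complex: "continuous_on S vec_to_complex"
 by (rule linear_continuous_on[OF bounded_linear_vec_to_complex])

text \<open>The area bound for differentiable images is expressed by determinants of matrices, hence
  on \<open>real^2\<close>; this identification carries it to the complex plane.\<close>

lemma lborel_complex_vec: "(lborel :: complex measure) = distr lborel borel vec_to_complex"
proof (rule lborel_eqI)
 fix l u :: complex
 assume le: "\<And>b. b \<in> Basis ==> l \<bullet> b \<le> u \<bullet> b"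
 then have le': "Re l \<le> Re u" "Im l \<le> Im u"
  using le[of 1] le[of \<i>] by (auto simp: Basis_complex_def inner_complex_def)
 have m: "vec_to_complex \<in> borel_measurable lborel"
  using borel_measurable_continuous_onI[OF continuous_vec_to_complex] by simp
 have "vec_to_complex -` box l u = box (complex_to_vec l) (complex_to_vec u)"
  unfolding set_eq_iff vimage_eq mem_box_cart forall_2
  by (auto simp: complex_to_vec_def box_def Basis_complex_def inner_complex_def vec_to_complex_def)
 moreover have "(\<Prod>b\<in>Basis. (complex_to_vec u - complex_to_vec l) \<bullet> b) = (Re u - Re l) * (Im u - Im l)"
  by (simp add: Basis_vec_def UNION_singleton_eq_range prod.reindex inj_on_def axis_eq_axis
    inner_axis complex_to_vec_def UNIV_2)
 moreover have "\<forall>b\<in>Basis. complex_to_vec l \<bullet> b \<le> complex_to_vec u \<bullet> b"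
 proof
  fix b :: "real^2" assume "b \<in> Basis"
  then obtain i where "b = axis i 1" by (auto simp: Basis_vec_def)
  then show "complex_to_vec l \<bullet> b \<le> complex_to_vec u \<bullet> b"
   using le' exhaust_2[of i] by (auto simp: inner_axis complex_to_vec_def)
 qed
 ultimately show "emeasure (distr lborel borel vec_to_complex) (box l u) = (\<Prod>b\<in>Basis. (u - l) \<bullet> b)"
  using le' by (subst emeasure_distr[OF m]) (auto simp: emeasure_lborel_box Basis_complex_def inner_complex_def)
qed simp

text \<open>The Jacobian determinant of a holomorphic map is the squared modulus of its derivative,
  so the image has area below 1/4. That is the area of the square with corners 0 and (1 + i)/2
  inside the unit disc, which the image would fill up to a null set if it missed only finitely many
  values.\<close>

lemma holomorphic_image_misses_infinite:
 assumes U: "open U" and g: "g holomorphic_on U"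
  and int: "set_integrable lborel U (%z. (norm (deriv g z))\<^sup>2)"
  and small: "(LINT z:U|lborel. (norm (deriv g z))\<^sup>2) < 1/4"
 shows "infinite (ball 0 1 - g ` U)"
proof
 assume fin: "finite (ball 0 1 - g ` U)"
 define S where "S = vec_to_complex -` U"
 define f where "f = complex_to_vec \<circ> g \<circ> vec_to_complex"
 define f' where "f' = (%x v. complex_to_vec (deriv g (vec_to_complex x) * vec_to_complex v))"
 have openS: "open S" unfolding S_def
  using U continuous_vec_to_complex[of UNIV] by (simp add: open_vimage)
 have d: "(f has_derivative f' x) (at x within S)" if "x \<in> S" for x
 proof -
  have "(g has_derivative (%v. deriv g (vec_to_complex x) * v)) (at (vec_to_complex x))"
   using that holomorphic_derivI[OF g U] by (auto simp: S_def has_field_derivative_def)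
  from has_derivative_compose[OF bounded_linear_imp_has_derivative[OF bounded_linear_vec_to_complex] this]
  have "((%x. g (vec_to_complex x)) has_derivative (%v. deriv g (vec_to_complex x) * vec_to_complex v)) (at x)" .
  from bounded_linear.has_derivative[OF bounded_linear_complex_to_vec this]
  show ?thesis by (auto simp: f_def f'_def o_def intro: has_derivative_at_withinI)
 qed
 have det: "\<bar>det (matrix (f' x))\<bar> = (norm (deriv g (vec_to_complex x)))\<^sup>2" for x
  unfolding cmod_power2
  by (simp add: det_2 matrix_def f'_def complex_to_vec_def vec_to_complex_def axis_def power2_eq_square)
 have m: "vec_to_complex \<in> borel_measurable lborel"
  using borel_measurable_continuous_onI[OF continuous_vec_to_complex] by simp
 let ?F = "%z. indicator U z *\<^sub>R (norm (deriv g z))\<^sup>2"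
 have mF: "?F \<in> borel_measurable borel"
  using borel_measurable_integrable[OF int[unfolded set_integrable_def]] by simp
 have S_eq: "?F (vec_to_complex x) = indicator S x *\<^sub>R \<bar>det (matrix (f' x))\<bar>" for x
  unfolding det by (simp add: S_def indicator_def)
 have iS: "set_integrable lborel S (%x. \<bar>det (matrix (f' x))\<bar>)"
  using int unfolding set_integrable_def S_eq[symmetric]
  by (subst (asm) lborel_complex_vec, subst (asm) integrable_distr_eq[OF m mF])
 have eq: "(LINT x:S|lborel. \<bar>det (matrix (f' x))\<bar>) = (LINT z:U|lborel. (norm (deriv g z))\<^sup>2)"
 proof -
  have "(LINT z:U|lborel. (norm (deriv g z))\<^sup>2) = (LINT z|distr lborel borel vec_to_complex. ?F z)"
   unfolding set_lebesgue_integral_def lborel_complex_vec[symmetric] ..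
  also have "\<dots> = (LINT x|lborel. ?F (vec_to_complex x))"
   by (rule integral_distr[OF m mF])
  finally show ?thesis unfolding S_eq by (simp add: set_lebesgue_integral_def)
 qed
 have leb: "S \<in> sets lebesgue" using openS by (simp add: borel_open)
 note I = set_borel_integral_eq_integral[OF iS]
 have fS: "f ` S \<in> lmeasurable" and le: "measure lebesgue (f ` S) \<le> integral S (%x. \<bar>det (matrix (f' x))\<bar>)"
  using measurable_differentiable_image[OF leb d I(1)] measure_differentiable_image[OF leb d I(1)] by auto
 let ?Q = "cbox (vec 0) (vec (1/2)) :: (real^2) set"
 let ?N = "complex_to_vec ` (ball 0 1 - g ` U)"
 have N: "negligible ?N" using fin by (simp add: negligible_finite)
 have "?Q \<subseteq> f ` S \<union> ?N"
 proof
  fix x :: "real^2" assume x: "x \<in> ?Q"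
  then have "norm (vec_to_complex x) < 1"
  proof -
   have "\<bar>x $ 1\<bar> \<le> 1/2" "\<bar>x $ 2\<bar> \<le> 1/2" using x by (auto simp: mem_box_cart forall_2)
   then have "(x $ 1)\<^sup>2 \<le> (1/2)\<^sup>2" "(x $ 2)\<^sup>2 \<le> (1/2)\<^sup>2" by (auto intro: power2_le_iff_abs_le[THEN iffD2])
   then have "(x $ 1)\<^sup>2 + (x $ 2)\<^sup>2 < 1" by (simp add: power2_eq_square)
   then show ?thesis by (simp add: vec_to_complex_def cmod_def)
  qed
  then show "x \<in> f ` S \<union> ?N"
  proof (cases "vec_to_complex x \<in> g ` U")
   case True
   then obtain z where "z \<in> U" "vec_to_complex x = g z" by auto
   then have "f (complex_to_vec z) = x" "complex_to_vec z \<in> S"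
    by (auto simp: f_def S_def) (metis vec_complex_inverse(2))
   then show ?thesis by blast
  next
   case False
   then have "vec_to_complex x \<in> ball 0 1 - g ` U" using \<open>norm (vec_to_complex x) < 1\<close> by auto
   then show ?thesis by (metis UnI2 imageI vec_complex_inverse(2))
  qed
 qed
 then have "measure lebesgue ?Q \<le> measure lebesgue (f ` S \<union> ?N)"
  using fS N by (intro measure_mono_fmeasurable fmeasurable.Un) (auto simp: negligible_imp_measurable)
 also have "\<dots> = measure lebesgue (f ` S)"
  using N fS by (intro measure_negligible_symdiff) (auto intro: negligible_subset)
 also have "\<dots> < 1/4" using le I(2) eq small by simp
 finally have "measure lborel ?Q < 1/4" by (simp only: measure_completion sets_lborel borel_closed closed_cbox)
 moreover have "0 \<in> ?Q" by (simp add: mem_box_cart)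
 then have "measure lborel ?Q = (\<Prod>i\<in>UNIV. (vec (1/2) :: real^2) $ i - (vec 0 :: real^2) $ i)"
  by (intro content_cbox_cart) auto
 then have "measure lborel ?Q = 1/4" by (simp only: vec_component) (simp add: power2_eq_square)
 ultimately show False by linarith
qed

section \<open>Complete flat ends\<close>

subsection \<open>Inverse branches on large discs\<close>

text \<open>In the application \<open>F\<close> is the developing map of the flat metric |f| |dz| in
  the logarithmic coordinate, and \<open>A\<close> is a disc; \<open>F\<close> need not be
  injective.\<close>

definition inv_branch :: "(complex => complex) => complex set => complex set => (complex => complex) => bool" where
 "inv_branch F H A G \<longleftrightarrow> G holomorphic_on A \<and> G ` A \<subseteq> H \<and> (\<forall>w\<in>A. F (G w) = w)"

lemma inv_branch_subset: "inv_branch F H A G ==> B \<subseteq> A ==> inv_branch F H B G"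
 by (auto simp: inv_branch_def intro: holomorphic_on_subset)

lemma inv_branch_local:
 assumes F: "F holomorphic_on H" "open H" "u \<in> H" "deriv F u \<noteq> 0"
 obtains W \<epsilon> K where "open W" "u \<in> W" "W \<subseteq> H" "inj_on F W" "\<epsilon> > 0"
  "inv_branch F H (ball (F u) \<epsilon>) K" "\<And>v. v \<in> W ==> K (F v) = v"
proof -
 obtain r where r: "r > 0" "ball u r \<subseteq> H" "open (F ` ball u r)" "inj_on F (ball u r)"
  using has_complex_derivative_locally_invertible[OF F(1,3,2,4)] .
 have hol: "F holomorphic_on ball u r" using F(1) r(2) holomorphic_on_subset by blast
 obtain K where K: "K holomorphic_on (F ` ball u r)"
   "\<And>v. v \<in> ball u r ==> deriv F v * deriv K (F v) = 1" "\<And>v. v \<in> ball u r ==> K (F v) = v"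
  by (rule holomorphic_has_inverse[OF hol open_ball r(4)]) (rule that)
 obtain \<epsilon> where \<epsilon>: "\<epsilon> > 0" "ball (F u) \<epsilon> \<subseteq> F ` ball u r"
  using r(1,3) by (metis centre_in_ball imageI openE)
 have "inv_branch F H (ball (F u) \<epsilon>) K"
  unfolding inv_branch_def
 proof (intro conjI ballI)
  show "K holomorphic_on ball (F u) \<epsilon>" using K(1) \<epsilon>(2) holomorphic_on_subset by blast
  show "K ` ball (F u) \<epsilon> \<subseteq> H" using K(3) \<epsilon>(2) r(2) by force
  show "F (K w) = w" if "w \<in> ball (F u) \<epsilon>" for w using that K(3) \<epsilon>(2) by force
 qed
 then show ?thesis using that[of "ball u r" \<epsilon> K] r K \<epsilon> by auto
qed

text \<open>Since \<open>F\<close> is injective near the common value at \<open>a\<close>, the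
  branches agree near \<open>a\<close>, and analytic continuation spreads the agreement over
  \<open>A\<close>.\<close>

lemma inv_branch_unique:
 assumes F: "F holomorphic_on H" "open H" "\<And>u. u \<in> H ==> deriv F u \<noteq> 0"
  and A: "open A" "connected A" and G: "inv_branch F H A G" "inv_branch F H A G'"
  and a: "a \<in> A" "G a = G' a" and w: "w \<in> A"
 shows "G w = G' w"
proof -
 have "G a \<in> H" using G a by (auto simp: inv_branch_def)
 then obtain W \<epsilon> K where W: "open W" "G a \<in> W" "inj_on F W"
  using inv_branch_local[OF F(1,2) _ F(3)] by metis
 have cont: "continuous_on A G" "continuous_on A G'"
  using G by (auto simp: inv_branch_def holomorphic_on_imp_continuous_on)
 define B where "B = (A \<inter> G -` W) \<inter> (A \<inter> G' -` W)"
 have "open B" unfolding B_def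
  by (rule open_Int[OF continuous_open_preimage[OF cont(1) A(1) W(1)] continuous_open_preimage[OF cont(2) A(1) W(1)]])
 then have B: "open B" "a \<in> B" "B \<subseteq> A" using W a by (auto simp: B_def)
 have "G x = G' x" if "x \<in> B" for x
  using that W(3) G unfolding B_def inv_branch_def inj_on_def by auto
 then show ?thesis
  using analytic_continuation_open[OF B(1) A(1) _ A(2) B(3), of G G'] B(2) G w
  by (auto simp: inv_branch_def)
qed

lemma inv_branch_glue:
 assumes I: "\<And>i. i \<in> I ==> open (A i)" "\<And>i. i \<in> I ==> inv_branch F H (A i) (K i)"
  and agree: "\<And>i j w. i \<in> I ==> j \<in> I ==> w \<in> A i ==> w \<in> A j ==> K i w = K j w"
 obtains G where "inv_branch F H (\<Union>i\<in>I. A i) G" "\<And>i w. i \<in> I ==> w \<in> A i ==> G w = K i w"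
proof -
 define G where "G = (%w. K (SOME i. i \<in> I \<and> w \<in> A i) w)"
 have G: "G w = K i w" if "i \<in> I" "w \<in> A i" for i w
 proof -
  have "(SOME i. i \<in> I \<and> w \<in> A i) \<in> I \<and> w \<in> A (SOME i. i \<in> I \<and> w \<in> A i)"
   by (rule someI[of "%i. i \<in> I \<and> w \<in> A i"]) (use that in blast)
  then show ?thesis unfolding G_def using agree that by blast
 qed
 have "G holomorphic_on (\<Union>i\<in>I. A i)"
 proof (rule holomorphic_on_UN_open)
  fix i assume i: "i \<in> I"
  show "G holomorphic_on A i"
   using I(2)[OF i] G[OF i] holomorphic_transform[of "K i" "A i" G] by (auto simp: inv_branch_def)
 qed (use I in auto)
 then have "inv_branch F H (\<Union>i\<in>I. A i) G"
  using I(2) G unfolding inv_branch_def by (auto simp: image_subset_iff)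
 then show ?thesis using that G by blast
qed

text \<open>If a branch on \<open>ball 0 R\<close> has radial limits in \<open>H\<close> at every boundary point, the local inverses
 at these limits extend it past the boundary circle.\<close>

lemma inv_branch_extend:
 assumes F: "F holomorphic_on H" "open H" "\<And>u. u \<in> H ==> deriv F u \<noteq> 0"
  and R: "R > 0" and G: "inv_branch F H (ball 0 R) G"
  and lim: "\<And>p. norm p = R ==> \<exists>u\<in>H. ((%s. G (of_real s * p)) \<longlongrightarrow> u) (at_left 1)"
 obtains R' G' where "R' > R" "inv_branch F H (ball 0 R') G'" "G' 0 = G 0"
proof -
 have "\<exists>K \<epsilon>. \<epsilon> > 0 \<and> inv_branch F H (ball p \<epsilon>) K \<and> (\<forall>w \<in> ball p \<epsilon> \<inter> ball 0 R. K w = G w)"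
  if p: "norm p = R" for p
 proof -
  obtain u where u: "u \<in> H" "((%s. G (of_real s * p)) \<longlongrightarrow> u) (at_left 1)" using lim[OF p] by blast
  obtain W \<epsilon> K where W: "open W" "u \<in> W" "W \<subseteq> H" "\<epsilon> > 0"
   "inv_branch F H (ball (F u) \<epsilon>) K" "\<And>v. v \<in> W ==> K (F v) = v"
   using inv_branch_local[OF F(1,2) u(1) F(3)[OF u(1)]] by metis
  have in_ball: "of_real s * p \<in> ball 0 R" if "0 < s" "s < 1" for s :: real
   using that p R by (simp add: norm_mult)
  have ev01: "\<forall>\<^sub>F s in at_left (1::real). 0 < s \<and> s < 1"
   by (auto simp: eventually_at_left_field intro!: exI[of _ 0])
  have "isCont F u" using F(1,2) u(1) holomorphic_on_imp_continuous_on continuous_on_eq_continuous_at by blast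
  then have "((%s. F (G (of_real s * p))) \<longlongrightarrow> F u) (at_left 1)"
   using u(2) isCont_tendsto_compose by blast
  moreover have "\<forall>\<^sub>F s in at_left (1::real). F (G (of_real s * p)) = of_real s * p"
   using ev01 by eventually_elim (use G in_ball in \<open>auto simp: inv_branch_def\<close>)
  ultimately have lF: "((%s. of_real s * p) \<longlongrightarrow> F u) (at_left 1)"
   by (rule Lim_transform_eventually)
  have lp: "((%s. of_real s * p) \<longlongrightarrow> p) (at_left 1)"
   by (rule tendsto_eq_intros refl | simp)+
  \<comment> \<open>Passing to the radial limit in \<open>F (G w) = w\<close> places
    \<open>u\<close> above \<open>p\<close>, so the local inverse at \<open>u\<close> lives on a
    disc centred at \<open>p\<close>.\<close>
  have Fu: "F u = p" by (rule tendsto_unique[OF _ lF lp]) simp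
  have "\<forall>\<^sub>F s in at_left (1::real). of_real s * p \<in> ball p \<epsilon>"
   using topological_tendstoD[OF lp open_ball] W(4) by simp
  moreover have "\<forall>\<^sub>F s in at_left (1::real). G (of_real s * p) \<in> W"
   by (rule topological_tendstoD[OF u(2) W(1,2)])
  ultimately have "\<forall>\<^sub>F s in at_left (1::real). of_real s * p \<in> ball p \<epsilon> \<and> G (of_real s * p) \<in> W \<and> 0 < s \<and> s < 1"
   using ev01 by eventually_elim auto
  then obtain s where s: "of_real s * p \<in> ball p \<epsilon>" "G (of_real s * p) \<in> W" "0 < s" "s < 1"
   using eventually_happens'[OF trivial_limit_at_left_real] by blast
  have Ks: "K (of_real s * p) = G (of_real s * p)"
   using W(6)[OF s(2)] G in_ball[OF s(3,4)] by (auto simp: inv_branch_def)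
  have "K w = G w" if "w \<in> ball p \<epsilon> \<inter> ball 0 R" for w
   by (rule inv_branch_unique[OF F, of "ball p \<epsilon> \<inter> ball 0 R" K G "of_real s * p"])
    (use that W(5) G s(1) in_ball[OF s(3,4)] Ks Fu in \<open>auto intro: inv_branch_subset convex_connected convex_Int\<close>)
  then show ?thesis using W(4,5) unfolding Fu by blast
 qed
 then obtain K \<epsilon> where K: "\<And>p. norm p = R ==> \<epsilon> p > 0 \<and> inv_branch F H (ball p (\<epsilon> p)) (K p) \<and>
   (\<forall>w \<in> ball p (\<epsilon> p) \<inter> ball 0 R. K p w = G w)" by metis
 have agree: "K p w = K q w"
  if pq: "norm p = R" "norm q = R" and w: "w \<in> ball p (\<epsilon> p)" "w \<in> ball q (\<epsilon> q)" for p q w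
 proof -
  have pos: "\<epsilon> p > 0" "\<epsilon> q > 0" using K pq by auto
  \<comment> \<open>The segment from \<open>p\<close> to \<open>q\<close> is divided in the ratio of
    the two radii, which puts \<open>x\<close> into both discs. By convexity \<open>x\<close> lies
    in the closed disc of radius \<open>R\<close>; points slightly closer to the origin lie in the
    open disc, where both local inverses equal \<open>G\<close>.\<close>
  define \<tau> where "\<tau> = \<epsilon> p / (\<epsilon> p + \<epsilon> q)"
  have \<tau>: "0 < \<tau>" "\<tau> < 1" "1 - \<tau> = \<epsilon> q / (\<epsilon> p + \<epsilon> q)" using pos by (auto simp: \<tau>_def field_simps)
  define x where "x = (1 - \<tau>) *\<^sub>R p + \<tau> *\<^sub>R q"
  have d: "dist p q < \<epsilon> p + \<epsilon> q" using w dist_triangle2[of p q w] by (auto simp: dist_commute)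
  have "dist p x = \<tau> * dist p q"
  proof -
   have "p - x = \<tau> *\<^sub>R (p - q)" by (simp add: x_def algebra_simps)
   then show ?thesis using \<tau> by (simp add: dist_norm)
  qed
  also have "\<dots> < \<tau> * (\<epsilon> p + \<epsilon> q)" using d \<tau> by simp
  also have "\<dots> = \<epsilon> p" using pos by (simp add: \<tau>_def)
  finally have xp: "x \<in> ball p (\<epsilon> p)" by simp
  have "dist q x = (1 - \<tau>) * dist p q"
  proof -
   have "q - x = (1 - \<tau>) *\<^sub>R (q - p)" by (simp add: x_def algebra_simps)
   then show ?thesis using \<tau>(1,2) by (simp add: dist_norm norm_minus_commute)
  qed
  also have "\<dots> < (1 - \<tau>) * (\<epsilon> p + \<epsilon> q)" using d \<tau>(1,2) by simp
  also have "\<dots> = \<epsilon> q" using pos unfolding \<tau>(3) by simp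
  finally have xq: "x \<in> ball q (\<epsilon> q)" by simp
  have "norm x \<le> (1 - \<tau>) * R + \<tau> * R"
   unfolding x_def using norm_triangle_ineq[of "(1 - \<tau>) *\<^sub>R p" "\<tau> *\<^sub>R q"] \<tau>(1,2) pq by simp
  then have nx: "norm x \<le> R" by (simp add: algebra_simps)
  have "((%s. of_real s * x) \<longlongrightarrow> x) (at_left 1)" by (rule tendsto_eq_intros refl | simp)+
  then have "\<forall>\<^sub>F s in at_left (1::real). of_real s * x \<in> ball p (\<epsilon> p) \<inter> ball q (\<epsilon> q)"
   by (rule topological_tendstoD) (use xp xq in auto)
  moreover have "\<forall>\<^sub>F s in at_left (1::real). 0 < s \<and> s < 1"
   by (auto simp: eventually_at_left_field intro!: exI[of _ 0])
  ultimately have "\<forall>\<^sub>F s in at_left (1::real). of_real s * x \<in> ball p (\<epsilon> p) \<inter> ball q (\<epsilon> q) \<and> 0 < s \<and> s < 1"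
   by eventually_elim auto
  then obtain s where s: "of_real s * x \<in> ball p (\<epsilon> p)" "of_real s * x \<in> ball q (\<epsilon> q)" "0 < s" "s < 1"
   using eventually_happens'[OF trivial_limit_at_left_real] by blast
  have "s * norm x \<le> s * R" using s nx by (intro mult_left_mono) auto
  also have "\<dots> < R" using s R by simp
  finally have "norm (of_real s * x) < R" using s by (simp add: norm_mult)
  then have eq: "K p (of_real s * x) = K q (of_real s * x)" using K pq s by auto
  show ?thesis
   by (rule inv_branch_unique[OF F, of "ball p (\<epsilon> p) \<inter> ball q (\<epsilon> q)" "K p" "K q" "of_real s * x"])
    (use K pq w s eq in \<open>auto intro: inv_branch_subset convex_connected convex_Int\<close>)
 qed
 \<comment> \<open>The index \<open>None\<close> stands for the original disc, \<open>Some p\<close>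
   for the disc around the boundary point \<open>p\<close>.\<close>
 define I where "I = insert None (Some ` sphere (0::complex) R)"
 define A where "A = (%i. case i of None => ball (0::complex) R | Some p => ball p (\<epsilon> p))"
 define L where "L = (%i. case i of None => G | Some p => K p)"
 obtain G' where G': "inv_branch F H (\<Union>i\<in>I. A i) G'" "\<And>i w. i \<in> I ==> w \<in> A i ==> G' w = L i w"
 proof (rule inv_branch_glue[of I A F H L])
  show "open (A i)" "inv_branch F H (A i) (L i)" if "i \<in> I" for i
   using that G K by (auto simp: I_def A_def L_def)
  have K3: "K p w = G w" if "norm p = R" "w \<in> ball p (\<epsilon> p)" "w \<in> ball 0 R" for p w
   using K that by blast
  show "L i w = L j w" if i: "i \<in> I" and j: "j \<in> I" and w: "w \<in> A i" "w \<in> A j" for i j w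
  proof (cases i)
   case None
   then show ?thesis using j w K3[of _ w] by (cases j) (simp_all add: I_def A_def L_def image_iff)
  next
   case (Some p)
   then have p: "norm p = R" using i by (auto simp: I_def)
   show ?thesis
   proof (cases j)
    case None
    then show ?thesis using Some p w K3[of p w] by (simp add: A_def L_def)
   next
    case (Some q)
    then have "norm q = R" using j by (auto simp: I_def)
    then show ?thesis using agree[of p q w] Some \<open>i = Some p\<close> p w by (simp add: A_def L_def)
   qed
  qed
 qed blast
 have "cball 0 R \<subseteq> (\<Union>i\<in>I. A i)"
 proof
  fix w :: complex assume w: "w \<in> cball 0 R"
  show "w \<in> (\<Union>i\<in>I. A i)"
  proof (cases "norm w < R")
   case True
   then show ?thesis by (auto simp: I_def A_def)
  next
   case False
   then have "norm w = R" using w by simp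
   then show ?thesis using K[of w] by (intro UN_I[of "Some w"]) (auto simp: I_def A_def)
  qed
 qed
 moreover have "open (\<Union>i\<in>I. A i)" by (auto simp: I_def A_def)
 ultimately obtain e where e: "e > 0" "(\<Union>x\<in>cball 0 R. ball x e) \<subseteq> (\<Union>i\<in>I. A i)"
  using compact_subset_open_imp_ball_epsilon_subset[of "cball 0 R"] compact_cball by metis
 have "ball (0::complex) (R + e) \<subseteq> (\<Union>x\<in>cball 0 R. ball x e)"
 proof
  fix w :: complex assume w: "w \<in> ball 0 (R + e)"
  show "w \<in> (\<Union>x\<in>cball 0 R. ball x e)"
  proof (cases "norm w \<le> R")
   case True
   then show ?thesis using e(1) by (intro UN_I[of w]) auto
  next
   case False
   define x where "x = (R / norm w) *\<^sub>R w"
   have w0: "norm w > 0" using R False by linarith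
   then have "norm x = R" using R by (simp add: x_def)
   have "x - w = (R / norm w - 1) *\<^sub>R w" by (simp add: x_def algebra_simps)
   then have "dist x w = \<bar>R / norm w - 1\<bar> * norm w" by (simp add: dist_norm)
   moreover have "R / norm w < 1" using w0 False by simp
   ultimately have "dist x w = norm w - R" using w0 by (simp add: algebra_simps)
   with \<open>norm x = R\<close> show ?thesis using w by (intro UN_I[of x]) auto
  qed
 qed
 then have "inv_branch F H (ball 0 (R + e)) G'"
  by (intro inv_branch_subset[OF G'(1)] subset_trans[OF _ e(2)])
 moreover have "G' 0 = G 0" using G'(2)[of None 0] R by (simp add: I_def A_def L_def)
 ultimately show ?thesis using that[of "R + e"] e(1) by simp
qed

text \<open>Continuity method: branches through \<open>u0\<close> on smaller discs agree, so they
  glue to a branch on the disc of supremal radius. If that radius were at most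
  \<open>\<rho>\<close>, the radial limits would allow an extension beyond it.\<close>

lemma inv_branch_large:
 assumes F: "F holomorphic_on H" "open H" "\<And>u. u \<in> H ==> deriv F u \<noteq> 0" "u0 \<in> H" "F u0 = 0"
  and lim: "\<And>R G p. 0 < R ==> R < R0 ==> inv_branch F H (ball 0 R) G ==> G 0 = u0 ==> norm p = R ==>
   \<exists>u\<in>H. ((%s. G (of_real s * p)) \<longlongrightarrow> u) (at_left 1)"
  and \<rho>: "0 < \<rho>" "\<rho> < R0"
 obtains G where "inv_branch F H (ball 0 \<rho>) G" "G 0 = u0"
proof -
 define P where "P = (%\<rho>. \<exists>G. inv_branch F H (ball 0 \<rho>) G \<and> G 0 = u0)"
 have mono: "P a" if "P b" "a \<le> b" for a b
  using that inv_branch_subset[of F H "ball 0 b" _ "ball 0 a"] unfolding P_def by (metis subset_ball)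
 obtain W \<epsilon> K where K: "u0 \<in> W" "\<epsilon> > 0" "inv_branch F H (ball (F u0) \<epsilon>) K" "\<And>v. v \<in> W ==> K (F v) = v"
  using inv_branch_local[OF F(1,2,4) F(3)[OF F(4)]] by metis
 have P\<epsilon>: "P \<epsilon>" using K F(5) unfolding P_def by metis
 show ?thesis
 proof (cases "P \<rho>")
  case True
  then show ?thesis using that unfolding P_def by blast
 next
  case False
  define R where "R = Sup {r. P r}"
  have bd: "r \<le> \<rho>" if "P r" for r using mono that False by (meson linear)
  then have bdd: "bdd_above {r. P r}" by (auto simp: bdd_above_def)
  have R\<epsilon>: "R \<ge> \<epsilon>" unfolding R_def using P\<epsilon> bdd by (intro cSup_upper) auto
  have R\<rho>: "R \<le> \<rho>" unfolding R_def using P\<epsilon> bd by (intro cSup_least) auto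
  have below: "P r" if "r < R" for r
  proof -
   obtain r' where "P r'" "r < r'" using \<open>r < R\<close> P\<epsilon> unfolding R_def
    by (metis (mono_tags, lifting) bdd empty_iff less_cSup_iff mem_Collect_eq)
   then show ?thesis using mono by simp
  qed
  then have "\<And>r. r \<in> {0<..<R} ==> \<exists>G. inv_branch F H (ball 0 r) G \<and> G 0 = u0"
   unfolding P_def by auto
  then obtain L where L: "\<And>r. r \<in> {0<..<R} ==> inv_branch F H (ball 0 r) (L r) \<and> L r 0 = u0" by metis
  have Lle: "L r w = L s w" if "r \<in> {0<..<R}" "s \<in> {0<..<R}" "w \<in> ball 0 r" "r \<le> s" for r s w
   by (rule inv_branch_unique[OF F(1,2,3), of "ball 0 r" "L r" "L s" 0])
    (use that L in \<open>auto intro: inv_branch_subset[of _ _ "ball 0 s"]\<close>)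
  obtain G where G: "inv_branch F H (\<Union>r\<in>{0<..<R}. ball 0 r) G"
   "\<And>r w. r \<in> {0<..<R} ==> w \<in> ball 0 r ==> G w = L r w"
  proof (rule inv_branch_glue[of "{0<..<R}" "%r. ball 0 r" F H L])
   show "L r w = L s w" if "r \<in> {0<..<R}" "s \<in> {0<..<R}" "w \<in> ball 0 r" "w \<in> ball 0 s" for r s w
    using Lle that by (metis linear)
  qed (use L in auto)
  have "ball 0 R \<subseteq> (\<Union>r\<in>{0<..<R}. ball (0::complex) r)"
  proof
   fix w :: complex assume "w \<in> ball 0 R"
   then have "(norm w + R) / 2 \<in> {0<..<R}" "w \<in> ball 0 ((norm w + R) / 2)"
    using norm_ge_zero[of w] R\<epsilon> K(2) by (simp_all del: norm_ge_zero)
   then show "w \<in> (\<Union>r\<in>{0<..<R}. ball 0 r)" by blast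
  qed
  then have GR: "inv_branch F H (ball 0 R) G" by (rule inv_branch_subset[OF G(1)])
  have G0: "G 0 = u0" using G(2)[of "R/2" 0] L[of "R/2"] R\<epsilon> K(2) by simp
  have R0: "0 < R" "R < R0" using R\<epsilon> R\<rho> \<rho> K(2) by auto
  obtain R' G' where "R' > R" "inv_branch F H (ball 0 R') G'" "G' 0 = G 0"
   by (rule inv_branch_extend[OF F(1,2,3) R0(1) GR lim[OF R0 GR G0]])
  then have "P R'" "R' > R" using G0 unfolding P_def by auto
  then show ?thesis using cSup_upper[of R' "{r. P r}"] bdd unfolding R_def by simp
 qed
qed

subsection \<open>Completeness bounds the conformal factor from below\<close>

text \<open>Between the last time \<open>u\<close> in the inner disc and the first later time
  \<open>v\<close> outside the outer one, the curve runs inside the annulus, where the lower bound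
  for f turns the bound on its f-speed into a bound on its Euclidean speed.\<close>

lemma annulus_crossing:
 fixes \<zeta> :: "real => complex"
 assumes d: "\<And>s. 0 \<le> s ==> s < 1 ==> (\<zeta> has_vector_derivative \<zeta>' s) (at s)"
  and len: "\<And>s. 0 \<le> s ==> s < 1 ==> norm (f (\<zeta> s)) * norm (\<zeta>' s) \<le> \<rho>"
  and f: "\<And>z. a \<le> norm z ==> norm z \<le> b ==> \<mu> \<le> norm (f z)" and "\<mu> > 0" "a < b"
  and s: "0 \<le> s1" "s1 \<le> s2" "s2 < 1" "norm (\<zeta> s1) \<le> a" "b \<le> norm (\<zeta> s2)"
 shows "\<mu> * (b - a) \<le> \<rho> * (s2 - s1)"
proof -
 have cont: "continuous_on S \<zeta>" if "S \<subseteq> {s1..s2}" for S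
 proof (rule continuous_at_imp_continuous_on, rule ballI)
  fix x assume "x \<in> S"
  then show "isCont \<zeta> x" using d[of x] s that has_vector_derivative_continuous by fastforce
 qed
 have cpt: "compact ({p..q} \<inter> (%t. norm (\<zeta> t)) -` S)" if "{p..q} \<subseteq> {s1..s2}" "closed S" for p q S
  unfolding compact_eq_bounded_closed using that
  by (auto intro!: continuous_closed_preimage continuous_on_norm cont bounded_Int)
 have "compact {t \<in> {s1..s2}. norm (\<zeta> t) \<le> a}"
  using cpt[of s1 s2 "{..a}"] by (simp add: Int_def vimage_def)
 then obtain u where u: "u \<in> {s1..s2}" "norm (\<zeta> u) \<le> a"
  "\<And>t. t \<in> {s1..s2} ==> norm (\<zeta> t) \<le> a ==> t \<le> u"
  using compact_attains_sup[of "{t \<in> {s1..s2}. norm (\<zeta> t) \<le> a}"] s by fastforce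
 have "compact {t \<in> {u..s2}. b \<le> norm (\<zeta> t)}"
  using cpt[of u s2 "{b..}"] u(1) by (simp add: Int_def vimage_def)
 then obtain v where v: "v \<in> {u..s2}" "b \<le> norm (\<zeta> v)"
  "\<And>t. t \<in> {u..s2} ==> b \<le> norm (\<zeta> t) ==> v \<le> t"
 proof -
  assume *: "\<And>v. \<lbrakk>v \<in> {u..s2}; b \<le> norm (\<zeta> v); \<And>t. t \<in> {u..s2} ==> b \<le> norm (\<zeta> t) ==> v \<le> t\<rbrakk> \<Longrightarrow> thesis"
  assume cp: "compact {t \<in> {u..s2}. b \<le> norm (\<zeta> t)}"
  have "s2 \<in> {t \<in> {u..s2}. b \<le> norm (\<zeta> t)}" using s u(1) by simp
  then have "{t \<in> {u..s2}. b \<le> norm (\<zeta> t)} \<noteq> {}" by blast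
  from compact_attains_inf[OF cp this] show thesis using * by blast
 qed
 have "u \<noteq> v" using u(2) v(2) \<open>a < b\<close> by fastforce
 then have uv: "u < v" using v(1) by simp
 have "\<exists>t\<in>{u<..<v}. norm (\<zeta> v - \<zeta> u) \<le> norm ((v - u) *\<^sub>R \<zeta>' t)"
  by (rule mvt_general[OF uv])
   (use u(1) v(1) s(1-3) d in \<open>auto intro!: cont simp: has_vector_derivative_def[symmetric]\<close>)
 then obtain t where t: "u < t" "t < v" "norm (\<zeta> v - \<zeta> u) \<le> (v - u) * norm (\<zeta>' t)" using uv by auto
 have "a \<le> norm (\<zeta> t)" "norm (\<zeta> t) \<le> b"
  using u(1) u(3)[of t] v(1) v(3)[of t] t(1,2) by force+
 then have "\<mu> * norm (\<zeta>' t) \<le> norm (f (\<zeta> t)) * norm (\<zeta>' t)" using f by (intro mult_right_mono) auto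
 also have "\<dots> \<le> \<rho>" using len[of t] u(1) v(1) t(1,2) s(1-3) by simp
 finally have "\<mu> * norm (\<zeta>' t) \<le> \<rho>" .
 have "b - a \<le> norm (\<zeta> v - \<zeta> u)" using u(2) v(2) norm_triangle_ineq2[of "\<zeta> v" "\<zeta> u"] by linarith
 then have "\<mu> * (b - a) \<le> \<mu> * ((v - u) * norm (\<zeta>' t))"
  using t(3) \<open>\<mu> > 0\<close> by (intro mult_left_mono) auto
 also have "\<dots> = (v - u) * (\<mu> * norm (\<zeta>' t))" by simp
 also have "\<dots> \<le> (v - u) * \<rho>" using \<open>\<mu> * norm (\<zeta>' t) \<le> \<rho>\<close> uv by (intro mult_left_mono) auto
 also have "\<dots> \<le> (s2 - s1) * \<rho>"
 proof (intro mult_right_mono)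
  show "0 \<le> \<rho>" using order_trans[OF _ len[of s1]] s by simp
 qed (use u(1) v(1) in simp)
 finally show ?thesis by (simp add: mult.commute)
qed

definition complete_end :: "real => (complex => real) => bool" where
 "complete_end r m \<longleftrightarrow> (\<forall>\<gamma>. \<gamma> C1_differentiable_on {0..} \<longrightarrow> \<gamma> ` {0..} \<subseteq> ball 0 r - {0} \<longrightarrow>
  (\<gamma> \<longlongrightarrow> 0) at_top \<longrightarrow>
  (\<integral>\<^sup>+s\<in>{0..}. ennreal (m (\<gamma> s) * norm (vector_derivative \<gamma> (at s))) \<partial>lborel) = \<infinity>)"

text \<open>The substitution s = 1 - exp(-\<tau>) turns the path into one on a half line, of length
  at most the finite integral of \<rho> exp(-\<tau>). The margin \<open>\<delta>\<close> to the left
  of 0 provides two-sided derivatives at the initial point.\<close>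

lemma complete_end_no_short_path:
 assumes comp: "complete_end r (%z. norm (f z))" and \<delta>: "\<delta> > 0"
  and d: "\<And>s. - \<delta> < s ==> s < 1 ==> (\<zeta> has_vector_derivative \<zeta>' s) (at s)"
  and c: "continuous_on {0..<1} \<zeta>'"
  and len: "\<And>s. 0 \<le> s ==> s < 1 ==> norm (f (\<zeta> s)) * norm (\<zeta>' s) \<le> \<rho>"
  and im: "\<And>s. 0 \<le> s ==> s < 1 ==> \<zeta> s \<in> ball 0 r - {0}"
  and lim: "(\<zeta> \<longlongrightarrow> 0) (at_left 1)"
 shows False
proof -
 define \<gamma> where "\<gamma> = (%\<tau>. \<zeta> (1 - exp (- \<tau>)))"
 have dg: "(\<gamma> has_vector_derivative exp (- \<tau>) *\<^sub>R \<zeta>' (1 - exp (- \<tau>))) (at \<tau>)" if "\<tau> \<ge> 0" for \<tau>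
 proof -
  have "((%\<tau>. 1 - exp (- \<tau>)) has_vector_derivative exp (- \<tau>)) (at \<tau>)"
   by (auto intro!: derivative_eq_intros simp: has_real_derivative_iff_has_vector_derivative[symmetric])
  moreover have ge: "1 - exp (- \<tau>) \<ge> 0" using that by simp
  have "(\<zeta> has_vector_derivative \<zeta>' (1 - exp (- \<tau>))) (at (1 - exp (- \<tau>)))"
   using \<delta> ge by (intro d) (linarith, simp)
  ultimately show ?thesis using vector_diff_chain_at[of "%\<tau>. 1 - exp (- \<tau>)" "exp (- \<tau>)" \<tau> \<zeta>]
   by (simp add: \<gamma>_def o_def)
 qed
 have C1: "\<gamma> C1_differentiable_on {0..}"
  unfolding C1_differentiable_on_def
  by (rule exI[of _ "%\<tau>. exp (- \<tau>) *\<^sub>R \<zeta>' (1 - exp (- \<tau>))"])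
   (auto intro!: dg continuous_intros continuous_on_compose2[OF c])
 have im': "\<gamma> ` {0..} \<subseteq> ball 0 r - {0}" using im by (auto simp: \<gamma>_def)
 have "filterlim (%\<tau>::real. 1 - exp (- \<tau>)) (at_left 1) at_top"
  by real_asymp
 then have "(\<gamma> \<longlongrightarrow> 0) at_top" unfolding \<gamma>_def by (rule filterlim_compose[OF lim])
 then have inf: "(\<integral>\<^sup>+s\<in>{0..}. ennreal (norm (f (\<gamma> s)) * norm (vector_derivative \<gamma> (at s))) \<partial>lborel) = \<infinity>"
  using comp C1 im' unfolding complete_end_def by blast
 have "(\<integral>\<^sup>+s\<in>{0..}. ennreal (norm (f (\<gamma> s)) * norm (vector_derivative \<gamma> (at s))) \<partial>lborel)
   \<le> (\<integral>\<^sup>+s\<in>{0..}. ennreal (\<rho> * exp (- s)) \<partial>lborel)"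
 proof (rule nn_integral_mono)
  fix s :: real
  show "ennreal (norm (f (\<gamma> s)) * norm (vector_derivative \<gamma> (at s))) * indicator {0..} s \<le> ennreal (\<rho> * exp (- s)) * indicator {0..} s"
  proof (cases "s \<ge> 0")
   case True
   have "norm (f (\<gamma> s)) * norm (vector_derivative \<gamma> (at s)) = exp (- s) * (norm (f (\<zeta> (1 - exp (- s)))) * norm (\<zeta>' (1 - exp (- s))))"
    using vector_derivative_at[OF dg[OF True]] by (simp add: \<gamma>_def)
   also have "\<dots> \<le> exp (- s) * \<rho>" using len[of "1 - exp (- s)"] True by (intro mult_left_mono) auto
   finally show ?thesis using True by (simp add: ennreal_leI mult.commute)
  qed simp
 qed
 also have "\<dots> = ennreal (0 - (- \<rho> * exp (- 0)))"
 proof (rule nn_integral_FTC_atLeast)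
  fix x :: real
  have "\<rho> \<ge> 0" using order_trans[OF _ len[of 0]] by simp
  then show "0 \<le> \<rho> * exp (- x)" by simp
  show "((%s. - \<rho> * exp (- s)) has_real_derivative \<rho> * exp (- x)) (at x)"
   by (auto intro!: derivative_eq_intros)
 next
  show "((%s::real. - \<rho> * exp (- s)) \<longlongrightarrow> 0) at_top" by real_asymp
 qed measurable
 finally show False unfolding inf by (simp add: top_unique)
qed

text \<open>Osserman's lemma in quantitative form: the branch of the inverse of \<open>\<integral> f\<close> exists on a disc whose
 radius is bounded below, and it takes values in a bounded set, so its derivative \<open>1 / f\<close> is bounded.\<close>

lemma complete_end_inverse_bounded:
 assumes r: "r > 0" and f: "f holomorphic_on ball 0 r - {0}" "\<And>z. z \<in> ball 0 r - {0} ==> f z \<noteq> 0"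
  and comp: "complete_end r (%z. norm (f z))"
 obtains C \<delta> where "\<delta> > 0" "\<delta> \<le> r" "\<And>z. z \<in> ball 0 \<delta> - {0} ==> norm (inverse (f z)) \<le> C"
proof -
 have ann: "\<exists>\<mu>>0. \<forall>z. a \<le> norm z \<and> norm z \<le> b \<longrightarrow> \<mu> \<le> norm (f z)" if "0 < a" "b < r" for a b
 proof -
  let ?A = "cball 0 b - ball (0::complex) a"
  have cA: "compact ?A" by (intro compact_diff) auto
  have sub: "?A \<subseteq> ball 0 r - {0}" using that by auto
  have "continuous_on ?A (%z. norm (f z))"
   using holomorphic_on_imp_continuous_on[OF f(1)] sub by (intro continuous_on_norm) (rule continuous_on_subset)
  show ?thesis
  proof (cases "?A = {}")
   case True
   then show ?thesis by (intro exI[of _ 1]) (force simp: set_eq_iff)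
  next
   case False
   then obtain w where w: "w \<in> ?A" "\<forall>z\<in>?A. norm (f w) \<le> norm (f z)"
    using continuous_attains_inf[OF cA False \<open>continuous_on ?A (%z. norm (f z))\<close>] by blast
   have "f w \<noteq> 0" using w(1) sub f(2) by blast
   then show ?thesis using w(2) by (intro exI[of _ "norm (f w)"]) auto
  qed
 qed
 obtain m where m: "m > 0" "\<And>z. r/4 \<le> norm z ==> norm z \<le> r/2 ==> m \<le> norm (f z)"
  using ann[of "r/4" "r/2"] r by auto
 \<comment> \<open>The annulus between r/4 and r/2 is a barrier: crossing it costs length at least
   \<open>R0\<close>, so a shorter path that starts inside cannot get out.\<close>
 define R0 where "R0 = m * r / 4"
 have R0: "R0 > 0" using m r by (simp add: R0_def)
 \<comment> \<open>The half plane covers the punctured disc of radius r/2 by the exponential map.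
   Being convex, it carries a primitive of the pulled-back form f dz.\<close>
 define H where "H = {u. Re u < ln (r/2)}"
 have H: "open H" "convex H" by (simp_all add: H_def open_halfspace_Re_lt convex_halfspace_Re_lt)
 have expH: "exp u \<in> ball 0 r - {0}" "norm (exp u) < r / 2" if "u \<in> H" for u
 proof -
  have "exp (Re u) < exp (ln (r/2))" using that by (simp add: H_def)
  then show *: "norm (exp u) < r/2" using r by simp
  show "exp u \<in> ball 0 r - {0}" using * r by simp
 qed
 define ff where "ff = (%u. f (exp u) * exp u)"
 have ff: "ff holomorphic_on H" unfolding ff_def
  using expH(1) by (intro holomorphic_intros holomorphic_on_compose_gen[OF _ f(1), unfolded o_def]) auto
 obtain F0 where F0: "\<And>u. u \<in> H ==> (F0 has_field_derivative ff u) (at u within H)"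
  using holomorphic_convex_primitive'[OF H(2,1) ff] by blast
 have bound: "norm (inverse (f z0)) \<le> 2 * r / R0" if z0: "z0 \<in> ball 0 (r/4) - {0}" for z0
 proof -
  define u0 where "u0 = Ln z0"
  have e0: "exp u0 = z0" using z0 by (simp add: u0_def)
  have "ln (norm z0) < ln (r/2)" using z0 r by (subst ln_less_cancel_iff) auto
  then have u0: "u0 \<in> H" using z0 by (simp add: u0_def H_def)
  define F where "F = (%u. F0 u - F0 u0)"
  have dF: "(F has_field_derivative ff u) (at u)" if "u \<in> H" for u
   unfolding F_def using F0[OF that] at_within_open[OF that H(1)] by (auto intro!: derivative_eq_intros)
  have F: "F holomorphic_on H" using dF H(1) by (auto simp: holomorphic_on_open)
  have dF0: "deriv F u \<noteq> 0" if "u \<in> H" for u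
   using DERIV_imp_deriv[OF dF[OF that]] f(2)[OF expH(1)[OF that]] by (simp add: ff_def)
  have lim: "\<exists>u\<in>H. ((%s. G (of_real s * p)) \<longlongrightarrow> u) (at_left 1)"
   if R: "0 < R" "R < R0" and G: "inv_branch F H (ball 0 R) G" "G 0 = u0" and p: "norm p = R" for R G p
  proof -
   have Gd: "(G has_field_derivative inverse (ff (G w))) (at w)" if w: "w \<in> ball 0 R" for w
   proof -
    have GH: "G w \<in> H" using G(1) w by (auto simp: inv_branch_def)
    have Gh: "(G has_field_derivative deriv G w) (at w)"
     using G(1) w by (auto simp: inv_branch_def intro: holomorphic_derivI)
    have "((%w. F (G w)) has_field_derivative ff (G w) * deriv G w) (at w)"
     using DERIV_chain2[OF dF[OF GH] Gh] .
    moreover have "((%w. F (G w)) has_field_derivative 1) (at w)"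
     by (rule has_field_derivative_transform_within_open[OF DERIV_ident, of "ball 0 R"])
      (use G(1) w in \<open>auto simp: inv_branch_def\<close>)
    ultimately have "ff (G w) * deriv G w = 1" by (rule DERIV_unique)
    then have "deriv G w = inverse (ff (G w))" by (metis inverse_unique)
    then show ?thesis using Gh by simp
   qed
   have in_ball: "of_real s * p \<in> ball 0 R" if "-1 < s" "s < 1" for s :: real
    using that p R by (simp add: norm_mult abs_less_iff)
   define g where "g = (%s::real. G (of_real s * p))"
   define g' where "g' = (%s. p * inverse (ff (g s)))"
   have gd: "(g has_vector_derivative g' s) (at s)" if "-1 < s" "s < 1" for s
   proof -
    have "((%s. of_real s * p) has_vector_derivative p) (at s)"
     by (auto intro!: derivative_eq_intros)
    from field_vector_diff_chain_at[OF this Gd[OF in_ball[OF that]]]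
    show ?thesis by (simp add: g_def g'_def o_def)
   qed
   have gH: "g s \<in> H" if "-1 < s" "s < 1" for s
    using G(1) in_ball[OF that] by (auto simp: inv_branch_def g_def)
   define \<zeta> where "\<zeta> = (%s. exp (g s))"
   define \<zeta>' where "\<zeta>' = (%s. p * inverse (f (\<zeta> s)))"
   have \<zeta>H: "\<zeta> s \<in> ball 0 r - {0}" "norm (\<zeta> s) < r/2" if "-1 < s" "s < 1" for s
    using expH[OF gH[OF that]] by (auto simp: \<zeta>_def)
   have \<zeta>d: "(\<zeta> has_vector_derivative \<zeta>' s) (at s)" if "-1 < s" "s < 1" for s
   proof -
    have "(exp has_field_derivative exp (g s)) (at (g s))" by (rule DERIV_exp)
    from field_vector_diff_chain_at[OF gd[OF that] this]
    show ?thesis using f(2)[OF \<zeta>H(1)[OF that]]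
     by (simp add: \<zeta>_def \<zeta>'_def g'_def ff_def o_def field_simps)
   qed
   have \<zeta>c: "isCont \<zeta> s" if "-1 < s" "s < 1" for s
    using has_vector_derivative_continuous[OF \<zeta>d[OF that]] .
   \<comment> \<open>\<open>G\<close> inverts the integral of f, so rays are mapped to curves of
     constant f-speed.\<close>
   have len: "norm (f (\<zeta> s)) * norm (\<zeta>' s) = R" if "-1 < s" "s < 1" for s
    using f(2)[OF \<zeta>H(1)[OF that]] p by (simp add: \<zeta>'_def norm_mult norm_inverse)
   have \<zeta>0: "\<zeta> 0 = z0" by (simp add: \<zeta>_def g_def G(2) e0)
   \<comment> \<open>The midpoint between r/4 + R/m and r/2: reaching it from r/4 already costs more
     than \<open>R\<close>, and staying below it keeps the limit inside the open half plane.\<close>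
   define b where "b = r/4 + (R/m + r/4) / 2"
   have Rm: "R/m < r/4" using R m by (simp add: R0_def field_simps)
   have b: "r/4 < b" "b < r/2" "R < m * (b - r/4)"
    using Rm R m by (auto simp: b_def field_simps)
   have out: "norm (\<zeta> s) < b" if s: "0 \<le> s" "s < 1" for s
   proof (rule ccontr)
    assume "\<not> norm (\<zeta> s) < b"
    then have "m * (b - r/4) \<le> R * (s - 0)"
     using annulus_crossing[of \<zeta> \<zeta>' f R "r/4" b m 0 s] \<zeta>d len m b s z0 \<zeta>0 by auto
    also have "\<dots> \<le> R" using s R by (simp add: mult_left_le)
    finally show False using b by simp
   qed
   \<comment> \<open>Either the curve keeps away from the puncture, and then its logarithmic speed
     is bounded and \<open>g\<close> has a limit in \<open>H\<close>; or it comes arbitrarily close,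
     and then it converges to the puncture with finite length, against completeness.\<close>
   show ?thesis
   proof (cases "\<exists>\<epsilon>>0. \<forall>s. 0 \<le> s \<and> s < 1 \<longrightarrow> \<epsilon> \<le> norm (\<zeta> s)")
    case True
    then obtain \<epsilon> where \<epsilon>: "\<epsilon> > 0" "\<And>s. 0 \<le> s ==> s < 1 ==> \<epsilon> \<le> norm (\<zeta> s)" by auto
    obtain \<mu> where \<mu>: "\<mu> > 0" "\<And>z. \<epsilon> \<le> norm z ==> norm z \<le> b ==> \<mu> \<le> norm (f z)"
     using ann[of \<epsilon> b] \<epsilon> b r by auto
    have g'b: "norm (g' s) \<le> R / (\<mu> * \<epsilon>)" if s: "0 \<le> s" "s < 1" for s
    proof -
     have "norm (g' s) = R / (norm (f (\<zeta> s)) * norm (\<zeta> s))"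
      using p by (simp add: g'_def ff_def \<zeta>_def norm_mult norm_inverse divide_inverse)
     also have "\<dots> \<le> R / (\<mu> * \<epsilon>)"
     proof -
      have "\<epsilon> \<le> norm (\<zeta> s)" "\<mu> \<le> norm (f (\<zeta> s))" using \<epsilon>(2)[OF s] \<mu>(2)[of "\<zeta> s"] out[OF s] by auto
      moreover from this have "0 < norm (\<zeta> s)" "0 < norm (f (\<zeta> s))" using \<epsilon>(1) \<mu>(1) by linarith+
      ultimately show ?thesis
       using \<mu>(1) \<epsilon>(1) R(1) by (intro divide_left_mono mult_mono mult_pos_pos) auto
     qed
     finally show ?thesis .
    qed
    have lip: "norm (g s - g t) \<le> R / (\<mu> * \<epsilon>) * norm (s - t)" if "s \<in> {0..<1}" "t \<in> {0..<1}" for s t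
    proof (rule differentiable_bound[of "{0..<1}" g "%s h. h *\<^sub>R g' s"])
     show "(g has_derivative (%h. h *\<^sub>R g' s)) (at s within {0..<1})" if "s \<in> {0..<1}" for s
      using gd[of s] that has_vector_derivative_at_within unfolding has_vector_derivative_def
      by (auto intro: has_derivative_at_withinI)
     show "onorm (%h. h *\<^sub>R g' s) \<le> R / (\<mu> * \<epsilon>)" if "s \<in> {0..<1}" for s
     proof (rule onorm_le)
      fix h :: real
      have "norm (g' s) * norm h \<le> R / (\<mu> * \<epsilon>) * norm h"
       using g'b[of s] that by (intro mult_right_mono) auto
      then show "norm (h *\<^sub>R g' s) \<le> R / (\<mu> * \<epsilon>) * norm h" by (simp add: mult.commute)
     qed
    qed (use that in \<open>auto intro: convex_real_interval\<close>)
    have "uniformly_continuous_on {0..<1} g"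
     unfolding uniformly_continuous_on_def
    proof (intro allI impI)
     fix e :: real assume e: "e > 0"
     let ?K = "R / (\<mu> * \<epsilon>)"
     have K: "?K > 0" using R \<mu> \<epsilon> by simp
     show "\<exists>d>0. \<forall>x\<in>{0..<1}. \<forall>x'\<in>{0..<1}. dist x' x < d \<longrightarrow> dist (g x') (g x) < e"
     proof (intro exI[of _ "e / ?K"] conjI ballI impI)
      fix x x' :: real assume x: "x \<in> {0..<1}" "x' \<in> {0..<1}" "dist x' x < e / ?K"
      have "norm (g x' - g x) \<le> ?K * norm (x' - x)" using lip x by blast
      also have "\<dots> < ?K * (e / ?K)" using x K by (intro mult_strict_left_mono) (auto simp: dist_norm)
      also have "\<dots> = e" using R \<mu>(1) \<epsilon>(1) by simp
      finally show "dist (g x') (g x) < e" by (simp add: dist_norm)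
     qed (use e R \<mu>(1) \<epsilon>(1) in simp)
    qed
    then obtain u where u: "(g \<longlongrightarrow> u) (at 1 within {0..<1})"
     by (rule uniformly_continuous_on_extension_at_closure[of _ _ 1]) auto
    have al: "at 1 within {0..<1} = at_left (1::real)"
     by (rule at_within_nhd[of _ "{0<..}"]) auto
    have "((%s. Re (g s)) \<longlongrightarrow> Re u) (at_left 1)" using u unfolding al by (rule tendsto_Re)
    moreover have "\<forall>\<^sub>F s in at_left (1::real). Re (g s) \<le> ln b"
    proof -
     have "\<forall>\<^sub>F s in at_left (1::real). 0 < s \<and> s < 1"
      by (auto simp: eventually_at_left_field intro!: exI[of _ 0])
     then show ?thesis
     proof eventually_elim
      case (elim s)
      then have "exp (Re (g s)) < b" using out[of s] by (simp add: \<zeta>_def)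
      then show ?case using b r by (simp add: ln_ge_iff)
     qed
    qed
    ultimately have "Re u \<le> ln b" by (intro tendsto_upperbound[of "%s. Re (g s)"]) auto
    also have "ln b < ln (r/2)" using b r by (subst ln_less_cancel_iff) auto
    finally have "u \<in> H" by (simp add: H_def)
    then show ?thesis using u unfolding al g_def by blast
   next
    case False
    have "(\<zeta> \<longlongrightarrow> 0) (at_left 1)"
    proof (rule tendstoI)
     fix e0 :: real assume e0: "e0 > 0"
     define e where "e = min e0 (r/4)"
     have e: "e > 0" "e \<le> r/4" "e \<le> e0" using e0 r by (auto simp: e_def)
     obtain \<mu> where \<mu>: "\<mu> > 0" "\<And>z. e/2 \<le> norm z ==> norm z \<le> e ==> \<mu> \<le> norm (f z)"
      using ann[of "e/2" e] e r by auto
     \<comment> \<open>A time span \<open>\<delta>\<close> is too short for a passage from e/2 to e.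
       The curve comes closer than all its points up to time \<open>1 - \<delta>\<close> only after
       that time, and from such a moment on it stays within e.\<close>
     define \<delta> where "\<delta> = min 1 (\<mu> * (e/2) / (2*R))"
     have \<delta>: "0 < \<delta>" "\<delta> \<le> 1" "R * \<delta> < \<mu> * (e - e/2)"
     proof -
      show "0 < \<delta>" "\<delta> \<le> 1" using \<mu> e R by (auto simp: \<delta>_def)
      have "R * \<delta> \<le> R * (\<mu> * (e/2) / (2*R))" using R by (intro mult_left_mono) (auto simp: \<delta>_def)
      also have "\<dots> = \<mu> * (e/2) / 2" using R by simp
      also have "\<dots> < \<mu> * (e - e/2)" using \<mu> e by simp
      finally show "R * \<delta> < \<mu> * (e - e/2)" .
     qed
     have "continuous_on {0..1-\<delta>} (%s. norm (\<zeta> s))"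
      using \<delta>(1) by (intro continuous_on_norm continuous_at_imp_continuous_on) (auto intro!: \<zeta>c)
     then obtain s0 where s0: "s0 \<in> {0..1-\<delta>}" "\<forall>s\<in>{0..1-\<delta>}. norm (\<zeta> s0) \<le> norm (\<zeta> s)"
      using continuous_attains_inf[of "{0..1-\<delta>}" "%s. norm (\<zeta> s)"] \<delta> by auto
     have "\<zeta> s0 \<noteq> 0" by (simp add: \<zeta>_def)
     then have "min (norm (\<zeta> s0)) (e/2) > 0" using e by simp
     then obtain s1 where s1: "0 \<le> s1" "s1 < 1" "norm (\<zeta> s1) < min (norm (\<zeta> s0)) (e/2)"
      using False by (meson not_less)
     have s1\<delta>: "s1 > 1 - \<delta>" using s0(2) s1 by (metis atLeastAtMost_iff linorder_not_less min_less_iff_conj)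
     have "norm (\<zeta> s) < e" if s: "s1 < s" "s < 1" for s
     proof (rule ccontr)
      assume "\<not> norm (\<zeta> s) < e"
      then have "\<mu> * (e - e/2) \<le> R * (s - s1)"
       using annulus_crossing[of \<zeta> \<zeta>' f R "e/2" e \<mu> s1 s] \<zeta>d len \<mu> e s s1 by auto
      also have "\<dots> \<le> R * \<delta>" using R s s1\<delta> by (intro mult_left_mono) auto
      finally show False using \<delta> by simp
     qed
     then show "\<forall>\<^sub>F s in at_left 1. dist (\<zeta> s) 0 < e0"
      using s1(2) e by (auto simp: eventually_at_left_field intro!: exI[of _ s1] intro: less_le_trans)
    qed
    moreover have "continuous_on {0..<1} \<zeta>'"
    proof -
     have "continuous_on {0..<1} \<zeta>"
      by (intro continuous_at_imp_continuous_on) (auto intro!: \<zeta>c)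
     moreover have "\<zeta> ` {0..<1} \<subseteq> ball 0 r - {0}" using \<zeta>H by auto
     ultimately show ?thesis
      unfolding \<zeta>'_def using f(2) \<zeta>H
      by (intro continuous_intros continuous_on_compose2[OF holomorphic_on_imp_continuous_on[OF f(1)]]) auto
    qed
    ultimately have False
     using complete_end_no_short_path[OF comp, of 1 \<zeta> \<zeta>' R] \<zeta>d len \<zeta>H by auto
    then show ?thesis ..
   qed
  qed
  obtain G where G: "inv_branch F H (ball 0 (R0/2)) G" "G 0 = u0"
  proof (rule inv_branch_large[OF F H(1) dF0 u0, of R0 "R0/2"])
   show "F u0 = 0" by (simp add: F_def)
  qed (use lim R0 in auto)
  have GH: "G w \<in> H" if "w \<in> ball 0 (R0/2)" for w using G(1) that by (auto simp: inv_branch_def)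
  define Z where "Z = (%w. exp (G w))"
  have Zh: "Z holomorphic_on ball 0 (R0/2)" unfolding Z_def
   using G(1) by (auto simp: inv_branch_def intro!: holomorphic_intros)
  \<comment> \<open>Cauchy's estimate on a disc of radius independent of \<open>z0\<close>, for a
    function with values in a fixed disc; its derivative at the centre is the inverse of
    \<open>f z0\<close>.\<close>
  have "norm ((deriv ^^ 1) Z 0) \<le> fact 1 * (r/2) / (R0/4) ^ 1"
  proof (rule Cauchy_higher_deriv_bound[where y = 0])
   show "Z holomorphic_on ball 0 (R0/4)" using Zh by (rule holomorphic_on_subset) (use R0 in auto)
   show "continuous_on (cball 0 (R0/4)) Z"
    by (rule continuous_on_subset[OF holomorphic_on_imp_continuous_on[OF Zh]]) (use R0 in auto)
   show "Z w \<in> ball 0 (r/2)" if "w \<in> ball 0 (R0/4)" for w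
    using expH(2)[OF GH[of w]] that R0 by (simp add: Z_def)
  qed (use R0 in auto)
  moreover have "deriv Z 0 * f z0 = 1"
  proof -
   have "0 \<in> ball 0 (R0/2)" using R0 by simp
   then have Gh: "(G has_field_derivative deriv G 0) (at 0)"
    using G(1) by (auto simp: inv_branch_def intro: holomorphic_derivI)
   have "((%w. F (G w)) has_field_derivative ff u0 * deriv G 0) (at 0)"
    using DERIV_chain2[OF dF Gh] u0 G(2) by simp
   moreover have "((%w. F (G w)) has_field_derivative 1) (at 0)"
    by (rule has_field_derivative_transform_within_open[OF DERIV_ident, of "ball 0 (R0/2)"])
     (use G(1) R0 in \<open>auto simp: inv_branch_def\<close>)
   ultimately have "ff u0 * deriv G 0 = 1" by (rule DERIV_unique)
   moreover have "deriv Z 0 = exp (G 0) * deriv G 0"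
    unfolding Z_def by (intro DERIV_imp_deriv DERIV_chain2[OF DERIV_exp Gh])
   ultimately show ?thesis by (simp add: G(2) ff_def e0 mult_ac)
  qed
  then have "deriv Z 0 = inverse (f z0)" by (metis inverse_unique mult.commute)
  ultimately show ?thesis by simp
 qed
 show ?thesis using bound r by (intro that[of "r/4" "2*r/R0"]) auto
qed

section \<open>Null curves near a puncture\<close>

text \<open>A null curve is a triple \<open>\<phi>\<close> of holomorphic functions with \<open>\<Sum> \<phi>\<^sub>j\<^sup>2 = 0\<close>; for a conformal minimal
 immersion \<open>\<phi> = X\<^sub>x - \<i> X\<^sub>y\<close>, and then \<open>null_norm\<close> is twice the conformal factor and \<open>null_curv\<close> is
 \<open>-2 \<kappa>\<close> times the area density, i.e. the squared norm of the differential of the Gauss map.\<close>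

definition null_norm :: "(3 => complex => complex) => complex => real" where
 "null_norm \<phi> z = (\<Sum>k\<in>UNIV. (norm (\<phi> k z))\<^sup>2)"

definition null_dnorm :: "(3 => complex => complex) => complex => real" where
 "null_dnorm \<phi> z = (\<Sum>k\<in>UNIV. (norm (deriv (\<phi> k) z))\<^sup>2)"

definition null_mixed :: "(3 => complex => complex) => complex => complex" where
 "null_mixed \<phi> z = (\<Sum>k\<in>UNIV. \<phi> k z * cnj (deriv (\<phi> k) z))"

definition null_curv :: "(3 => complex => complex) => complex => real" where
 "null_curv \<phi> z = 4 * (null_dnorm \<phi> z * null_norm \<phi> z - (norm (null_mixed \<phi> z))\<^sup>2) / (null_norm \<phi> z)\<^sup>2"

text \<open>\<open>null_f 1\<close> and \<open>null_g 1\<close> are the Weierstrass data; \<open>null_f (-1)\<close>, \<open>null_g (-1)\<close> are those of the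
 mirror image \<open>x\<^sub>2 \<mapsto> -x\<^sub>2\<close>, which serve as the chart near a pole of the Gauss map.\<close>

definition null_f :: "complex => (3 => complex => complex) => complex => complex" where
 "null_f \<epsilon> \<phi> z = \<phi> 1 z - \<epsilon> * \<i> * \<phi> 2 z"

definition null_g :: "complex => (3 => complex => complex) => complex => complex" where
 "null_g \<epsilon> \<phi> z = \<phi> 3 z / null_f \<epsilon> \<phi> z"

lemma of_real_norm_square: "(complex_of_real (norm w))\<^sup>2 = w * cnj w"
 by (simp add: complex_norm_square[symmetric])

text \<open>The triple is Weierstrass's parametrisation of a null vector and \<open>d1\<close>,
  \<open>d2\<close>, \<open>d3\<close> are the derivatives of its entries. Stated for free
  variables, the identities are purely algebraic.\<close>

lemma cross_norm_identity:
 fixes F F' G G' :: complex and \<epsilon> :: complex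
 assumes e: "\<epsilon> = 1 \<or> \<epsilon> = -1"
 defines "p1 \<equiv> F * (1 - G\<^sup>2) / 2" and "p2 \<equiv> \<epsilon> * \<i> * F * (1 + G\<^sup>2) / 2" and "p3 \<equiv> F * G"
  and "d1 \<equiv> F' * (1 - G\<^sup>2) / 2 - F * G * G'" and "d2 \<equiv> \<epsilon> * \<i> * (F' * (1 + G\<^sup>2) / 2 + F * G * G')"
  and "d3 \<equiv> F' * G + F * G'"
 shows "p1 * cnj p1 + p2 * cnj p2 + p3 * cnj p3 = F * cnj F * (1 + G * cnj G)\<^sup>2 / 2"
  and "p1 * cnj d1 + p2 * cnj d2 + p3 * cnj d3 =
   F * (1 + G * cnj G) * (cnj F' * (1 + G * cnj G) / 2 + cnj F * G * cnj G')"
  and "d1 * cnj d1 + d2 * cnj d2 + d3 * cnj d3 =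
   F' * cnj F' * (1 + G * cnj G)\<^sup>2 / 2 + (F' * cnj F * G * cnj G' + cnj F' * F * cnj G * G')
   * (1 + G * cnj G) + F * cnj F * G' * cnj G' * (1 + 2 * G * cnj G)"
 using e unfolding p1_def p2_def p3_def d1_def d2_def d3_def
 by (auto simp: field_simps power2_eq_square)

lemma null_chart:
 assumes e: "\<epsilon> = 1 \<or> \<epsilon> = -1" and U: "open U" "z \<in> U" and hol: "\<And>k. \<phi> k holomorphic_on U"
  and null: "\<forall>z\<in>U. (\<Sum>k\<in>UNIV. (\<phi> k z)\<^sup>2) = 0" and f0: "\<forall>z\<in>U. null_f \<epsilon> \<phi> z \<noteq> 0"
 defines "f \<equiv> null_f \<epsilon> \<phi>" and "g \<equiv> null_g \<epsilon> \<phi>"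
 shows "\<phi> 1 z = f z * (1 - (g z)\<^sup>2) / 2" "\<phi> 2 z = \<epsilon> * \<i> * f z * (1 + (g z)\<^sup>2) / 2" "\<phi> 3 z = f z * g z"
  and "f holomorphic_on U" "g holomorphic_on U"
  and "deriv (\<phi> 1) z = deriv f z * (1 - (g z)\<^sup>2) / 2 - f z * g z * deriv g z"
  and "deriv (\<phi> 2) z = \<epsilon> * \<i> * (deriv f z * (1 + (g z)\<^sup>2) / 2 + f z * g z * deriv g z)"
  and "deriv (\<phi> 3) z = deriv f z * g z + f z * deriv g z"
proof -
 show fh: "f holomorphic_on U" unfolding f_def null_f_def[abs_def] by (intro holomorphic_intros hol)
 show gh: "g holomorphic_on U" unfolding g_def null_g_def[abs_def] f_def[symmetric]
  by (intro holomorphic_intros hol fh) (use f0 in \<open>auto simp: f_def\<close>)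
 have eq: "\<phi> 1 z = f z * (1 - (g z)\<^sup>2) / 2" "\<phi> 2 z = \<epsilon> * \<i> * f z * (1 + (g z)\<^sup>2) / 2" "\<phi> 3 z = f z * g z"
  if z: "z \<in> U" for z
 proof -
  have n: "(\<phi> 1 z)\<^sup>2 + (\<phi> 2 z)\<^sup>2 + (\<phi> 3 z)\<^sup>2 = 0" using null z by (simp add: sum_3)
  show p3: "\<phi> 3 z = f z * g z" using f0[rule_format, OF z] by (simp add: f_def g_def null_g_def)
  have ff: "f z = \<phi> 1 z - \<epsilon> * \<i> * \<phi> 2 z" by (simp add: f_def null_f_def)
  \<comment> \<open>The null condition factors: the sum of the first two squares is the product of
    \<open>f z\<close> with the same expression of opposite sign.\<close>
  have "f z * (\<phi> 1 z + \<epsilon> * \<i> * \<phi> 2 z) = f z * (- f z * (g z)\<^sup>2)"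
   using n e unfolding p3 ff by (auto simp: algebra_simps power2_eq_square)
  then have "\<phi> 1 z + \<epsilon> * \<i> * \<phi> 2 z = - f z * (g z)\<^sup>2"
   using mult_left_cancel[OF f0[rule_format, OF z, folded f_def]] by blast
  moreover have "2 * \<phi> 1 z = f z + (\<phi> 1 z + \<epsilon> * \<i> * \<phi> 2 z)" "2 * (\<epsilon> * \<i> * \<phi> 2 z) = (\<phi> 1 z + \<epsilon> * \<i> * \<phi> 2 z) - f z"
   unfolding ff by simp_all
  ultimately have "2 * \<phi> 1 z = f z - f z * (g z)\<^sup>2" "2 * (\<epsilon> * \<i> * \<phi> 2 z) = - f z - f z * (g z)\<^sup>2"
   by simp_all
  then show "\<phi> 1 z = f z * (1 - (g z)\<^sup>2) / 2" "\<phi> 2 z = \<epsilon> * \<i> * f z * (1 + (g z)\<^sup>2) / 2"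
   using e by (auto simp: field_simps complex_eq_iff)
 qed
 show "\<phi> 1 z = f z * (1 - (g z)\<^sup>2) / 2" "\<phi> 2 z = \<epsilon> * \<i> * f z * (1 + (g z)\<^sup>2) / 2" "\<phi> 3 z = f z * g z"
  by (fact eq[OF U(2)])+
 have fd: "(f has_field_derivative deriv f z) (at z)" and gd: "(g has_field_derivative deriv g z) (at z)"
  using fh gh U holomorphic_derivI by blast+
 have d: "deriv (\<phi> k) z = D" if "(F has_field_derivative D) (at z)" "\<And>z. z \<in> U ==> \<phi> k z = F z" for k F D
  using that U by (intro DERIV_imp_deriv) (rule has_field_derivative_transform_within_open[of F], auto)
 show "deriv (\<phi> 1) z = deriv f z * (1 - (g z)\<^sup>2) / 2 - f z * g z * deriv g z"
  by (rule d[OF _ eq(1)]) (auto intro!: derivative_eq_intros fd gd simp: field_simps)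
 show "deriv (\<phi> 2) z = \<epsilon> * \<i> * (deriv f z * (1 + (g z)\<^sup>2) / 2 + f z * g z * deriv g z)"
  by (rule d[OF _ eq(2)]) (auto intro!: derivative_eq_intros fd gd simp: field_simps)
 show "deriv (\<phi> 3) z = deriv f z * g z + f z * deriv g z"
  by (rule d[OF _ eq(3)]) (auto intro!: derivative_eq_intros fd gd simp: field_simps)
qed

text \<open>The derivative of \<open>f\<close> cancels from \<open>null_curv\<close>, which becomes
  the pullback of the spherical metric by the Gauss map \<open>g\<close>, up to a constant
  factor.\<close>

lemma null_chart_norm:
 assumes e: "\<epsilon> = 1 \<or> \<epsilon> = -1" and U: "open U" "z \<in> U" and hol: "\<And>k. \<phi> k holomorphic_on U"
  and null: "\<forall>z\<in>U. (\<Sum>k\<in>UNIV. (\<phi> k z)\<^sup>2) = 0" and f0: "\<forall>z\<in>U. null_f \<epsilon> \<phi> z \<noteq> 0"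
 defines "f \<equiv> null_f \<epsilon> \<phi>" and "g \<equiv> null_g \<epsilon> \<phi>"
 shows "null_norm \<phi> z = (norm (f z))\<^sup>2 * (1 + (norm (g z))\<^sup>2)\<^sup>2 / 2"
  and "null_mixed \<phi> z = f z * (1 + g z * cnj (g z)) *
     (cnj (deriv f z) * (1 + g z * cnj (g z)) / 2 + cnj (f z) * g z * cnj (deriv g z))"
  and "null_curv \<phi> z = 8 * (norm (deriv g z))\<^sup>2 / (1 + (norm (g z))\<^sup>2)\<^sup>2"
proof -
 note c = null_chart[OF e U hol null f0, folded f_def g_def]
 note i1 = cross_norm_identity(1)[OF e, where F = "f z" and G = "g z", folded c(1-3)]
 note i2 = cross_norm_identity(2)[OF e, where F = "f z" and G = "g z" and F' = "deriv f z" and G' = "deriv g z",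
   folded c(1-3) c(6-8)]
 note i3 = cross_norm_identity(3)[OF e, where F = "f z" and G = "g z" and F' = "deriv f z" and G' = "deriv g z",
   folded c(6-8)]
 let ?G = "g z * cnj (g z)" let ?F = "f z * cnj (f z)"
 have D: "of_real (null_norm \<phi> z) = ?F * (1 + ?G)\<^sup>2 / 2"
  unfolding i1[symmetric] by (simp add: null_norm_def sum_3 of_real_norm_square)
 have S: "null_mixed \<phi> z = f z * (1 + ?G) * (cnj (deriv f z) * (1 + ?G) / 2 + cnj (f z) * g z * cnj (deriv g z))"
  unfolding i2[symmetric] by (simp add: null_mixed_def sum_3)
 have T: "of_real (null_dnorm \<phi> z) = deriv f z * cnj (deriv f z) * (1 + ?G)\<^sup>2 / 2
   + (deriv f z * cnj (f z) * g z * cnj (deriv g z) + cnj (deriv f z) * f z * cnj (g z) * deriv g z) * (1 + ?G)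
   + ?F * deriv g z * cnj (deriv g z) * (1 + 2 * g z * cnj (g z))"
  unfolding i3[symmetric] by (simp add: null_dnorm_def sum_3 of_real_norm_square)
 show "null_mixed \<phi> z = f z * (1 + g z * cnj (g z)) *
     (cnj (deriv f z) * (1 + g z * cnj (g z)) / 2 + cnj (f z) * g z * cnj (deriv g z))" by (fact S)
 have "of_real (null_norm \<phi> z) = complex_of_real ((norm (f z))\<^sup>2 * (1 + (norm (g z))\<^sup>2)\<^sup>2 / 2)"
  unfolding D by (simp add: of_real_norm_square)
 then show D': "null_norm \<phi> z = (norm (f z))\<^sup>2 * (1 + (norm (g z))\<^sup>2)\<^sup>2 / 2" using of_real_eq_iff by blast
 have "of_real (null_dnorm \<phi> z * null_norm \<phi> z - (norm (null_mixed \<phi> z))\<^sup>2) =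
   ?F\<^sup>2 * (deriv g z * cnj (deriv g z)) * (1 + ?G)\<^sup>2 / 2"
  unfolding of_real_diff of_real_mult of_real_power D T
  unfolding of_real_norm_square S
  by (simp add: field_simps power2_eq_square)
 also have "\<dots> = complex_of_real ((norm (f z))^4 * (norm (deriv g z))\<^sup>2 * (1 + (norm (g z))\<^sup>2)\<^sup>2 / 2)"
  by (simp add: of_real_norm_square[symmetric] power_mult_distrib)
 finally have E: "null_dnorm \<phi> z * null_norm \<phi> z - (norm (null_mixed \<phi> z))\<^sup>2 =
   (norm (f z))^4 * (norm (deriv g z))\<^sup>2 * (1 + (norm (g z))\<^sup>2)\<^sup>2 / 2" using of_real_eq_iff by blast
 have pos: "norm (f z) \<noteq> 0" "1 + (norm (g z))\<^sup>2 \<noteq> 0"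
  using f0[rule_format, OF U(2)] by (auto simp: f_def) (metis add_pos_nonneg less_irrefl zero_le_power2 zero_less_one)
 show "null_curv \<phi> z = 8 * (norm (deriv g z))\<^sup>2 / (1 + (norm (g z))\<^sup>2)\<^sup>2"
 proof -
  have "4 * (a ^ 4 * c * b\<^sup>2 / 2) / (a\<^sup>2 * b\<^sup>2 / 2)\<^sup>2 = 8 * c / b\<^sup>2" if "a \<noteq> 0" "b \<noteq> 0" for a b c :: real
   using that by (simp add: divide_simps power2_eq_square power4_eq_xxxx)
  from this[OF pos] show ?thesis unfolding null_curv_def E unfolding D' .
 qed
qed

subsection \<open>The Gauss map at a puncture\<close>

text \<open>The behaviour of \<open>\<phi>\<close> under the two reflections: signs of \<open>\<phi>\<^sub>j\<close> for \<open>z \<mapsto> - cnj z\<close> and \<open>z \<mapsto> cnj z\<close>.\<close>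

definition sgn1 :: "3 => real" where "sgn1 j = (if j = 1 then 1 else -1)"
definition sgn2 :: "3 => real" where "sgn2 j = (if j = 2 then -1 else 1)"

lemma sgn12_simps [simp]:
 "sgn1 1 = 1" "sgn1 2 = -1" "sgn1 3 = -1" "sgn2 1 = 1" "sgn2 2 = -1" "sgn2 3 = 1"
 by (simp_all add: sgn1_def sgn2_def)

lemma curv_nonneg: "null_curv \<phi> z \<ge> 0"
proof -
 have "norm (null_mixed \<phi> z) \<le> (\<Sum>k\<in>UNIV. \<bar>norm (\<phi> k z)\<bar> * \<bar>norm (deriv (\<phi> k) z)\<bar>)"
  unfolding null_mixed_def by (rule order_trans[OF norm_sum]) (simp add: norm_mult)
 also have "\<dots> \<le> L2_set (%k. norm (\<phi> k z)) UNIV * L2_set (%k. norm (deriv (\<phi> k) z)) UNIV"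
  by (rule L2_set_mult_ineq)
 finally have "(norm (null_mixed \<phi> z))\<^sup>2 \<le> (L2_set (%k. norm (\<phi> k z)) UNIV * L2_set (%k. norm (deriv (\<phi> k) z)) UNIV)\<^sup>2"
  by (intro power_mono) auto
 also have "\<dots> = null_norm \<phi> z * null_dnorm \<phi> z"
  by (simp add: power_mult_distrib L2_set_def null_norm_def null_dnorm_def sum_nonneg)
 finally show ?thesis unfolding null_curv_def by (intro divide_nonneg_nonneg) (auto simp: mult.commute)
qed

text \<open>The local data at one puncture, moved to the origin; the two reflections are then
  reflections in the coordinate axes.\<close>

locale null_end =
 fixes r :: real and \<phi> :: "3 => complex => complex"
 assumes r: "r > 0" and hol: "\<And>k. \<phi> k holomorphic_on ball 0 r - {0}"
  and null: "\<forall>z\<in>ball 0 r - {0}. (\<Sum>k\<in>UNIV. (\<phi> k z)\<^sup>2) = 0"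
  and pos: "\<And>z. z \<in> ball 0 r - {0} ==> null_norm \<phi> z > 0"
  and sym1: "\<And>z k. z \<in> ball 0 r - {0} ==> \<phi> k (- cnj z) = of_real (sgn1 k) * cnj (\<phi> k z)"
  and sym2: "\<And>z k. z \<in> ball 0 r - {0} ==> \<phi> k (cnj z) = of_real (sgn2 k) * cnj (\<phi> k z)"
  and curv: "set_integrable lborel (ball 0 r - {0}) (null_curv \<phi>)"
  and comp: "complete_end r (%z. sqrt (null_norm \<phi> z))"
begin

lemma null_sum: "z \<in> ball 0 r - {0} ==> (\<phi> 1 z)\<^sup>2 + (\<phi> 2 z)\<^sup>2 + (\<phi> 3 z)\<^sup>2 = 0"
 using null by (auto simp: sum_3)

lemma f_product:
 "z \<in> ball 0 r - {0} ==> null_f 1 \<phi> z * null_f (-1) \<phi> z = - (\<phi> 3 z)\<^sup>2"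
 using null_sum[of z] unfolding eq_neg_iff_add_eq_0 by (simp add: null_f_def algebra_simps power2_eq_square)

lemma f_not_both_0:
 assumes "z \<in> ball 0 r - {0}" shows "null_f 1 \<phi> z \<noteq> 0 \<or> null_f (-1) \<phi> z \<noteq> 0"
proof (rule ccontr)
 assume "\<not> ?thesis"
 then have 0: "\<phi> 1 z - \<i> * \<phi> 2 z = 0" "\<phi> 1 z + \<i> * \<phi> 2 z = 0" by (auto simp: null_f_def)
 have "2 * \<phi> 1 z = (\<phi> 1 z - \<i> * \<phi> 2 z) + (\<phi> 1 z + \<i> * \<phi> 2 z)" by simp
 then have 1: "\<phi> 1 z = 0" unfolding 0 by simp
 then have 2: "\<phi> 2 z = 0" using 0 by simp
 have "\<phi> 3 z = 0" using null_sum[OF assms] 1 2 by simp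
 with 1 2 have "null_norm \<phi> z = 0" by (simp add: null_norm_def sum_3)
 then show False using pos[OF assms] by simp
qed

lemma small_curvature:
 assumes "e > 0"
 obtains r' where "0 < r'" "r' \<le> r" "set_integrable lborel (ball 0 r' - {0}) (null_curv \<phi>)"
  "(LINT z:ball 0 r' - {0}|lborel. null_curv \<phi> z) < e"
proof -
 define A where "A = (%n::nat. ball (0::complex) (r / (real n + 1)) - {0})"
 have A: "A n \<subseteq> ball 0 r - {0}" for n
 proof -
  have "r / (real n + 1) \<le> r" using r by (simp add: divide_le_eq distrib_left)
  then show ?thesis by (auto simp: A_def)
 qed
 have m: "A n \<in> sets lborel" for n by (simp add: A_def)
 have "(%n. LINT z:A n|lborel. null_curv \<phi> z) \<longlonglongrightarrow> (LINT z|(lborel :: complex measure). (0::real))"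
  unfolding set_lebesgue_integral_def
 proof (rule integral_dominated_convergence[where f = "%z. 0" and w = "%z. norm (indicator (ball 0 r - {0}) z *\<^sub>R null_curv \<phi> z)"])
  show "integrable lborel (%z. norm (indicator (ball 0 r - {0}) z *\<^sub>R null_curv \<phi> z))"
   using curv unfolding set_integrable_def by (rule integrable_norm)
  show "(%z. indicator (A n) z *\<^sub>R null_curv \<phi> z) \<in> borel_measurable lborel" for n
   using set_integrable_subset[OF curv m A] unfolding set_integrable_def by (rule borel_measurable_integrable)
  show "AE z in lborel. (%n. indicator (A n) z *\<^sub>R null_curv \<phi> z) \<longlonglongrightarrow> 0"
  proof (rule AE_I2)
   fix z :: complex
   show "(%n. indicator (A n) z *\<^sub>R null_curv \<phi> z) \<longlonglongrightarrow> 0"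
   proof (cases "z = 0")
    case False
    have "(%n::nat. r / (real n + 1)) \<longlonglongrightarrow> 0" by real_asymp
    then have "\<forall>\<^sub>F n in sequentially. r / (real n + 1) < norm z"
     using False by (intro order_tendstoD) auto
    then have "\<forall>\<^sub>F n in sequentially. 0 = indicator (A n) z *\<^sub>R null_curv \<phi> z"
     by eventually_elim (auto simp: A_def)
    then show ?thesis by (rule Lim_transform_eventually[OF tendsto_const])
   qed (simp add: A_def)
  qed
  show "AE z in lborel. norm (indicator (A n) z *\<^sub>R null_curv \<phi> z) \<le> norm (indicator (ball 0 r - {0}) z *\<^sub>R null_curv \<phi> z)" for n
   by (rule AE_I2) (use A[of n] in \<open>auto simp: indicator_def subset_iff\<close>)
 qed auto
 then have "\<forall>\<^sub>F n in sequentially. (LINT z:A n|lborel. null_curv \<phi> z) < e"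
  using assms by (intro order_tendstoD) auto
 then obtain n where "(LINT z:A n|lborel. null_curv \<phi> z) < e" by (meson eventually_sequentially order_refl)
 then show ?thesis
  using that[of "r / (real n + 1)"] r A m set_integrable_subset[OF curv m A] unfolding A_def
  by (auto simp: divide_le_eq mult_le_cancel_left1)
qed

text \<open>Small total curvature forces the Gauss map to omit many values, so Picard's theorem gives a limit.
 The reflections confine the limit to the real and the imaginary axis.\<close>

lemma gauss_map_limit:
 obtains \<epsilon> \<delta> where "\<epsilon> = 1 \<or> \<epsilon> = -1" "0 < \<delta>" "\<delta> \<le> r" "\<forall>z\<in>ball 0 \<delta> - {0}. null_f \<epsilon> \<phi> z \<noteq> 0"
  "(null_g \<epsilon> \<phi> \<longlongrightarrow> 0) (at 0)"
proof -
 note result = that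
 \<comment> \<open>Where |g| < 1, the squared modulus of the derivative of g is at most half of
   \<open>null_curv\<close>; so 1/2 becomes the bound 1/4 of the area argument.\<close>
 obtain r' where r': "0 < r'" "r' \<le> r" "set_integrable lborel (ball 0 r' - {0}) (null_curv \<phi>)"
  "(LINT z:ball 0 r' - {0}|lborel. null_curv \<phi> z) < 1/2"
  using small_curvature[of "1/2"] by auto
 define B where "B = ball (0::complex) r' - {0}"
 have B: "open B" "B \<subseteq> ball 0 r - {0}" using r'(2) by (auto simp: B_def open_delete)
 define f p where "f = null_f 1 \<phi>" and "p = null_f (-1) \<phi>"
 have holB: "\<phi> k holomorphic_on B" for k using hol B(2) holomorphic_on_subset by blast
 have fp: "f holomorphic_on B" "p holomorphic_on B"
  unfolding f_def p_def null_f_def[abs_def] by (intro holomorphic_intros holB)+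
 have prod: "f z * p z = - (\<phi> 3 z)\<^sup>2" if "z \<in> B" for z using f_product[of z] that B(2) unfolding f_def p_def by blast
 have nz: "p z \<noteq> 0" if "z \<in> B" "f z = 0" for z using f_not_both_0[of z] that B(2) unfolding f_def p_def by blast
 \<comment> \<open>The part of the end that the Gauss map sends into the open unit disc. Values of
   the disc omitted on \<open>U\<close> are omitted altogether.\<close>
 define U where "U = {z \<in> B. norm (\<phi> 3 z) < norm (f z)}"
 have U: "open U"
 proof -
  have "continuous_on B (%z. norm (f z) - norm (\<phi> 3 z))"
   by (intro continuous_intros holomorphic_on_imp_continuous_on fp holB)
  then have "open (B \<inter> (%z. norm (f z) - norm (\<phi> 3 z)) -` {0<..})"
   by (rule continuous_open_preimage) (auto simp: B)
  moreover have "B \<inter> (%z. norm (f z) - norm (\<phi> 3 z)) -` {0<..} = U" by (auto simp: U_def)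
  ultimately show ?thesis by simp
 qed
 define g where "g = null_g 1 \<phi>"
 have f0: "\<forall>z\<in>U. null_f 1 \<phi> z \<noteq> 0" by (auto simp: U_def f_def)
 have UB: "U \<subseteq> B" by (auto simp: U_def)
 have holU: "\<phi> k holomorphic_on U" for k using holB UB holomorphic_on_subset by blast
 have nullU: "\<forall>z\<in>U. (\<Sum>k\<in>UNIV. (\<phi> k z)\<^sup>2) = 0" using null UB B by blast
 have gU: "g holomorphic_on U"
  unfolding g_def null_g_def[abs_def] null_f_def[abs_def]
  by (intro holomorphic_intros holU) (use f0 in \<open>auto simp: null_f_def\<close>)
 have gle: "(norm (deriv g z))\<^sup>2 \<le> null_curv \<phi> z / 2" if z: "z \<in> U" for z
 proof -
  have V: "null_curv \<phi> z = 8 * (norm (deriv g z))\<^sup>2 / (1 + (norm (g z))\<^sup>2)\<^sup>2"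
   using null_chart_norm(3)[OF _ U z holU nullU f0] by (simp add: g_def)
  have "norm (g z) < 1" using z by (auto simp: U_def g_def null_g_def f_def norm_divide divide_less_eq)
  then have "(norm (g z))\<^sup>2 \<le> 1" by (simp add: power_le_one)
  then have "(1 + (norm (g z))\<^sup>2)\<^sup>2 \<le> 2\<^sup>2" by (intro power_mono) auto
  moreover have p: "0 < 1 + (norm (g z))\<^sup>2" by (simp add: add_pos_nonneg)
  ultimately have "8 * (norm (deriv g z))\<^sup>2 / 4 \<le> 8 * (norm (deriv g z))\<^sup>2 / (1 + (norm (g z))\<^sup>2)\<^sup>2"
   using p by (intro divide_left_mono) auto
  then show ?thesis using V by simp
 qed
 have mU: "U \<in> sets lborel" using U by simp
 have intU: "set_integrable lborel U (%z. null_curv \<phi> z / 2)"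
  using set_integrable_subset[OF r'(3) mU] UB B_def by (intro set_integrable_divide) auto
 have cg: "continuous_on U (%z. (norm (deriv g z))\<^sup>2)"
  by (intro continuous_intros holomorphic_on_imp_continuous_on holomorphic_deriv gU U)
 have ig: "set_integrable lborel U (%z. (norm (deriv g z))\<^sup>2)"
 proof (rule set_integrable_bound[OF intU])
  show "set_borel_measurable lborel U (%z. (norm (deriv g z))\<^sup>2)"
   using borel_measurable_continuous_on_indicator[OF _ cg] U by (simp add: set_borel_measurable_def)
  show "AE x in lborel. x \<in> U \<longrightarrow> norm ((norm (deriv g x))\<^sup>2) \<le> norm (null_curv \<phi> x / 2)"
   using gle curv_nonneg by (intro AE_I2) auto
 qed
 have "(LINT z:U|lborel. (norm (deriv g z))\<^sup>2) \<le> (LINT z:U|lborel. null_curv \<phi> z / 2)"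
  using gle by (intro set_integral_mono ig intU)
 also have "\<dots> \<le> (LINT z:ball 0 r' - {0}|lborel. null_curv \<phi> z / 2)"
  unfolding set_lebesgue_integral_def
  by (intro integral_mono set_integrable_divide[OF r'(3), unfolded set_integrable_def] intU[unfolded set_integrable_def])
   (use UB curv_nonneg in \<open>auto simp: indicator_def B_def\<close>)
 also have "\<dots> < 1/4" using r'(4) by simp
 finally have "infinite (ball 0 1 - g ` U)"
  by (rule holomorphic_image_misses_infinite[OF U gU ig])
 then obtain W where W: "finite W" "card W = 3" "W \<subseteq> ball 0 1 - g ` U"
  using infinite_arbitrarily_large by blast
 then obtain w1 w2 w3 where w: "W = {w1, w2, w3}" "w1 \<noteq> w2" "w1 \<noteq> w3" "w2 \<noteq> w3"
  by (auto simp: card_Suc_eq numeral_3_eq_3)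
 have miss: "\<phi> 3 z \<noteq> w * f z" if "w \<in> W" "z \<in> B" "f z \<noteq> 0" for w z
 proof
  assume eq: "\<phi> 3 z = w * f z"
  then have "norm (\<phi> 3 z) < norm (f z)" using that W(3) by (auto simp: norm_mult)
  then have "z \<in> U" using that by (simp add: U_def)
  moreover have "g z = w" using eq that(3) by (simp add: g_def null_g_def f_def)
  ultimately show False using that(1) W(3) by auto
 qed
 \<comment> \<open>\<open>f z * Q a b z\<close> is the product of
   \<open>\<phi> 3 z - a * f z\<close> and \<open>\<phi> 3 z - b * f z\<close>, but \<open>Q\<close>
   itself has no zero at the poles of g. Hence \<open>k\<close> is the Moebius transform (g - w2)/(g
   - w1) of g, holomorphic across those poles, with two omitted values for Picard's theorem.\<close>
 define Q where "Q = (%a b z. - p z - (a + b) * \<phi> 3 z + a * b * f z)"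
 have fQ: "f z * Q a b z = (\<phi> 3 z - a * f z) * (\<phi> 3 z - b * f z)" if "z \<in> B" for a b z
 proof -
  have "f z * Q a b z = - (f z * p z) - (a + b) * \<phi> 3 z * f z + a * b * (f z)\<^sup>2"
   by (simp add: Q_def algebra_simps power2_eq_square)
  then show ?thesis unfolding prod[OF that] by (simp add: algebra_simps power2_eq_square)
 qed
 have p30: "\<phi> 3 z = 0" if "z \<in> B" "f z = 0" for z using prod[OF that(1)] that(2) by simp
 have Q0: "Q a b z \<noteq> 0" if "a \<in> W" "b \<in> W" "z \<in> B" for a b z
 proof (cases "f z = 0")
  case True
  then show ?thesis using nz[OF that(3) True] p30[OF that(3) True] by (simp add: Q_def)
 next
  case False
  then show ?thesis using fQ[OF that(3), of a b] miss[OF that(1,3)] miss[OF that(2,3)] by auto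
 qed
 define k where "k = (%z. Q w1 w2 z / Q w1 w1 z)"
 have Qh: "Q a b holomorphic_on B" for a b
  unfolding Q_def by (intro holomorphic_intros fp holB)
 have kh: "k holomorphic_on ball 0 r' - {0}" unfolding k_def B_def[symmetric]
  using Qh Q0 w(1) by (intro holomorphic_on_divide) auto
 have kf: "k z * (\<phi> 3 z - w1 * f z) = \<phi> 3 z - w2 * f z" if "z \<in> B" "f z \<noteq> 0" for z
 proof -
  have n: "\<phi> 3 z - w1 * f z \<noteq> 0" using miss[of w1 z] that w(1) by auto
  have "f z * (Q w1 w2 z * (\<phi> 3 z - w1 * f z)) = (f z * Q w1 w1 z) * (\<phi> 3 z - w2 * f z)"
   unfolding mult.assoc[symmetric] fQ[OF that(1)] by (simp add: algebra_simps)
  then have "Q w1 w2 z * (\<phi> 3 z - w1 * f z) = Q w1 w1 z * (\<phi> 3 z - w2 * f z)"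
   using that(2) by (simp add: mult.assoc)
  then show ?thesis using Q0[of w1 w1 z] w(1) that by (simp add: k_def field_simps)
 qed
 have k1: "k z = 1" if "z \<in> B" "f z = 0" for z
  using nz[OF that] p30[OF that] that(2) by (simp add: k_def Q_def)
 have kne: "k z \<noteq> 0 \<and> k z \<noteq> (w3 - w2) / (w3 - w1)" if z: "z \<in> B" for z
 proof (cases "f z = 0")
  case True
  have "(w3 - w2) / (w3 - w1) \<noteq> 1" using w by (simp add: field_simps)
  then show ?thesis using k1[OF z True] by simp
 next
  case False
  have "k z \<noteq> (w3 - w2) / (w3 - w1)"
  proof
   assume "k z = (w3 - w2) / (w3 - w1)"
   then have "k z * (w3 - w1) = w3 - w2" using w(3) by (simp add: field_simps)
   then have "(w3 - w2) * (\<phi> 3 z - w1 * f z) = (w3 - w1) * (\<phi> 3 z - w2 * f z)"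
    using kf[OF z False] by (metis mult.assoc mult.commute)
   then have "(w2 - w1) * (\<phi> 3 z - w3 * f z) = 0" by (simp add: algebra_simps)
   then show False using w(2) miss[of w3 z] z False w(1) by auto
  qed
  then show ?thesis using Q0[of w1 w2 z] Q0[of w1 w1 z] w(1) z by (simp add: k_def)
 qed
 have "(w3 - w2) / (w3 - w1) \<noteq> 0" using w by simp
 then obtain l where l: "(k \<longlongrightarrow> l) (at 0) \<or> ((inverse \<circ> k) \<longlongrightarrow> l) (at 0)"
  using great_Picard[of "ball 0 r'" 0 0 "(w3 - w2) / (w3 - w1)" k] kh kne r'(1) unfolding B_def
  by (metis centre_in_ball open_ball)
 have evB: "\<forall>\<^sub>F z in at 0. z \<in> B"
  using eventually_at_ball'[OF r'(1), of 0 UNIV] by eventually_elim (auto simp: B_def)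
 have chart: ?thesis if "\<epsilon> = 1 \<or> \<epsilon> = -1" "\<forall>\<^sub>F z in at 0. null_f \<epsilon> \<phi> z \<noteq> 0" "(null_g \<epsilon> \<phi> \<longlongrightarrow> 0) (at 0)" for \<epsilon>
 proof -
  obtain d where "d > 0" "\<And>z. z \<noteq> 0 ==> dist z 0 < d ==> null_f \<epsilon> \<phi> z \<noteq> 0"
   using \<open>\<forall>\<^sub>F z in at 0. null_f \<epsilon> \<phi> z \<noteq> 0\<close> unfolding eventually_at by auto
  then show ?thesis using that(1,3) r by (intro result[of \<epsilon> "min d r"]) auto
 qed
 have finite_case: ?thesis if ev: "\<forall>\<^sub>F z in at 0. f z \<noteq> 0" and lim: "(g \<longlongrightarrow> G0) (at 0)" for G0
 proof -
  have real_lim: "\<exists>x. G0 = u * of_real x" if u: "u \<noteq> 0" "\<And>s. 0 < s ==> s < r ==> \<exists>x. g (v * of_real s) = u * of_real x" and v: "norm v = 1" for u v :: complex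
  proof -
   have "filterlim (%s. v * of_real s) (at 0) (at_right (0::real))"
    unfolding filterlim_at
   proof
    show "((%s. v * of_real s) \<longlongrightarrow> 0) (at_right (0::real))"
     by (rule tendsto_eq_intros refl | simp)+
    have "v \<noteq> 0" using v by auto
    then show "\<forall>\<^sub>F s in at_right (0::real). v * of_real s \<in> UNIV \<and> v * of_real s \<noteq> 0"
     by (auto simp: eventually_at_filter)
   qed
   from filterlim_compose[OF lim this]
   have L: "((%s. g (v * of_real s) / u) \<longlongrightarrow> G0 / u) (at_right (0::real))" using u(1) by (intro tendsto_divide tendsto_const)
   have "\<forall>\<^sub>F s in at_right (0::real). 0 < s \<and> s < r"
    using r by (auto simp: eventually_at_right_field)
   then have "\<forall>\<^sub>F s in at_right (0::real). g (v * of_real s) / u \<in> \<real>"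
   proof eventually_elim
    case (elim s)
    then obtain x where "g (v * of_real s) = u * of_real x" using u(2) by blast
    then show ?case using u(1) by simp
   qed
   then have "G0 / u \<in> \<real>"
    by (intro Lim_in_closed_set[OF closed_complex_Reals _ _ L]) auto
   then show ?thesis using u(1) by (auto simp: Reals_def field_simps)
  qed
  have 1: "\<exists>x. g (1 * of_real s) = 1 * of_real x" if "0 < s" "s < r" for s
  proof -
   have s: "complex_of_real s \<in> ball 0 r - {0}" using that by simp
   have e: "cnj (\<phi> 1 (of_real s)) = \<phi> 1 (of_real s)" "cnj (\<phi> 2 (of_real s)) = - \<phi> 2 (of_real s)"
    "cnj (\<phi> 3 (of_real s)) = \<phi> 3 (of_real s)"
    using sym2[OF s, of 1] sym2[OF s, of 2] sym2[OF s, of 3] by (auto simp: complex_eq_iff)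
   have "cnj (g (of_real s)) = g (of_real s)" by (simp add: g_def null_g_def null_f_def e)
   then have "g (of_real s) \<in> \<real>" by (simp add: Reals_cnj_iff)
   then show ?thesis by (auto simp: Reals_def)
  qed
  have 2: "\<exists>x. g (\<i> * of_real s) = \<i> * of_real x" if "0 < s" "s < r" for s
  proof -
   have s: "\<i> * of_real s \<in> ball 0 r - {0}" using that by (simp add: norm_mult)
   have e: "cnj (\<phi> 1 (\<i> * of_real s)) = \<phi> 1 (\<i> * of_real s)" "cnj (\<phi> 2 (\<i> * of_real s)) = - \<phi> 2 (\<i> * of_real s)"
    "cnj (\<phi> 3 (\<i> * of_real s)) = - \<phi> 3 (\<i> * of_real s)"
    using sym1[OF s, of 1] sym1[OF s, of 2] sym1[OF s, of 3] by (auto simp: complex_eq_iff)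
   have "cnj (g (\<i> * of_real s)) = - g (\<i> * of_real s)" by (simp add: g_def null_g_def null_f_def e)
   then have "cnj (g (\<i> * of_real s) / \<i>) = g (\<i> * of_real s) / \<i>" by simp
   then have "g (\<i> * of_real s) / \<i> \<in> \<real>" by (simp only: Reals_cnj_iff)
   then obtain x where "g (\<i> * of_real s) / \<i> = of_real x" by (auto simp: Reals_def)
   then have "g (\<i> * of_real s) = of_real x * \<i>" by (metis complex_i_not_zero nonzero_divide_eq_eq)
   then show ?thesis by (metis mult.commute)
  qed
  obtain x y where "G0 = 1 * of_real x" "G0 = \<i> * of_real y"
   using real_lim[of 1 1] real_lim[of \<i> \<i>] 1 2 by auto
  then have "G0 = 0" by (auto simp: complex_eq_iff)
  then show ?thesis using chart[of 1] ev lim by (simp add: f_def g_def)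
 qed
 \<comment> \<open>The limit 1 of \<open>k\<close> corresponds to a pole of g. In that case the
   chart with the opposite sign applies, and its Gauss map, expressed through \<open>k\<close>,
   tends to 0.\<close>
 have lim_case: ?thesis if L: "(k \<longlongrightarrow> L) (at 0)" for L
 proof (cases "L = 1")
  case False
  have "\<forall>\<^sub>F z in at 0. k z \<noteq> 1" using L False tendsto_imp_eventually_ne by blast
  with evB have ev: "\<forall>\<^sub>F z in at 0. z \<in> B \<and> k z \<noteq> 1 \<and> f z \<noteq> 0"
   by eventually_elim (use k1 in auto)
  have "((%z. (w1 * k z - w2) / (k z - 1)) \<longlongrightarrow> (w1 * L - w2) / (L - 1)) (at 0)"
   using False by (intro tendsto_intros L) auto
  moreover have "\<forall>\<^sub>F z in at 0. (w1 * k z - w2) / (k z - 1) = g z"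
   using ev
  proof eventually_elim
   case (elim z)
   then have "\<phi> 3 z * (k z - 1) = (w1 * k z - w2) * f z" using kf[of z] by (simp add: algebra_simps)
   then show ?case using elim by (simp add: g_def null_g_def f_def[symmetric] field_simps)
  qed
  ultimately have "(g \<longlongrightarrow> (w1 * L - w2) / (L - 1)) (at 0)" by (rule Lim_transform_eventually)
  moreover have "\<forall>\<^sub>F z in at 0. f z \<noteq> 0" using ev by eventually_elim auto
  ultimately show ?thesis using finite_case by blast
 next
  case True
  have "((%z. w1 * k z - w2) \<longlongrightarrow> w1 * L - w2) (at 0)" by (intro tendsto_intros L)
  then have "\<forall>\<^sub>F z in at 0. w1 * k z - w2 \<noteq> 0"
   using w(2) True by (intro tendsto_imp_eventually_ne) auto
  with evB have ev: "\<forall>\<^sub>F z in at 0. z \<in> B \<and> w1 * k z - w2 \<noteq> 0" by eventually_elim auto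
  have eq: "\<phi> 3 z * (w1 * k z - w2) = - (k z - 1) * p z" if z: "z \<in> B" for z
  proof (cases "f z = 0")
   case True
   then show ?thesis using k1[OF z True] p30[OF z True] by simp
  next
   case False
   have e1: "\<phi> 3 z * (k z - 1) = (w1 * k z - w2) * f z" using kf[OF z False] by (simp add: algebra_simps)
   have "f z * (\<phi> 3 z * (w1 * k z - w2)) = \<phi> 3 z * (\<phi> 3 z * (k z - 1))" unfolding e1 by simp
   also have "\<dots> = - (k z - 1) * (- (\<phi> 3 z)\<^sup>2)" by (simp add: power2_eq_square algebra_simps)
   also have "\<dots> = f z * (- (k z - 1) * p z)" unfolding prod[OF z, symmetric] by simp
   finally show ?thesis using False by simp
  qed
  have pz: "\<forall>\<^sub>F z in at 0. p z \<noteq> 0" using ev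
  proof eventually_elim
   case (elim z)
   show ?case
   proof
    assume p0: "p z = 0"
    then have "\<phi> 3 z = 0" using eq[of z] elim by simp
    moreover have "f z \<noteq> 0" using nz[of z] p0 elim by auto
    ultimately have "w1 * k z = w2" using kf[of z] elim by (simp add: algebra_simps)
    then show False using elim by simp
   qed
  qed
  have "((%z. - (k z - 1) / (w1 * k z - w2)) \<longlongrightarrow> - (L - 1) / (w1 * L - w2)) (at 0)"
   using w(2) True by (intro tendsto_intros L) auto
  moreover have "\<forall>\<^sub>F z in at 0. - (k z - 1) / (w1 * k z - w2) = null_g (-1) \<phi> z"
   using ev pz
  proof eventually_elim
   case (elim z)
   then show ?case using eq[of z] by (simp add: null_g_def p_def[symmetric] field_simps)
  qed
  ultimately have "(null_g (-1) \<phi> \<longlongrightarrow> - (L - 1) / (w1 * L - w2)) (at 0)" by (rule Lim_transform_eventually)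
  then show ?thesis using chart[of "-1"] pz True by (simp add: p_def)
 qed
 show ?thesis using l
 proof
  assume "(k \<longlongrightarrow> l) (at 0)"
  then show ?thesis by (rule lim_case)
 next
  assume L: "((inverse \<circ> k) \<longlongrightarrow> l) (at 0)"
  show ?thesis
  proof (cases "l = 0")
   case False
   have "((%z. inverse (inverse (k z))) \<longlongrightarrow> inverse l) (at 0)"
    using tendsto_inverse[OF L False] by simp
   then show ?thesis using lim_case[of "inverse l"] by simp
  next
   case True
   \<comment> \<open>Here \<open>k\<close> tends to infinity, that is, g tends to \<open>w1\<close>,
     and g is expressed through the reciprocal of \<open>k\<close>.\<close>
   define j where "j = (%z. inverse (k z))"
   have j: "(j \<longlongrightarrow> 0) (at 0)" using L True by (simp add: j_def o_def)
   then have "\<forall>\<^sub>F z in at 0. j z \<noteq> 1" by (rule tendsto_imp_eventually_ne) auto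
   with evB have ev: "\<forall>\<^sub>F z in at 0. z \<in> B \<and> j z \<noteq> 1 \<and> f z \<noteq> 0"
    by eventually_elim (use k1 in \<open>auto simp: j_def\<close>)
   have "((%z. (w1 - w2 * j z) / (1 - j z)) \<longlongrightarrow> (w1 - w2 * 0) / (1 - 0)) (at 0)"
    by (intro tendsto_intros j) auto
   moreover have "\<forall>\<^sub>F z in at 0. (w1 - w2 * j z) / (1 - j z) = g z"
    using ev
   proof eventually_elim
    case (elim z)
    have jk: "j z * k z = 1" using kne[of z] elim by (simp add: j_def)
    have "j z * (k z * (\<phi> 3 z - w1 * f z)) = j z * (\<phi> 3 z - w2 * f z)" using kf[of z] elim by simp
    then have "\<phi> 3 z - w1 * f z = j z * (\<phi> 3 z - w2 * f z)" unfolding mult.assoc[symmetric] jk by simp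
    then have "\<phi> 3 z * (1 - j z) = (w1 - w2 * j z) * f z" by (simp add: algebra_simps)
    then show ?case using elim by (simp add: g_def null_g_def f_def[symmetric] field_simps)
   qed
   ultimately have "(g \<longlongrightarrow> (w1 - w2 * 0) / (1 - 0)) (at 0)" by (rule Lim_transform_eventually)
   moreover have "\<forall>\<^sub>F z in at 0. f z \<noteq> 0" using ev by eventually_elim auto
   ultimately show ?thesis using finite_case by blast
  qed
 qed
qed

end

text \<open>Evenness annihilates the first derivative at 0, and Taylor's formula leaves a quadratic
  remainder.\<close>

lemma even_holomorphic_quadratic_zero:
 assumes "\<delta> > 0" "K holomorphic_on ball 0 \<delta>" "K 0 = 0" and even: "\<And>z. z \<in> ball 0 \<delta> ==> K (- z) = K z"
 obtains C where "\<And>z. z \<in> ball 0 (\<delta>/2) ==> norm (K z) \<le> C * (norm z)\<^sup>2"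
proof -
 have d: "(K has_field_derivative deriv K z) (at z)" if "z \<in> ball 0 \<delta>" for z
  using assms(2) that holomorphic_derivI by blast
 have "((%z. K (- z)) has_field_derivative deriv K (- 0) * (- 1)) (at 0)"
  by (rule DERIV_chain2[OF d]) (use assms in \<open>auto intro!: derivative_eq_intros\<close>)
 moreover have "((%z. K (- z)) has_field_derivative deriv K 0) (at 0)"
  by (rule has_field_derivative_transform_within_open[OF d[of 0], of "ball 0 \<delta>"]) (use assms in auto)
 ultimately have "deriv K (- 0) * (- 1) = deriv K 0" by (rule DERIV_unique)
 then have d0: "deriv K 0 = 0" by (simp add: eq_neg_iff_add_eq_0 neg_eq_iff_add_eq_0)
 have h2: "(deriv ^^ n) K holomorphic_on ball 0 \<delta>" for n
  using assms(2) by (intro holomorphic_higher_deriv) auto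
 have "bounded ((deriv ^^ 2) K ` cball 0 (\<delta>/2))"
  by (intro compact_imp_bounded compact_continuous_image holomorphic_on_imp_continuous_on
    holomorphic_on_subset[OF h2]) (use assms(1) in auto)
 then obtain C where "\<forall>z\<in>cball 0 (\<delta>/2). norm ((deriv ^^ 2) K z) \<le> C"
  unfolding bounded_iff by auto
 then have C: "norm ((deriv ^^ 2) K z) \<le> C" if "z \<in> cball 0 (\<delta>/2)" for z using that by blast
 have "norm (K z) \<le> C * (norm z)\<^sup>2" if z: "z \<in> ball 0 (\<delta>/2)" for z
 proof -
  have "cmod ((deriv ^^ 0) K z - (\<Sum>i\<le>1. (deriv ^^ i) K 0 * (z - 0)^i / (fact i))) \<le> C * cmod(z - 0)^(Suc 1) / fact 1"
  proof (rule complex_Taylor[of "ball 0 (\<delta>/2)"])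
   fix i and x :: complex assume "x \<in> ball 0 (\<delta>/2)" "i \<le> (1::nat)"
   then have "x \<in> ball 0 \<delta>" using assms(1) by auto
   then show "((deriv ^^ i) K has_field_derivative (deriv ^^ Suc i) K x) (at x within ball 0 (\<delta>/2))"
    using holomorphic_derivI[OF h2[of i] open_ball] by (auto intro: has_field_derivative_at_within)
  next
   fix x :: complex assume "x \<in> ball 0 (\<delta>/2)"
   then show "cmod ((deriv ^^ Suc 1) K x) \<le> C" using C[of x] by (simp add: numeral_2_eq_2)
  qed (use assms(1) z in auto)
  then show ?thesis using d0 assms(3) by (simp add: power2_eq_square)
 qed
 then show ?thesis using that by blast
qed

context null_end
begin

text \<open>The conformal factor is at least of order \<open>|z|\<^sup>-\<^sup>2\<close>: \<open>1 / f\<close> extends holomorphically, vanishes at the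
 puncture by completeness, and is even by symmetry.\<close>

theorem end_growth:
 obtains \<epsilon> \<delta> C where "\<epsilon> = 1 \<or> \<epsilon> = -1" "0 < \<delta>" "\<delta> \<le> r" "\<forall>z\<in>ball 0 \<delta> - {0}. null_f \<epsilon> \<phi> z \<noteq> 0"
  "(null_g \<epsilon> \<phi> \<longlongrightarrow> 0) (at 0)" "\<forall>z\<in>ball 0 \<delta> - {0}. norm (inverse (null_f \<epsilon> \<phi> z)) \<le> C * (norm z)\<^sup>2"
proof -
 note result = that
 obtain \<epsilon> \<delta>0 where e: "\<epsilon> = 1 \<or> \<epsilon> = -1" and \<delta>0: "0 < \<delta>0" "\<delta>0 \<le> r" "\<forall>z\<in>ball 0 \<delta>0 - {0}. null_f \<epsilon> \<phi> z \<noteq> 0"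
  and g0: "(null_g \<epsilon> \<phi> \<longlongrightarrow> 0) (at 0)" by (rule gauss_map_limit)
 obtain d where d: "d > 0" "\<And>z. z \<noteq> 0 ==> norm z < d ==> norm (null_g \<epsilon> \<phi> z) < 1"
  using tendstoD[OF g0, of 1] unfolding eventually_at by auto
 define \<delta> where "\<delta> = min d \<delta>0"
 define f where "f = null_f \<epsilon> \<phi>"
 define B where "B = ball 0 \<delta> - {0::complex}"
 have \<delta>: "0 < \<delta>" "\<delta> \<le> \<delta>0" "\<delta> \<le> d" "\<delta> \<le> r" using d \<delta>0 by (auto simp: \<delta>_def)
 have B: "open B" "B \<subseteq> ball 0 r - {0}" "B \<subseteq> ball 0 \<delta>0 - {0}" using \<delta> by (auto simp: B_def open_delete)
 have fB: "\<forall>z\<in>B. null_f \<epsilon> \<phi> z \<noteq> 0" using \<delta>0 B by blast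
 have holB: "\<phi> k holomorphic_on B" for k using hol B(2) holomorphic_on_subset by blast
 have nullB: "\<forall>z\<in>B. (\<Sum>k\<in>UNIV. (\<phi> k z)\<^sup>2) = 0" using null B by blast
 have fh: "f holomorphic_on ball 0 \<delta> - {0}"
  unfolding f_def null_f_def[abs_def] B_def[symmetric] by (intro holomorphic_intros holB)
 have f0: "f z \<noteq> 0" if "z \<in> ball 0 \<delta> - {0}" for z using fB that by (simp add: f_def B_def)
 \<comment> \<open>For |g| < 1 the conformal factor is at most a constant multiple of |f|, so
   completeness passes on to the flat metric defined by \<open>f\<close>.\<close>
 have norm_le: "sqrt (null_norm \<phi> z) \<le> 2 * norm (f z)" if z: "z \<in> B" for z
 proof -
  have "norm (null_g \<epsilon> \<phi> z) < 1" using d(2)[of z] z \<delta> by (auto simp: B_def)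
  then have "(norm (null_g \<epsilon> \<phi> z))\<^sup>2 \<le> 1" by (simp add: power_le_one)
  then have "(1 + (norm (null_g \<epsilon> \<phi> z))\<^sup>2)\<^sup>2 \<le> 2\<^sup>2" by (intro power_mono) auto
  then have "(norm (f z))\<^sup>2 * (1 + (norm (null_g \<epsilon> \<phi> z))\<^sup>2)\<^sup>2 / 2 \<le> (norm (f z))\<^sup>2 * 2\<^sup>2 / 2"
   by (intro divide_right_mono mult_left_mono) auto
  also have "\<dots> \<le> (2 * norm (f z))\<^sup>2" by (simp add: power_mult_distrib)
  finally have "null_norm \<phi> z \<le> (2 * norm (f z))\<^sup>2"
   using null_chart_norm(1)[OF e B(1) z holB nullB fB] by (simp add: f_def)
  then show ?thesis by (intro real_le_lsqrt) auto
 qed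
 have comp': "complete_end \<delta> (%z. norm (f z))"
  unfolding complete_end_def
 proof (intro allI impI)
  fix \<gamma> :: "real => complex"
  assume \<gamma>: "\<gamma> C1_differentiable_on {0..}" "\<gamma> ` {0..} \<subseteq> ball 0 \<delta> - {0}" "(\<gamma> \<longlongrightarrow> 0) at_top"
  have "\<gamma> ` {0..} \<subseteq> ball 0 r - {0}" using \<gamma>(2) \<delta> by fastforce
  then have inf: "(\<integral>\<^sup>+s\<in>{0..}. ennreal (sqrt (null_norm \<phi> (\<gamma> s)) * norm (vector_derivative \<gamma> (at s))) \<partial>lborel) = \<infinity>"
   using comp \<gamma> unfolding complete_end_def by blast
  obtain D where D: "\<forall>x\<in>{0..}. (\<gamma> has_vector_derivative D x) (at x)" "continuous_on {0..} D"
   using \<gamma>(1) unfolding C1_differentiable_on_def by blast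
  have vd: "vector_derivative \<gamma> (at s) = D s" if "s \<ge> 0" for s
   using D(1) that by (intro vector_derivative_at) auto
  have cg: "continuous_on {0..} \<gamma>"
   using D(1) by (intro continuous_at_imp_continuous_on) (auto intro: has_vector_derivative_continuous)
  have cf: "continuous_on {0..} (%s. norm (f (\<gamma> s)) * norm (D s))"
   using \<gamma>(2) D(2)
   by (intro continuous_intros continuous_on_compose2[OF holomorphic_on_imp_continuous_on[OF fh] cg])
  have "(\<integral>\<^sup>+s\<in>{0..}. ennreal (sqrt (null_norm \<phi> (\<gamma> s)) * norm (vector_derivative \<gamma> (at s))) \<partial>lborel)
   \<le> (\<integral>\<^sup>+s\<in>{0..}. ennreal 2 * ennreal (norm (f (\<gamma> s)) * norm (vector_derivative \<gamma> (at s))) \<partial>lborel)"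
  proof (rule nn_integral_mono)
   fix s :: real
   show "ennreal (sqrt (null_norm \<phi> (\<gamma> s)) * norm (vector_derivative \<gamma> (at s))) * indicator {0..} s
    \<le> ennreal 2 * ennreal (norm (f (\<gamma> s)) * norm (vector_derivative \<gamma> (at s))) * indicator {0..} s"
   proof (cases "s \<ge> 0")
    case True
    then have "\<gamma> s \<in> B" using \<gamma>(2) by (auto simp: B_def)
    then have "sqrt (null_norm \<phi> (\<gamma> s)) * norm (vector_derivative \<gamma> (at s)) \<le> 2 * norm (f (\<gamma> s)) * norm (vector_derivative \<gamma> (at s))"
     by (intro mult_right_mono norm_le) auto
    then have "ennreal (sqrt (null_norm \<phi> (\<gamma> s)) * norm (vector_derivative \<gamma> (at s)))
      \<le> ennreal (2 * (norm (f (\<gamma> s)) * norm (vector_derivative \<gamma> (at s))))"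
     by (intro ennreal_leI) (simp add: mult.assoc)
    also have "\<dots> = ennreal 2 * ennreal (norm (f (\<gamma> s)) * norm (vector_derivative \<gamma> (at s)))"
     by (rule ennreal_mult) auto
    finally show ?thesis using True by simp
   qed simp
  qed
  also have "\<dots> = (\<integral>\<^sup>+s. ennreal 2 * (ennreal (norm (f (\<gamma> s)) * norm (D s)) * indicator {0..} s) \<partial>lborel)"
   by (intro nn_integral_cong) (auto simp: indicator_def mult.assoc vd)
  also have "\<dots> = ennreal 2 * (\<integral>\<^sup>+s. ennreal (norm (f (\<gamma> s)) * norm (D s)) * indicator {0..} s \<partial>lborel)"
  proof (rule nn_integral_cmult)
   have "(%s. indicator {0..} s *\<^sub>R (norm (f (\<gamma> s)) * norm (D s))) \<in> borel_measurable lborel"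
    using borel_measurable_continuous_on_indicator[OF _ cf] by simp
   then have meas: "(%s. ennreal (indicator {0..} s *\<^sub>R (norm (f (\<gamma> s)) * norm (D s)))) \<in> borel_measurable lborel"
    by measurable
   have eq: "ennreal (indicator {0..} s *\<^sub>R (norm (f (\<gamma> s)) * norm (D s))) = ennreal (norm (f (\<gamma> s)) * norm (D s)) * indicator {0..} s" for s
    by (auto simp: indicator_def)
   show "(%s. ennreal (norm (f (\<gamma> s)) * norm (D s)) * indicator {0..} s) \<in> borel_measurable lborel"
    using meas unfolding eq .
  qed
  also have "(\<integral>\<^sup>+s. ennreal (norm (f (\<gamma> s)) * norm (D s)) * indicator {0..} s \<partial>lborel)
   = (\<integral>\<^sup>+s\<in>{0..}. ennreal (norm (f (\<gamma> s)) * norm (vector_derivative \<gamma> (at s))) \<partial>lborel)"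
   by (intro nn_integral_cong) (auto simp: indicator_def vd)
  finally show "(\<integral>\<^sup>+s\<in>{0..}. ennreal (norm (f (\<gamma> s)) * norm (vector_derivative \<gamma> (at s))) \<partial>lborel) = \<infinity>"
   unfolding inf by (simp add: top_unique ennreal_mult_eq_top_iff)
 qed
 obtain C1 \<delta>1 where C1: "\<delta>1 > 0" "\<delta>1 \<le> \<delta>" "\<And>z. z \<in> ball 0 \<delta>1 - {0} ==> norm (inverse (f z)) \<le> C1"
  by (rule complete_end_inverse_bounded[OF \<delta>(1) fh _ comp']) (use f0 in blast, rule that)
 have fh1: "(%z. inverse (f z)) holomorphic_on ball 0 \<delta>1 - {0}"
  by (intro holomorphic_on_inverse holomorphic_on_subset[OF fh]) (use f0 C1(2) in auto)
 have "\<forall>\<^sub>F z in at 0. norm (inverse (f z)) \<le> C1"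
  using C1 by (auto simp: eventually_at dist_norm intro!: exI[of _ \<delta>1])
 then obtain K where K: "K holomorphic_on ball 0 \<delta>1" "\<forall>z\<in>ball 0 \<delta>1 - {0}. K z = inverse (f z)"
  using holomorphic_on_extend_bounded[OF fh1] C1(1) by auto
 \<comment> \<open>Otherwise \<open>f\<close> would be bounded near the puncture, and a radial
   segment would reach it with finite length.\<close>
 have K0: "K 0 = 0"
 proof (rule ccontr)
  assume K0: "K 0 \<noteq> 0"
  have "isCont K 0" using holomorphic_on_imp_continuous_on[OF K(1)] C1(1) by (simp add: continuous_on_eq_continuous_at)
  then have "((%z. norm (K z)) \<longlongrightarrow> norm (K 0)) (at 0)" by (intro tendsto_norm) (simp add: isCont_def)
  then have "\<forall>\<^sub>F z in at 0. norm (K z) > norm (K 0) / 2" using K0 by (intro order_tendstoD) auto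
  then obtain d where d: "d > 0" "\<And>z. z \<noteq> 0 ==> norm z < d ==> norm (K z) > norm (K 0) / 2"
   unfolding eventually_at by auto
  define s0 where "s0 = min d \<delta>1 / 2"
  have s0: "0 < s0" "s0 < d" "2 * s0 \<le> \<delta>1" using d C1 by (auto simp: s0_def)
  show False
  proof (rule complete_end_no_short_path[OF comp', of 1 "%s. of_real (s0 * (1 - s))" "%s. - of_real s0" "2 * s0 / norm (K 0)"])
   show "((%s. complex_of_real (s0 * (1 - s))) has_vector_derivative - of_real s0) (at s)" for s
    by (auto intro!: derivative_eq_intros)
   show "((%s. complex_of_real (s0 * (1 - s))) \<longlongrightarrow> 0) (at_left 1)"
    by (rule tendsto_eq_intros refl | simp)+
   fix s :: real assume s: "0 \<le> s" "s < 1"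
   have le: "s0 * (1 - s) \<le> s0" using s s0 by (simp add: mult_left_le)
   define z where "z = complex_of_real (s0 * (1 - s))"
   have "norm z = s0 * (1 - s)" unfolding z_def norm_of_real using s s0 by simp
   then have z: "z \<noteq> 0" "norm z \<le> s0" using s s0 le by (auto simp: z_def)
   have "norm (K z) > norm (K 0) / 2" using d z s0 by auto
   moreover have "K z = inverse (f z)" using K(2) z s0 C1 by auto
   ultimately have "norm (inverse (f z)) > norm (K 0) / 2" by simp
   moreover have "f z \<noteq> 0" using f0[of z] z s0 C1(2) by auto
   ultimately have "norm (K 0) * norm (f z) < 2" unfolding norm_inverse by (simp add: field_simps)
   then have "norm (f z) \<le> 2 / norm (K 0)" using K0 by (simp add: field_simps)
   then have "norm (f z) * s0 \<le> 2 / norm (K 0) * s0" using s0 by (intro mult_right_mono) auto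
   then show "norm (f (complex_of_real (s0 * (1 - s)))) * norm (- complex_of_real s0) \<le> 2 * s0 / norm (K 0)"
    using s0 by (simp add: z_def)
   show "complex_of_real (s0 * (1 - s)) \<in> ball 0 \<delta> - {0}"
    using z s0 C1 unfolding z_def[symmetric] by auto
  qed auto
 qed
 \<comment> \<open>The two reflections compose to z -> -z, which preserves \<open>\<phi> 1\<close>
   and \<open>\<phi> 2\<close>.\<close>
 have even: "K (- z) = K z" if z: "z \<in> ball 0 \<delta>1" for z
 proof (cases "z = 0")
  case False
  have zr: "z \<in> ball 0 r - {0}" "cnj z \<in> ball 0 r - {0}" using z False C1(2) \<delta>(4) by auto
  have "\<phi> k (- z) = of_real (sgn1 k * sgn2 k) * \<phi> k z" for k
   using sym1[OF zr(2), of k] sym2[OF zr(1), of k] by simp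
  from this[of 1] this[of 2] have "f (- z) = f z" by (simp add: f_def null_f_def)
  then show ?thesis using K(2) z False by simp
 qed simp
 obtain C where C: "\<And>z. z \<in> ball 0 (\<delta>1/2) ==> norm (K z) \<le> C * (norm z)\<^sup>2"
  using even_holomorphic_quadratic_zero[OF C1(1) K(1) K0 even] by blast
 show ?thesis
 proof (rule result[OF e, of "\<delta>1/2" C])
  show "\<forall>z\<in>ball 0 (\<delta>1/2) - {0}. null_f \<epsilon> \<phi> z \<noteq> 0" using f0 C1 by (auto simp: f_def)
  show "\<forall>z\<in>ball 0 (\<delta>1/2) - {0}. norm (inverse (null_f \<epsilon> \<phi> z)) \<le> C * (norm z)\<^sup>2"
  proof
   fix z assume z: "z \<in> ball 0 (\<delta>1/2) - {0::complex}"
   then have "K z = inverse (null_f \<epsilon> \<phi> z)" using K(2) C1(1) by (simp add: f_def)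
   then show "norm (inverse (null_f \<epsilon> \<phi> z)) \<le> C * (norm z)\<^sup>2" using C[of z] z by simp
  qed
 qed (use C1 \<delta> g0 in auto)
qed

end

section \<open>Jacobi fields from holomorphic sections\<close>

text \<open>For \<open>\<phi> = X\<^sub>x - \<i> X\<^sub>y\<close> and a harmonic one-form \<open>Re (h dz)\<close>, \<open>jvar \<phi> h j\<close> is the \<open>j\<close>-th Euclidean coordinate
 of the dual tangent vector field.\<close>

definition jvar :: "(3 => complex => complex) => (complex => complex) => 3 => complex => real" where
 "jvar \<phi> h j z = Re (h z * (2 * cnj (\<phi> j z) * inverse (of_real (null_norm \<phi> z))))"

definition jac :: "(3 => complex => complex) => (complex => real) => complex => real" where
 "jac \<phi> u z = lap u z + null_curv \<phi> z * u z"

text \<open>\<open>jnormal\<close> is a complex multiple of the unit normal; it vanishes at the umbilics.\<close>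

definition jnormal :: "(3 => complex => complex) => 3 => complex => complex" where
 "jnormal \<phi> j z = cnj (deriv (\<phi> j) z) * of_real (null_norm \<phi> z) - cnj (\<phi> j z) * null_mixed \<phi> z"

text \<open>The covariant derivative of the form h dz: the subtracted term is h times the
  z-derivative of the logarithm of the conformal factor.\<close>

definition jcoeff :: "(3 => complex => complex) => (complex => complex) => complex => complex" where
 "jcoeff \<phi> h z = deriv h z - h z * cnj (null_mixed \<phi> z) * inverse (of_real (null_norm \<phi> z))"

lemma null_norm_complex: "of_real (null_norm \<phi> z) = (\<Sum>k\<in>UNIV. \<phi> k z * cnj (\<phi> k z))"
 by (simp add: null_norm_def of_real_norm_square)

lemma null_dnorm_complex: "of_real (null_dnorm \<phi> z) = (\<Sum>k\<in>UNIV. deriv (\<phi> k) z * cnj (deriv (\<phi> k) z))"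
 by (simp add: null_dnorm_def of_real_norm_square)

lemma null_curv_complex:
 "of_real (null_curv \<phi> z) = 4 * (of_real (null_dnorm \<phi> z) * of_real (null_norm \<phi> z) - null_mixed \<phi> z * cnj (null_mixed \<phi> z))
  * inverse (of_real (null_norm \<phi> z)) ^ 2"
 by (simp add: null_curv_def of_real_norm_square divide_inverse power_inverse)

section \<open>The Jacobi operator applied to the dual fields\<close>

context
 fixes U :: "complex set" and \<phi> :: "3 => complex => complex"
 assumes U: "open U" and hol: "\<And>k. \<phi> k holomorphic_on U"
  and D0: "\<And>z. z \<in> U ==> null_norm \<phi> z > 0"
begin

lemma phi_deriv: "z \<in> U ==> (\<phi> k has_field_derivative deriv (\<phi> k) z) (at z)"
 using hol U holomorphic_derivI by blast

lemma wirt_phi: "z \<in> U ==> wirt (\<phi> k) (deriv (\<phi> k) z) 0 z"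
 by (rule wirt_holomorphic[OF phi_deriv])

lemma wirt_dphi: "z \<in> U ==> wirt (deriv (\<phi> k)) (deriv (deriv (\<phi> k)) z) 0 z"
 using holomorphic_deriv[OF hol U] U holomorphic_derivI by (blast intro: wirt_holomorphic)

lemma smooth_on_null_norm: "smooth_on U (%z. complex_of_real (null_norm \<phi> z))"
 unfolding null_norm_complex by (intro smooth_intros U smooth_on_holomorphic hol)

lemma smooth_on_null_mixed: "smooth_on U (null_mixed \<phi>)"
 unfolding null_mixed_def[abs_def]
 by (intro smooth_intros U smooth_on_holomorphic hol holomorphic_deriv)

lemma smooth_on_null_curv: "smooth_on U (null_curv \<phi>)"
proof -
 have "smooth_on U (%z. complex_of_real (null_curv \<phi> z))"
  unfolding null_curv_complex null_dnorm_complex using D0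
  by (intro smooth_intros U smooth_on_holomorphic hol holomorphic_deriv smooth_on_null_mixed smooth_on_null_norm)
   (auto simp: less_imp_neq[symmetric])
 from smooth_on_Re[OF U this] show ?thesis by (rule smooth_on_cong[OF U, rotated]) simp
qed

lemma wirt_norm:
 "z \<in> U ==> wirt (%z. complex_of_real (null_norm \<phi> z)) (cnj (null_mixed \<phi> z)) (null_mixed \<phi> z) z"
proof -
 assume z: "z \<in> U"
 have "wirt (%z. \<Sum>k\<in>UNIV. \<phi> k z * cnj (\<phi> k z))
  (\<Sum>k\<in>UNIV. deriv (\<phi> k) z * cnj (\<phi> k z) + \<phi> k z * cnj 0) (\<Sum>k\<in>UNIV. 0 * cnj (\<phi> k z) + \<phi> k z * cnj (deriv (\<phi> k) z)) z"
  by (intro wirt_sum wirt_mult wirt_cnj wirt_phi z)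
 then show ?thesis by (simp add: null_norm_complex null_mixed_def mult.commute)
qed

lemma wirt_mixed:
 "z \<in> U ==> \<exists>B. wirt (null_mixed \<phi>) (of_real (null_dnorm \<phi> z)) B z"
proof -
 assume z: "z \<in> U"
 have "wirt (%z. \<Sum>k\<in>UNIV. \<phi> k z * cnj (deriv (\<phi> k) z))
  (\<Sum>k\<in>UNIV. deriv (\<phi> k) z * cnj (deriv (\<phi> k) z) + \<phi> k z * cnj 0)
  (\<Sum>k\<in>UNIV. 0 * cnj (deriv (\<phi> k) z) + \<phi> k z * cnj (deriv (deriv (\<phi> k)) z)) z"
  by (intro wirt_sum wirt_mult wirt_cnj wirt_phi wirt_dphi z)
 then show ?thesis by (auto simp: null_dnorm_complex null_mixed_def[abs_def])
qed

lemma smooth_on_jvar_complex: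
 "h holomorphic_on U ==> smooth_on U (%z. h z * (2 * cnj (\<phi> j z) * inverse (complex_of_real (null_norm \<phi> z))))"
 using D0 by (intro smooth_intros U smooth_on_holomorphic hol smooth_on_null_norm) (auto simp: less_imp_neq[symmetric])

lemma smooth_on_jvar: "h holomorphic_on U ==> smooth_on U (jvar \<phi> h j)"
 unfolding jvar_def[abs_def] by (intro smooth_on_Re U smooth_on_jvar_complex)

text \<open>For the complex field \<open>F\<close> the derivative with respect to cnj z is already
  proportional to the normal vector, because h is holomorphic. Differentiating it in z gives the
  Laplacian, in which the tangential part is cancelled by the curvature potential.\<close>

lemma jac_jvar:
 assumes h: "h holomorphic_on U" and z: "z \<in> U"
 shows "jac \<phi> (jvar \<phi> h j) z = Re (8 * jcoeff \<phi> h z * inverse (of_real (null_norm \<phi> z)) ^ 2 * jnormal \<phi> j z)"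
proof -
 define D where "D = (%z. complex_of_real (null_norm \<phi> z))"
 have Dn: "D z \<noteq> 0" if "z \<in> U" for z using D0[OF that] by (simp add: D_def)
 define S where "S = null_mixed \<phi>"
 define T where "T = complex_of_real (null_dnorm \<phi> z)"
 define F where "F = (%z. h z * (2 * cnj (\<phi> j z) * inverse (D z)))"
 define N where "N = (%z. cnj (deriv (\<phi> j) z) * D z - cnj (\<phi> j z) * S z)"
 have hd: "wirt h (deriv h z) 0 z" if "z \<in> U" for z
  using h U that holomorphic_derivI by (blast intro: wirt_holomorphic)
 have Dw: "wirt D (cnj (S z)) (S z) z" if "z \<in> U" for z using wirt_norm[OF that] by (simp add: D_def S_def)
 have Fw: "\<exists>A. wirt F A (2 * h z * N z * inverse (D z) ^ 2) z" if z: "z \<in> U" for z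
 proof -
  have "wirt F (deriv h z * (2 * cnj (\<phi> j z) * inverse (D z)) + h z * ((0 * cnj (\<phi> j z) + 2 * cnj 0) * inverse (D z)
    + (2 * cnj (\<phi> j z)) * (- cnj (S z) * inverse (D z) ^ 2)))
   (0 * (2 * cnj (\<phi> j z) * inverse (D z)) + h z * ((0 * cnj (\<phi> j z) + 2 * cnj (deriv (\<phi> j) z)) * inverse (D z)
    + (2 * cnj (\<phi> j z)) * (- S z * inverse (D z) ^ 2))) z"
   unfolding F_def by (intro wirt_mult hd wirt_const wirt_cnj wirt_phi wirt_inverse Dw z Dn)
  moreover have "0 * (2 * cnj (\<phi> j z) * inverse (D z)) + h z * ((0 * cnj (\<phi> j z) + 2 * cnj (deriv (\<phi> j) z)) * inverse (D z)
    + (2 * cnj (\<phi> j z)) * (- S z * inverse (D z) ^ 2)) = 2 * h z * N z * inverse (D z) ^ 2"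
   using Dn[OF z] by (simp add: N_def field_simps power2_eq_square)
  ultimately show ?thesis by metis
 qed
 then obtain A where A: "\<And>z. z \<in> U ==> wirt F (A z) (2 * h z * N z * inverse (D z) ^ 2) z" by metis
 obtain B where B: "wirt S T B z" using wirt_mixed[OF z] by (auto simp: S_def T_def)
 have Nw: "\<exists>B. wirt N (cnj (deriv (\<phi> j) z) * cnj (S z) - cnj (\<phi> j z) * T) B z"
 proof -
  have "\<exists>B. wirt N (cnj 0 * D z + cnj (deriv (\<phi> j) z) * cnj (S z) - (cnj 0 * S z + cnj (\<phi> j z) * T)) B z"
   unfolding N_def
   using wirt_diff[OF wirt_mult[OF wirt_cnj[OF wirt_dphi[OF z, of j]] Dw[OF z]] wirt_mult[OF wirt_cnj[OF wirt_phi[OF z, of j]] B]]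
   by (rule exI)
  then show ?thesis by simp
 qed
 then obtain B' where B': "wirt N (cnj (deriv (\<phi> j) z) * cnj (S z) - cnj (\<phi> j z) * T) B' z" ..
 define G1 where "G1 = (2 * deriv h z * N z + 2 * h z * (cnj (deriv (\<phi> j) z) * cnj (S z) - cnj (\<phi> j z) * T)) * inverse (D z) ^ 2
   - 4 * h z * N z * cnj (S z) * inverse (D z) ^ 3"
 have "\<exists>B. wirt (%z. 2 * h z * N z * inverse (D z) ^ 2) G1 B z"
 proof -
  have w1: "wirt (%z. 2 * h z * N z)
   ((0 * h z + 2 * deriv h z) * N z + (2 * h z) * (cnj (deriv (\<phi> j) z) * cnj (S z) - cnj (\<phi> j z) * T))
   ((0 * h z + 2 * 0) * N z + (2 * h z) * B') z"
   by (intro wirt_mult wirt_const hd z B')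
  have w2: "wirt (%z. inverse (D z) * inverse (D z))
   ((- cnj (S z) * inverse (D z) ^ 2) * inverse (D z) + inverse (D z) * (- cnj (S z) * inverse (D z) ^ 2))
   ((- S z * inverse (D z) ^ 2) * inverse (D z) + inverse (D z) * (- S z * inverse (D z) ^ 2)) z"
   by (intro wirt_mult wirt_inverse Dw z Dn)
  have "\<exists>B. wirt (%z. 2 * h z * N z * (inverse (D z) * inverse (D z)))
   (((0 * h z + 2 * deriv h z) * N z + (2 * h z) * (cnj (deriv (\<phi> j) z) * cnj (S z) - cnj (\<phi> j z) * T)) * (inverse (D z) * inverse (D z))
    + (2 * h z * N z) * ((- cnj (S z) * inverse (D z) ^ 2) * inverse (D z) + inverse (D z) * (- cnj (S z) * inverse (D z) ^ 2))) B z"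
   by (rule exI, rule wirt_mult[OF w1 w2])
  moreover have "((0 * h z + 2 * deriv h z) * N z + (2 * h z) * (cnj (deriv (\<phi> j) z) * cnj (S z) - cnj (\<phi> j z) * T)) * (inverse (D z) * inverse (D z))
    + (2 * h z * N z) * ((- cnj (S z) * inverse (D z) ^ 2) * inverse (D z) + inverse (D z) * (- cnj (S z) * inverse (D z) ^ 2)) = G1"
   by (simp add: G1_def power2_eq_square power3_eq_cube algebra_simps)
  ultimately show ?thesis by (simp only: power2_eq_square)
 qed
 then obtain B'' where B'': "wirt (%z. 2 * h z * N z * inverse (D z) ^ 2) G1 B'' z" ..
 have "smooth_on U F" unfolding F_def D_def by (rule smooth_on_jvar_complex[OF h])
 note lapF = lap_eq_wirt[OF U z this A B'']
 have lapRe: "lap (%z. Re (F z)) z = Re (lap F z)"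
 proof -
  have *: "pd v (pd w (%z. Re (F z))) z = Re (pd v (pd w F) z)" for v w
  proof -
   have "pd v (pd w (%z. Re (F z))) z = pd v (%z. Re (pd w F z)) z"
    using \<open>smooth_on U F\<close> by (intro pd_cong_open[OF U z] pd_linear bounded_linear_Re smooth_on_differentiable)
   also have "\<dots> = Re (pd v (pd w F) z)"
    using \<open>smooth_on U F\<close> z by (intro pd_linear bounded_linear_Re smooth_on_differentiable smooth_on_pd)
   finally show ?thesis .
  qed
  show ?thesis by (simp add: lap_def *)
 qed
 have "jac \<phi> (jvar \<phi> h j) z = Re (4 * G1) + null_curv \<phi> z * Re (F z)"
  unfolding jac_def using lapRe lapF by (simp add: jvar_def[abs_def] F_def D_def)
 also have "\<dots> = Re (4 * G1 + of_real (null_curv \<phi> z) * F z)" by simp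
 \<comment> \<open>The term with \<open>T\<close> in \<open>G1\<close> cancels against the one in
   \<open>null_curv\<close>; what remains is a multiple of \<open>N\<close>.\<close>
 also have "4 * G1 + of_real (null_curv \<phi> z) * F z = 8 * jcoeff \<phi> h z * inverse (D z) ^ 2 * jnormal \<phi> j z"
 proof -
  have n: "jnormal \<phi> j z = N z" by (simp add: jnormal_def N_def D_def S_def)
  have "4 * G1 + of_real (null_curv \<phi> z) * F z =
    8 * (deriv h z - h z * cnj (S z) * inverse (D z)) * inverse (D z) ^ 2 * N z"
   unfolding null_curv_complex F_def G1_def D_def[symmetric, THEN fun_cong, simplified] S_def[symmetric] T_def[symmetric]
   using Dn[OF z] unfolding D_def N_def S_def[symmetric]
   by (simp add: field_simps power2_eq_square power3_eq_cube)
  then show ?thesis unfolding n by (simp add: jcoeff_def D_def S_def)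
 qed
 finally show ?thesis by (simp add: D_def)
qed

text \<open>The dual field is tangential and its image under the Jacobi operator is normal. In
  coordinates, \<open>jnormal\<close> is orthogonal to \<open>\<phi>\<close> and to its conjugate by
  the null condition, its derivative and the definition of \<open>null_mixed\<close>.\<close>

lemma sum_jvar_jac:
 assumes h: "h holomorphic_on U" and z: "z \<in> U"
  and null: "\<forall>z\<in>U. (\<Sum>k\<in>UNIV. (\<phi> k z)\<^sup>2) = 0"
 shows "(\<Sum>j\<in>UNIV. jvar \<phi> h j z * jac \<phi> (jvar \<phi> h j) z) = 0"
proof -
 have n1: "(\<Sum>k\<in>UNIV. \<phi> k z * deriv (\<phi> k) z) = 0"
 proof -
  have "((%z. \<Sum>k\<in>UNIV. (\<phi> k z)\<^sup>2) has_field_derivative (\<Sum>k\<in>UNIV. 2 * (\<phi> k z * deriv (\<phi> k) z))) (at z)"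
   by (auto intro!: derivative_eq_intros phi_deriv z sum.cong)
  moreover have "((%z. \<Sum>k\<in>UNIV. (\<phi> k z)\<^sup>2) has_field_derivative 0) (at z)"
   by (rule has_field_derivative_transform_within_open[OF DERIV_const[of 0] U z]) (use null in auto)
  ultimately have "(\<Sum>k\<in>UNIV. 2 * (\<phi> k z * deriv (\<phi> k) z)) = 0" by (rule DERIV_unique)
  then show ?thesis by (simp add: sum_distrib_left[symmetric])
 qed
 have n0: "(\<Sum>k\<in>UNIV. (\<phi> k z)\<^sup>2) = 0" using null z by blast
 let ?D = "complex_of_real (null_norm \<phi> z)" and ?S = "null_mixed \<phi> z"
 have a1: "(\<Sum>j\<in>UNIV. cnj (\<phi> j z) * jnormal \<phi> j z) = 0"
 proof -
  have "(\<Sum>j\<in>UNIV. cnj (\<phi> j z) * jnormal \<phi> j z) =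
   cnj (\<Sum>k\<in>UNIV. \<phi> k z * deriv (\<phi> k) z) * ?D - cnj (\<Sum>k\<in>UNIV. (\<phi> k z)\<^sup>2) * ?S"
   by (simp add: jnormal_def sum_3 algebra_simps power2_eq_square)
  then show ?thesis by (simp add: n0 n1)
 qed
 have a2: "(\<Sum>j\<in>UNIV. \<phi> j z * jnormal \<phi> j z) = 0"
 proof -
  have "(\<Sum>j\<in>UNIV. \<phi> j z * jnormal \<phi> j z) =
   (\<Sum>k\<in>UNIV. \<phi> k z * cnj (deriv (\<phi> k) z)) * ?D - (\<Sum>k\<in>UNIV. \<phi> k z * cnj (\<phi> k z)) * ?S"
   by (simp add: jnormal_def sum_3 algebra_simps)
  then show ?thesis by (simp add: null_norm_complex null_mixed_def)
 qed
 define c where "c = 8 * jcoeff \<phi> h z * inverse ?D ^ 2"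
 define e where "e = h z * 2 * inverse ?D"
 have "(\<Sum>j\<in>UNIV. jvar \<phi> h j z * jac \<phi> (jvar \<phi> h j) z) = (\<Sum>j\<in>UNIV. Re (e * cnj (\<phi> j z)) * Re (c * jnormal \<phi> j z))"
  unfolding jac_jvar[OF h z] jvar_def c_def e_def by (simp add: mult_ac)
 also have "\<dots> = (\<Sum>j\<in>UNIV. Re (e * c * (cnj (\<phi> j z) * jnormal \<phi> j z) + cnj e * c * (\<phi> j z * jnormal \<phi> j z)) / 2)"
 proof (intro sum.cong refl)
  have r: "Re x * Re y = Re (x * y + cnj x * y) / 2" for x y :: complex by simp
  show "Re (e * cnj (\<phi> j z)) * Re (c * jnormal \<phi> j z) = Re (e * c * (cnj (\<phi> j z) * jnormal \<phi> j z) + cnj e * c * (\<phi> j z * jnormal \<phi> j z)) / 2" for j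
   unfolding r by (simp add: mult_ac)
 qed
 also have "\<dots> = Re (e * c * (\<Sum>j\<in>UNIV. cnj (\<phi> j z) * jnormal \<phi> j z) + cnj e * c * (\<Sum>j\<in>UNIV. \<phi> j z * jnormal \<phi> j z)) / 2"
  by (simp add: sum_3 distrib_left add_divide_distrib)
 finally show ?thesis unfolding a1 a2 by simp
qed

end

subsection \<open>Sections that only generate rotations\<close>

text \<open>\<open>q\<close> is a holomorphic vector field along the Gauss map \<open>g\<close>, and the hypothesis says that its real part has
 vanishing divergence for the round metric. Applying \<open>\<partial>/\<partial>z\<close> twice shows that \<open>q\<close> is a quadratic polynomial in
 \<open>g\<close>; the relations between the coefficients are those of a rotation field.\<close>

lemma killing_field_quadratic:
 assumes A: "open A" "connected A" "z0 \<in> A" and g: "g holomorphic_on A" and q: "q holomorphic_on A"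
  and g': "\<And>z. z \<in> A ==> deriv g z \<noteq> 0"
  and E: "\<And>z. z \<in> A ==> Re (cnj (deriv g z) * ((1 + g z * cnj (g z)) * deriv q z - 2 * q z * cnj (g z) * deriv g z)) = 0"
 obtains a b c where "\<And>z. z \<in> A ==> q z = c * (g z)\<^sup>2 / 2 + b * g z + a" "Re b = 0" "c = 2 * cnj a"
proof -
 define D where "D = (%z. deriv q z / deriv g z)"
 define k where "k = (%z. deriv D z / deriv g z)"
 have hol: "deriv g holomorphic_on A" "D holomorphic_on A" "deriv D holomorphic_on A" "k holomorphic_on A"
 proof -
  show 1: "deriv g holomorphic_on A" using g A(1) by (rule holomorphic_deriv)
  show 2: "D holomorphic_on A" unfolding D_def
   using g' by (intro holomorphic_on_divide 1 holomorphic_deriv q A(1)) auto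
  show 3: "deriv D holomorphic_on A" using 2 A(1) by (rule holomorphic_deriv)
  show "k holomorphic_on A" unfolding k_def using g' by (intro holomorphic_on_divide 1 3) auto
 qed
 have w: "wirt F (deriv F z) 0 z" if "F holomorphic_on A" "z \<in> A" for F z
  using that A(1) holomorphic_derivI by (blast intro: wirt_holomorphic)
 have q': "deriv q z = D z * deriv g z" if "z \<in> A" for z using g'[OF that] by (simp add: D_def)
 have D': "deriv D z = k z * deriv g z" if "z \<in> A" for z using g'[OF that] by (simp add: k_def)
 have zero: "P = 0" if "wirt F P Q z" "z \<in> A" "\<And>z. z \<in> A ==> F z = 0" for F P Q z
 proof -
  have "wirt F 0 0 z" by (rule wirt_cong_open[OF A(1) that(2) _ wirt_const[of 0]]) (use that in auto)
  then show ?thesis using wirt_unique that(1) by blast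
 qed
 have E1: "(1 + g z * cnj (g z)) * (D z + cnj (D z)) - 2 * (cnj (g z) * q z + g z * cnj (q z)) = 0" if z: "z \<in> A" for z
 proof -
  let ?P = "cnj (deriv g z) * ((1 + g z * cnj (g z)) * deriv q z - 2 * q z * cnj (g z) * deriv g z)"
  have "?P + cnj ?P = 0" using E[OF z] by (simp only: complex_add_cnj mult_zero_right of_real_0)
  moreover have "?P + cnj ?P = (deriv g z * cnj (deriv g z)) *
   ((1 + g z * cnj (g z)) * (D z + cnj (D z)) - 2 * (cnj (g z) * q z + g z * cnj (q z)))"
   unfolding q'[OF z] by (simp add: algebra_simps)
  ultimately show ?thesis using g'[OF z] by simp
 qed
 have E2: "cnj (g z) * (cnj (D z) - D z) + (1 + g z * cnj (g z)) * k z - 2 * cnj (q z) = 0" if z: "z \<in> A" for z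
 proof -
  have gw: "wirt g (deriv g z) 0 z" "wirt D (deriv D z) 0 z" "wirt q (deriv q z) 0 z" using w g q hol z by blast+
  note cw = wirt_cnj[OF gw(1)] wirt_cnj[OF gw(2)] wirt_cnj[OF gw(3)]
  note W = wirt_diff[OF wirt_mult[OF wirt_add[OF wirt_const[of 1] wirt_mult[OF gw(1) cw(1)]] wirt_add[OF gw(2) cw(2)]]
   wirt_mult[OF wirt_const[of 2] wirt_add[OF wirt_mult[OF cw(1) gw(3)] wirt_mult[OF gw(1) cw(3)]]]]
  from zero[OF W z E1] have "deriv g z * (cnj (g z) * (D z + cnj (D z)) + (1 + g z * cnj (g z)) * k z - 2 * cnj (g z) * D z - 2 * cnj (q z)) = 0"
   unfolding q'[OF z] D'[OF z] by (simp add: algebra_simps)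
  then have "cnj (g z) * (D z + cnj (D z)) + (1 + g z * cnj (g z)) * k z - 2 * cnj (g z) * D z - 2 * cnj (q z) = 0"
   using g'[OF z] by simp
  then show ?thesis by (simp add: algebra_simps)
 qed
 have k0: "deriv k z = 0" if z: "z \<in> A" for z
 proof -
  have gw: "wirt g (deriv g z) 0 z" "wirt D (deriv D z) 0 z" "wirt q (deriv q z) 0 z" "wirt k (deriv k z) 0 z"
   using w g q hol z by blast+
  note cw = wirt_cnj[OF gw(1)] wirt_cnj[OF gw(2)] wirt_cnj[OF gw(3)]
  note W = wirt_diff[OF wirt_add[OF wirt_mult[OF cw(1) wirt_diff[OF cw(2) gw(2)]]
   wirt_mult[OF wirt_add[OF wirt_const[of 1] wirt_mult[OF gw(1) cw(1)]] gw(4)]] wirt_mult[OF wirt_const[of 2] cw(3)]]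
  from zero[OF W z E2] have "(1 + g z * cnj (g z)) * deriv k z = 0"
   unfolding D'[OF z] by (simp add: algebra_simps)
  moreover have "1 + g z * cnj (g z) \<noteq> 0"
  proof
   assume "1 + g z * cnj (g z) = 0"
   then have "complex_of_real (1 + (norm (g z))\<^sup>2) = 0" by (simp add: of_real_norm_square)
   then have "1 + (norm (g z))\<^sup>2 = 0" using of_real_eq_0_iff by blast
   then show False using zero_le_power2[of "norm (g z)"] by linarith
  qed
  ultimately show ?thesis by simp
 qed
 have const: "\<exists>c. \<forall>z\<in>A. F z = c" if F: "F holomorphic_on A" "\<And>z. z \<in> A ==> deriv F z = 0" for F
 proof -
  have "F z = F z0" if z: "z \<in> A" for z
   by (rule DERIV_zero_connected_constant[OF A(2,1) finite.emptyI holomorphic_on_imp_continuous_on[OF F(1)]])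
    (use F A z holomorphic_derivI[OF F(1) A(1)] in auto)
  then show ?thesis by blast
 qed
 obtain c where c: "\<And>z. z \<in> A ==> k z = c" using const[OF hol(4) k0] by auto
 have d: "(F has_field_derivative deriv F z) (at z)" if "F holomorphic_on A" "z \<in> A" for F z
  using that A(1) holomorphic_derivI by blast
 have z1: "deriv (%z. D z - c * g z) z = 0" if z: "z \<in> A" for z
  by (intro DERIV_imp_deriv) (auto intro!: derivative_eq_intros d hol g z simp: D'[OF z] c[OF z])
 have "(%z. D z - c * g z) holomorphic_on A" by (intro holomorphic_intros hol g)
 from const[OF this z1] obtain b where b: "\<forall>z\<in>A. D z - c * g z = b" by blast
 then have Db: "D z = c * g z + b" if "z \<in> A" for z using that b by (metis add.commute diff_add_cancel)
 have z2: "deriv (%z. q z - c * (g z)\<^sup>2 / 2 - b * g z) z = 0" if z: "z \<in> A" for z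
  by (intro DERIV_imp_deriv) (auto intro!: derivative_eq_intros d q g z simp: q'[OF z] Db[OF z] algebra_simps)
 have "(%z. q z - c * (g z)\<^sup>2 / 2 - b * g z) holomorphic_on A" by (intro holomorphic_intros q g) auto
 from const[OF this z2] obtain a where a: "\<forall>z\<in>A. q z - c * (g z)\<^sup>2 / 2 - b * g z = a" by blast
 have qa: "q z = c * (g z)\<^sup>2 / 2 + b * g z + a" if "z \<in> A" for z
  using a that by (metis add.assoc add.commute diff_add_cancel)
 have rel: "c - 2 * cnj a - cnj (g z) * (b + cnj b) = 0" if z: "z \<in> A" for z
 proof -
  have "cnj (g z) * (cnj (c * g z + b) - (c * g z + b)) + (1 + g z * cnj (g z)) * c - 2 * cnj (c * (g z)\<^sup>2 / 2 + b * g z + a)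
   = c - 2 * cnj a - cnj (g z) * (b + cnj b)"
   by (simp add: algebra_simps power2_eq_square)
  with E2[OF z] show ?thesis unfolding Db[OF z] qa[OF z] c[OF z] by (simp only:)
 qed
 \<comment> \<open>The relation \<open>rel\<close> is affine in \<open>cnj (g z)\<close>; two
   distinct values of \<open>g\<close> force both coefficients to vanish.\<close>
 have "\<exists>z1\<in>A. g z1 \<noteq> g z0"
 proof (rule ccontr)
  assume "\<not> ?thesis"
  then have "(g has_field_derivative 0) (at z0)"
   by (intro has_field_derivative_transform_within_open[OF DERIV_const[of "g z0"] A(1,3)]) auto
  then show False using g'[OF A(3)] DERIV_imp_deriv by blast
 qed
 then obtain z1 where z1: "z1 \<in> A" "g z1 \<noteq> g z0" by blast
 have "(cnj (g z1) - cnj (g z0)) * (b + cnj b) = 0" using rel[OF z1(1)] rel[OF A(3)] by (simp add: algebra_simps)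
 then have b0: "b + cnj b = 0" using z1(2) by (simp add: complex_cnj_diff[symmetric] del: complex_cnj_diff)
 then have "Re b = 0" by (simp add: complex_eq_iff)
 moreover have "c = 2 * cnj a" using rel[OF A(3)] b0 by simp
 ultimately show ?thesis using that qa by blast
qed

text \<open>The coefficients are 2 Re G, 2 \<epsilon> Im G and |G|^2 - 1, that is, the unit normal
  by stereographic projection up to the factor 1 + |G|^2.\<close>

lemma jnormal_contraction:
 fixes F F' G G' :: complex and \<epsilon> :: complex
 assumes e: "\<epsilon> = 1 \<or> \<epsilon> = -1"
 shows "(G + cnj G) * cnj (F' * (1 - G\<^sup>2) / 2 - F * G * G') + (- \<epsilon> * \<i> * (G - cnj G)) * cnj (\<epsilon> * \<i> * (F' * (1 + G\<^sup>2) / 2 + F * G * G'))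
   + (G * cnj G - 1) * cnj (F' * G + F * G') = - cnj (F * G') * (1 + G * cnj G)"
  and "(G + cnj G) * cnj (F * (1 - G\<^sup>2) / 2) + (- \<epsilon> * \<i> * (G - cnj G)) * cnj (\<epsilon> * \<i> * F * (1 + G\<^sup>2) / 2)
   + (G * cnj G - 1) * cnj (F * G) = 0"
 using e by (auto simp: field_simps power2_eq_square)

text \<open>Contracting the equations \<open>J\<close> with the normal gives the divergence
  condition of \<open>killing_field_quadratic\<close> for q = h/f. As q and g tend to 0 at the
  puncture, the constant term vanishes, and with it the quadratic one. What is left is the rotation
  about the vertical axis, q = b g.\<close>

theorem jacobi_kernel:
 assumes e: "\<epsilon> = 1 \<or> \<epsilon> = -1" and \<delta>: "\<delta> > 0"
  and hol: "\<And>k. \<phi> k holomorphic_on ball 0 \<delta> - {0}"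
  and null: "\<forall>z\<in>ball 0 \<delta> - {0}. (\<Sum>k\<in>UNIV. (\<phi> k z)\<^sup>2) = 0"
  and f0: "\<forall>z\<in>ball 0 \<delta> - {0}. null_f \<epsilon> \<phi> z \<noteq> 0"
  and glim: "(null_g \<epsilon> \<phi> \<longlongrightarrow> 0) (at 0)" and gnz: "\<exists>z\<in>ball 0 \<delta> - {0}. null_g \<epsilon> \<phi> z \<noteq> 0"
  and h: "h holomorphic_on ball 0 \<delta> - {0}" and qlim: "((%z. h z / null_f \<epsilon> \<phi> z) \<longlongrightarrow> 0) (at 0)"
  and J: "\<And>z j. z \<in> ball 0 \<delta> - {0} ==> Re (jcoeff \<phi> h z * jnormal \<phi> j z) = 0"
 obtains b where "Re b = 0" "\<And>z. z \<in> ball 0 \<delta> - {0} ==> h z = b * \<phi> 3 z"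
proof -
 define B where "B = ball 0 \<delta> - {0::complex}"
 have B: "open B" "connected B" by (auto simp: B_def open_delete intro: connected_punctured_ball)
 note [folded B_def] = hol null f0 gnz h J
 note hol = hol[folded B_def] and null = null[folded B_def] and f0 = f0[folded B_def]
  and gnz = gnz[folded B_def] and h = h[folded B_def] and J = J[folded B_def]
 define f g q where "f = null_f \<epsilon> \<phi>" and "g = null_g \<epsilon> \<phi>" and "q = (%z. h z / f z)"
 obtain z1 where z1: "z1 \<in> B" "g z1 \<noteq> 0" using gnz by (auto simp: g_def)
 note c = null_chart[OF e B(1) _ hol null f0, folded f_def g_def]
 note n = null_chart_norm[OF e B(1) _ hol null f0, folded f_def g_def]
 have fh: "f holomorphic_on B" and gh: "g holomorphic_on B" using c(4,5) z1(1) by auto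
 have fz: "f z \<noteq> 0" if "z \<in> B" for z using f0 that by (simp add: f_def)
 have qh: "q holomorphic_on B" unfolding q_def using fz by (intro holomorphic_on_divide h fh)
 have hq: "h z = q z * f z" if "z \<in> B" for z using fz[OF that] by (simp add: q_def)
 have E: "Re (cnj (deriv g z) * ((1 + g z * cnj (g z)) * deriv q z - 2 * q z * cnj (g z) * deriv g z)) = 0" if z: "z \<in> B" for z
 proof -
  let ?G = "1 + g z * cnj (g z)"
  define n1 n2 n3 where "n1 = 2 * Re (g z)" and "n2 = 2 * Re \<epsilon> * Im (g z)" and "n3 = (norm (g z))\<^sup>2 - 1"
  have nc: "complex_of_real n1 = g z + cnj (g z)" "complex_of_real n2 = - \<epsilon> * \<i> * (g z - cnj (g z))"
   "complex_of_real n3 = g z * cnj (g z) - 1"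
   using e by (auto simp: n1_def n2_def n3_def of_real_norm_square complex_eq_iff)
  have sn: "of_real n1 * jnormal \<phi> 1 z + of_real n2 * jnormal \<phi> 2 z + of_real n3 * jnormal \<phi> 3 z =
   - cnj (f z * deriv g z) * ?G * of_real (null_norm \<phi> z)"
  proof -
   have "of_real n1 * jnormal \<phi> 1 z + of_real n2 * jnormal \<phi> 2 z + of_real n3 * jnormal \<phi> 3 z =
    (of_real n1 * cnj (deriv (\<phi> 1) z) + of_real n2 * cnj (deriv (\<phi> 2) z) + of_real n3 * cnj (deriv (\<phi> 3) z)) * of_real (null_norm \<phi> z)
    - (of_real n1 * cnj (\<phi> 1 z) + of_real n2 * cnj (\<phi> 2 z) + of_real n3 * cnj (\<phi> 3 z)) * null_mixed \<phi> z"
    by (simp add: jnormal_def algebra_simps)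
   also have "of_real n1 * cnj (deriv (\<phi> 1) z) + of_real n2 * cnj (deriv (\<phi> 2) z) + of_real n3 * cnj (deriv (\<phi> 3) z)
     = - cnj (f z * deriv g z) * ?G"
    unfolding nc c(6-8)[OF z] by (rule jnormal_contraction(1)[OF e])
   also have "of_real n1 * cnj (\<phi> 1 z) + of_real n2 * cnj (\<phi> 2 z) + of_real n3 * cnj (\<phi> 3 z) = 0"
    unfolding nc c(1-3)[OF z] by (rule jnormal_contraction(2)[OF e])
   finally show ?thesis by simp
  qed
  have jc: "jcoeff \<phi> h z * ?G = f z * (?G * deriv q z - 2 * q z * cnj (g z) * deriv g z)"
  proof -
   have "(h has_field_derivative deriv q z * f z + q z * deriv f z) (at z)"
    by (rule has_field_derivative_transform_within_open[of "%z. q z * f z", OF _ B(1) z])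
     (auto intro!: derivative_eq_intros holomorphic_derivI[OF qh B(1) z] holomorphic_derivI[OF fh B(1) z] simp: hq)
   then have dh: "deriv h z = deriv q z * f z + q z * deriv f z" by (rule DERIV_imp_deriv)
   have G0: "?G \<noteq> 0" "cnj ?G = ?G"
   proof -
    have "?G = complex_of_real (1 + (norm (g z))\<^sup>2)" by (simp add: of_real_norm_square)
    moreover have "1 + (norm (g z))\<^sup>2 \<noteq> 0" using zero_le_power2[of "norm (g z)"] by linarith
    ultimately show "?G \<noteq> 0" "cnj ?G = ?G" by (simp_all only: of_real_eq_0_iff complex_cnj_complex_of_real not_False_eq_True)
   qed
   have D: "complex_of_real (null_norm \<phi> z) = f z * cnj (f z) * ?G\<^sup>2 / 2"
    unfolding n(1)[OF z] by (simp add: of_real_norm_square)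
   have S: "cnj (null_mixed \<phi> z) = cnj (f z) * ?G * (deriv f z * ?G / 2 + f z * cnj (g z) * deriv g z)"
    unfolding n(2)[OF z] by (simp add: mult.commute[of "cnj (g z)" "g z"])
   have "cnj (null_mixed \<phi> z) * inverse (of_real (null_norm \<phi> z)) * ?G = deriv f z / f z * ?G + 2 * cnj (g z) * deriv g z"
    unfolding D S using fz[OF z] G0(1) by (simp add: divide_simps) (simp add: algebra_simps power2_eq_square)
   moreover have "jcoeff \<phi> h z * ?G = deriv h z * ?G - h z * (cnj (null_mixed \<phi> z) * inverse (of_real (null_norm \<phi> z)) * ?G)"
    by (simp add: jcoeff_def algebra_simps)
   ultimately have "jcoeff \<phi> h z * ?G = (deriv q z * f z + q z * deriv f z) * ?G
     - (q z * f z) * (deriv f z / f z * ?G + 2 * cnj (g z) * deriv g z)"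
    by (simp only: dh hq[OF z])
   also have "\<dots> = f z * (?G * deriv q z - 2 * q z * cnj (g z) * deriv g z)"
    using fz[OF z] by (simp add: field_simps)
   finally show ?thesis .
  qed
  have "Re (jcoeff \<phi> h z * (of_real n1 * jnormal \<phi> 1 z + of_real n2 * jnormal \<phi> 2 z + of_real n3 * jnormal \<phi> 3 z))
   = n1 * Re (jcoeff \<phi> h z * jnormal \<phi> 1 z) + n2 * Re (jcoeff \<phi> h z * jnormal \<phi> 2 z) + n3 * Re (jcoeff \<phi> h z * jnormal \<phi> 3 z)"
   by (simp add: algebra_simps)
  also have "\<dots> = 0" using J[OF z] by simp
  also have "jcoeff \<phi> h z * (of_real n1 * jnormal \<phi> 1 z + of_real n2 * jnormal \<phi> 2 z + of_real n3 * jnormal \<phi> 3 z)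
   = - (jcoeff \<phi> h z * ?G) * cnj (f z * deriv g z) * of_real (null_norm \<phi> z)"
   unfolding sn by simp
  also have "\<dots> = of_real (- null_norm \<phi> z * (norm (f z))\<^sup>2) *
   (cnj (deriv g z) * (?G * deriv q z - 2 * q z * cnj (g z) * deriv g z))"
   unfolding jc by (simp add: of_real_norm_square)
  finally have "- null_norm \<phi> z * (norm (f z))\<^sup>2 * Re (cnj (deriv g z) * (?G * deriv q z - 2 * q z * cnj (g z) * deriv g z)) = 0"
   by (simp only: Re_complex_of_real times_complex.sel complex_of_real_def) simp
  moreover have "null_norm \<phi> z \<noteq> 0"
   unfolding n(1)[OF z] using fz[OF z] add_pos_nonneg[OF zero_less_one zero_le_power2[of "norm (g z)"]] by simp
  ultimately show ?thesis using fz[OF z] by simp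
 qed
 have "\<exists>z2\<in>B. deriv g z2 \<noteq> 0"
 proof (rule ccontr)
  assume "\<not> ?thesis"
  then have "(g has_field_derivative 0) (at z)" if "z \<in> B" for z
   using holomorphic_derivI[OF gh B(1) that] that by auto
  then have "\<forall>z\<in>B - {}. (g has_field_derivative 0) (at z)" by blast
  from DERIV_zero_connected_constant[OF B(2,1) finite.emptyI holomorphic_on_imp_continuous_on[OF gh] this]
  obtain c where "\<And>z. z \<in> B ==> g z = c" by blast
  then have "g z = g z1" if "z \<in> B" for z using that z1(1) by simp
  then have "\<forall>\<^sub>F z in at 0. g z1 = g z"
   unfolding eventually_at using \<delta> by (intro exI[of _ \<delta>]) (auto simp: B_def dist_norm)
  then have "(g \<longlongrightarrow> g z1) (at 0)" by (rule Lim_transform_eventually[OF tendsto_const])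
  then have "g z1 = 0" by (rule tendsto_unique[OF at_neq_bot _ glim[folded g_def]])
  then show False using z1(2) by simp
 qed
 then obtain z2 where z2: "z2 \<in> B" "deriv g z2 \<noteq> 0" by blast
 have "open (B \<inter> deriv g -` (- {0}))"
  by (rule continuous_open_preimage[OF holomorphic_on_imp_continuous_on[OF holomorphic_deriv[OF gh B(1)]] B(1)]) auto
 moreover have "z2 \<in> B \<inter> deriv g -` (- {0})" using z2 by simp
 ultimately obtain s where s: "s > 0" "ball z2 s \<subseteq> B \<inter> deriv g -` (- {0})" using openE by blast
 have sB: "ball z2 s \<subseteq> B" using s(2) by blast
 obtain a b c where abc: "\<And>z. z \<in> ball z2 s ==> q z = c * (g z)\<^sup>2 / 2 + b * g z + a" "Re b = 0" "c = 2 * cnj a"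
 proof (rule killing_field_quadratic[of "ball z2 s" z2 g q])
  show "g holomorphic_on ball z2 s" "q holomorphic_on ball z2 s" using gh qh sB holomorphic_on_subset by blast+
  show "deriv g z \<noteq> 0" if "z \<in> ball z2 s" for z using s(2) that by blast
  show "Re (cnj (deriv g z) * ((1 + g z * cnj (g z)) * deriv q z - 2 * q z * cnj (g z) * deriv g z)) = 0"
   if "z \<in> ball z2 s" for z using E that sB by blast
 qed (use s(1) that in auto)
 have qB: "q z = c * (g z)\<^sup>2 / 2 + b * g z + a" if "z \<in> B" for z
  by (rule analytic_continuation_open[of "ball z2 s" B])
   (use s(1) sB B that qh gh abc(1) in \<open>auto intro!: holomorphic_intros\<close>)
 have "((%z. c * (g z)\<^sup>2 / 2 + b * g z + a) \<longlongrightarrow> c * 0\<^sup>2 / 2 + b * 0 + a) (at 0)"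
  using glim unfolding g_def by (intro tendsto_intros) auto
 moreover have "\<forall>\<^sub>F z in at 0. c * (g z)\<^sup>2 / 2 + b * g z + a = q z"
  unfolding eventually_at using \<delta> qB by (intro exI[of _ \<delta>]) (auto simp: B_def dist_norm)
 ultimately have "(q \<longlongrightarrow> c * 0\<^sup>2 / 2 + b * 0 + a) (at 0)" by (rule Lim_transform_eventually)
 moreover have "(q \<longlongrightarrow> 0) (at 0)" using qlim by (simp add: q_def f_def)
 ultimately have "c * 0\<^sup>2 / 2 + b * 0 + a = 0" by (rule tendsto_unique[OF at_neq_bot])
 then have "a = 0" by simp
 then have "q z = b * g z" if "z \<in> B" for z using qB[OF that] abc(3) by simp
 then have "h z = b * \<phi> 3 z" if "z \<in> B" for z using hq[OF that] c(3)[OF that] that by simp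
 then show ?thesis using that[of b] abc(2) by (simp add: B_def)
qed

section \<open>Elliptic functions as series of trigonometric functions\<close>

text \<open>\<open>T\<close> is a trigonometric function of period 1 that decays away from the real
  axis; summing its translates by multiples of i t yields an elliptic function. The untranslated
  term is kept apart, since the other terms are holomorphic in the central strip and the principal
  parts on the real axis are those of \<open>T\<close>.\<close>

locale strip_series =
 fixes t :: real and T :: "complex => complex" and A :: "complex set" and C :: real
 assumes t: "t > 0" and A: "open A" "\<And>z. Im z \<noteq> 0 ==> z \<in> A" and T: "T holomorphic_on A"
  and per: "\<And>z. z \<in> A \<longleftrightarrow> z + 1 \<in> A" "\<And>z. T (z + 1) = T z"
  and bound: "\<And>z. \<bar>Im z\<bar> \<ge> t ==> norm (T z) \<le> C * exp (- \<bar>Im z\<bar>)"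
begin

definition tail :: "complex => complex" where
 "tail z = (\<Sum>n. T (z - \<i> * of_real (t * real (Suc n))) + T (z + \<i> * of_real (t * real (Suc n))))"

definition total :: "complex => complex" where
 "total z = T z + tail z"

definition dom :: "complex set" where
 "dom = {z. \<forall>n::int. z - of_int n * (\<i> * of_real t) \<in> A}"

lemma C_nonneg: "C \<ge> 0"
 using order_trans[OF norm_ge_zero bound[of "\<i> * of_real t"]] t
 by (simp add: zero_le_mult_iff)

lemma tail_bound:
 assumes "\<bar>Im z\<bar> \<le> M" "t * real (Suc n) \<ge> M + t"
 shows "norm (T (z - \<i> * of_real (t * real (Suc n))) + T (z + \<i> * of_real (t * real (Suc n))))
  \<le> 2 * C * exp M * exp (- t) ^ Suc n"
proof -
 have *: "norm (T w) \<le> C * exp M * exp (- t) ^ Suc n" if "\<bar>Im w\<bar> \<ge> t * real (Suc n) - M" for w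
 proof -
  have "norm (T w) \<le> C * exp (- \<bar>Im w\<bar>)" using that assms by (intro bound) linarith
  also have "\<dots> \<le> C * exp (M - t * real (Suc n))" using that C_nonneg by (intro mult_left_mono) auto
  also have "exp (M - t * real (Suc n)) = exp M * exp (- t) ^ Suc n"
   unfolding exp_of_nat_mult[symmetric] by (simp add: exp_add[symmetric] mult.commute algebra_simps)
  finally show ?thesis by (simp add: mult.assoc)
 qed
 have "\<bar>Im (z - \<i> * of_real (t * real (Suc n)))\<bar> \<ge> t * real (Suc n) - M"
  "\<bar>Im (z + \<i> * of_real (t * real (Suc n)))\<bar> \<ge> t * real (Suc n) - M"
  using assms t by simp_all
 from *[OF this(1)] *[OF this(2)] show ?thesis
  using norm_triangle_ineq[of "T (z - \<i> * of_real (t * real (Suc n)))" "T (z + \<i> * of_real (t * real (Suc n)))"] by linarith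
qed

lemma tail_bound_eventually:
 "\<forall>\<^sub>F n in sequentially. \<forall>z\<in>{z. \<bar>Im z\<bar> \<le> M}. norm (T (z - \<i> * of_real (t * real (Suc n))) + T (z + \<i> * of_real (t * real (Suc n))))
  \<le> 2 * C * exp M * exp (- t) ^ Suc n"
proof -
 have "\<forall>\<^sub>F n in sequentially. t * real (Suc n) \<ge> M + t"
  using t by real_asymp
 then show ?thesis by eventually_elim (use tail_bound in auto)
qed

lemma summable_bound: "summable (%n. 2 * C * exp M * exp (- t) ^ Suc n)"
 using t by (intro summable_mult) (simp add: summable_geometric del: power_Suc add: summable_Suc_iff)

lemma summable_tail:
 "summable (%n. T (z - \<i> * of_real (t * real (Suc n))) + T (z + \<i> * of_real (t * real (Suc n))))"
 by (rule summable_comparison_test_ev[OF _ summable_bound[of "\<bar>Im z\<bar>"]])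
  (use tail_bound_eventually[of "\<bar>Im z\<bar>"] in \<open>auto elim: eventually_mono\<close>)

lemma uniform_tail:
 "uniform_limit {z. \<bar>Im z\<bar> \<le> M} (%N z. \<Sum>n<N. T (z - \<i> * of_real (t * real (Suc n))) + T (z + \<i> * of_real (t * real (Suc n)))) tail sequentially"
 unfolding tail_def[abs_def] by (rule Weierstrass_m_test_ev[OF tail_bound_eventually summable_bound])

lemma tail_holomorphic:
 assumes S: "open S" "\<And>z n. z \<in> S ==> z - \<i> * of_real (t * real (Suc n)) \<in> A \<and> z + \<i> * of_real (t * real (Suc n)) \<in> A"
 shows "tail holomorphic_on S"
proof (rule holomorphic_uniform_sequence[OF S(1)])
 show "(%z. \<Sum>n<N. T (z - \<i> * of_real (t * real (Suc n))) + T (z + \<i> * of_real (t * real (Suc n)))) holomorphic_on S" for N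
  using S(2) by (intro holomorphic_intros holomorphic_on_compose_gen[OF _ T, unfolded o_def]) auto
 fix z assume z: "z \<in> S"
 then obtain d where d: "d > 0" "cball z d \<subseteq> S" using S(1) open_contains_cball by blast
 have "\<bar>Im w\<bar> \<le> \<bar>Im z\<bar> + d" if "w \<in> cball z d" for w
  using abs_Im_le_cmod[of "w - z"] that by (auto simp: dist_norm norm_minus_commute)
 then have "cball z d \<subseteq> {w. \<bar>Im w\<bar> \<le> \<bar>Im z\<bar> + d}" by blast
 with d show "\<exists>d>0. cball z d \<subseteq> S \<and> uniform_limit (cball z d)
   (%N z. \<Sum>n<N. T (z - \<i> * of_real (t * real (Suc n))) + T (z + \<i> * of_real (t * real (Suc n)))) tail sequentially"
  using uniform_limit_on_subset[OF uniform_tail] by blast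
qed

lemma tail_holomorphic_strip: "tail holomorphic_on {z. \<bar>Im z\<bar> < t}"
proof (rule tail_holomorphic)
 show "open {z. \<bar>Im z\<bar> < t}" by (intro open_Collect_less continuous_intros)
 fix z n assume z: "z \<in> {z. \<bar>Im z\<bar> < t}"
 have "t * 1 \<le> t * real (Suc n)" using t by (intro mult_left_mono) auto
 then show "z - \<i> * of_real (t * real (Suc n)) \<in> A \<and> z + \<i> * of_real (t * real (Suc n)) \<in> A"
  using z by (auto intro!: A(2))
qed

lemma dom_sub: "z \<in> dom ==> z \<in> A" "z \<in> dom ==> z - \<i> * of_real (t * real (Suc n)) \<in> A"
 "z \<in> dom ==> z + \<i> * of_real (t * real (Suc n)) \<in> A"
proof -
 assume "z \<in> dom"
 then have *: "z - of_int n * (\<i> * of_real t) \<in> A" for n by (auto simp: dom_def)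
 show "z \<in> A" using *[of 0] by simp
 show "z - \<i> * of_real (t * real (Suc n)) \<in> A" using *[of "int (Suc n)"] by (simp add: algebra_simps)
 show "z + \<i> * of_real (t * real (Suc n)) \<in> A" using *[of "- int (Suc n)"] by (simp add: algebra_simps)
qed

lemma total_holomorphic:
 assumes "open S" "S \<subseteq> dom" shows "total holomorphic_on S"
 unfolding total_def[abs_def]
 by (intro holomorphic_on_add holomorphic_on_subset[OF T] tail_holomorphic assms(1)) (use assms(2) dom_sub in blast)+

lemma total_add_1: "total (z + 1) = total z"
proof -
 have "T (z + 1 - w) = T (z - w)" "T (z + 1 + w) = T (z + w)" for w
  using per(2)[of "z - w"] per(2)[of "z + w"] by (simp_all add: algebra_simps)
 then show ?thesis by (simp add: total_def tail_def per(2))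
qed

text \<open>For the symmetric partial sums a shift by i t telescopes: one term enters, one leaves,
  and both tend to 0.\<close>

lemma total_add_it: "total (z + \<i> * of_real t) = total z"
proof -
 define P where "P = (%N z. T z + (\<Sum>n<N. T (z - \<i> * of_real (t * real (Suc n))) + T (z + \<i> * of_real (t * real (Suc n)))))"
 have lim: "(%N. P N z) \<longlonglongrightarrow> total z" for z
  unfolding P_def total_def tail_def using summable_LIMSEQ[OF summable_tail[of z]] by (intro tendsto_intros)
 have diff: "P N (z + \<i> * of_real t) - P N z = T (z + \<i> * of_real (t * real (Suc N))) - T (z - \<i> * of_real (t * real N))" for N
 proof (induction N)
  case 0
  then show ?case by (simp add: P_def)
 next
  case (Suc N)
  have "P (Suc N) w = P N w + (T (w - \<i> * of_real (t * real (Suc N))) + T (w + \<i> * of_real (t * real (Suc N))))" for w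
   by (simp add: P_def)
  moreover have "z + \<i> * of_real t - \<i> * of_real (t * real (Suc N)) = z - \<i> * of_real (t * real N)"
   "z + \<i> * of_real t + \<i> * of_real (t * real (Suc N)) = z + \<i> * of_real (t * real (Suc (Suc N)))"
   by (simp_all add: algebra_simps)
  moreover have "(X + (D + E)) - (Y + (F + C)) = E - F" if "X - Y = C - D" for X Y C D E F :: complex
   using that by (simp add: algebra_simps)
  ultimately show ?case using Suc.IH by (simp only:)
 qed
 have T0: "(%N. T (z + \<i> * of_real (t * real N))) \<longlonglongrightarrow> 0" "(%N. T (z - \<i> * of_real (t * real N))) \<longlonglongrightarrow> 0"
 proof -
  have ev: "\<forall>\<^sub>F N in sequentially. t * real N \<ge> \<bar>Im z\<bar> + t" using t by real_asymp
  have l: "(%N::nat. C * exp (\<bar>Im z\<bar> - t * real N)) \<longlonglongrightarrow> 0" using t by real_asymp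
  have b: "norm (T w) \<le> C * exp (\<bar>Im z\<bar> - t * real N)"
   if "t * real N \<ge> \<bar>Im z\<bar> + t" "\<bar>Im w\<bar> \<ge> t * real N - \<bar>Im z\<bar>" for w N
  proof -
   have "norm (T w) \<le> C * exp (- \<bar>Im w\<bar>)" using that by (intro bound) linarith
   also have "\<dots> \<le> C * exp (\<bar>Im z\<bar> - t * real N)" using that C_nonneg by (intro mult_left_mono) auto
   finally show ?thesis .
  qed
  show "(%N. T (z + \<i> * of_real (t * real N))) \<longlonglongrightarrow> 0"
   by (rule tendsto_norm_zero_cancel, rule Lim_null_comparison[OF _ l])
    (use ev in eventually_elim, auto intro!: b)
  show "(%N. T (z - \<i> * of_real (t * real N))) \<longlonglongrightarrow> 0"
   by (rule tendsto_norm_zero_cancel, rule Lim_null_comparison[OF _ l])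
    (use ev in eventually_elim, auto intro!: b)
 qed
 have "(%N. P N (z + \<i> * of_real t) - P N z) \<longlonglongrightarrow> 0 - 0"
  unfolding diff by (intro tendsto_diff T0(2) LIMSEQ_Suc[OF T0(1)])
 moreover have "(%N. P N (z + \<i> * of_real t) - P N z) \<longlonglongrightarrow> total (z + \<i> * of_real t) - total z"
  by (intro tendsto_diff lim)
 ultimately have "total (z + \<i> * of_real t) - total z = 0 - 0" using LIMSEQ_unique by blast
 then show ?thesis by simp
qed

lemma total_lattice:
 assumes "l \<in> lattice t" shows "total (z + l) = total z"
proof -
 have 1: "total (z + of_int m) = total z" for m :: int and z
 proof (induction m rule: int_induct[where k = 0])
  case (step1 i)
  then show ?case using total_add_1[of "z + of_int i"] by (simp add: algebra_simps)
 next
  case (step2 i)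
  then show ?case using total_add_1[of "z + of_int (i - 1)"] by (simp add: algebra_simps)
 qed simp
 have 2: "total (z + of_int m * (\<i> * of_real t)) = total z" for m :: int and z
 proof (induction m rule: int_induct[where k = 0])
  case (step1 i)
  then show ?case using total_add_it[of "z + of_int i * (\<i> * of_real t)"] by (simp add: algebra_simps)
 next
  case (step2 i)
  then show ?case using total_add_it[of "z + of_int (i - 1) * (\<i> * of_real t)"] by (simp add: algebra_simps)
 qed simp
 obtain m n where "l = of_int m + of_int n * (\<i> * of_real t)" using assms by (auto simp: lattice_def)
 then show ?thesis using 1[of "z + of_int n * (\<i> * of_real t)" m] 2[of z n] by (simp add: algebra_simps)
qed

lemma total_minus:
 assumes "\<And>z. T (- z) = s * T z" shows "total (- z) = s * total z"
proof -
 have "T (- z - w) + T (- z + w) = s * (T (z - w) + T (z + w))" for w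
 proof -
  have "- z - w = - (z + w)" "- z + w = - (z - w)" by simp_all
  then show ?thesis by (simp only: assms distrib_left add.commute)
 qed
 then show ?thesis unfolding total_def tail_def
  using suminf_mult[OF summable_tail[of z], of s] assms by (simp add: distrib_left)
qed

lemma total_cnj:
 assumes "\<And>z. T (cnj z) = cnj (T z)" shows "total (cnj z) = cnj (total z)"
proof -
 define a where "a = (%n. T (z - \<i> * of_real (t * real (Suc n))) + T (z + \<i> * of_real (t * real (Suc n))))"
 have c: "T (cnj z - \<i> * of_real x) + T (cnj z + \<i> * of_real x) = cnj (T (z - \<i> * of_real x) + T (z + \<i> * of_real x))" for x :: real
 proof -
  have 1: "T (cnj z - \<i> * of_real x) = cnj (T (z + \<i> * of_real x))" using assms[of "z + \<i> * of_real x"] by simp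
  have 2: "T (cnj z + \<i> * of_real x) = cnj (T (z - \<i> * of_real x))" using assms[of "z - \<i> * of_real x"] by simp
  show ?thesis unfolding 1 2 by (simp only: complex_cnj_add add.commute)
 qed
 have "(%n. cnj (a n)) sums cnj (suminf a)"
  using summable_sums[OF summable_tail[of z]] unfolding a_def by (simp only: sums_cnj)
 then have "suminf (%n. cnj (a n)) = cnj (suminf a)" by (rule sums_unique[symmetric])
 then show ?thesis unfolding total_def tail_def c a_def assms by simp
qed

text \<open>In a bounded strip only finitely many translates can meet the complement of
  \<open>A\<close>, because \<open>A\<close> contains everything off the real axis.\<close>

lemma open_dom: "open dom"
proof -
 have *: "open (dom \<inter> {z. \<bar>Im z\<bar> < M})" for M
 proof -
  define K where "K = \<lceil>M / t\<rceil>"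
  have big: "z - of_int n * (\<i> * of_real t) \<in> A" if "\<bar>Im z\<bar> < M" "\<bar>n\<bar> > K" for z and n :: int
  proof (rule A(2))
   have "M / t \<le> of_int K" by (simp add: K_def)
   then have "M \<le> of_int K * t" using t by (simp add: field_simps)
   also have "\<dots> < \<bar>of_int n\<bar> * t"
    using that(2) t by (intro mult_strict_right_mono) (metis of_int_abs of_int_less_iff)
   also have "\<dots> = \<bar>of_int n * t\<bar>" using t by (simp add: abs_mult)
   finally show "Im (z - of_int n * (\<i> * of_real t)) \<noteq> 0" using that(1) by auto
  qed
  have "dom \<inter> {z. \<bar>Im z\<bar> < M} = {z. \<bar>Im z\<bar> < M} \<inter> (\<Inter>n\<in>{-K..K}. (%z. z - of_int n * (\<i> * of_real t)) -` A)"
   using big unfolding dom_def by (auto, meson abs_le_iff atLeastAtMost_iff minus_le_iff not_le)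
  moreover have "open {z. \<bar>Im z\<bar> < M}" by (intro open_Collect_less continuous_intros)
  moreover have "open (\<Inter>n\<in>{-K..K}. (%z. z - of_int n * (\<i> * of_real t)) -` A)"
   by (intro open_INT finite_atLeastAtMost_int ballI open_vimage A(1) continuous_intros)
  ultimately show ?thesis by (simp only: open_Int)
 qed
 have "dom = (\<Union>M. dom \<inter> {z. \<bar>Im z\<bar> < M})" by (auto intro: less_add_one)
 then show ?thesis using * by (metis open_UN)
qed

end

text \<open>Pole order at most \<open>k\<close>, expressed by growth and insensitive to the value of
  \<open>F\<close> at \<open>a\<close>; order 0 means boundedness near \<open>a\<close>.\<close>

definition order_at :: "(complex => complex) => complex => nat => bool" where
 "order_at F a k \<longleftrightarrow> (\<exists>C \<delta>. \<delta> > 0 \<and> (\<forall>w\<in>ball 0 \<delta> - {0}. norm (F (a + w)) * norm w ^ k \<le> C))"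

lemma order_at_isCont:
 assumes "isCont F a" shows "order_at F a k"
proof -
 obtain \<delta> where \<delta>: "\<delta> > 0" "\<And>z. dist z a < \<delta> ==> dist (F z) (F a) < 1"
  using assms unfolding continuous_at_eps_delta by (metis zero_less_one)
 have "norm (F (a + w)) * norm w ^ k \<le> (norm (F a) + 1) * 1" if "w \<in> ball 0 (min \<delta> 1) - {0}" for w
 proof (intro mult_mono)
  have "dist (F (a + w)) (F a) < 1" using that by (intro \<delta>(2)) (simp add: dist_norm)
  then show "norm (F (a + w)) \<le> norm (F a) + 1" using norm_triangle_ineq2[of "F (a + w)" "F a"] by (simp add: dist_norm)
  show "norm w ^ k \<le> 1" using that by (simp add: power_le_one)
 qed auto
 then show ?thesis unfolding order_at_def using \<delta>(1) by (intro exI[of _ "norm (F a) + 1"] exI[of _ "min \<delta> 1"]) auto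
qed

lemma order_at_mono:
 assumes "order_at F a k" "k \<le> l" shows "order_at F a l"
proof -
 obtain C \<delta> where \<delta>: "\<delta> > 0" "\<And>w. w \<in> ball 0 \<delta> - {0} ==> norm (F (a + w)) * norm w ^ k \<le> C"
  using assms(1) unfolding order_at_def by blast
 have "norm (F (a + w)) * norm w ^ l \<le> C" if "w \<in> ball 0 (min \<delta> 1) - {0}" for w
 proof -
  have "norm w ^ l \<le> norm w ^ k" using that assms(2) by (intro power_decreasing) auto
  then have "norm (F (a + w)) * norm w ^ l \<le> norm (F (a + w)) * norm w ^ k" by (intro mult_left_mono) auto
  also have "\<dots> \<le> C" using that by (intro \<delta>(2)) auto
  finally show ?thesis .
 qed
 then show ?thesis unfolding order_at_def using \<delta>(1) by (intro exI[of _ C] exI[of _ "min \<delta> 1"]) auto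
qed

lemma order_at_add:
 assumes "order_at F a k" "order_at G a k" shows "order_at (%z. F z + G z) a k"
proof -
 obtain C \<delta> where \<delta>: "\<delta> > 0" "\<And>w. w \<in> ball 0 \<delta> - {0} ==> norm (F (a + w)) * norm w ^ k \<le> C"
  using assms(1) unfolding order_at_def by blast
 obtain C' \<delta>' where \<delta>': "\<delta>' > 0" "\<And>w. w \<in> ball 0 \<delta>' - {0} ==> norm (G (a + w)) * norm w ^ k \<le> C'"
  using assms(2) unfolding order_at_def by blast
 have "norm (F (a + w) + G (a + w)) * norm w ^ k \<le> C + C'" if "w \<in> ball 0 (min \<delta> \<delta>') - {0}" for w
 proof -
  have "norm (F (a + w) + G (a + w)) * norm w ^ k \<le> (norm (F (a + w)) + norm (G (a + w))) * norm w ^ k"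
   by (intro mult_right_mono norm_triangle_ineq) auto
  also have "\<dots> \<le> C + C'" using \<delta>(2)[of w] \<delta>'(2)[of w] that by (simp add: distrib_right)
  finally show ?thesis .
 qed
 then show ?thesis unfolding order_at_def using \<delta>(1) \<delta>'(1) by (intro exI[of _ "C + C'"] exI[of _ "min \<delta> \<delta>'"]) auto
qed

lemma order_at_cmult:
 assumes "order_at F a k" shows "order_at (%z. c * F z) a k"
proof -
 obtain C \<delta> where \<delta>: "\<delta> > 0" "\<And>w. w \<in> ball 0 \<delta> - {0} ==> norm (F (a + w)) * norm w ^ k \<le> C"
  using assms unfolding order_at_def by blast
 have "norm (c * F (a + w)) * norm w ^ k \<le> norm c * C" if "w \<in> ball 0 \<delta> - {0}" for w
  using mult_left_mono[OF \<delta>(2)[OF that], of "norm c"] by (simp add: norm_mult mult.assoc)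
 then show ?thesis unfolding order_at_def using \<delta>(1) by blast
qed

text \<open>|sin w| is at least sinh |Im w|, and for |Im w| \<ge> d this is at least
  \<open>(1 - exp (- 2 * d)) / 2\<close> times exp |Im w|.\<close>

lemma norm_inverse_sin_le:
 fixes w :: complex
 assumes "d > 0" "\<bar>Im w\<bar> \<ge> d"
 shows "norm (inverse (sin w)) \<le> 2 / (1 - exp (- 2 * d)) * exp (- \<bar>Im w\<bar>)" "sin w \<noteq> 0"
proof -
 define y where "y = \<bar>Im w\<bar>"
 have k: "1 - exp (- 2 * d) > 0" using assms by simp
 have "(norm (sin w))\<^sup>2 \<ge> ((exp y - exp (- y)) / 2)\<^sup>2"
 proof -
  have "exp (2 * Im w) + inverse (exp (2 * Im w)) = exp (2 * y) + exp (- 2 * y)"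
   by (cases "Im w \<ge> 0") (simp_all add: y_def exp_minus)
  then have "(norm (sin w))\<^sup>2 = (exp (2 * y) + exp (- 2 * y) - 2 * cos (2 * Re w)) / 4"
   unfolding norm_sin_squared by simp
  also have "\<dots> \<ge> (exp (2 * y) + exp (- 2 * y) - 2 * 1) / 4"
   by (intro divide_right_mono diff_left_mono mult_left_mono) auto
  also have "(exp (2 * y) + exp (- 2 * y) - 2 * 1) / 4 = ((exp y - exp (- y)) / 2)\<^sup>2"
   by (simp add: power2_eq_square algebra_simps exp_add[symmetric] mult_exp_exp)
  finally show ?thesis .
 qed
 moreover have y: "exp y - exp (- y) \<ge> exp y * (1 - exp (- 2 * d))" "y \<ge> d"
 proof -
  show "y \<ge> d" using assms by (simp add: y_def)
  have "exp (- y) \<le> exp (y + - 2 * d)" using \<open>y \<ge> d\<close> by simp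
  then show "exp y - exp (- y) \<ge> exp y * (1 - exp (- 2 * d))" unfolding exp_add by (simp add: algebra_simps)
 qed
 have pos: "exp y * (1 - exp (- 2 * d)) > 0" using k by simp
 ultimately have ge: "norm (sin w) \<ge> (exp y - exp (- y)) / 2"
  by (metis power2_le_imp_le norm_ge_zero)
 have "exp y * (1 - exp (- 2 * d)) / 2 \<le> (exp y - exp (- y)) / 2" by (rule divide_right_mono[OF y(1)]) simp
 then have ge': "norm (sin w) \<ge> exp y * (1 - exp (- 2 * d)) / 2" using ge by (rule order_trans)
 then show "sin w \<noteq> 0" using pos by auto
 have "norm (inverse (sin w)) \<le> inverse (exp y * (1 - exp (- 2 * d)) / 2)"
  unfolding norm_inverse using pos by (intro le_imp_inverse_le ge') auto
 then show "norm (inverse (sin w)) \<le> 2 / (1 - exp (- 2 * d)) * exp (- \<bar>Im w\<bar>)"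
  by (simp add: y_def exp_minus field_simps)
qed

lemma order_at_tendsto:
 assumes "((%w. F (a + w) * w ^ k) \<longlongrightarrow> L) (at 0)"
 shows "order_at F a k"
proof -
 have "((%w. norm (F (a + w) * w ^ k)) \<longlongrightarrow> norm L) (at 0)" using assms by (rule tendsto_norm)
 then have "\<forall>\<^sub>F w in at 0. norm (F (a + w) * w ^ k) < norm L + 1" by (rule order_tendstoD) simp
 then obtain \<delta> where \<delta>: "\<delta> > 0" "\<And>w. w \<noteq> 0 ==> dist w 0 < \<delta> ==> norm (F (a + w) * w ^ k) < norm L + 1"
  unfolding eventually_at by auto
 have "norm (F (a + w)) * norm w ^ k \<le> norm L + 1" if "w \<in> ball 0 \<delta> - {0}" for w
  using \<delta>(2)[of w] that by (simp add: norm_mult norm_power)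
 then show ?thesis unfolding order_at_def using \<delta>(1) by blast
qed

lemma not_order_at_tendsto:
 assumes L: "((%w. F (a + w) * w ^ k) \<longlongrightarrow> L) (at 0)" "L \<noteq> 0" "k > 0"
 shows "\<not> order_at F a 0"
proof
 assume "order_at F a 0"
 then obtain C \<delta> where \<delta>: "\<delta> > 0" "\<And>w. w \<in> ball 0 \<delta> - {0} ==> norm (F (a + w)) \<le> C"
  unfolding order_at_def power_0 mult_1_right by blast
 have "((%w. F (a + w) * w ^ k) \<longlongrightarrow> 0) (at 0)"
 proof (rule tendsto_norm_zero_cancel, rule Lim_null_comparison)
  show "\<forall>\<^sub>F w in at 0. norm (norm (F (a + w) * w ^ k)) \<le> C * norm (w ^ k)"
   unfolding eventually_at
  proof (intro exI[of _ \<delta>] conjI ballI impI)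
   fix w :: complex assume "w \<noteq> 0 \<and> dist w 0 < \<delta>"
   then have "norm (F (a + w)) \<le> C" by (intro \<delta>(2)) simp
   then show "norm (norm (F (a + w) * w ^ k)) \<le> C * norm (w ^ k)" by (simp add: norm_mult mult_right_mono)
  qed (rule \<delta>(1))
  have "((%w::complex. C * norm (w ^ k)) \<longlongrightarrow> C * norm ((0::complex) ^ k)) (at 0)" by (intro tendsto_intros)
  then show "((%w::complex. C * norm (w ^ k)) \<longlongrightarrow> 0) (at 0)" using L(3) by (simp add: zero_power)
 qed
 then show False using L(2) tendsto_unique[OF at_neq_bot L(1)] by blast
qed

lemma inverse_sin_limit:
 assumes "c \<noteq> (0::complex)"
 shows "((%w. inverse (sin (c * w)) * w) \<longlongrightarrow> inverse c) (at 0)"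
proof -
 have "((%w. sin (c * w)) has_field_derivative cos (c * 0) * c) (at 0)"
  by (auto intro!: derivative_eq_intros)
 then have "((%w. (sin (c * (0 + w)) - sin (c * 0)) / w) \<longlongrightarrow> c) (at 0)" unfolding DERIV_def by simp
 then have "((%w. inverse (sin (c * w) / w)) \<longlongrightarrow> inverse c) (at 0)"
  using assms by (intro tendsto_inverse) auto
 then show ?thesis by (simp add: field_simps)
qed

text \<open>The tail is continuous at real points and does not contribute to the principal
  part.\<close>

lemma (in strip_series) total_limit:
 assumes "((%w. T (a + w) * w ^ k) \<longlongrightarrow> L) (at 0)" "Im a = 0" "k > 0"
 shows "((%w. total (a + w) * w ^ k) \<longlongrightarrow> L) (at 0)"
proof -
 have "isCont tail a"
  using holomorphic_on_imp_continuous_on[OF tail_holomorphic_strip] assms(2) t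
  by (subst (asm) continuous_on_eq_continuous_at) (auto intro!: open_Collect_less continuous_intros)
 then have "((%w. tail (a + w)) \<longlongrightarrow> tail a) (at 0)" by (simp add: isCont_iff)
 then have "((%w. T (a + w) * w ^ k + tail (a + w) * w ^ k) \<longlongrightarrow> L + tail a * 0 ^ k) (at 0)"
  by (intro tendsto_intros assms(1))
 then show ?thesis using assms(3) by (simp add: total_def distrib_right zero_power)
qed

lemma sin_multiple_eq_0: "sin (of_real (pi * c) * z) = 0 \<longleftrightarrow> (\<exists>n::int. of_real c * z = of_int n)" for z :: complex
proof -
 have "sin (of_real (pi * c) * z) = 0 \<longleftrightarrow> (\<exists>n::int. of_real (pi * c) * z = of_real (of_int n * pi))"
  by (simp add: Complex_Transcendental.sin_eq_0)
 also have "\<dots> \<longleftrightarrow> (\<exists>n::int. of_real c * z = of_int n)"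
 proof (intro ex_cong1)
  fix n :: int
  have "of_real (pi * c) * z = of_real (of_int n * pi) \<longleftrightarrow> of_real pi * (of_real c * z) = of_real pi * of_int n"
   by (simp add: mult.assoc mult.commute)
  also have "\<dots> \<longleftrightarrow> of_real c * z = of_int n" by simp
  finally show "of_real (pi * c) * z = of_real (of_int n * pi) \<longleftrightarrow> of_real c * z = of_int n" .
 qed
 finally show ?thesis .
qed

section \<open>Two explicit elliptic functions\<close>

lemma lattice_minus:
 assumes "l \<in> lattice t" shows "- l \<in> lattice t"
proof -
 obtain m n where "l = of_int m + of_int n * (\<i> * of_real t)" using assms by (auto simp: lattice_def)
 then have "- l = of_int (- m) + of_int (- n) * (\<i> * of_real t)" by simp
 then show ?thesis unfolding lattice_def by blast
qed

text \<open>The sum of 1/sin^2(pi z) over the translates by multiples of i t; up to a factor and an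
  additive constant it is the Weierstrass function of the lattice.\<close>

lemma elliptic_double_pole:
 assumes t: "t > 0"
 obtains P where "P holomorphic_on - lattice t" "open (- lattice t)"
  "\<And>z l. l \<in> lattice t ==> P (z + l) = P z" "\<And>z. P (- z) = P z" "\<And>z. P (cnj z) = cnj (P z)"
  "order_at P 0 2" "\<not> order_at P 0 0"
proof -
 define T where "T = (%z. inverse (sin (of_real (pi * 1) * z)) ^ 2 :: complex)"
 define A where "A = {z. sin (of_real (pi * 1) * z) \<noteq> (0::complex)}"
 define C where "C = (2 / (1 - exp (- 2 * (pi * t))))\<^sup>2"
 have per: "sin (of_real (pi * 1) * (z + 1)) = - sin (of_real (pi * 1) * z)" for z :: complex
  by (simp add: distrib_left sin_add)
 interpret strip_series t T A C
 proof
  show "open A" unfolding A_def by (intro open_Collect_neq continuous_intros)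
  show "T holomorphic_on A" unfolding T_def A_def by (intro holomorphic_intros) auto
  show "z \<in> A \<longleftrightarrow> z + 1 \<in> A" for z unfolding A_def mem_Collect_eq per by simp
  show "T (z + 1) = T z" for z unfolding T_def per by simp
  show "z \<in> A" if "Im z \<noteq> 0" for z
   using norm_inverse_sin_le(2)[of "pi * \<bar>Im z\<bar>" "of_real (pi * 1) * z"] that by (simp add: A_def abs_mult)
  show "norm (T z) \<le> C * exp (- \<bar>Im z\<bar>)" if z: "t \<le> \<bar>Im z\<bar>" for z
  proof -
   have "norm (inverse (sin (of_real (pi * 1) * z))) \<le> 2 / (1 - exp (- 2 * (pi * t))) * exp (- \<bar>Im (of_real (pi * 1) * z)\<bar>)"
    using z t by (intro norm_inverse_sin_le(1)) (auto simp: abs_mult)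
   then have "norm (T z) \<le> (2 / (1 - exp (- 2 * (pi * t))) * exp (- \<bar>Im (of_real (pi * 1) * z)\<bar>))\<^sup>2"
    unfolding T_def norm_power by (intro power_mono) auto
   also have "\<dots> = C * exp (- (2 * pi * \<bar>Im z\<bar>))"
    by (simp add: C_def power_mult_distrib power_divide abs_mult exp_double[symmetric] mult_ac)
   also have "\<dots> \<le> C * exp (- \<bar>Im z\<bar>)"
   proof (intro mult_left_mono)
    have "1 * \<bar>Im z\<bar> \<le> 2 * pi * \<bar>Im z\<bar>" using pi_gt3 by (intro mult_right_mono) auto
    then show "exp (- (2 * pi * \<bar>Im z\<bar>)) \<le> exp (- \<bar>Im z\<bar>)" by simp
   qed (simp add: C_def)
   finally show ?thesis .
  qed
 qed (fact t)
 have dom: "dom = - lattice t"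
 proof -
  have "z \<notin> dom \<longleftrightarrow> z \<in> lattice t" for z
  proof -
   have A: "w \<in> A \<longleftrightarrow> \<not> (\<exists>m. of_real 1 * w = of_int m)" for w
    unfolding A_def mem_Collect_eq sin_multiple_eq_0 ..
   have "z \<notin> dom \<longleftrightarrow> (\<exists>n m. of_real 1 * (z - of_int n * (\<i> * of_real t)) = of_int m)"
    unfolding dom_def mem_Collect_eq A by blast
   also have "\<dots> \<longleftrightarrow> z \<in> lattice t"
    unfolding lattice_def by (auto simp: algebra_simps)
   finally show ?thesis .
  qed
  then show ?thesis by blast
 qed
 have lim: "((%w. T (0 + w) * w ^ 2) \<longlongrightarrow> inverse (of_real (pi * 1)) ^ 2) (at 0)"
  using tendsto_power[OF inverse_sin_limit[of "of_real (pi * 1)"], of 2] by (simp add: T_def power_mult_distrib)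
 show ?thesis
 proof (rule that[of total])
  show "total holomorphic_on - lattice t" using total_holomorphic[OF open_dom order_refl] by (simp add: dom)
  show "open (- lattice t)" using open_dom by (simp add: dom)
  show "total (- z) = total z" for z using total_minus[of 1 z] by (simp add: T_def)
  show "total (cnj z) = cnj (total z)" for z
  proof (rule total_cnj)
   show "T (cnj z) = cnj (T z)" for z by (simp add: T_def cnj_sin)
  qed
  show "order_at total 0 2" using total_limit[OF lim] by (intro order_at_tendsto) auto
  show "\<not> order_at total 0 0" by (rule not_order_at_tendsto[OF total_limit[OF lim]]) auto
 qed (rule total_lattice)
qed

text \<open>The sum of 1/sin(2 pi z) over the translates by multiples of i t. The half period 1/2
  reverses the sign of a term, which gives opposite residues at 0 and 1/2.\<close>

lemma elliptic_simple_poles: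
 assumes t: "t > 0"
 obtains Z where "Z holomorphic_on {z. z \<notin> lattice t \<and> z - 1/2 \<notin> lattice t}" "open {z. z \<notin> lattice t \<and> z - 1/2 \<notin> lattice t}"
  "\<And>z l. l \<in> lattice t ==> Z (z + l) = Z z" "\<And>z. Z (- z) = - Z z" "\<And>z. Z (cnj z) = cnj (Z z)"
  "order_at Z 0 1" "order_at Z (1/2) 1" "\<not> order_at Z 0 0" "\<not> order_at Z (1/2) 0"
proof -
 define T where "T = (%z. inverse (sin (of_real (pi * 2) * z)) :: complex)"
 define A where "A = {z. sin (of_real (pi * 2) * z) \<noteq> (0::complex)}"
 define C where "C = 2 / (1 - exp (- 2 * (2 * pi * t)))"
 have cs: "cos (2 * of_real pi) = (1::complex)" "sin (2 * of_real pi) = (0::complex)"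
  using cos_of_real[of "2 * pi", where ?'a = complex] sin_of_real[of "2 * pi", where ?'a = complex] by auto
 have per: "sin (of_real (pi * 2) * (z + 1)) = sin (of_real (pi * 2) * z)" for z :: complex
 proof -
  have "of_real (pi * 2) * (z + 1) = of_real (pi * 2) * z + 2 * of_real pi" by (simp add: algebra_simps)
  then show ?thesis using cs
   by (simp only: sin_add) simp
 qed
 interpret strip_series t T A C
 proof
  show "open A" unfolding A_def by (intro open_Collect_neq continuous_intros)
  show "T holomorphic_on A" unfolding T_def A_def by (intro holomorphic_intros) auto
  show "z \<in> A \<longleftrightarrow> z + 1 \<in> A" for z unfolding A_def mem_Collect_eq per by simp
  show "T (z + 1) = T z" for z unfolding T_def per by simp
  show "z \<in> A" if "Im z \<noteq> 0" for z
   using norm_inverse_sin_le(2)[of "pi * 2 * \<bar>Im z\<bar>" "of_real (pi * 2) * z"] that by (simp add: A_def abs_mult)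
  show "norm (T z) \<le> C * exp (- \<bar>Im z\<bar>)" if z: "t \<le> \<bar>Im z\<bar>" for z
  proof -
   have "norm (T z) \<le> C * exp (- \<bar>Im (of_real (pi * 2) * z)\<bar>)"
    unfolding T_def C_def using z t by (intro norm_inverse_sin_le(1)) (auto simp: abs_mult)
   also have "\<dots> \<le> C * exp (- \<bar>Im z\<bar>)"
   proof (intro mult_left_mono)
    have "1 * \<bar>Im z\<bar> \<le> 2 * pi * \<bar>Im z\<bar>" using pi_gt3 by (intro mult_right_mono) auto
    then show "exp (- \<bar>Im (of_real (pi * 2) * z)\<bar>) \<le> exp (- \<bar>Im z\<bar>)" by (simp add: abs_mult mult_ac)
   qed (use t in \<open>simp add: C_def\<close>)
   finally show ?thesis .
  qed
 qed (fact t)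
 have dom: "dom = {z. z \<notin> lattice t \<and> z - 1/2 \<notin> lattice t}"
 proof -
  have "z \<notin> dom \<longleftrightarrow> z \<in> lattice t \<or> z - 1/2 \<in> lattice t" for z
  proof -
   have A: "w \<in> A \<longleftrightarrow> \<not> (\<exists>m. of_real 2 * w = of_int m)" for w
    unfolding A_def mem_Collect_eq sin_multiple_eq_0 ..
   have "z \<notin> dom \<longleftrightarrow> (\<exists>n m. of_real 2 * (z - of_int n * (\<i> * of_real t)) = of_int m)"
    unfolding dom_def mem_Collect_eq A by blast
   also have "\<dots> \<longleftrightarrow> z \<in> lattice t \<or> z - 1/2 \<in> lattice t"
   proof
    assume "\<exists>n m. of_real 2 * (z - of_int n * (\<i> * of_real t)) = of_int m"
    then obtain n m where nm: "2 * (z - of_int n * (\<i> * of_real t)) = of_int m" by auto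
    show "z \<in> lattice t \<or> z - 1/2 \<in> lattice t"
    proof (cases "even m")
     case True
     then obtain k where "m = 2 * k" by auto
     then have "2 * z = 2 * (of_int k + of_int n * (\<i> * of_real t))" using nm by (simp add: algebra_simps)
     then have "z = of_int k + of_int n * (\<i> * of_real t)" by (metis mult_left_cancel zero_neq_numeral)
     then show ?thesis unfolding lattice_def by blast
    next
     case False
     then obtain k where "m = 2 * k + 1" by (auto elim: oddE)
     then have "2 * (z - 1/2) = 2 * (of_int k + of_int n * (\<i> * of_real t))" using nm by (simp add: algebra_simps)
     then have "z - 1/2 = of_int k + of_int n * (\<i> * of_real t)" by (metis mult_left_cancel zero_neq_numeral)
     then show ?thesis unfolding lattice_def by blast
    qed
   next
    assume "z \<in> lattice t \<or> z - 1/2 \<in> lattice t"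
    then show "\<exists>n m. of_real 2 * (z - of_int n * (\<i> * of_real t)) = of_int m"
    proof
     assume "z \<in> lattice t"
     then obtain k n where "z = of_int k + of_int n * (\<i> * of_real t)" by (auto simp: lattice_def)
     then show ?thesis by (intro exI[of _ n] exI[of _ "2 * k"]) simp
    next
     assume "z - 1/2 \<in> lattice t"
     then obtain k n where "z - 1/2 = of_int k + of_int n * (\<i> * of_real t)" by (auto simp: lattice_def)
     then have "z = of_int k + of_int n * (\<i> * of_real t) + 1/2" by (simp add: algebra_simps)
     then show ?thesis by (intro exI[of _ n] exI[of _ "2 * k + 1"]) simp
    qed
   qed
   finally show ?thesis .
  qed
  then show ?thesis by blast
 qed
 have lim0: "((%w. T (0 + w) * w ^ 1) \<longlongrightarrow> inverse (of_real (pi * 2))) (at 0)"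
  using inverse_sin_limit[of "of_real (pi * 2)"] by (simp add: T_def)
 have "T (1/2 + w) = - T w" for w
  by (simp add: T_def distrib_left sin_add)
 then have lim1: "((%w. T (1/2 + w) * w ^ 1) \<longlongrightarrow> - inverse (of_real (pi * 2))) (at 0)"
  using tendsto_minus[OF lim0] by simp
 show ?thesis
 proof (rule that[of total])
  show "total holomorphic_on {z. z \<notin> lattice t \<and> z - 1/2 \<notin> lattice t}" "open {z. z \<notin> lattice t \<and> z - 1/2 \<notin> lattice t}"
   using total_holomorphic[OF open_dom order_refl] open_dom unfolding dom by auto
  show "total (- z) = - total z" for z using total_minus[of "-1" z] by (simp add: T_def)
  show "total (cnj z) = cnj (total z)" for z
  proof (rule total_cnj)
   show "T (cnj z) = cnj (T z)" for z by (simp add: T_def cnj_sin)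
  qed
  show "order_at total 0 1" using total_limit[OF lim0] by (intro order_at_tendsto) auto
  show "order_at total (1/2) 1" using total_limit[OF lim1] by (intro order_at_tendsto) auto
  show "\<not> order_at total 0 0" by (rule not_order_at_tendsto[OF total_limit[OF lim0]]) auto
  show "\<not> order_at total (1/2) 0" by (rule not_order_at_tendsto[OF total_limit[OF lim1]]) auto
 qed (rule total_lattice)
qed

section \<open>The punctured torus and logarithmic cutoff functions\<close>

lemma lattice_0: "0 \<in> lattice t"
 unfolding lattice_def by (auto intro!: exI[of _ 0])

lemma lattice_add: assumes "a \<in> lattice t" "b \<in> lattice t" shows "a + b \<in> lattice t"
proof -
 obtain m n where "a = of_int m + of_int n * (\<i> * of_real t)" using assms(1) by (auto simp: lattice_def)
 moreover obtain m' n' where "b = of_int m' + of_int n' * (\<i> * of_real t)" using assms(2) by (auto simp: lattice_def)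
 ultimately have "a + b = of_int (m + m') + of_int (n + n') * (\<i> * of_real t)" by (simp add: algebra_simps)
 then show ?thesis unfolding lattice_def by blast
qed

lemma lattice_cnj: assumes "a \<in> lattice t" shows "cnj a \<in> lattice t"
proof -
 obtain m n where "a = of_int m + of_int n * (\<i> * of_real t)" using assms(1) by (auto simp: lattice_def)
 then have "cnj a = of_int m + of_int (- n) * (\<i> * of_real t)" by simp
 then show ?thesis unfolding lattice_def by blast
qed

lemma lattice_1: "1 \<in> lattice t" and lattice_it: "\<i> * of_real t \<in> lattice t"
 unfolding lattice_def by (auto intro: exI[of _ 1] exI[of _ 0])

lemma lattice_uminus_iff: "- a \<in> lattice t \<longleftrightarrow> a \<in> lattice t"
 using lattice_minus[of a t] lattice_minus[of "- a" t] by auto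

lemma lattice_cnj_iff: "cnj a \<in> lattice t \<longleftrightarrow> a \<in> lattice t"
 using lattice_cnj[of a t] lattice_cnj[of "cnj a" t] by auto

lemma lattice_add_iff: "l \<in> lattice t ==> a + l \<in> lattice t \<longleftrightarrow> a \<in> lattice t"
 using lattice_add[of a t l] lattice_add[of "a + l" t "- l"] lattice_minus[of l t] by auto

section \<open>The punctures and the reflections\<close>

definition punctures :: "real => complex set" where
 "punctures t = {0, 1/2, \<i> * of_real t / 2}"

lemma punctured_plane_alt: "punctured_plane t = {z. \<forall>a\<in>punctures t. z - a \<notin> lattice t}"
 by (simp add: punctured_plane_def punctures_def)

lemma punctures_double: "a \<in> punctures t ==> 2 * a \<in> lattice t"
proof -
 have "\<forall>a\<in>punctures t. 2 * a \<in> lattice t"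
  unfolding punctures_def by (simp add: lattice_0 lattice_1 lattice_it)
 then show "a \<in> punctures t ==> 2 * a \<in> lattice t" by blast
qed

lemma punctures_cnj: "a \<in> punctures t ==> a - cnj a \<in> lattice t"
proof -
 have "\<i> * of_real t / 2 - cnj (\<i> * of_real t / 2) = \<i> * of_real t" by (simp add: complex_eq_iff)
 moreover have "1/2 - cnj (1/2) = (0::complex)" by simp
 ultimately have "\<forall>a\<in>punctures t. a - cnj a \<in> lattice t"
  unfolding punctures_def ball_simps
  by (simp only: lattice_0 lattice_it complex_cnj_zero diff_self simp_thms)
 then show "a \<in> punctures t ==> a - cnj a \<in> lattice t" by blast
qed

lemma punctured_plane_add: "l \<in> lattice t ==> z + l \<in> punctured_plane t \<longleftrightarrow> z \<in> punctured_plane t"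
proof -
 have "z + l - a = (z - a) + l" for a by simp
 then show "l \<in> lattice t ==> z + l \<in> punctured_plane t \<longleftrightarrow> z \<in> punctured_plane t"
  by (simp only: punctured_plane_alt mem_Collect_eq lattice_add_iff)
qed

text \<open>The punctures are half periods on the coordinate axes, so each of them is fixed by both
  reflections modulo the lattice.\<close>

lemma puncture_reflect:
 assumes "a \<in> punctures t"
 shows "cnj z - a \<in> lattice t \<longleftrightarrow> z - a \<in> lattice t" "- cnj z - a \<in> lattice t \<longleftrightarrow> z - a \<in> lattice t"
proof -
 have "cnj z - a = cnj (z - a) + - (a - cnj a)" by simp
 then show 1: "cnj z - a \<in> lattice t \<longleftrightarrow> z - a \<in> lattice t"
  using lattice_add_iff[OF lattice_minus[OF punctures_cnj[OF assms]], of "cnj (z - a)"] lattice_cnj_iff by metis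
 have "- cnj z - a = - (cnj z - a) + - (2 * a)" by simp
 then have "- cnj z - a \<in> lattice t \<longleftrightarrow> cnj z - a \<in> lattice t"
  using lattice_add_iff[OF lattice_minus[OF punctures_double[OF assms]], of "- (cnj z - a)"] lattice_uminus_iff by metis
 then show "- cnj z - a \<in> lattice t \<longleftrightarrow> z - a \<in> lattice t" using 1 by simp
qed

lemma punctured_plane_reflect:
 "cnj z \<in> punctured_plane t \<longleftrightarrow> z \<in> punctured_plane t" "- cnj z \<in> punctured_plane t \<longleftrightarrow> z \<in> punctured_plane t"
 by (simp_all add: punctured_plane_alt puncture_reflect)

lemma open_punctured_plane:
 assumes "t > 0" shows "open (punctured_plane t)"
proof -
 obtain P where "open (- lattice t)" using elliptic_double_pole[OF assms] by blast
 then have "open (\<Inter>a\<in>punctures t. (%z. z - a) -` (- lattice t))"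
  by (intro open_INT) (auto simp: punctures_def intro!: open_vimage continuous_intros)
 moreover have "punctured_plane t = (\<Inter>a\<in>punctures t. (%z. z - a) -` (- lattice t))"
  by (auto simp: punctured_plane_alt)
 ultimately show ?thesis by simp
qed

lemma connected_punctured_plane: "connected (punctured_plane t)"
proof -
 have "lattice t = (%(m, n). of_int m + of_int n * (\<i> * of_real t)) ` UNIV" by (auto simp: lattice_def)
 then have c: "countable (lattice t)" by simp
 have "punctured_plane t = UNIV - (\<Union>a\<in>punctures t. (%l. a + l) ` lattice t)"
  by (auto simp: punctured_plane_alt image_iff) (metis add_diff_cancel_left' diff_add_cancel add.commute)+
 moreover have "connected (UNIV - (\<Union>a\<in>punctures t. (%l. a + l) ` lattice t))"
  using c by (intro connected_open_diff_countable) (auto simp: punctures_def)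
 ultimately show ?thesis by simp
qed

lemma fund_domain_cover:
 assumes "t > 0" obtains l where "l \<in> lattice t" "z - l \<in> fund_domain t"
proof
 let ?l = "of_int \<lfloor>Re z\<rfloor> + of_int \<lfloor>Im z / t\<rfloor> * (\<i> * of_real t)"
 show "?l \<in> lattice t" unfolding lattice_def by blast
 have "of_int \<lfloor>Im z / t\<rfloor> * t \<le> Im z / t * t" using assms by (intro mult_right_mono) auto
 moreover have "Im z / t * t < (of_int \<lfloor>Im z / t\<rfloor> + 1) * t" using assms by (intro mult_strict_right_mono) linarith+
 moreover have "Re z < of_int \<lfloor>Re z\<rfloor> + 1" by linarith
 ultimately show "z - ?l \<in> fund_domain t" using assms by (simp add: fund_domain_def algebra_simps)
qed

text \<open>\<open>bell t\<close> is a smooth periodic function comparable to the squared distance from the lattice.\<close>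

definition bell :: "real => complex => real" where
 "bell t z = (sin (pi * Re z))\<^sup>2 + (sin (pi / t * Im z))\<^sup>2"

lemma sin_sq_shift: "(sin (x + pi * of_int n))\<^sup>2 = (sin x)\<^sup>2"
proof -
 have "sin (pi * of_int n) = 0" "(cos (pi * of_int n))\<^sup>2 = 1"
  using sin_zero_iff_int2[of "pi * of_int n"] sin_cos_squared_add[of "pi * of_int n"] by auto
 then show ?thesis by (simp add: sin_add power_mult_distrib)
qed

lemma bell_lattice:
 assumes "t > 0" "l \<in> lattice t" shows "bell t (z + l) = bell t z"
proof -
 obtain m n where l: "l = of_int m + of_int n * (\<i> * of_real t)" using assms(2) by (auto simp: lattice_def)
 have "pi * Re (z + l) = pi * Re z + pi * of_int m" "pi / t * Im (z + l) = pi / t * Im z + pi * of_int n"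
  using assms(1) by (simp_all add: l field_simps)
 then show ?thesis unfolding bell_def by (simp only: sin_sq_shift)
qed

lemma bell_reflect: "bell t (cnj z) = bell t z" "bell t (- z) = bell t z"
 by (simp_all add: bell_def)

lemma bell_nonneg: "bell t z \<ge> 0" by (simp add: bell_def)

lemma bell_pos: assumes "t > 0" "z \<notin> lattice t" shows "bell t z > 0"
proof (rule ccontr)
 assume "\<not> ?thesis"
 then have "bell t z = 0" using bell_nonneg[of t z] by linarith
 then have "sin (pi * Re z) = 0" "sin (pi / t * Im z) = 0" unfolding bell_def sum_power2_eq_zero_iff by blast+
 then obtain m n :: int where "pi * Re z = of_int m * pi" "pi / t * Im z = of_int n * pi"
  unfolding sin_zero_iff_int2 by blast
 then have "Re z = of_int m" "Im z = of_int n * t" using assms(1) by (simp_all add: field_simps)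
 then have "z = of_int m + of_int n * (\<i> * of_real t)" by (simp add: complex_eq_iff)
 then show False using assms(2) unfolding lattice_def by blast
qed

lemma smooth_on_bell [smooth_intros]: "open S ==> smooth_on S f ==> smooth_on S (%z. bell t (f z))"
 unfolding bell_def by (intro smooth_intros)

text \<open>The analogue of |grad r^2|^2 = 4 r^2; it makes the energy of a cutoff in
  \<open>bell\<close> independent of the scale. For \<open>t \<ge> 1\<close> the vertical frequency
  pi/t is at most pi.\<close>

lemma bell_gradient:
 assumes "t \<ge> 1"
 shows "(pd 1 (bell t) z)\<^sup>2 + (pd \<i> (bell t) z)\<^sup>2 \<le> 4 * pi\<^sup>2 * bell t z"
proof -
 define s1 s2 where "s1 = sin (pi * Re z)" and "s2 = sin (pi / t * Im z)"
 have "(bell t has_derivative (%v. 2 * s1 * (cos (pi * Re z) * (pi * Re v)) + 2 * s2 * (cos (pi / t * Im z) * (pi / t * Im v)))) (at z)"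
  unfolding bell_def[abs_def] s1_def s2_def
  using assms by (auto intro!: derivative_eq_intros)
 note d = pd_eqI[OF this]
 have "(pd 1 (bell t) z)\<^sup>2 = 4 * pi\<^sup>2 * s1\<^sup>2 * (cos (pi * Re z))\<^sup>2" by (simp add: d power_mult_distrib)
 also have "\<dots> \<le> 4 * pi\<^sup>2 * s1\<^sup>2 * 1" by (intro mult_left_mono) (auto simp: abs_square_le_1)
 finally have 1: "(pd 1 (bell t) z)\<^sup>2 \<le> 4 * pi\<^sup>2 * s1\<^sup>2" by simp
 have "(pd \<i> (bell t) z)\<^sup>2 = 4 * pi\<^sup>2 * s2\<^sup>2 * ((cos (pi / t * Im z))\<^sup>2 * (1 / t\<^sup>2))"
  by (simp add: d power_mult_distrib power_divide)
 also have "\<dots> \<le> 4 * pi\<^sup>2 * s2\<^sup>2 * (1 * 1)"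
 proof (intro mult_left_mono mult_mono)
  have "1 \<le> t\<^sup>2" using assms by simp
  then have "1 / t\<^sup>2 \<le> 1 / 1" by (intro frac_le) auto
  then show "1 / t\<^sup>2 \<le> 1" by simp
 qed (use assms in \<open>auto simp: abs_square_le_1\<close>)
 finally have 2: "(pd \<i> (bell t) z)\<^sup>2 \<le> 4 * pi\<^sup>2 * s2\<^sup>2" by simp
 from add_mono[OF 1 2] show ?thesis by (simp add: bell_def s1_def s2_def algebra_simps)
qed

text \<open>For the distance v of \<open>u\<close> to the nearest integer, sin(pi v) \<ge> v. Up to
  v = 1/3 the cosine is at least 1/2 and the mean value theorem applies; beyond that the sine is at
  least 1/2.\<close>

lemma sin_pi_small:
 assumes "\<bar>sin (pi * u)\<bar> < \<delta>" obtains m :: int where "\<bar>u - of_int m\<bar> \<le> \<delta>"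
proof -
 define v where "v = \<bar>u - of_int (round u)\<bar>"
 have v: "0 \<le> v" "v \<le> 1/2" using of_int_round_abs_le[of u] by (auto simp: v_def abs_minus_commute)
 have "\<bar>sin (pi * u)\<bar> = sin (pi * v)"
 proof -
  have "sin (pi * v) \<ge> 0" using v by (intro sin_ge_zero) (auto simp: mult_left_le)
  moreover have "(sin (pi * v))\<^sup>2 = (sin (pi * u))\<^sup>2"
  proof -
   have "(sin (pi * \<bar>d\<bar>))\<^sup>2 = (sin (pi * d))\<^sup>2" for d :: real by (cases "d \<ge> 0") simp_all
   then have "(sin (pi * v))\<^sup>2 = (sin (pi * (u - of_int (round u))))\<^sup>2" unfolding v_def .
   also have "pi * (u - of_int (round u)) = pi * u + pi * of_int (- round u)" by (simp add: algebra_simps)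
   finally show ?thesis unfolding sin_sq_shift .
  qed
  ultimately show ?thesis by (metis abs_of_nonneg power2_eq_iff abs_minus_cancel)
 qed
 moreover have "v \<le> sin (pi * v)"
 proof (cases "v \<le> 1/3")
  case True
  have "\<exists>z. 0 \<le> z \<and> z \<le> pi * v \<and> sin (pi * v) - sin 0 = (pi * v - 0) * cos z"
  proof (cases "v = 0")
   case False
   then have "0 < pi * v" using v by simp
   from MVT2[OF this, of sin cos] show ?thesis by (auto intro: less_imp_le)
  qed auto
  then obtain z where z: "0 \<le> z" "z \<le> pi * v" "sin (pi * v) = pi * v * cos z" by auto
  have "pi * v \<le> pi * (1/3)" using True by (intro mult_left_mono) auto
  then have "z \<le> pi / 3" using z(2) by linarith
  then have "cos (pi / 3) \<le> cos z" using z(1) by (intro cos_monotone_0_pi_le) auto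
  then have "pi * v * (1/2) \<le> pi * v * cos z" using v by (intro mult_left_mono) (auto simp: cos_60)
  moreover have "2 * v \<le> pi * v" using pi_ge_two v by (intro mult_right_mono) auto
  ultimately show ?thesis unfolding z(3) by linarith
 next
  case False
  have "sin (pi / 6) \<le> sin (pi * v)" using False v by (intro sin_monotone_2pi_le) (auto simp: field_simps)
  then show ?thesis using v by (simp add: sin_30)
 qed
 ultimately show ?thesis using assms that[of "round u"] by (simp add: v_def)
qed

text \<open>With \<delta> the square root of s, the set is covered by boxes of area
  \<open>4 * t * s\<close> around translates of the puncture; four values of each index suffice as
  \<open>\<delta> \<le> 1\<close>, hence 16 boxes and the constant 64.\<close>

lemma bell_sublevel_measure:
 assumes "t \<ge> 1" "a \<in> punctures t" "0 < s" "s \<le> 1"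
 shows "measure lborel (fund_domain t \<inter> {z. bell t (z - a) < s}) \<le> 64 * t * s"
proof -
 define \<delta> where "\<delta> = sqrt s"
 have \<delta>: "0 < \<delta>" "\<delta> \<le> 1" "\<delta>\<^sup>2 = s" using assms by (auto simp: \<delta>_def)
 have "\<forall>a\<in>punctures t. 0 \<le> Re a \<and> Re a \<le> 1/2 \<and> 0 \<le> Im a \<and> Im a \<le> t/2"
  unfolding punctures_def using assms(1) by simp
 then have a: "0 \<le> Re a" "Re a \<le> 1/2" "0 \<le> Im a" "Im a \<le> t/2" using assms(2) by auto
 define B where "B = (%(m::int, n::int). cbox (Complex (Re a + of_int m - \<delta>) (Im a + t * of_int n - t * \<delta>))
  (Complex (Re a + of_int m + \<delta>) (Im a + t * of_int n + t * \<delta>)))"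
 have "fund_domain t \<inter> {z. bell t (z - a) < s} \<subseteq> (\<Union>p\<in>{-1..2} \<times> {-1..2}. B p)"
 proof
  fix z assume z: "z \<in> fund_domain t \<inter> {z. bell t (z - a) < s}"
  have "(sin (pi * Re (z - a)))\<^sup>2 < \<delta>\<^sup>2" "(sin (pi / t * Im (z - a)))\<^sup>2 < \<delta>\<^sup>2"
  proof -
   have "bell t (z - a) < s" using z by simp
   then show "(sin (pi * Re (z - a)))\<^sup>2 < \<delta>\<^sup>2" "(sin (pi / t * Im (z - a)))\<^sup>2 < \<delta>\<^sup>2"
    using zero_le_power2[of "sin (pi * Re (z - a))"] zero_le_power2[of "sin (pi / t * Im (z - a))"]
    unfolding \<delta>(3) bell_def by linarith+
  qed
  then have "\<bar>sin (pi * Re (z - a))\<bar> < \<delta>" "\<bar>sin (pi * (Im (z - a) / t))\<bar> < \<delta>"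
  proof -
   have "\<bar>x\<bar> < \<delta>" if "x\<^sup>2 < \<delta>\<^sup>2" for x
    using that \<delta>(1) by (intro power2_less_imp_less[of "\<bar>x\<bar>"]) auto
   from this[of "sin (pi * Re (z - a))"] this[of "sin (pi / t * Im (z - a))"]
   show "(sin (pi * Re (z - a)))\<^sup>2 < \<delta>\<^sup>2 ==> (sin (pi / t * Im (z - a)))\<^sup>2 < \<delta>\<^sup>2 ==> \<bar>sin (pi * Re (z - a))\<bar> < \<delta>"
    "(sin (pi * Re (z - a)))\<^sup>2 < \<delta>\<^sup>2 ==> (sin (pi / t * Im (z - a)))\<^sup>2 < \<delta>\<^sup>2 ==> \<bar>sin (pi * (Im (z - a) / t))\<bar> < \<delta>"
    by (simp_all only: times_divide_eq_left times_divide_eq_right)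
  qed
  then obtain m n :: int where mn: "\<bar>Re (z - a) - of_int m\<bar> \<le> \<delta>" "\<bar>Im (z - a) / t - of_int n\<bar> \<le> \<delta>"
   by (metis sin_pi_small)
  have f: "0 \<le> Re z" "Re z < 1" "0 \<le> Im z" "Im z < t" using z by (auto simp: fund_domain_def)
  have "of_int m \<le> (2::real)" "of_int m \<ge> (- 3/2::real)" using mn(1) f a \<delta> unfolding minus_complex.sel by linarith+
  then have m: "m \<in> {-1..2}" by (auto intro: ccontr)
  have q: "Im (z - a) / t \<le> 1" "Im (z - a) / t \<ge> - 1/2" using f a assms(1) by (simp_all add: field_simps)
  have "of_int n \<le> (2::real)" "of_int n \<ge> (- 3/2::real)" using mn(2) q \<delta> by linarith+
  then have n: "n \<in> {-1..2}" by (auto intro: ccontr)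
  have "\<bar>Im (z - a) / t - of_int n\<bar> * t \<le> \<delta> * t" using mn(2) assms(1) by (intro mult_right_mono) auto
  moreover have "\<bar>Im (z - a) / t - of_int n\<bar> * t = \<bar>Im z - Im a - t * of_int n\<bar>"
  proof -
   have "\<bar>Im (z - a) / t - of_int n\<bar> * t = \<bar>(Im (z - a) / t - of_int n) * t\<bar>" using assms(1) by (simp add: abs_mult)
   also have "(Im (z - a) / t - of_int n) * t = Im z - Im a - t * of_int n" using assms(1) by (simp add: field_simps)
   finally show ?thesis .
  qed
  ultimately have "z \<in> B (m, n)" using mn(1)
   by (auto simp: B_def cbox_def Basis_complex_def inner_complex_def abs_le_iff algebra_simps)
  then show "z \<in> (\<Union>p\<in>{-1..2} \<times> {-1..2}. B p)" using m n by blast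
 qed
 then have "measure lborel (fund_domain t \<inter> {z. bell t (z - a) < s}) \<le> measure lborel (\<Union>p\<in>{-1..2} \<times> {-1..2}. B p)"
 proof (rule measure_mono_fmeasurable)
  have "continuous_on UNIV (%z. bell t (z - a))"
   unfolding bell_def by (intro continuous_intros)
  then have "open {z. bell t (z - a) < s}" by (intro open_Collect_less continuous_intros)
  then show "fund_domain t \<inter> {z. bell t (z - a) < s} \<in> sets lborel"
   using fund_domain_measurable by auto
  show "(\<Union>p\<in>{-1..2} \<times> {-1..2}. B p) \<in> fmeasurable lborel"
   by (intro fmeasurable.finite_UN) (auto simp: B_def split_beta)
 qed
 also have "\<dots> \<le> (\<Sum>p\<in>{-1..2} \<times> {-1..2}. measure lborel (B p))"
  by (intro measure_UNION_le) (auto simp: B_def split_beta)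
 also have "\<dots> = (\<Sum>p\<in>({-1..2::int} \<times> {-1..2::int}). 4 * t * s)"
 proof (intro sum.cong refl)
  fix p :: "int \<times> int"
  obtain m n where p: "p = (m, n)" by (cases p)
  have "measure lborel (B p) = (2 * \<delta>) * (2 * (t * \<delta>))"
   unfolding B_def p prod.case using \<delta> assms(1)
   by (subst measure_lborel_cbox) (auto simp: Basis_complex_def inner_complex_def algebra_simps)
  then show "measure lborel (B p) = 4 * t * s" unfolding \<delta>(3)[symmetric] by (simp add: power2_eq_square)
 qed
 also have "\<dots> = 64 * t * s" by (simp add: card_cartesian_product)
 finally show ?thesis .
qed

text \<open>Averaging the cutoffs at the scales \<open>4\<^sup>-\<^sup>k\<close>, \<open>n < k \<le> 2n\<close>, whose gradients have disjoint supports and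
 uniformly bounded energy, gives Dirichlet energy \<open>O(1/n)\<close>: points have capacity zero.\<close>

definition log_cutoff :: "nat => real => real" where
 "log_cutoff n s = (\<Sum>k\<in>{n<..2*n}. cutoff (4 ^ k * s)) / real n"

lemma smooth_on_log_cutoff [smooth_intros]:
 "open S ==> smooth_on S f ==> smooth_on S (%z. log_cutoff n (f z))"
 unfolding log_cutoff_def divide_inverse by (intro smooth_intros)

lemma log_cutoff_range: "0 \<le> log_cutoff n s" "log_cutoff n s \<le> 1"
proof -
 show "0 \<le> log_cutoff n s" unfolding log_cutoff_def by (intro divide_nonneg_nonneg sum_nonneg cutoff_range) auto
 have "(\<Sum>k\<in>{n<..2*n}. cutoff (4 ^ k * s)) \<le> (\<Sum>k\<in>{n<..2*n}. 1)" by (intro sum_mono cutoff_range)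
 then show "log_cutoff n s \<le> 1" unfolding log_cutoff_def by (cases "n = 0") (auto simp: divide_le_eq)
qed

lemma log_cutoff_0: assumes "s < 1 / 4 ^ (2 * n)" shows "log_cutoff n s = 0"
proof -
 have "cutoff (4 ^ k * s) = 0" if "k \<in> {n<..2*n}" for k
 proof (cases "s \<le> 0")
  case True
  then show ?thesis by (intro cutoff_0) (simp add: mult_nonneg_nonpos order_trans[of _ 0])
 next
  case False
  have "4 ^ k * s \<le> 4 ^ (2 * n) * s" using that False by (intro mult_right_mono power_increasing) auto
  also have "\<dots> \<le> 1" using assms by (simp add: field_simps)
  finally show ?thesis by (rule cutoff_0)
 qed
 then show ?thesis by (simp add: log_cutoff_def)
qed

lemma log_cutoff_1: assumes "s \<ge> 1 / 4 ^ n" "n > 0" shows "log_cutoff n s = 1"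
proof -
 have "cutoff (4 ^ k * s) = 1" if "k \<in> {n<..2*n}" for k
 proof (rule cutoff_1)
  have "s \<ge> 0" using assms(1) by (rule order_trans[rotated]) simp
  have "(4::real) ^ Suc n * s \<ge> 4" using assms(1) by (simp add: field_simps)
  moreover have "(4::real) ^ Suc n * s \<le> 4 ^ k * s" using that \<open>s \<ge> 0\<close> by (intro mult_right_mono power_increasing) auto
  ultimately show "4 \<le> 4 ^ k * s" by linarith
 qed
 then show ?thesis using assms(2) by (simp add: log_cutoff_def)
qed

definition bell_cutoff :: "real => nat => complex => complex => real" where
 "bell_cutoff t n a z = log_cutoff n (bell t (z - a))"

lemma smooth_on_bell_cutoff: "smooth_on UNIV (bell_cutoff t n a)"
 unfolding bell_cutoff_def[abs_def] by (intro smooth_intros open_UNIV)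

lemma fint_le_measure:
 assumes F: "continuous_on UNIV F" "\<And>z. F z \<le> B" "\<And>z. z \<notin> S ==> F z \<le> 0" "B \<ge> 0"
  and S: "S \<in> sets borel"
 shows "fint t F \<le> B * measure lborel (fund_domain t \<inter> S)"
proof -
 have fd: "fund_domain t \<in> fmeasurable lborel"
 proof (rule fmeasurableI2)
  show "cbox 0 (Complex 1 t) \<in> fmeasurable lborel" by simp
  show "fund_domain t \<subseteq> cbox 0 (Complex 1 t)" by (auto simp: fund_domain_def cbox_def Basis_complex_def inner_complex_def)
  show "fund_domain t \<in> sets lborel" using fund_domain_measurable by simp
 qed
 have fS: "fund_domain t \<inter> S \<in> fmeasurable lborel"
  using fd S by (intro fmeasurableI2[OF fd]) (auto simp: fund_domain_measurable)
 have "fint t F \<le> (LINT z|lborel. indicator (fund_domain t \<inter> S) z *\<^sub>R B)"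
  unfolding fint_def set_lebesgue_integral_def
 proof (rule integral_mono)
  show "integrable lborel (%z. indicator (fund_domain t) z *\<^sub>R F z)"
   using set_integrable_fund_domain[OF F(1)] by (simp add: set_integrable_def)
  show "integrable lborel (%z. indicator (fund_domain t \<inter> S) z *\<^sub>R B)"
   using fS by (auto simp: fmeasurable_def)
  show "indicator (fund_domain t) z *\<^sub>R F z \<le> indicator (fund_domain t \<inter> S) z *\<^sub>R B" for z
   using F by (auto simp: indicator_def)
 qed
 also have "\<dots> = B * measure lborel (fund_domain t \<inter> S)"
  using fS by (simp add: fmeasurable_def mult.commute)
 finally show ?thesis .
qed

text \<open>Each of the n scales has energy at most \<open>K\<close>, and gradients at different
  scales are never simultaneously nonzero. So the energy of the average is at most n K /
  n^2.\<close>

lemma bell_cutoff_energy: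
 assumes t: "t \<ge> 1"
 obtains C where "\<And>n a. n > 0 ==> a \<in> punctures t ==>
  fint t (%z. (pd 1 (bell_cutoff t n a) z)\<^sup>2 + (pd \<i> (bell_cutoff t n a) z)\<^sup>2) \<le> C / real n"
proof -
 obtain dc C where dc: "\<And>s. (cutoff has_real_derivative dc s) (at s)" "\<And>s. \<bar>dc s\<bar> \<le> C" "\<And>s. s \<le> 1 \<or> s \<ge> 4 ==> dc s = 0"
  using cutoff_derivative_bounded by blast
 have C0: "C \<ge> 0" using dc(2)[of 0] by simp
 define K where "K = C\<^sup>2 * 16 * pi\<^sup>2 * (64 * t * 4)"
 have "fint t (%z. (pd 1 (bell_cutoff t n a) z)\<^sup>2 + (pd \<i> (bell_cutoff t n a) z)\<^sup>2) \<le> K / real n"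
  if n: "n > 0" and a: "a \<in> punctures t" for n a
 proof -
  define W where "W = (%z. bell t (z - a))"
  have W: "smooth_on UNIV W" unfolding W_def by (intro smooth_intros open_UNIV)
  have Wgrad: "(pd 1 W z)\<^sup>2 + (pd \<i> W z)\<^sup>2 \<le> 4 * pi\<^sup>2 * W z" for z
  proof -
   have "((%z. bell t (z - a)) has_derivative (%v. pd v (bell t) (z - a))) (at z)"
    by (rule has_derivative_compose[of "%z. z - a" "%v. v"])
     (auto intro!: derivative_eq_intros smooth_on_has_derivative[of UNIV] smooth_on_bell[of UNIV "%z. z"] smooth_on_ident)
   from pd_eqI[OF this] have "pd v W z = pd v (bell t) (z - a)" for v by (simp add: W_def)
   then show ?thesis using bell_gradient[OF t, of "z - a"] by (simp add: W_def)
  qed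
  have W0: "W z \<ge> 0" for z by (simp add: W_def bell_nonneg)
  define G where "G = (%k z. (dc (4 ^ k * W z) * 4 ^ k)\<^sup>2 * ((pd 1 W z)\<^sup>2 + (pd \<i> W z)\<^sup>2))"
  have dcut: "((%z. cutoff (4 ^ k * W z)) has_derivative (%v. dc (4 ^ k * W z) * 4 ^ k * pd v W z)) (at z)" for k z
  proof -
   have "((%z. 4 ^ k * W z) has_derivative (%v. 4 ^ k * pd v W z)) (at z)"
    using smooth_on_has_derivative[OF W] by (intro has_derivative_mult_right) auto
   from has_derivative_compose[OF this dc(1)[unfolded has_field_derivative_def]] show ?thesis by (simp add: mult.assoc)
  qed
  have pdcut: "pd v (%z. cutoff (4 ^ k * W z)) z = dc (4 ^ k * W z) * 4 ^ k * pd v W z" for v k z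
   by (rule pd_eqI[OF dcut])
  have Gcont: "continuous_on UNIV (G k)" for k
  proof -
   have s: "smooth_on UNIV (%z. cutoff (4 ^ k * W z))" by (intro smooth_intros open_UNIV W)
   have "continuous_on UNIV (%z. (pd 1 (%z. cutoff (4 ^ k * W z)) z)\<^sup>2 + (pd \<i> (%z. cutoff (4 ^ k * W z)) z)\<^sup>2)"
    by (intro continuous_intros smooth_on_continuous smooth_on_pd s)
   moreover have "(pd 1 (%z. cutoff (4 ^ k * W z)) z)\<^sup>2 + (pd \<i> (%z. cutoff (4 ^ k * W z)) z)\<^sup>2 = G k z" for z
    unfolding pdcut G_def by (simp add: power_mult_distrib algebra_simps)
   ultimately show ?thesis by simp
  qed
  have Gint: "fint t (G k) \<le> K" if k: "k \<in> {n<..2*n}" for k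
  proof -
   \<comment> \<open>The gradient at scale k lives where \<open>W < s\<close>. The squared slope
     \<open>16 ^ k\<close> is compensated by one factor s from the gradient bound and another from
     the area.\<close>
   define s :: real where "s = 4 / 4 ^ k"
   have s: "0 < s" "s \<le> 1"
    using k power_increasing[of 1 k "4::real"] by (auto simp: s_def divide_le_eq)
   define B where "B = C\<^sup>2 * 16 ^ k * (4 * pi\<^sup>2 * s)"
   have G0: "G k z = 0" if "z \<notin> {z. W z < s}" for z
   proof -
    have "4 ^ k * s \<le> 4 ^ k * W z" using that by (intro mult_left_mono) auto
    then have "4 ^ k * W z \<ge> 4" by (simp add: s_def)
    then show ?thesis using dc(3) by (simp add: G_def)
   qed
   have GB: "G k z \<le> B" for z
   proof (cases "W z < s")
    case True
    have "(dc (4 ^ k * W z) * 4 ^ k)\<^sup>2 \<le> C\<^sup>2 * 16 ^ k"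
    proof -
     have "(dc (4 ^ k * W z))\<^sup>2 \<le> C\<^sup>2" using dc(2) C0 by (simp add: abs_le_square_iff[symmetric])
     moreover have "((4::real) ^ k)\<^sup>2 = 16 ^ k" by (simp add: power2_eq_square power_mult_distrib[symmetric])
     ultimately show ?thesis by (simp add: power_mult_distrib mult_right_mono)
    qed
    moreover have "(pd 1 W z)\<^sup>2 + (pd \<i> W z)\<^sup>2 \<le> 4 * pi\<^sup>2 * s"
     by (rule order_trans[OF Wgrad mult_left_mono[OF less_imp_le[OF True]]]) simp
    ultimately show ?thesis unfolding G_def B_def by (intro mult_mono) auto
   next
    case False
    then have "G k z = 0" using G0 by simp
    then show ?thesis using s by (simp add: B_def)
   qed
   have "open {z. W z < s}" using smooth_on_continuous[OF W] by (intro open_Collect_less continuous_intros) auto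
   then have "fint t (G k) \<le> B * measure lborel (fund_domain t \<inter> {z. W z < s})"
    using G0 GB s by (intro fint_le_measure Gcont) (auto simp: B_def)
   also have "\<dots> \<le> B * (64 * t * s)"
    unfolding W_def using bell_sublevel_measure[OF t a s] s by (intro mult_left_mono) (auto simp: B_def)
   also have "\<dots> = K"
   proof -
    have "16 ^ k * s * s = 16"
    proof -
     have "(16::real) ^ k = 4 ^ k * 4 ^ k" by (simp add: power_mult_distrib[symmetric])
     then show ?thesis by (simp add: s_def)
    qed
    then have "16 ^ k * (s * s) = 16" by (simp add: mult.assoc)
    then have "C\<^sup>2 * (4 * pi\<^sup>2) * (64 * t) * (16 ^ k * (s * s)) = K" by (simp add: K_def)
    then show ?thesis unfolding B_def by (simp add: mult_ac)
   qed
   finally show ?thesis .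
  qed
  have eq: "(pd 1 (bell_cutoff t n a) z)\<^sup>2 + (pd \<i> (bell_cutoff t n a) z)\<^sup>2 = 1 / (real n)\<^sup>2 * (\<Sum>k\<in>{n<..2*n}. G k z)" for z
  proof -
   define x where "x = (%k. dc (4 ^ k * W z) * 4 ^ k)"
   have "(bell_cutoff t n a has_derivative (%v. (\<Sum>k\<in>{n<..2*n}. x k * pd v W z) / real n)) (at z)"
   proof -
    have "((%z. inverse (real n) * (\<Sum>k\<in>{n<..2*n}. cutoff (4 ^ k * W z))) has_derivative
      (%v. inverse (real n) * (\<Sum>k\<in>{n<..2*n}. dc (4 ^ k * W z) * 4 ^ k * pd v W z))) (at z)"
     by (intro has_derivative_mult_right has_derivative_sum dcut)
    then show ?thesis
     by (simp add: bell_cutoff_def[abs_def] log_cutoff_def W_def x_def divide_inverse mult.commute)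
   qed
   from pd_eqI[OF this] have p: "pd v (bell_cutoff t n a) z = (\<Sum>k\<in>{n<..2*n}. x k) * pd v W z / real n" for v
    by (simp add: sum_distrib_right)
   \<comment> \<open>Where the coarser cutoff has begun its transition, the finer one has completed
     it.\<close>
   have zero: "x j * x k = 0" if "j < k" for j k
   proof (cases "x j = 0")
    case False
    then have "4 ^ j * W z > 1" using dc(3)[of "4 ^ j * W z"] unfolding x_def by fastforce
    moreover have "4 ^ Suc j * W z \<le> 4 ^ k * W z" using that W0 by (intro mult_right_mono power_increasing) auto
    ultimately have "4 ^ k * W z \<ge> 4" by simp
    then show ?thesis using dc(3) by (simp add: x_def)
   qed simp
   have "(\<Sum>k\<in>I. x k)\<^sup>2 = (\<Sum>k\<in>I. (x k)\<^sup>2)" if "finite I" for I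
    using that
   proof (induction I)
    case (insert i I)
    have "x i * x j = 0" if "j \<in> I" for j
     using zero[of i j] zero[of j i] that insert(2) by (cases i j rule: linorder_cases) (auto simp: mult.commute)
    then have "(\<Sum>j\<in>I. x i * x j) = 0" by (intro sum.neutral) blast
    then have "x i * (\<Sum>j\<in>I. x j) = 0" by (simp only: sum_distrib_left)
    then show ?case using insert by (simp add: power2_sum)
   qed simp
   then have "(\<Sum>k\<in>{n<..2*n}. x k)\<^sup>2 = (\<Sum>k\<in>{n<..2*n}. (x k)\<^sup>2)" by simp
   then have "(pd 1 (bell_cutoff t n a) z)\<^sup>2 + (pd \<i> (bell_cutoff t n a) z)\<^sup>2
     = 1 / (real n)\<^sup>2 * ((\<Sum>k\<in>{n<..2*n}. (x k)\<^sup>2) * ((pd 1 W z)\<^sup>2 + (pd \<i> W z)\<^sup>2))"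
    unfolding p power_divide power_mult_distrib by (simp add: algebra_simps add_divide_distrib)
   then show ?thesis by (simp add: sum_distrib_right G_def x_def)
  qed
  have "fint t (%z. (pd 1 (bell_cutoff t n a) z)\<^sup>2 + (pd \<i> (bell_cutoff t n a) z)\<^sup>2) = 1 / (real n)\<^sup>2 * (\<Sum>k\<in>{n<..2*n}. fint t (G k))"
   unfolding eq fint_cmult using fint_sum[of "{n<..2*n}" G t] Gcont by simp
  also have "\<dots> \<le> 1 / (real n)\<^sup>2 * (\<Sum>k\<in>{n<..2*n}. K)"
   using Gint by (intro mult_left_mono sum_mono) auto
  also have "\<dots> = K / real n" using n by (simp add: power2_eq_square)
  finally show ?thesis .
 qed
 then show ?thesis using that by blast
qed

definition puncture_cutoff :: "real => nat => complex => real" where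
 "puncture_cutoff t n z = (\<Prod>a\<in>punctures t. bell_cutoff t n a z)"

lemma finite_punctures: "finite (punctures t)" and card_punctures: "card (punctures t) \<le> 3"
 unfolding punctures_def by (simp_all add: card_insert_if)

lemma smooth_on_puncture_cutoff: "smooth_on UNIV (puncture_cutoff t n)"
 unfolding puncture_cutoff_def[abs_def] by (intro smooth_intros open_UNIV smooth_on_bell_cutoff)

lemma bell_puncture_reflect:
 assumes "t > 0" "a \<in> punctures t"
 shows "bell t (cnj z - a) = bell t (z - a)" "bell t (- cnj z - a) = bell t (z - a)"
proof -
 have "cnj z - a = cnj (z - a) + - (a - cnj a)" by simp
 then show 1: "bell t (cnj z - a) = bell t (z - a)"
  using bell_lattice[OF assms(1) lattice_minus[OF punctures_cnj[OF assms(2)]], of "cnj (z - a)"] bell_reflect(1) by metis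
 have "- cnj z - a = - (cnj z - a) + - (2 * a)" by simp
 then show "bell t (- cnj z - a) = bell t (z - a)"
  using bell_lattice[OF assms(1) lattice_minus[OF punctures_double[OF assms(2)]], of "- (cnj z - a)"] bell_reflect(2) 1 by metis
qed

lemma puncture_cutoff_props:
 assumes "t > 0"
 shows "l \<in> lattice t ==> puncture_cutoff t n (z + l) = puncture_cutoff t n z"
  "puncture_cutoff t n (cnj z) = puncture_cutoff t n z" "puncture_cutoff t n (- cnj z) = puncture_cutoff t n z"
  "0 \<le> puncture_cutoff t n z" "puncture_cutoff t n z \<le> 1"
  "a \<in> punctures t ==> bell t (z - a) < 1 / 4 ^ (2 * n) ==> puncture_cutoff t n z = 0"
  "n > 0 ==> (\<And>a. a \<in> punctures t ==> bell t (z - a) \<ge> 1 / 4 ^ n) ==> puncture_cutoff t n z = 1"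
proof -
 show "puncture_cutoff t n (z + l) = puncture_cutoff t n z" if "l \<in> lattice t"
 proof -
  have "bell t (z + l - a) = bell t (z - a)" for a
   using bell_lattice[OF assms that, of "z - a"] by (simp add: add.commute add_diff_eq)
  then show ?thesis by (simp add: puncture_cutoff_def bell_cutoff_def)
 qed
 show "puncture_cutoff t n (cnj z) = puncture_cutoff t n z" "puncture_cutoff t n (- cnj z) = puncture_cutoff t n z"
  unfolding puncture_cutoff_def bell_cutoff_def using bell_puncture_reflect[OF assms] by (auto intro!: prod.cong)
 show "0 \<le> puncture_cutoff t n z" "puncture_cutoff t n z \<le> 1"
  unfolding puncture_cutoff_def bell_cutoff_def using log_cutoff_range by (auto intro!: prod_nonneg prod_le_1)
 show "puncture_cutoff t n z = 0" if "a \<in> punctures t" "bell t (z - a) < 1 / 4 ^ (2 * n)"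
  unfolding puncture_cutoff_def bell_cutoff_def using that log_cutoff_0 finite_punctures by (intro prod_zero) auto
 show "puncture_cutoff t n z = 1" if "n > 0" "\<And>a. a \<in> punctures t ==> bell t (z - a) \<ge> 1 / 4 ^ n"
  unfolding puncture_cutoff_def bell_cutoff_def using that log_cutoff_1 by (intro prod.neutral) auto
qed

text \<open>All factors lie between 0 and 1, so the product rule bounds the gradient by the sum of
  at most three gradients. Cauchy-Schwarz gives one factor 3, the number of punctures
  another.\<close>

lemma puncture_cutoff_energy:
 assumes t: "t \<ge> 1"
 shows "(%n. fint t (%z. (pd 1 (puncture_cutoff t n) z)\<^sup>2 + (pd \<i> (puncture_cutoff t n) z)\<^sup>2)) \<longlonglongrightarrow> 0"
proof -
 obtain C where C: "\<And>n a. n > 0 ==> a \<in> punctures t ==>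
  fint t (%z. (pd 1 (bell_cutoff t n a) z)\<^sup>2 + (pd \<i> (bell_cutoff t n a) z)\<^sup>2) \<le> C / real n"
  using bell_cutoff_energy[OF t] by blast
 let ?E = "%f z. (pd 1 f z)\<^sup>2 + (pd \<i> f z)\<^sup>2"
 have cont: "continuous_on UNIV (?E f)" if "smooth_on UNIV f" for f :: "complex => real"
  by (intro continuous_intros smooth_on_continuous smooth_on_pd that)
 have "fint t (?E (puncture_cutoff t n)) \<le> 9 * C / real n" if n: "n > 0" for n
 proof -
  have pt: "(pd v (puncture_cutoff t n) z)\<^sup>2 \<le> 3 * (\<Sum>a\<in>punctures t. (pd v (bell_cutoff t n a) z)\<^sup>2)" for v z
  proof -
   let ?b = "%a. bell_cutoff t n a"
   have "(puncture_cutoff t n has_derivative (%v. \<Sum>a\<in>punctures t. pd v (?b a) z * (\<Prod>b\<in>punctures t - {a}. ?b b z))) (at z)"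
    unfolding puncture_cutoff_def[abs_def]
    by (intro has_derivative_prod smooth_on_has_derivative[OF smooth_on_bell_cutoff]) auto
   from pd_eqI[OF this] have "pd v (puncture_cutoff t n) z = (\<Sum>a\<in>punctures t. pd v (?b a) z * (\<Prod>b\<in>punctures t - {a}. ?b b z))" .
   then have "\<bar>pd v (puncture_cutoff t n) z\<bar> \<le> (\<Sum>a\<in>punctures t. \<bar>pd v (?b a) z * (\<Prod>b\<in>punctures t - {a}. ?b b z)\<bar>)"
    using sum_abs by simp
   also have "\<dots> \<le> (\<Sum>a\<in>punctures t. \<bar>pd v (?b a) z\<bar> * 1)"
    unfolding abs_mult abs_prod bell_cutoff_def using log_cutoff_range
    by (intro sum_mono mult_left_mono prod_le_1) (auto simp: abs_le_iff)
   finally have "\<bar>pd v (puncture_cutoff t n) z\<bar> \<le> (\<Sum>a\<in>punctures t. \<bar>pd v (?b a) z\<bar> * 1)" .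
   then have "(pd v (puncture_cutoff t n) z)\<^sup>2 \<le> (\<Sum>a\<in>punctures t. \<bar>pd v (?b a) z\<bar> * 1)\<^sup>2"
    by (metis abs_ge_zero power2_abs power_mono)
   also have "\<dots> \<le> (\<Sum>a\<in>punctures t. \<bar>pd v (?b a) z\<bar>\<^sup>2) * (\<Sum>a\<in>punctures t. 1\<^sup>2)"
    by (rule Cauchy_Schwarz_ineq_sum)
   also have "\<dots> \<le> (\<Sum>a\<in>punctures t. \<bar>pd v (?b a) z\<bar>\<^sup>2) * 3"
   proof (intro mult_left_mono sum_nonneg)
    have "real (card (punctures t)) \<le> 3" using card_punctures[of t] by linarith
    then show "(\<Sum>a\<in>punctures t. 1\<^sup>2) \<le> (3::real)" by simp
   qed simp
   finally show ?thesis by (simp add: mult.commute)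
  qed
  have "fint t (?E (puncture_cutoff t n)) \<le> fint t (%z. 3 * (\<Sum>a\<in>punctures t. ?E (bell_cutoff t n a) z))"
  proof (intro fint_mono cont smooth_on_puncture_cutoff continuous_intros smooth_on_continuous smooth_on_pd smooth_on_bell_cutoff)
   show "?E (puncture_cutoff t n) z \<le> 3 * (\<Sum>a\<in>punctures t. ?E (bell_cutoff t n a) z)" for z
    using pt[of 1 z] pt[of \<i> z] by (simp add: sum.distrib)
  qed
  also have "\<dots> = 3 * (\<Sum>a\<in>punctures t. fint t (?E (bell_cutoff t n a)))"
   unfolding fint_cmult using fint_sum[of "punctures t" "%a. ?E (bell_cutoff t n a)" t] cont smooth_on_bell_cutoff by simp
  also have "\<dots> \<le> 3 * (\<Sum>a\<in>punctures t. C / real n)" using C[OF n] by (intro mult_left_mono sum_mono) auto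
  also have "\<dots> \<le> 3 * (3 * (C / real n))"
  proof -
   have "0 \<le> fint t (?E (bell_cutoff t n 0))"
    using fint_mono[of "%z. 0" "?E (bell_cutoff t n 0)" t] cont[OF smooth_on_bell_cutoff] fint_cmult[of t 0 "%z. 0"] by simp
   also have "\<dots> \<le> C / real n" using C[OF n, of 0] by (simp add: punctures_def)
   finally have "0 \<le> C / real n" .
   moreover have "real (card (punctures t)) \<le> 3" using card_punctures[of t] by linarith
   ultimately have "real (card (punctures t)) * (C / real n) \<le> 3 * (C / real n)" by (rule mult_right_mono[rotated])
   then show ?thesis by simp
  qed
  finally show ?thesis by simp
 qed
 moreover have "0 \<le> fint t (?E (puncture_cutoff t n))" for n
  using fint_mono[of "%z. 0" "?E (puncture_cutoff t n)" t] cont[OF smooth_on_puncture_cutoff] fint_cmult[of t 0 "%z. 0"] by simp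
 moreover have "(%n. 9 * C / real n) \<longlonglongrightarrow> 0" by (rule lim_const_over_n)
 ultimately show ?thesis
  using real_tendsto_sandwich[of "%n. 0" "%n. fint t (?E (puncture_cutoff t n))" sequentially "%n. 9 * C / real n" 0,
    OF always_eventually eventually_sequentiallyI[of 1]] by simp
qed

section \<open>The index form of a periodic potential\<close>

definition periodic_smooth :: "real => (complex => real) => bool" where
 "periodic_smooth t u \<longleftrightarrow> smooth_on (punctured_plane t) u \<and>
  (\<forall>z\<in>punctured_plane t. \<forall>l\<in>lattice t. u (z + l) = u z)"

definition near_punctures :: "real => real => complex set" where
 "near_punctures t s = {z. \<exists>a\<in>punctures t. bell t (z - a) < s}"

text \<open>Vanishing on a whole neighbourhood of the punctures, rather than merely at them, makes
  products with functions that are smooth only off the punctures smooth everywhere.\<close>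

definition tame :: "real => (complex => real) => bool" where
 "tame t f \<longleftrightarrow> smooth_on UNIV f \<and> (\<forall>z. \<forall>l\<in>lattice t. f (z + l) = f z) \<and>
  (\<exists>s>0. \<forall>z\<in>near_punctures t s. f z = 0)"

text \<open>The reflections here fix the origin; for periodic functions those through the centre of
  the period rectangle give the same signs.\<close>

definition has_parity :: "real => real => real => (complex => real) => bool" where
 "has_parity t p q u \<longleftrightarrow> (\<forall>z\<in>punctured_plane t. u (- cnj z) = p * u z \<and> u (cnj z) = q * u z)"

lemma open_near_punctures: "open (near_punctures t s)"
proof -
 have "continuous_on UNIV (%z. bell t (z - a))" for a unfolding bell_def by (intro continuous_intros)
 then have "open (\<Union>a\<in>punctures t. {z. bell t (z - a) < s})"
  by (intro open_UN ballI open_Collect_less continuous_intros)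
 moreover have "near_punctures t s = (\<Union>a\<in>punctures t. {z. bell t (z - a) < s})" by (auto simp: near_punctures_def)
 ultimately show ?thesis by simp
qed

lemma near_punctures_mono: "s \<le> s' ==> near_punctures t s \<subseteq> near_punctures t s'"
 unfolding near_punctures_def by force

lemma has_parity_mult: "has_parity t p q u ==> has_parity t p' q' v ==> has_parity t (p * p') (q * q') (%z. u z * v z)"
 by (simp add: has_parity_def mult_ac)

lemma has_parity_lincomb: "has_parity t p q u ==> has_parity t p q v ==> has_parity t p q (%z. u z + c * v z)"
 by (simp add: has_parity_def algebra_simps)

section \<open>Periodic functions on the punctured torus and their derivatives\<close>

locale puncture_torus =
 fixes t :: real
 assumes t: "t \<ge> 1"
begin

abbreviation "PP \<equiv> punctured_plane t"

lemma tame_continuous: "tame t f ==> continuous_on UNIV f"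
 by (simp add: tame_def smooth_on_continuous)

lemma t0: "t > 0" using t by simp

lemma open_PP: "open PP" using open_punctured_plane t by simp

lemma PP_Un: "s > 0 ==> PP \<union> near_punctures t s = UNIV"
proof -
 have "bell t z = 0" if "z \<in> lattice t" for z
  using bell_lattice[OF t0 that, of 0] by (simp add: bell_def)
 then show "s > 0 ==> PP \<union> near_punctures t s = UNIV"
  unfolding punctured_plane_alt near_punctures_def by force
qed

lemma tame_0: assumes "tame t f" "z \<notin> PP" shows "f z = 0"
proof -
 obtain s where s: "s > 0" "\<forall>z\<in>near_punctures t s. f z = 0" using assms(1) unfolding tame_def by blast
 then show ?thesis using PP_Un[OF s(1)] assms(2) by (intro bspec[OF s(2)]) auto
qed

lemma tame_periodic_smooth: "tame t f ==> periodic_smooth t f"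
 unfolding tame_def periodic_smooth_def using smooth_on_subset by blast

lemma periodic_smooth_differentiable: "periodic_smooth t u ==> z \<in> PP ==> (u has_derivative (%v. pd v u z)) (at z)"
 unfolding periodic_smooth_def by (intro smooth_on_has_derivative[of PP]) auto

lemma tame_differentiable: "tame t f ==> (f has_derivative (%v. pd v f z)) (at z)"
 unfolding tame_def by (intro smooth_on_has_derivative[of UNIV]) auto

lemma periodic_smooth_mult: "periodic_smooth t u ==> periodic_smooth t v ==> periodic_smooth t (%z. u z * v z)"
 unfolding periodic_smooth_def by (auto intro!: smooth_intros open_PP)

lemma periodic_smooth_lincomb: "periodic_smooth t u ==> periodic_smooth t v ==> periodic_smooth t (%z. u z + c * v z)"
 unfolding periodic_smooth_def by (auto intro!: smooth_intros open_PP)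

lemma pd_shift:
 assumes "(u has_derivative D) (at (z + l))" "open S" "z \<in> S" "\<And>z. z \<in> S ==> u (z + l) = u z"
 shows "pd v u (z + l) = pd v u z"
proof -
 have "((%z. u (z + l)) has_derivative D) (at z)"
  by (rule has_derivative_compose[of "%z. z + l" "%v. v", OF _ assms(1)]) (auto intro!: derivative_eq_intros)
 from pd_eqI[OF this] pd_cong_open[OF assms(2-4)] pd_eqI[OF assms(1)] show ?thesis by simp
qed

lemma periodic_smooth_pd: assumes "periodic_smooth t u" shows "periodic_smooth t (pd v u)"
 unfolding periodic_smooth_def
proof (intro conjI ballI)
 show "smooth_on PP (pd v u)" using assms unfolding periodic_smooth_def by (blast intro: smooth_on_pd)
 show "pd v u (z + l) = pd v u z" if "z \<in> PP" "l \<in> lattice t" for z l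
  using periodic_smooth_differentiable[OF assms, of "z + l"] that assms punctured_plane_add[OF that(2), of z]
  by (intro pd_shift[OF _ open_PP that(1)]) (auto simp: periodic_smooth_def)
qed

lemma tame_pd: assumes "tame t f" shows "tame t (pd v f)"
 unfolding tame_def
proof (intro conjI allI ballI)
 show "smooth_on UNIV (pd v f)" using assms unfolding tame_def by (blast intro: smooth_on_pd)
 show "pd v f (z + l) = pd v f z" if "l \<in> lattice t" for z l
  using assms that by (intro pd_shift[OF tame_differentiable[OF assms] open_UNIV]) (auto simp: tame_def)
 obtain s where s: "s > 0" "\<forall>z\<in>near_punctures t s. f z = 0" using assms unfolding tame_def by blast
 have "pd v f z = 0" if "z \<in> near_punctures t s" for z
  using pd_cong_open[OF open_near_punctures that, of f "%z. 0"] s(2) pd_eqI[OF has_derivative_const] by metis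
 then show "\<exists>s>0. \<forall>z\<in>near_punctures t s. pd v f z = 0" using s(1) by blast
qed

lemma tame_mult: assumes "tame t f" "periodic_smooth t u" shows "tame t (%z. f z * u z)"
 unfolding tame_def
proof (intro conjI allI ballI)
 obtain s where s: "s > 0" "\<forall>z\<in>near_punctures t s. f z = 0" using assms(1) unfolding tame_def by blast
 have "smooth_on PP f" using tame_periodic_smooth[OF assms(1)] by (simp add: periodic_smooth_def)
 then have 1: "smooth_on PP (%z. f z * u z)" using assms(2) unfolding periodic_smooth_def by (intro smooth_intros open_PP) auto
 have 2: "smooth_on (near_punctures t s) (%z. f z * u z)"
  by (rule smooth_on_cong[OF open_near_punctures _ smooth_on_const[of _ 0]]) (simp add: s)
 show "smooth_on UNIV (%z. f z * u z)"
  using smooth_on_open_Un[OF 1 2 open_PP open_near_punctures] unfolding PP_Un[OF s(1)] .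
 show "f (z + l) * u (z + l) = f z * u z" if l: "l \<in> lattice t" for z l
 proof (cases "z \<in> PP")
  case True
  then show ?thesis using assms l by (simp add: tame_def periodic_smooth_def)
 next
  case False
  then show ?thesis using tame_0[OF assms(1)] punctured_plane_add[OF l] by simp
 qed
 show "\<exists>s>0. \<forall>z\<in>near_punctures t s. f z * u z = 0" using s by auto
qed

lemma tame_lincomb: assumes "tame t f" "tame t g" shows "tame t (%z. f z + c * g z)"
 unfolding tame_def
proof (intro conjI allI ballI)
 show "smooth_on UNIV (%z. f z + c * g z)" using assms unfolding tame_def by (intro smooth_intros open_UNIV) auto
 show "f (z + l) + c * g (z + l) = f z + c * g z" if "l \<in> lattice t" for z l
  using assms that by (simp add: tame_def)
 obtain s where s: "s > 0" "\<forall>z\<in>near_punctures t s. f z = 0" using assms(1) unfolding tame_def by blast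
 obtain s' where s': "s' > 0" "\<forall>z\<in>near_punctures t s'. g z = 0" using assms(2) unfolding tame_def by blast
 have "f z + c * g z = 0" if "z \<in> near_punctures t (min s s')" for z
  using that s(2) s'(2) subsetD[OF near_punctures_mono, of "min s s'" s z t] subsetD[OF near_punctures_mono, of "min s s'" s' z t] by simp
 then show "\<exists>s>0. \<forall>z\<in>near_punctures t s. f z + c * g z = 0" using s(1) s'(1) by (intro exI[of _ "min s s'"]) auto
qed

lemma tame_test_functions: assumes "tame t f" shows "f \<in> test_functions t"
proof -
 obtain s where s: "s > 0" "\<forall>z\<in>near_punctures t s. f z = 0" using assms unfolding tame_def by blast
 define K where "K = cbox 0 (Complex 1 t) - near_punctures t s"
 have "compact K" unfolding K_def by (intro compact_diff compact_cbox open_near_punctures)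
 moreover have "K \<subseteq> PP" using PP_Un[OF s(1)] by (auto simp: K_def)
 moreover have "f z = 0" if z: "z \<notin> lattice_translates t K" for z
 proof -
  obtain l where l: "l \<in> lattice t" "z - l \<in> fund_domain t" using fund_domain_cover[OF t0] .
  have "z - l \<in> cbox 0 (Complex 1 t)"
   using l(2) by (auto simp: fund_domain_def cbox_def Basis_complex_def inner_complex_def)
  moreover have "z - l \<notin> K"
  proof
   assume "z - l \<in> K"
   then have "\<exists>z' l'. z = z' + l' \<and> z' \<in> K \<and> l' \<in> lattice t" using l(1) by (intro exI[of _ "z - l"] exI[of _ l]) simp
   then show False using z unfolding lattice_translates_def by blast
  qed
  ultimately have "f (z - l) = 0" using s(2) by (auto simp: K_def)
  moreover have "f (z - l + l) = f (z - l)" using assms l(1) by (simp only: tame_def)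
  ultimately show ?thesis by simp
 qed
 ultimately show ?thesis using assms unfolding test_functions_def tame_def by blast
qed

lemma tame_fint_pos:
 assumes "tame t G" "\<And>z. G z \<ge> 0" "G z0 \<noteq> 0" shows "fint t G > 0"
proof -
 note c = tame_continuous[OF assms(1)]
 have "fint t G \<ge> 0" using fint_mono[of "%z. 0" G t] c assms(2) fint_cmult[of t 0 "%z. 0"] by simp
 moreover have "fint t G \<noteq> 0"
 proof
  assume 0: "fint t G = 0"
  have "G z = 0" if "z \<in> box 0 (Complex 1 t)" for z
   using that by (intro fint_eq_0_D[OF c assms(2) 0]) (auto simp: box_def Basis_complex_def inner_complex_def)
  moreover have "box 0 (Complex 1 t) \<noteq> {}"
   using t by (simp add: box_ne_empty Basis_complex_def inner_complex_def)
  then have "closure (box 0 (Complex 1 t)) = cbox 0 (Complex 1 t)" by (rule closure_box)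
  ultimately have cb: "G z = 0" if "z \<in> cbox 0 (Complex 1 t)" for z
   using continuous_constant_on_closure[of "box 0 (Complex 1 t)" G 0 z] continuous_on_subset[OF c] that by simp
  obtain l where l: "l \<in> lattice t" "z0 - l \<in> fund_domain t" using fund_domain_cover[OF t0] .
  then have "G (z0 - l) = 0" by (intro cb) (auto simp: fund_domain_def cbox_def Basis_complex_def inner_complex_def)
  moreover have "G (z0 - l + l) = G (z0 - l)" using assms l(1) by (simp only: tame_def)
  ultimately show False using assms(3) by simp
 qed
 ultimately show ?thesis by simp
qed

lemma pd_mult_tame:
 assumes "tame t f" "periodic_smooth t u"
 shows "pd v (%z. f z * u z) z = pd v f z * u z + f z * pd v u z"
proof (cases "z \<in> PP")
 case True
 have "((%z. f z * u z) has_derivative (%v. f z * pd v u z + pd v f z * u z)) (at z)"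
  by (intro has_derivative_mult tame_differentiable assms periodic_smooth_differentiable True)
 from pd_eqI[OF this] show ?thesis by simp
next
 case False
 then have "f z = 0" "pd v f z = 0" "pd v (%z. f z * u z) z = 0"
  using tame_0[OF assms(1)] tame_0[OF tame_pd[OF assms(1)]] tame_0[OF tame_pd[OF tame_mult[OF assms]]] by auto
 then show ?thesis by simp
qed

lemma fint_pd_tame:
 assumes "tame t W" "v \<in> {1, \<i>}" shows "fint t (pd v W) = 0"
proof (rule fint_pd_periodic)
 show "continuous_on UNIV (pd v W)" by (intro tame_continuous tame_pd assms)
 show "W differentiable at z" for z using tame_differentiable[OF assms(1)] by (auto simp: differentiable_def)
 show "v = 1 \<and> (\<forall>z. W (z + 1) = W z) \<or> v = \<i> \<and> (\<forall>z. W (z + \<i> * complex_of_real t) = W z)"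
  using assms lattice_1 lattice_it unfolding tame_def by blast
qed (use t in simp)

lemma has_parity_pd:
 assumes u: "periodic_smooth t u" and par: "has_parity t p q u"
 shows "has_parity t (- p) q (pd 1 u)" "has_parity t p (- q) (pd \<i> u)"
proof -
 have *: "pd v u (- cnj z) = p * pd (- cnj v) u z \<and> pd v u (cnj z) = q * pd (cnj v) u z" if z: "z \<in> PP" for z v
 proof -
  have d: "(u has_derivative (%v. pd v u (- cnj z))) (at (- cnj z))" "(u has_derivative (%v. pd v u (cnj z))) (at (cnj z))"
   using z punctured_plane_reflect by (auto intro!: periodic_smooth_differentiable u)
  have du: "(u has_derivative (%v. pd v u z)) (at z)" by (rule periodic_smooth_differentiable[OF u z])
  have "((%z. u (- cnj z)) has_derivative (%v. pd (- cnj v) u (- cnj z))) (at z)"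
   by (rule has_derivative_compose[of "%z. - cnj z" "%v. - cnj v" z UNIV u, OF _ d(1)]) (auto intro!: derivative_eq_intros)
  moreover have "((%z. p * u z) has_derivative (%v. p * pd v u z)) (at z)" by (intro has_derivative_mult_right du)
  ultimately have 1: "pd (- cnj v) u (- cnj z) = p * pd v u z" for v
   using pd_cong_open[OF open_PP z, of "%z. u (- cnj z)" "%z. p * u z" v] par
   by (simp add: pd_eqI has_parity_def)
  have "((%z. u (cnj z)) has_derivative (%v. pd (cnj v) u (cnj z))) (at z)"
   by (rule has_derivative_compose[of cnj cnj z UNIV u, OF _ d(2)]) (auto intro!: derivative_eq_intros)
  moreover have "((%z. q * u z) has_derivative (%v. q * pd v u z)) (at z)" by (intro has_derivative_mult_right du)
  ultimately have 2: "pd (cnj v) u (cnj z) = q * pd v u z" for v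
   using pd_cong_open[OF open_PP z, of "%z. u (cnj z)" "%z. q * u z" v] par
   by (simp add: pd_eqI has_parity_def)
  show ?thesis using 1[of "- cnj v"] 2[of "cnj v"] by simp
 qed
 have neg: "pd (- v) u z = - pd v u z" if "z \<in> PP" for v z
  using linear_neg[OF has_derivative_linear[OF periodic_smooth_differentiable[OF u that]]] .
 show "has_parity t (- p) q (pd 1 u)" "has_parity t p (- q) (pd \<i> u)"
  unfolding has_parity_def using * neg by auto
qed

lemma has_parity_lap:
 assumes "periodic_smooth t u" "has_parity t p q u" shows "has_parity t p q (lap u)"
 using has_parity_pd(1)[OF periodic_smooth_pd has_parity_pd(1)[OF assms], OF assms(1)]
  has_parity_pd(2)[OF periodic_smooth_pd has_parity_pd(2)[OF assms], OF assms(1)]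
 unfolding has_parity_def lap_def by (simp add: distrib_left)

end

section \<open>The index form as a bilinear form\<close>

locale torus_potential = puncture_torus +
 fixes V :: "complex => real"
 assumes V: "periodic_smooth t V" "has_parity t 1 1 V"
begin

text \<open>The polarised index form in a conformal coordinate: the Dirichlet integral is
  conformally invariant, and \<open>V\<close> will be -2 times the Gauss curvature times the area
  density. Only one argument has to be tame, so fields on the whole punctured torus can be paired
  with test functions.\<close>

definition B :: "(complex => real) => (complex => real) => real" where
 "B u f = fint t (%z. pd 1 f z * pd 1 u z + pd \<i> f z * pd \<i> u z - f z * (V z * u z))"

definition J :: "(complex => real) => complex => real" where
 "J u z = lap u z + V z * u z"

lemma periodic_smooth_J: assumes "periodic_smooth t u" shows "periodic_smooth t (J u)"
proof -
 have "periodic_smooth t (%z. (pd 1 (pd 1 u) z + 1 * pd \<i> (pd \<i> u) z) + 1 * (V z * u z))"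
  by (intro periodic_smooth_lincomb periodic_smooth_mult periodic_smooth_pd assms V)
 then show ?thesis by (simp add: J_def[abs_def] lap_def[abs_def])
qed

lemma has_parity_J: assumes "periodic_smooth t u" "has_parity t p q u" shows "has_parity t p q (J u)"
proof -
 have "has_parity t (1 * p) (1 * q) (%z. V z * u z)" by (intro has_parity_mult V assms)
 then show ?thesis using has_parity_lap[OF assms] by (simp add: has_parity_def J_def[abs_def] distrib_left)
qed

lemma B_integrand_tame:
 assumes "periodic_smooth t u" "tame t f"
 shows "tame t (%z. pd 1 f z * pd 1 u z + pd \<i> f z * pd \<i> u z - f z * (V z * u z))"
proof -
 have "tame t (%z. (pd 1 f z * pd 1 u z + 1 * (pd \<i> f z * pd \<i> u z)) + (-1) * (f z * (V z * u z)))"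
  by (intro tame_lincomb tame_mult tame_pd periodic_smooth_mult periodic_smooth_pd assms V)
 then show ?thesis by simp
qed

lemma B_eq: assumes u: "periodic_smooth t u" and f: "tame t f" shows "B u f = - fint t (%z. f z * J u z)"
proof -
 define W where "W = (%v z. f z * pd v u z)"
 have W: "tame t (W v)" for v unfolding W_def by (intro tame_mult periodic_smooth_pd f u)
 have Wd: "pd v (W w) z = pd v f z * pd w u z + f z * pd v (pd w u) z" for v w z
  unfolding W_def by (intro pd_mult_tame periodic_smooth_pd f u)
 have c: "continuous_on UNIV (pd v (W w))" "continuous_on UNIV (%z. f z * J u z)" for v w
  by (intro tame_continuous tame_pd tame_mult W f u periodic_smooth_J)+
 have "B u f = fint t (%z. (pd 1 (W 1) z + pd \<i> (W \<i>) z) + (-1) * (f z * J u z))"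
  unfolding B_def Wd J_def lap_def by (simp add: algebra_simps)
 also have "\<dots> = (fint t (pd 1 (W 1)) + fint t (pd \<i> (W \<i>))) + (-1) * fint t (%z. f z * J u z)"
  unfolding fint_cmult[symmetric] by (simp only: fint_add c continuous_on_add continuous_on_mult_left)
 finally show ?thesis using fint_pd_tame[OF W] by simp
qed

lemma B_commute: "B f g = B g f"
 unfolding B_def by (simp add: mult_ac)

lemma B_lincomb_right:
 assumes "periodic_smooth t u" "tame t f" "tame t g"
 shows "B u (%z. f z + c * g z) = B u f + c * B u g"
proof -
 have "pd v (%z. f z + c * g z) z = pd v f z + c * pd v g z" for v z
  by (rule pd_eqI, intro has_derivative_add has_derivative_mult_right tame_differentiable assms)
 then have "B u (%z. f z + c * g z) = fint t (%z. (pd 1 f z * pd 1 u z + pd \<i> f z * pd \<i> u z - f z * (V z * u z))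
   + c * (pd 1 g z * pd 1 u z + pd \<i> g z * pd \<i> u z - g z * (V z * u z)))"
  unfolding B_def by (simp add: algebra_simps)
 then show ?thesis unfolding B_def fint_cmult[symmetric]
  by (simp only: fint_add tame_continuous B_integrand_tame assms continuous_on_mult_left)
qed

lemma B_lincomb_left:
 assumes u: "periodic_smooth t u" "periodic_smooth t w" and f: "tame t f"
 shows "B (%z. u z + c * w z) f = B u f + c * B w f"
proof -
 have d: "f z = 0 \<and> (\<forall>v. pd v f z = 0) \<or> (\<forall>v. pd v (%z. u z + c * w z) z = pd v u z + c * pd v w z)" for z
 proof (cases "z \<in> PP")
  case True
  then have "pd v (%z. u z + c * w z) z = pd v u z + c * pd v w z" for v
   by (intro pd_eqI, intro has_derivative_add has_derivative_mult_right periodic_smooth_differentiable u) auto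
  then show ?thesis by blast
 next
  case False
  then show ?thesis using tame_0[OF f] tame_0[OF tame_pd[OF f]] by blast
 qed
 have "pd 1 f z * pd 1 (%z. u z + c * w z) z + pd \<i> f z * pd \<i> (%z. u z + c * w z) z - f z * (V z * (u z + c * w z))
  = (pd 1 f z * pd 1 u z + pd \<i> f z * pd \<i> u z - f z * (V z * u z))
   + c * (pd 1 f z * pd 1 w z + pd \<i> f z * pd \<i> w z - f z * (V z * w z))" for z
  using d[of z] by (elim disjE conjE) (simp_all add: algebra_simps)
 then show ?thesis unfolding B_def fint_cmult[symmetric]
  by (simp only: fint_add tame_continuous B_integrand_tame u f continuous_on_mult_left)
qed

text \<open>The integrand changes sign under one of the reflections, while its integral is
  invariant.\<close>

lemma B_parity:
 assumes u: "periodic_smooth t u" "has_parity t p q u" and f: "tame t f" "has_parity t p' q' f"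
  and ne: "p * p' = -1 \<or> q * q' = -1"
 shows "B u f = 0"
proof -
 define G where "G = (%z. pd 1 f z * pd 1 u z + pd \<i> f z * pd \<i> u z - f z * (V z * u z))"
 have G: "tame t G" unfolding G_def by (intro B_integrand_tame u f)
 note P = has_parity_pd[OF u] has_parity_pd[OF tame_periodic_smooth[OF f(1)] f(2)] u(2) f(2) V(2)
 have "has_parity t (p * p') (q * q') G"
  using P unfolding has_parity_def G_def by (simp add: algebra_simps)
 moreover have "G (- cnj z) = 0 \<and> G (cnj z) = 0 \<and> G z = 0" if "z \<notin> PP" for z
  using that tame_0[OF G] punctured_plane_reflect[of z t] by blast
 ultimately have "G (- cnj z) = p * p' * G z" "G (cnj z) = q * q' * G z" for z
  unfolding has_parity_def by (cases "z \<in> PP"; simp)+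
 moreover have "fint t (%z. G (- cnj z)) = fint t G" "fint t (%z. G (cnj z)) = fint t G"
  using G lattice_1 lattice_it by (intro fint_reflect tame_continuous; simp add: tame_def)+
 ultimately have "p * p' * fint t G = fint t G" "q * q' * fint t G = fint t G"
  by (simp_all only: fint_cmult)
 then have "fint t G = 0" using ne by auto
 then show ?thesis by (simp add: B_def G_def)
qed

text \<open>The energy of \<open>f u\<close> differs from that of \<open>u\<close> tested with
  \<open>f\<^sup>2 u\<close> exactly by the gradient term of \<open>f\<close>. For fields whose
  products with their images under \<open>J\<close> sum to zero, only the energy of the cutoff
  survives.\<close>

lemma B_square:
 assumes f: "tame t f" and u: "periodic_smooth t u"
 shows "B (%z. f z * u z) (%z. f z * u z) =
  fint t (%z. ((pd 1 f z)\<^sup>2 + (pd \<i> f z)\<^sup>2) * (u z)\<^sup>2) - fint t (%z. (f z)\<^sup>2 * (u z * J u z))"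
proof -
 define g where "g = (%z. f z * (f z * u z))"
 have fu: "periodic_smooth t (%z. f z * u z)" by (intro tame_periodic_smooth tame_mult f u)
 have g: "tame t g" unfolding g_def by (intro tame_mult f fu)
 have g': "pd v g z = pd v f z * (f z * u z) + f z * (pd v f z * u z + f z * pd v u z)" for v z
  unfolding g_def by (simp only: pd_mult_tame[OF f fu] pd_mult_tame[OF f u])
 have E: "tame t (%z. pd v f z * (pd v f z * (u z * u z)))" for v
  by (intro tame_mult tame_pd f periodic_smooth_mult tame_periodic_smooth u)
 have "B (%z. f z * u z) (%z. f z * u z) = fint t (%z. ((pd 1 f z)\<^sup>2 + (pd \<i> f z)\<^sup>2) * (u z)\<^sup>2
   + (pd 1 g z * pd 1 u z + pd \<i> g z * pd \<i> u z - g z * (V z * u z)))"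
  unfolding B_def pd_mult_tame[OF f u] g' by (simp add: g_def power2_eq_square algebra_simps)
 also have "\<dots> = fint t (%z. ((pd 1 f z)\<^sup>2 + (pd \<i> f z)\<^sup>2) * (u z)\<^sup>2) + B u g"
  unfolding B_def
 proof (rule fint_add)
  show "continuous_on UNIV (%z. ((pd 1 f z)\<^sup>2 + (pd \<i> f z)\<^sup>2) * (u z)\<^sup>2)"
   using tame_continuous[OF tame_lincomb[OF E[of 1] E[of \<i>], of 1]] by (simp add: power2_eq_square algebra_simps)
 qed (intro tame_continuous B_integrand_tame u g)
 also have "B u g = - fint t (%z. (f z)\<^sup>2 * (u z * J u z))"
  unfolding B_eq[OF u g] by (simp add: g_def power2_eq_square mult_ac)
 finally show ?thesis by simp
qed

text \<open>On the open set where \<open>g\<close> is nonzero the functions \<open>f u\<close> and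
  \<open>u\<close> coincide, hence so do their images under \<open>J\<close>.\<close>

lemma B_cutoff:
 assumes f: "tame t f" and u: "periodic_smooth t u" and g: "tame t g" and 1: "\<And>z. g z \<noteq> 0 ==> f z = 1"
 shows "B (%z. f z * u z) g = B u g"
proof -
 define S where "S = {z. g z \<noteq> 0}"
 have S: "open S" unfolding S_def using tame_continuous[OF g] by (intro open_Collect_neq) auto
 have "g z * J (%z. f z * u z) z = g z * J u z" for z
 proof (cases "z \<in> S")
  case True
  have e: "f x * u x = u x" if "x \<in> S" for x using that 1 by (simp add: S_def)
  have "pd v (pd v (%z. f z * u z)) z = pd v (pd v u) z" for v
   by (intro pd_cong_open[OF S True] pd_cong_open[OF S]) (simp_all add: e)
  then show ?thesis using e[OF True] by (simp add: J_def lap_def)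
 qed (simp add: S_def)
 then show ?thesis unfolding B_eq[OF u g] B_eq[OF tame_periodic_smooth[OF tame_mult[OF f u]] g] by (simp only:)
qed

end

text \<open>This expression is the derivative of tanh, namely 1/cosh^2. The last bound, from cosh w
  \<ge> |w|/2, controls steep approximations of the sign function in
  \<open>parity_flip\<close>.\<close>

lemma one_minus_tanh_square:
 fixes w :: real shows "1 - (tanh w)\<^sup>2 \<ge> 0" "1 - (tanh w)\<^sup>2 \<le> 1" "w\<^sup>2 * (1 - (tanh w)\<^sup>2) \<le> 4"
proof -
 have "\<bar>tanh w\<bar> < 1" using tanh_real_bounds[of w] by (simp add: abs_if)
 then show "1 - (tanh w)\<^sup>2 \<ge> 0" "1 - (tanh w)\<^sup>2 \<le> 1" by (simp_all add: abs_square_le_1)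
 have "cosh w \<noteq> 0" using cosh_real_ge_1[of w] by linarith
 then have "1 - (tanh w)\<^sup>2 = ((cosh w)\<^sup>2 - (sinh w)\<^sup>2) / (cosh w)\<^sup>2"
  by (simp add: tanh_def power_divide diff_divide_distrib)
 moreover have "(cosh w)\<^sup>2 - (sinh w)\<^sup>2 = 1" by (simp add: cosh_square_eq)
 ultimately have e: "1 - (tanh w)\<^sup>2 = 1 / (cosh w)\<^sup>2" by (simp only:)
 have "2 * cosh w = exp w + exp (- w)" by (simp add: cosh_def)
 then have "\<bar>w\<bar> \<le> 2 * cosh w"
  using exp_ge_add_one_self[of w] exp_ge_add_one_self[of "- w"] exp_gt_zero[of w] exp_gt_zero[of "- w"] by linarith
 then have "w\<^sup>2 \<le> (2 * cosh w)\<^sup>2" by (metis abs_ge_zero power2_abs power_mono)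
 then show "w\<^sup>2 * (1 - (tanh w)\<^sup>2) \<le> 4" unfolding e using \<open>cosh w \<noteq> 0\<close> by (simp add: field_simps)
qed

lemma smooth_on_tanh [smooth_intros]:
 fixes f :: "complex => real"
 assumes "open S" "smooth_on S f" shows "smooth_on S (%z. tanh (f z))"
proof -
 have "smooth_on S (%z. 1 - 2 * inverse (exp (2 * f z) + 1))"
  using assms by (intro smooth_intros) (auto simp: add_pos_pos less_imp_neq[symmetric])
 moreover have "1 - 2 * inverse (exp (2 * x) + 1) = tanh x" for x :: real
 proof -
  define y where "y = exp (2 * x)"
  have "y > 0" "exp (- 2 * x) = inverse y" by (simp_all add: y_def exp_minus)
  moreover from this have "1 - 2 * inverse (y + 1) = (1 - inverse y) / (1 + inverse y)" by (simp add: divide_simps)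
  ultimately show ?thesis unfolding tanh_real_altdef y_def by simp
 qed
 ultimately show ?thesis by simp
qed

section \<open>Passage to the limit with cutoffs\<close>

lemma fint_tendsto:
 assumes F: "\<And>n. continuous_on UNIV (F n)" "continuous_on UNIV G" and lim: "\<And>z. (%n. F n z) \<longlonglongrightarrow> G z"
  and bd: "\<And>n z. \<bar>F n z\<bar> \<le> C"
 shows "(%n. fint t (F n)) \<longlonglongrightarrow> fint t G"
 unfolding fint_def set_lebesgue_integral_def
proof (rule integral_dominated_convergence[where w = "%z. indicator (fund_domain t) z *\<^sub>R C"])
 show "integrable lborel (%z. indicator (fund_domain t) z *\<^sub>R C)"
  using set_integrable_fund_domain[of "%z. C" t] by (simp add: set_integrable_def)
 show "(%z. indicator (fund_domain t) z *\<^sub>R G z) \<in> borel_measurable lborel"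
  "\<And>n. (%z. indicator (fund_domain t) z *\<^sub>R F n z) \<in> borel_measurable lborel"
  using F set_integrable_fund_domain unfolding set_integrable_def by blast+
qed (use lim bd in \<open>auto intro!: tendsto_intros simp: indicator_def\<close>)

context puncture_torus
begin

lemma tame_bounded: assumes "tame t g" obtains M where "\<And>z. \<bar>g z\<bar> \<le> M"
proof -
 have "bounded (g ` cbox 0 (Complex 1 t))"
  by (intro compact_imp_bounded compact_continuous_image compact_cbox continuous_on_subset[OF tame_continuous[OF assms]]) auto
 then obtain M where M: "\<forall>z\<in>cbox 0 (Complex 1 t). \<bar>g z\<bar> \<le> M" unfolding bounded_iff by auto
 have "\<bar>g z\<bar> \<le> M" for z
 proof -
  obtain l where l: "l \<in> lattice t" "z - l \<in> fund_domain t" using fund_domain_cover[OF t0] .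
  then have "\<bar>g (z - l)\<bar> \<le> M" by (intro bspec[OF M]) (auto simp: fund_domain_def cbox_def Basis_complex_def inner_complex_def)
  moreover have "g (z - l + l) = g (z - l)" using assms l(1) by (simp only: tame_def)
  ultimately show ?thesis by simp
 qed
 then show ?thesis using that by blast
qed

lemma tame_puncture_cutoff: "tame t (puncture_cutoff t n)"
 unfolding tame_def
proof (intro conjI allI ballI smooth_on_puncture_cutoff exI[of _ "1 / 4 ^ (2 * n)"])
 show "puncture_cutoff t n z = 0" if "z \<in> near_punctures t (1 / 4 ^ (2 * n))" for z
  using that puncture_cutoff_props(6)[OF t0] unfolding near_punctures_def by blast
qed (use puncture_cutoff_props(1)[OF t0] in auto)

lemma eventually_inverse_power4: "s > 0 ==> \<forall>\<^sub>F n in sequentially. (1::real) / 4 ^ n \<le> s"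
proof -
 have "(%n. (1/4::real) ^ n) \<longlonglongrightarrow> 0" by (rule LIMSEQ_power_zero) simp
 then show "s > 0 ==> \<forall>\<^sub>F n in sequentially. (1::real) / 4 ^ n \<le> s"
  using order_tendstoD(2)[of _ 0 sequentially s] by (force simp: power_one_over elim: eventually_mono)
qed

lemma puncture_cutoff_eventually_1:
 assumes "tame t g"
 shows "\<forall>\<^sub>F n in sequentially. \<forall>z. g z \<noteq> 0 \<longrightarrow> puncture_cutoff t n z = 1"
proof -
 obtain s where s: "s > 0" "\<forall>z\<in>near_punctures t s. g z = 0" using assms unfolding tame_def by blast
 show ?thesis using eventually_inverse_power4[OF s(1)] eventually_gt_at_top[of 0]
 proof eventually_elim
  case (elim n)
  show ?case
  proof (intro allI impI puncture_cutoff_props(7)[OF t0 elim(2)])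
   fix z a assume "g z \<noteq> 0" "a \<in> punctures t"
   then show "1 / 4 ^ n \<le> bell t (z - a)" using s(2) elim(1) unfolding near_punctures_def by force
  qed
 qed
qed

lemma puncture_cutoff_eventually_1_at:
 assumes "z \<in> PP" shows "\<forall>\<^sub>F n in sequentially. puncture_cutoff t n z = 1"
proof -
 define s where "s = Min ((%a. bell t (z - a)) ` punctures t)"
 have ne: "punctures t \<noteq> {}" by (simp add: punctures_def)
 have "s > 0" unfolding s_def using assms finite_punctures ne bell_pos[OF t0]
  by (subst Min_gr_iff) (auto simp: punctured_plane_alt)
 from eventually_inverse_power4[OF this] eventually_gt_at_top[of 0] show ?thesis
 proof eventually_elim
  case (elim n)
  have "s \<le> bell t (z - a)" if "a \<in> punctures t" for a
   unfolding s_def using that finite_punctures by (intro Min_le) auto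
  then show ?case using elim by (intro puncture_cutoff_props(7)[OF t0 elim(2)]) force
 qed
qed

lemma has_parity_puncture_cutoff: "has_parity t 1 1 (puncture_cutoff t n)"
 unfolding has_parity_def using puncture_cutoff_props(2,3)[OF t0] by simp

end

section \<open>Families of negative directions and their extension\<close>

context torus_potential
begin

text \<open>Mutual orthogonality reduces negative definiteness on the span to the diagonal, and the
  definite parities make orthogonality to most fields automatic.\<close>

definition negative_family :: "nat => (nat => complex => real) => (nat => real) => (nat => real) => bool" where
 "negative_family N \<psi> p q \<longleftrightarrow> (\<forall>i<N. tame t (\<psi> i) \<and> has_parity t (p i) (q i) (\<psi> i) \<and> p i \<in> {1, -1} \<and> q i \<in> {1, -1} \<and>
  B (\<psi> i) (\<psi> i) < 0 \<and> (\<forall>j<N. i \<noteq> j \<longrightarrow> B (\<psi> i) (\<psi> j) = 0))"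

definition extendable :: "nat => (nat => complex => real) => bool" where
 "extendable N \<psi> \<longleftrightarrow> (\<exists>f p q. tame t f \<and> has_parity t p q f \<and> p \<in> {1, -1} \<and> q \<in> {1, -1} \<and> B f f < 0 \<and>
  (\<forall>i<N. B f (\<psi> i) = 0))"

lemma negative_family_extend:
 assumes "negative_family N \<psi> p q" "extendable N \<psi>"
 shows "\<exists>\<psi> p q. negative_family (Suc N) \<psi> p q"
proof -
 obtain f r s where f: "tame t f" "has_parity t r s f" "r \<in> {1, -1}" "s \<in> {1, -1}" "B f f < 0" "\<forall>i<N. B f (\<psi> i) = 0"
  using assms(2) unfolding extendable_def by blast
 moreover have "\<forall>i<N. B (\<psi> i) f = 0" using f(6) by (simp only: B_commute[of _ f])
 ultimately have "negative_family (Suc N) (\<psi>(N := f)) (p(N := r)) (q(N := s))"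
  using assms(1) unfolding negative_family_def by (auto simp: less_Suc_eq)
 then show ?thesis by blast
qed

lemma negative_family_definite:
 assumes fam: "negative_family N \<psi> p q" and c: "\<exists>i<N. c i \<noteq> 0"
 defines "f \<equiv> %z. \<Sum>i<N. c i * \<psi> i z"
 shows "tame t f" "B f f < 0"
proof -
 define g where "g = (%n z. \<Sum>i<n. c i * \<psi> i z)"
 have gS: "g (Suc n) = (%z. g n z + c n * \<psi> n z)" for n by (simp add: g_def)
 have tm: "tame t (g n)" if "n \<le> N" for n
  using that
 proof (induction n)
  case 0
  show ?case unfolding g_def tame_def by (auto intro!: smooth_intros exI[of _ 1])
 next
  case (Suc n)
  then show ?case unfolding gS using fam by (intro tame_lincomb) (auto simp: negative_family_def)
 qed
 then show "tame t f" by (simp add: f_def g_def)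
 have B0: "B u (g 0) = 0" for u by (simp add: B_def g_def pd_eqI[OF has_derivative_const] fint_def)
 have Bj: "B u (g n) = (\<Sum>i<n. c i * B u (\<psi> i))" if "n \<le> N" "periodic_smooth t u" for n u
  using that(1)
 proof (induction n)
  case (Suc n)
  then have "tame t (\<psi> n)" using fam by (simp add: negative_family_def)
  with Suc show ?case unfolding gS by (simp add: B_lincomb_right tm that)
 qed (simp add: B0)
 have "B f f = (\<Sum>i<N. c i * (c i * B (\<psi> i) (\<psi> i)))"
 proof -
  have "B (\<psi> i) f = c i * B (\<psi> i) (\<psi> i)" if "i < N" for i
  proof -
   have "B (\<psi> i) (g N) = (\<Sum>j<N. c j * B (\<psi> i) (\<psi> j))"
    using fam that by (intro Bj tame_periodic_smooth) (auto simp: negative_family_def)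
   also have "\<dots> = (\<Sum>j<N. if j = i then c i * B (\<psi> i) (\<psi> i) else 0)"
    using fam that by (intro sum.cong) (auto simp: negative_family_def)
   finally show ?thesis using that by (simp add: f_def g_def)
  qed
  moreover have "B f (g N) = (\<Sum>i<N. c i * B f (\<psi> i))"
   using tm[of N] by (intro Bj tame_periodic_smooth) (auto simp: f_def g_def)
  moreover have "f = g N" by (simp add: f_def g_def)
  ultimately show ?thesis by (simp add: B_commute[of "g N" "\<psi> _"])
 qed
 also have "\<dots> < (\<Sum>i<N. 0)"
 proof -
  have le: "c i * (c i * B (\<psi> i) (\<psi> i)) \<le> 0" if "i < N" for i
   using fam that unfolding negative_family_def mult.assoc[symmetric] by (auto intro!: mult_nonneg_nonpos)
  obtain i where i: "i < N" "c i \<noteq> 0" using c by blast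
  have "c i * c i * B (\<psi> i) (\<psi> i) < 0"
   using fam i unfolding negative_family_def by (intro mult_pos_neg) (auto simp: zero_less_mult_iff not_less_iff_gr_or_eq)
  then show ?thesis using le i by (intro sum_strict_mono_ex1) (auto simp: mult.assoc)
 qed
 finally show "B f f < 0" by simp
qed

text \<open>Gram-Schmidt without leaving a parity class: members of another parity are already
  orthogonal and receive coefficient 0. The last clause holds because only multiples of members of
  the family are added.\<close>

lemma orthogonal_projection:
 assumes fam: "negative_family N \<psi> p q" and \<zeta>: "tame t \<zeta>" "has_parity t r s \<zeta>" "r \<in> {1, -1}" "s \<in> {1, -1}" and "n \<le> N"
 shows "\<exists>\<xi>. tame t \<xi> \<and> has_parity t r s \<xi> \<and> (\<forall>i<n. B \<xi> (\<psi> i) = 0) \<and>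
  (\<forall>u. periodic_smooth t u \<and> (\<forall>i<n. B u (\<psi> i) = 0) \<longrightarrow> B u \<xi> = B u \<zeta>)"
 using \<open>n \<le> N\<close>
proof (induction n)
 case 0
 show ?case using \<zeta> by (intro exI[of _ \<zeta>]) simp
next
 case (Suc n)
 then obtain \<xi> where \<xi>: "tame t \<xi>" "has_parity t r s \<xi>" "\<forall>i<n. B \<xi> (\<psi> i) = 0"
  "\<forall>u. periodic_smooth t u \<and> (\<forall>i<n. B u (\<psi> i) = 0) \<longrightarrow> B u \<xi> = B u \<zeta>" by auto
 have n: "tame t (\<psi> n)" "has_parity t (p n) (q n) (\<psi> n)" "p n \<in> {1, -1}" "q n \<in> {1, -1}" "B (\<psi> n) (\<psi> n) \<noteq> 0"
  "\<forall>i<n. B (\<psi> n) (\<psi> i) = 0"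
  using fam[unfolded negative_family_def, rule_format, of n] Suc.prems by auto
 define c where "c = - (B \<xi> (\<psi> n) / B (\<psi> n) (\<psi> n))"
 show ?case
 proof (intro exI[of _ "%z. \<xi> z + c * \<psi> n z"] conjI allI impI)
  show "tame t (%z. \<xi> z + c * \<psi> n z)" by (intro tame_lincomb \<xi> n)
  show "has_parity t r s (%z. \<xi> z + c * \<psi> n z)"
  proof (cases "p n = r \<and> q n = s")
   case True
   then show ?thesis using n \<xi> by (intro has_parity_lincomb) auto
  next
   case False
   then have "r * p n = -1 \<or> s * q n = -1" using n \<zeta> by auto
   then have "B \<xi> (\<psi> n) = 0" by (intro B_parity[OF tame_periodic_smooth[OF \<xi>(1)] \<xi>(2) n(1,2)])
   then show ?thesis using \<xi>(2) by (simp add: c_def)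
  qed
  show "B (%z. \<xi> z + c * \<psi> n z) (\<psi> i) = 0" if "i < Suc n" for i
  proof -
   have "tame t (\<psi> i)" using fam Suc.prems that unfolding negative_family_def by auto
   then have "B (%z. \<xi> z + c * \<psi> n z) (\<psi> i) = B \<xi> (\<psi> i) + c * B (\<psi> n) (\<psi> i)"
    by (intro B_lincomb_left tame_periodic_smooth \<xi> n)
   then show ?thesis using that \<xi>(3) n(5,6) by (cases "i = n") (auto simp: c_def)
  qed
  show "B u (%z. \<xi> z + c * \<psi> n z) = B u \<zeta>" if u: "periodic_smooth t u \<and> (\<forall>i<Suc n. B u (\<psi> i) = 0)" for u
  proof -
   have "B u \<xi> = B u \<zeta>" using u by (intro mp[OF spec[OF \<xi>(4)]]) auto
   moreover have "B u (\<psi> n) = 0" using u by blast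
   ultimately show ?thesis using B_lincomb_right[of u \<xi> "\<psi> n" c] u \<xi>(1) n(1) by simp
  qed
 qed
qed

text \<open>If no extension existed, then \<open>Q(\<eta> u\<^sub>j + \<epsilon> \<xi>) \<ge> 0\<close> for the cutoffs \<open>\<eta>\<close> and all \<open>\<epsilon>\<close>, where \<open>\<xi>\<close> is the projection of a
 cut-off \<open>J u\<^sub>j\<close>; but \<open>Q(\<eta> u\<^sub>j)\<close> tends to \<open>0\<close> while the cross term is a negative multiple of \<open>\<epsilon>\<close>.\<close>

lemma jacobi_sections_extend:
 fixes u :: "3 => complex => real"
 assumes fam: "negative_family N \<psi> p q"
  and u: "\<And>j. periodic_smooth t (u j)" "\<And>j. has_parity t (r j) (s j) (u j)" "\<And>j. r j \<in> {1, -1}" "\<And>j. s j \<in> {1, -1}"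
  and M: "\<And>j z. z \<in> PP ==> \<bar>u j z\<bar> \<le> M"
  and sum0: "\<And>z. z \<in> PP ==> (\<Sum>j\<in>UNIV. u j z * J (u j) z) = 0"
  and orth: "\<And>i j. i < N ==> B (u j) (\<psi> i) = 0"
  and z0: "z0 \<in> PP" "J (u k) z0 \<noteq> 0"
 shows "extendable N \<psi>"
proof (rule ccontr)
 assume ne: "\<not> extendable N \<psi>"
 have ge0: "B f f \<ge> 0" if "tame t f" "has_parity t (r j) (s j) f" "\<forall>i<N. B f (\<psi> i) = 0" for f j
  using ne that u(3,4)[of j] unfolding extendable_def by (meson not_less)
 let ?\<eta> = "puncture_cutoff t"
 note \<eta> = tame_puncture_cutoff
 obtain m where m: "?\<eta> m z0 = 1"
  using eventually_happens[OF puncture_cutoff_eventually_1_at[OF z0(1)]] by auto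
 \<comment> \<open>A tame multiple of \<open>J (u k)\<close> by a non-negative function which is 1
   at \<open>z0\<close>; its pairing with \<open>J (u k)\<close> is therefore positive.\<close>
 define \<zeta> where "\<zeta> = (%z. ?\<eta> m z * J (u k) z)"
 have \<zeta>: "tame t \<zeta>" "has_parity t (r k) (s k) \<zeta>"
  using has_parity_mult[OF has_parity_puncture_cutoff has_parity_J[OF u(1,2)]] tame_mult[OF \<eta> periodic_smooth_J[OF u(1)]]
  by (simp_all add: \<zeta>_def)
 from orthogonal_projection[OF fam this u(3,4) order_refl] obtain \<xi> where \<xi>: "tame t \<xi>" "has_parity t (r k) (s k) \<xi>"
  "\<forall>i<N. B \<xi> (\<psi> i) = 0" "\<forall>w. periodic_smooth t w \<and> (\<forall>i<N. B w (\<psi> i) = 0) \<longrightarrow> B w \<xi> = B w \<zeta>" by blast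
 define d where "d = fint t (%z. \<zeta> z * J (u k) z)"
 have "B (u k) \<xi> = B (u k) \<zeta>" using u orth by (intro mp[OF spec[OF \<xi>(4)]]) auto
 then have Bd: "B (u k) \<xi> = - d" using B_eq[OF u(1) \<zeta>(1)] by (simp add: d_def)
 have d: "d > 0"
  unfolding d_def
 proof (rule tame_fint_pos)
  show "tame t (%z. \<zeta> z * J (u k) z)" by (intro tame_mult \<zeta> periodic_smooth_J u)
  show "\<zeta> z * J (u k) z \<ge> 0" for z using puncture_cutoff_props(4)[OF t0] by (simp add: \<zeta>_def mult.assoc)
  show "\<zeta> z0 * J (u k) z0 \<noteq> 0" using z0 m by (simp add: \<zeta>_def)
 qed
 define E where "E = (%n. fint t (%z. (pd 1 (?\<eta> n) z)\<^sup>2 + (pd \<i> (?\<eta> n) z)\<^sup>2))"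
 have E0: "E \<longlonglongrightarrow> 0" unfolding E_def by (rule puncture_cutoff_energy[OF t])
 let ?u = "%n j z. ?\<eta> n z * u j z"
 have tu: "tame t (?u n j)" "has_parity t (r j) (s j) (?u n j)" for n j
  using has_parity_mult[OF has_parity_puncture_cutoff u(2)] by (simp_all add: tame_mult \<eta> u)
 have total: "(\<Sum>j\<in>UNIV. B (?u n j) (?u n j)) \<le> 3 * M\<^sup>2 * E n" for n
 proof -
  let ?G = "%j z. ((pd 1 (?\<eta> n) z)\<^sup>2 + (pd \<i> (?\<eta> n) z)\<^sup>2) * (u j z)\<^sup>2"
  have T: "tame t (%z. (?\<eta> n z)\<^sup>2 * (u j z * J (u j) z))" for j
   unfolding power2_eq_square
   by (intro tame_mult \<eta> tame_periodic_smooth[OF \<eta>] periodic_smooth_mult u periodic_smooth_J)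
  have T': "tame t (%z. ((pd 1 (?\<eta> n) z)\<^sup>2 + (pd \<i> (?\<eta> n) z)\<^sup>2) * c z)" if "periodic_smooth t c" for c
  proof -
   have "tame t (%z. (pd 1 (?\<eta> n) z * pd 1 (?\<eta> n) z + 1 * (pd \<i> (?\<eta> n) z * pd \<i> (?\<eta> n) z)) * c z)"
    by (intro tame_mult tame_lincomb tame_pd tame_periodic_smooth \<eta> that)
   then show ?thesis by (simp add: power2_eq_square)
  qed
  have c1: "periodic_smooth t (%z. M\<^sup>2)" unfolding periodic_smooth_def by (simp add: smooth_on_const)
  have bd: "fint t (?G j) \<le> M\<^sup>2 * E n" for j
  proof -
   have "fint t (?G j) \<le> fint t (%z. ((pd 1 (?\<eta> n) z)\<^sup>2 + (pd \<i> (?\<eta> n) z)\<^sup>2) * M\<^sup>2)"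
   proof (rule fint_mono)
    have "periodic_smooth t (%z. (u j z)\<^sup>2)" unfolding power2_eq_square by (intro periodic_smooth_mult u)
    then show "continuous_on UNIV (?G j)" by (intro tame_continuous T')
    show "continuous_on UNIV (%z. ((pd 1 (?\<eta> n) z)\<^sup>2 + (pd \<i> (?\<eta> n) z)\<^sup>2) * M\<^sup>2)" by (intro tame_continuous T' c1)
    show "?G j z \<le> ((pd 1 (?\<eta> n) z)\<^sup>2 + (pd \<i> (?\<eta> n) z)\<^sup>2) * M\<^sup>2" for z
    proof (cases "z \<in> PP")
     case True
     have "(u j z)\<^sup>2 \<le> M\<^sup>2" using power_mono[OF M[OF True, of j], of 2] by simp
     then show ?thesis by (intro mult_left_mono) auto
    qed (simp add: tame_0[OF tame_pd[OF \<eta>]])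
   qed
   then show ?thesis unfolding E_def fint_cmult[symmetric] by (simp add: mult.commute)
  qed
  have "(\<Sum>j\<in>UNIV. fint t (%z. (?\<eta> n z)\<^sup>2 * (u j z * J (u j) z))) = fint t (%z. \<Sum>j\<in>UNIV. (?\<eta> n z)\<^sup>2 * (u j z * J (u j) z))"
   by (rule fint_sum[symmetric]) (rule tame_continuous[OF T])
  also have "\<dots> = fint t (%z. 0)"
  proof -
   have "(\<Sum>j\<in>UNIV. (?\<eta> n z)\<^sup>2 * (u j z * J (u j) z)) = 0" for z
    using sum0[of z] tame_0[OF \<eta>, of z n] by (cases "z \<in> PP") (simp_all flip: sum_distrib_left)
   then show ?thesis by simp
  qed
  finally have "(\<Sum>j\<in>UNIV. B (?u n j) (?u n j)) = (\<Sum>j\<in>UNIV. fint t (?G j))"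
   unfolding B_square[OF \<eta> u(1)] sum_subtractf by (simp add: fint_def)
  also have "\<dots> \<le> (\<Sum>j\<in>(UNIV::3 set). M\<^sup>2 * E n)" by (intro sum_mono bd)
  finally show ?thesis by simp
 qed
 have all1: "\<forall>\<^sub>F n in sequentially. (\<forall>i<N. \<forall>z. \<psi> i z \<noteq> 0 \<longrightarrow> ?\<eta> n z = 1) \<and> (\<forall>z. \<xi> z \<noteq> 0 \<longrightarrow> ?\<eta> n z = 1)"
 proof (intro eventually_conj puncture_cutoff_eventually_1 \<xi>)
  have "\<forall>\<^sub>F n in sequentially. \<forall>i\<in>{..<N}. \<forall>z. \<psi> i z \<noteq> 0 \<longrightarrow> ?\<eta> n z = 1"
   using fam unfolding negative_family_def
   by (intro eventually_ball_finite ballI puncture_cutoff_eventually_1) auto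
  then show "\<forall>\<^sub>F n in sequentially. \<forall>i<N. \<forall>z. \<psi> i z \<noteq> 0 \<longrightarrow> ?\<eta> n z = 1" by (rule eventually_mono) auto
 qed
 have key: "0 \<le> 3 * M\<^sup>2 * 0 - 2 * e * d + e\<^sup>2 * B \<xi> \<xi>" for e
 proof (rule tendsto_lowerbound)
  show "(%n. 3 * M\<^sup>2 * E n - 2 * e * d + e\<^sup>2 * B \<xi> \<xi>) \<longlonglongrightarrow> 3 * M\<^sup>2 * 0 - 2 * e * d + e\<^sup>2 * B \<xi> \<xi>"
   by (intro tendsto_intros E0)
  show "\<forall>\<^sub>F n in sequentially. 0 \<le> 3 * M\<^sup>2 * E n - 2 * e * d + e\<^sup>2 * B \<xi> \<xi>" using all1
  proof eventually_elim
   case (elim n)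
   have 0: "B (?u n j) (\<psi> i) = 0" if "i < N" for i j
    using B_cutoff[OF \<eta> u(1), of "\<psi> i" n j] orth[OF that] fam that elim unfolding negative_family_def by auto
   have nn: "B (?u n j) (?u n j) \<ge> 0" for j using 0 by (intro ge0[OF tu]) auto
   \<comment> \<open>Only the sum over the three components is known to be small. As no component is
     negative, each one is bounded by the sum.\<close>
   have le: "B (?u n k) (?u n k) \<le> 3 * M\<^sup>2 * E n"
    using total[of n] member_le_sum[of k UNIV "%j. B (?u n j) (?u n j)"] nn by simp
   define f where "f = (%z. ?u n k z + e * \<xi> z)"
   have f: "tame t f" "has_parity t (r k) (s k) f"
    unfolding f_def using tu \<xi> by (auto intro!: tame_lincomb has_parity_lincomb)
   have Bl: "B f g = B (?u n k) g + e * B \<xi> g" if "tame t g" for g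
    unfolding f_def by (intro B_lincomb_left tame_periodic_smooth tu \<xi> that)
   have "B f (\<psi> i) = 0" if "i < N" for i
    using Bl[of "\<psi> i"] fam that 0 \<xi>(3) unfolding negative_family_def by simp
   then have "0 \<le> B f f" using ge0[OF f] by blast
   also have "B f f = B (?u n k) f + e * B \<xi> f" by (rule Bl[OF f(1)])
   also have "\<dots> = B (?u n k) (?u n k) + 2 * e * B (?u n k) \<xi> + e\<^sup>2 * B \<xi> \<xi>"
    using Bl[OF tu(1)] Bl[OF \<xi>(1)] B_commute[of "?u n k" f] B_commute[of \<xi> f] B_commute[of \<xi> "?u n k"]
    by (simp add: power2_eq_square algebra_simps)
   also have "B (?u n k) \<xi> = - d" using B_cutoff[OF \<eta> u(1) \<xi>(1), of n k] elim Bd by simp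
   finally show ?case using le by simp
  qed
 qed simp
 \<comment> \<open>With this choice the quadratic term is at most half of the linear one, so that
   the limit inequality \<open>key\<close> fails.\<close>
 define e where "e = d / (\<bar>B \<xi> \<xi>\<bar> + 1)"
 have e: "e > 0" using d by (simp add: e_def)
 have "e * B \<xi> \<xi> \<le> e * (\<bar>B \<xi> \<xi>\<bar> + 1)" using e by (intro mult_left_mono) auto
 also have "\<dots> = d" by (simp add: e_def add_pos_nonneg less_imp_neq[symmetric])
 finally have "e * (e * B \<xi> \<xi>) \<le> e * d" using e by (intro mult_left_mono) auto
 moreover have "e * d > 0" using e d by simp
 ultimately show False using key[of e] by (simp add: power2_eq_square mult.assoc)
qed

text \<open>On these vertical lines the reflection acts like a translation by a lattice vector, so
  the function equals its own negative.\<close>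

lemma odd_vanishes_on_walls:
 assumes f: "tame t f" "has_parity t (-1) q f" and z: "Re z = of_int m / 2" shows "f z = 0"
proof (cases "z \<in> PP")
 case True
 have "- cnj z = z + of_int (- m)" using z by (simp add: complex_eq_iff)
 moreover have "(of_int (- m) :: complex) \<in> lattice t" unfolding lattice_def by (intro CollectI exI[of _ "- m"] exI[of _ 0]) simp
 ultimately have "f (- cnj z) = f z" using f(1) unfolding tame_def by metis
 then show ?thesis using f(2) True unfolding has_parity_def by force
qed (use tame_0[OF f(1)] in simp)

text \<open>The mean value theorem along the horizontal segment to the nearest wall; the distance to
  it is controlled by the sine through \<open>sin_pi_small\<close>, applied to
  \<open>2 * Re z\<close>.\<close>

lemma odd_bound:
 assumes f: "tame t f" "has_parity t (-1) q f"
 obtains C where "C \<ge> 0" "\<And>z. \<bar>f z\<bar> \<le> C * \<bar>sin (2 * pi * Re z)\<bar>"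
proof -
 obtain M where M: "\<And>z. \<bar>pd 1 f z\<bar> \<le> M" using tame_bounded[OF tame_pd[OF f(1)]] by blast
 have M0: "M \<ge> 0" using M[of 0] by simp
 have "\<bar>f z\<bar> \<le> M * \<bar>sin (2 * pi * Re z)\<bar>" for z
 proof (rule field_le_epsilon)
  fix e :: real assume e: "e > 0"
  \<comment> \<open>The slack provides the strict inequality required by
    \<open>sin_pi_small\<close>; it disappears with \<open>e\<close>.\<close>
  define \<delta> where "\<delta> = \<bar>sin (2 * pi * Re z)\<bar> + e / (M + 1)"
  have "\<bar>sin (pi * (2 * Re z))\<bar> < \<delta>" using e M0 by (simp add: \<delta>_def mult_ac)
  then obtain m :: int where m: "\<bar>2 * Re z - of_int m\<bar> \<le> \<delta>" using sin_pi_small by blast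
  define p where "p = (%x. complex_of_real x + \<i> * of_real (Im z))"
  define g where "g = (%x. f (p x))"
  have g: "(g has_field_derivative pd 1 f (p x)) (at x within UNIV)" for x
  proof -
   have 1: "(p has_derivative (%h. of_real h)) (at x)"
    unfolding p_def by (auto intro!: derivative_eq_intros)
   have "(g has_derivative (%h. pd (of_real h) f (p x))) (at x)"
    unfolding g_def by (rule has_derivative_compose[OF 1, of f]) (rule tame_differentiable[OF f(1)])
   moreover have "pd (of_real h) f w = pd 1 f w * h" for h w
    using linear_scale[OF has_derivative_linear[OF tame_differentiable[OF f(1)]], of h 1 w] by (simp add: scaleR_conv_of_real mult.commute)
   ultimately show ?thesis by (simp add: has_field_derivative_def)
  qed
  have "\<bar>g (Re z) - g (of_int m / 2)\<bar> \<le> M * \<bar>Re z - of_int m / 2\<bar>"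
   using field_differentiable_bound[OF convex_UNIV g, of M] M by simp
  moreover have "g (of_int m / 2) = 0" unfolding g_def by (intro odd_vanishes_on_walls[OF f, of _ m]) (simp add: p_def)
  moreover have "p (Re z) = z" by (simp add: p_def complex_eq_iff)
  ultimately have "\<bar>f z\<bar> \<le> M * \<bar>Re z - of_int m / 2\<bar>" by (simp add: g_def)
  also have "\<dots> \<le> M * \<delta>" using m M0 by (intro mult_left_mono) linarith+
  also have "\<dots> = M * \<bar>sin (2 * pi * Re z)\<bar> + e * (M / (M + 1))" by (simp add: \<delta>_def distrib_left)
  also have "e * (M / (M + 1)) \<le> e * 1" using e M0 by (intro mult_left_mono) auto
  finally show "\<bar>f z\<bar> \<le> M * \<bar>sin (2 * pi * Re z)\<bar> + e" by simp
 qed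
 then show ?thesis using M0 that by blast
qed

text \<open>An odd function vanishes on the fixed lines of the reflection, so multiplying it by an approximation of the sign
 of \<open>sin (2\<pi>x)\<close> changes its parity but hardly its energy.\<close>

lemma parity_flip:
 assumes f: "tame t f" "has_parity t (-1) (-1) f" and neg: "B f f < 0"
 shows "\<exists>g. tame t g \<and> has_parity t 1 (-1) g \<and> B g g < 0"
proof -
 define y where "y = (%z. sin (2 * pi * Re z))"
 define sg where "sg = (%n z. tanh (real n * y z))"
 have fp: "periodic_smooth t f" by (rule tame_periodic_smooth[OF f(1)])
 obtain m where "\<forall>z. f z \<noteq> 0 \<longrightarrow> puncture_cutoff t m z = 1"
  using eventually_happens[OF puncture_cutoff_eventually_1[OF f(1)]] by auto
 then have m: "f z \<noteq> 0 ==> puncture_cutoff t m z = 1" for z by blast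
 have y_smooth: "smooth_on UNIV y" unfolding y_def by (intro smooth_intros open_UNIV)
 have yper: "y (z + l) = y z" if l: "l \<in> lattice t" for z l
 proof -
  obtain k n where "l = of_int k + of_int n * (\<i> * of_real t)" using l by (auto simp: lattice_def)
  then have e: "2 * pi * Re (z + l) = 2 * pi * Re z + 2 * pi * of_int k" by (simp add: algebra_simps)
  have "sin (2 * pi * of_int k) = 0" "cos (2 * pi * of_int k) = 1"
   using sin_int_2pin[of k] cos_int_2pin[of k] by simp_all
  then show ?thesis unfolding y_def e sin_add by simp
 qed
 have ps: "periodic_smooth t (sg n)" for n
  unfolding periodic_smooth_def sg_def
  using yper smooth_on_subset[OF y_smooth, of PP] by (auto intro!: smooth_intros open_PP)
 \<comment> \<open>The puncture cutoff is 1 wherever \<open>f\<close> is nonzero; it makes the sign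
   approximation tame without changing its product with \<open>f\<close>.\<close>
 define F where "F = (%n z. puncture_cutoff t m z * sg n z)"
 have F: "tame t (F n)" for n unfolding F_def by (intro tame_mult tame_puncture_cutoff ps)
 have Ff: "tame t (%z. F n z * f z)" for n by (intro tame_mult F fp)
 have parity: "has_parity t 1 (-1) (%z. F n z * f z)" for n
 proof -
  have "has_parity t (-1) 1 (sg n)" by (simp add: has_parity_def sg_def y_def)
  from has_parity_mult[OF has_parity_mult[OF has_parity_puncture_cutoff this] f(2)] show ?thesis by (simp add: F_def)
 qed
 have dsg: "(sg n has_derivative (%v. (1 - (sg n z)\<^sup>2) * (real n * (cos (2 * pi * Re z) * (2 * pi * Re v))))) (at z)" for n z
 proof -
  have "cosh (real n * y z) \<noteq> 0" using cosh_real_ge_1[of "real n * y z"] by linarith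
  then have "((%x. tanh x) has_real_derivative (1 - (sg n z)\<^sup>2)) (at (real n * y z))"
   by (auto intro!: derivative_eq_intros simp: sg_def)
  then have "(tanh has_derivative (%h. (1 - (sg n z)\<^sup>2) * h)) (at (real n * y z))"
   by (simp add: has_field_derivative_def)
  moreover have "((%z. real n * y z) has_derivative (%v. real n * (cos (2 * pi * Re z) * (2 * pi * Re v)))) (at z)"
   unfolding y_def by (auto intro!: derivative_eq_intros)
  ultimately show ?thesis unfolding sg_def by (rule has_derivative_compose[rotated])
 qed
 obtain C where C: "C \<ge> 0" "\<And>z. \<bar>f z\<bar> \<le> C * \<bar>y z\<bar>" using odd_bound[OF f] unfolding y_def by blast
 \<comment> \<open>The gradient of \<open>sg n\<close> times \<open>f\<close> is bounded by a
   multiple of \<open>k n\<close>: the zero of \<open>f\<close> on the walls absorbs the slope n.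
   Then \<open>k n\<close> is uniformly bounded and tends to 0 off the walls, as dominated
   convergence requires.\<close>
 define k where "k = (%n z. (1 - (sg n z)\<^sup>2) * real n * \<bar>y z\<bar>)"
 have k: "0 \<le> k n z" "k n z \<le> 3" "real n * y z \<noteq> 0 ==> k n z \<le> 4 / (real n * \<bar>y z\<bar>)" for n z
 proof -
  define w where "w = real n * \<bar>y z\<bar>"
  have "(tanh w)\<^sup>2 = (sg n z)\<^sup>2" using tanh_real_abs[of "real n * y z"] by (simp add: w_def sg_def abs_mult)
  then have kw: "k n z = (1 - (tanh w)\<^sup>2) * w" by (simp add: k_def w_def mult_ac)
  have w0: "w \<ge> 0" by (simp add: w_def)
  show "0 \<le> k n z" unfolding kw by (intro mult_nonneg_nonneg one_minus_tanh_square w0)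
  have "2 * w \<le> 1 + w\<^sup>2" using sum_squares_bound[of 1 w] by (simp add: power2_eq_square)
  then have "(1 - (tanh w)\<^sup>2) * (2 * w) \<le> (1 - (tanh w)\<^sup>2) * (1 + w\<^sup>2)" by (intro mult_left_mono one_minus_tanh_square)
  moreover have "(1 - (tanh w)\<^sup>2) * (1 + w\<^sup>2) = (1 - (tanh w)\<^sup>2) + w\<^sup>2 * (1 - (tanh w)\<^sup>2)" by (simp add: algebra_simps)
  ultimately show "k n z \<le> 3" using one_minus_tanh_square[of w] unfolding kw by linarith
  assume "real n * y z \<noteq> 0"
  then have "w > 0" by (simp add: w_def)
  then show "k n z \<le> 4 / (real n * \<bar>y z\<bar>)"
   using one_minus_tanh_square(3)[of w] unfolding kw w_def[symmetric] by (simp add: field_simps power2_eq_square)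
 qed
 have grad: "((pd 1 (F n) z)\<^sup>2 + (pd \<i> (F n) z)\<^sup>2) * (f z)\<^sup>2 \<le> (C * (2 * pi) * k n z)\<^sup>2" for n z
 proof (cases "f z = 0")
  case False
  define S where "S = {z. f z \<noteq> 0}"
  have S: "open S" "z \<in> S" using False tame_continuous[OF f(1)] by (auto simp: S_def intro!: open_Collect_neq)
  have "pd v (F n) z = pd v (sg n) z" for v
   by (rule pd_cong_open[OF S]) (simp add: F_def S_def m)
  then have p: "pd 1 (F n) z = (1 - (sg n z)\<^sup>2) * (real n * (cos (2 * pi * Re z) * (2 * pi)))" "pd \<i> (F n) z = 0"
   by (simp_all add: pd_eqI[OF dsg])
  have "\<bar>pd 1 (F n) z * f z\<bar> \<le> ((1 - (sg n z)\<^sup>2) * (real n * (1 * (2 * pi)))) * (C * \<bar>y z\<bar>)"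
   unfolding abs_mult p using one_minus_tanh_square C
   by (intro mult_mono) (auto simp: sg_def abs_mult intro!: mult_nonneg_nonneg)
  also have "\<dots> = C * (2 * pi) * k n z" by (simp add: k_def mult_ac)
  finally have "(pd 1 (F n) z * f z)\<^sup>2 \<le> (C * (2 * pi) * k n z)\<^sup>2" by (metis abs_ge_zero power2_abs power_mono)
  then show ?thesis using p by (simp add: power_mult_distrib)
 qed simp
 have lim0: "(%n. fint t (%z. ((pd 1 (F n) z)\<^sup>2 + (pd \<i> (F n) z)\<^sup>2) * (f z)\<^sup>2)) \<longlonglongrightarrow> fint t (%z. 0)"
 proof (rule fint_tendsto)
  show "continuous_on UNIV (%z. ((pd 1 (F n) z)\<^sup>2 + (pd \<i> (F n) z)\<^sup>2) * (f z)\<^sup>2)" for n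
   by (intro continuous_intros tame_continuous tame_pd F f)
  show "\<bar>((pd 1 (F n) z)\<^sup>2 + (pd \<i> (F n) z)\<^sup>2) * (f z)\<^sup>2\<bar> \<le> (C * (2 * pi) * 3)\<^sup>2" for n z
  proof -
   have "(C * (2 * pi) * k n z)\<^sup>2 \<le> (C * (2 * pi) * 3)\<^sup>2" using k C(1) by (intro power_mono mult_left_mono) auto
   then show ?thesis using grad[of n z] by simp
  qed
  show "(%n. ((pd 1 (F n) z)\<^sup>2 + (pd \<i> (F n) z)\<^sup>2) * (f z)\<^sup>2) \<longlonglongrightarrow> 0" for z
  proof (cases "y z = 0")
   case True
   then have "f z = 0" using C(2)[of z] by simp
   then show ?thesis by simp
  next
   case False
   have "(%n. (4 / \<bar>y z\<bar>) / real n) \<longlonglongrightarrow> 0" by (rule lim_const_over_n)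
   then have "(%n. k n z) \<longlonglongrightarrow> 0"
    by (rule tendsto_sandwich[OF _ _ tendsto_const, rotated 2])
     (use k False in \<open>auto intro!: always_eventually eventually_sequentiallyI[of 1] simp: mult.commute\<close>)
   then have "(%n. (C * (2 * pi) * k n z)\<^sup>2) \<longlonglongrightarrow> (C * (2 * pi) * 0)\<^sup>2" by (intro tendsto_intros)
   then have "(%n. (C * (2 * pi) * k n z)\<^sup>2) \<longlonglongrightarrow> 0" by simp
   then show ?thesis
    by (rule tendsto_sandwich[OF _ _ tendsto_const, rotated 2]) (use grad in \<open>auto intro!: always_eventually\<close>)
  qed
 qed simp
 have fJ: "tame t (%z. f z * J f z)" by (intro tame_mult f periodic_smooth_J fp)
 obtain D where D: "\<And>z. \<bar>f z * J f z\<bar> \<le> D" using tame_bounded[OF fJ] by blast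
 have lim1: "(%n. fint t (%z. (F n z)\<^sup>2 * (f z * J f z))) \<longlonglongrightarrow> fint t (%z. f z * J f z)"
 proof (rule fint_tendsto)
  show "continuous_on UNIV (%z. (F n z)\<^sup>2 * (f z * J f z))" "continuous_on UNIV (%z. f z * J f z)" for n
   by (intro continuous_intros tame_continuous[OF F] tame_continuous[OF fJ])+
  have sg1: "(sg n z)\<^sup>2 \<le> 1" for n z using one_minus_tanh_square[of "real n * y z"] by (simp add: sg_def)
  have Fsg: "(F n z)\<^sup>2 * (f z * J f z) = (sg n z)\<^sup>2 * (f z * J f z)" for n z
   using m[of z] by (cases "f z = 0") (simp_all add: F_def)
  show "\<bar>(F n z)\<^sup>2 * (f z * J f z)\<bar> \<le> D" for n z
  proof -
   have "(sg n z)\<^sup>2 * \<bar>f z * J f z\<bar> \<le> 1 * D" using sg1 D by (intro mult_mono) auto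
   then show ?thesis unfolding Fsg by (simp add: abs_mult)
  qed
  show "(%n. (F n z)\<^sup>2 * (f z * J f z)) \<longlonglongrightarrow> f z * J f z" for z
  proof (cases "y z = 0")
   case True
   then have "f z = 0" using C(2)[of z] by simp
   then show ?thesis by simp
  next
   case False
   have "(%n. (3 / \<bar>y z\<bar>) / real n) \<longlonglongrightarrow> 0" by (rule lim_const_over_n)
   then have "(%n. 1 - (sg n z)\<^sup>2) \<longlonglongrightarrow> 0"
   proof (rule tendsto_sandwich[OF _ _ tendsto_const, rotated 2])
    show "\<forall>\<^sub>F n in sequentially. 0 \<le> 1 - (sg n z)\<^sup>2" using sg1 by simp
    show "\<forall>\<^sub>F n in sequentially. 1 - (sg n z)\<^sup>2 \<le> (3 / \<bar>y z\<bar>) / real n"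
    proof (rule eventually_sequentiallyI[of 1])
     fix n :: nat assume "1 \<le> n"
     then show "1 - (sg n z)\<^sup>2 \<le> (3 / \<bar>y z\<bar>) / real n" using k(2)[of n z] False by (simp add: k_def field_simps)
    qed
   qed
   then have "(%n. (1 - (1 - (sg n z)\<^sup>2)) * (f z * J f z)) \<longlonglongrightarrow> (1 - 0) * (f z * J f z)" by (intro tendsto_intros)
   then show ?thesis unfolding Fsg by simp
  qed
 qed
 have "(%n. B (%z. F n z * f z) (%z. F n z * f z)) \<longlonglongrightarrow> fint t (%z. 0) - fint t (%z. f z * J f z)"
  unfolding B_square[OF F fp] by (intro tendsto_diff lim0 lim1)
 moreover have "fint t (%z. 0) - fint t (%z. f z * J f z) = B f f" unfolding B_eq[OF fp f(1)] by (simp add: fint_def)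
 ultimately have "(%n. B (%z. F n z * f z) (%z. F n z * f z)) \<longlonglongrightarrow> B f f" by simp
 from eventually_happens[OF order_tendstoD(2)[OF this neg]] obtain n where "B (%z. F n z * f z) (%z. F n z * f z) < 0" by auto
 then show ?thesis using Ff parity by blast
qed

end

section \<open>Null curves on the punctured torus\<close>

lemma lattice_small:
 assumes "t \<ge> 1" "l \<in> lattice t" "norm l < 1" shows "l = 0"
proof -
 obtain m n where l: "l = of_int m + of_int n * (\<i> * of_real t)" using assms(2) by (auto simp: lattice_def)
 have "\<bar>of_int m :: real\<bar> < 1" using abs_Re_le_cmod[of l] assms(3) by (simp add: l)
 then have m: "m = 0" by linarith
 have "\<bar>of_int n\<bar> * 1 \<le> \<bar>of_int n\<bar> * t" using assms(1) by (intro mult_left_mono) auto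
 also have "\<dots> < 1" using abs_Im_le_cmod[of l] assms(1,3) by (simp add: l abs_mult)
 finally have "n = 0" by simp
 then show ?thesis by (simp add: l m)
qed

lemma bell_small:
 assumes "t > 0" "\<delta> > 0"
 obtains s where "s > 0" "\<And>u. bell t u < s ==> \<exists>l\<in>lattice t. norm (u - l) < \<delta>"
proof -
 define d where "d = \<delta> / (2 * (1 + t))"
 have d: "d > 0" using assms by (simp add: d_def)
 have "\<exists>l\<in>lattice t. norm (u - l) < \<delta>" if u: "bell t u < d\<^sup>2" for u
 proof -
  have "(sin (pi * Re u))\<^sup>2 < d\<^sup>2" "(sin (pi / t * Im u))\<^sup>2 < d\<^sup>2"
   using u zero_le_power2[of "sin (pi * Re u)"] zero_le_power2[of "sin (pi / t * Im u)"] unfolding bell_def by linarith+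
  moreover have "\<bar>x\<bar> < d" if "x\<^sup>2 < d\<^sup>2" for x
   using that d by (intro power2_less_imp_less[of "\<bar>x\<bar>"]) auto
  ultimately have s: "\<bar>sin (pi * Re u)\<bar> < d" "\<bar>sin (pi * (Im u / t))\<bar> < d" by auto
  obtain m n where mn: "\<bar>Re u - of_int m\<bar> \<le> d" "\<bar>Im u / t - of_int n\<bar> \<le> d" using sin_pi_small[OF s(1)] sin_pi_small[OF s(2)] by metis
  define l where "l = of_int m + of_int n * (\<i> * of_real t)"
  have "norm (u - l) \<le> \<bar>Re u - of_int m\<bar> + \<bar>Im u - of_int n * t\<bar>" using cmod_le[of "u - l"] by (simp add: l_def)
  also have "\<bar>Im u - of_int n * t\<bar> = \<bar>Im u / t - of_int n\<bar> * t" using assms(1) abs_mult[of "Im u / t - of_int n" t] by (simp add: field_simps)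
  also have "\<dots> \<le> d * t" using mn(2) assms(1) by (intro mult_right_mono) auto
  finally have "norm (u - l) \<le> d * (1 + t)" using mn(1) by (simp add: distrib_left)
  also have "d * (1 + t) = \<delta> / 2" using add_pos_pos[OF zero_less_one assms(1)] by (simp add: d_def field_simps)
  finally have "norm (u - l) < \<delta>" using assms(2) by simp
  then show ?thesis unfolding l_def lattice_def by blast
 qed
 then show ?thesis using that[of "d\<^sup>2"] d by simp
qed

lemma deriv_translate: "deriv (%w. f (a + w)) w = deriv f (a + w)"
 unfolding deriv_def add.commute[of a] by (simp only: DERIV_shift)

section \<open>From neighbourhoods of the punctures to the whole torus\<close>

context puncture_torus
begin

lemma near_puncture_PP: assumes "a \<in> punctures t" "w \<in> ball 0 (1/2) - {0}" shows "a + w \<in> PP"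
proof (rule ccontr)
 assume "a + w \<notin> PP"
 then obtain b where b: "b \<in> punctures t" "a + w - b \<in> lattice t" by (auto simp: punctured_plane_alt)
 have "(a + w - b) + (a + w - b) + 2 * b + - (2 * a) \<in> lattice t"
  by (intro lattice_add b punctures_double lattice_minus assms)
 then have "2 * w \<in> lattice t" by (simp add: algebra_simps)
 then show False using lattice_small[OF t, of "2 * w"] assms(2) by (simp add: norm_mult)
qed

lemma near_punctures_uniform:
 assumes R: "\<And>z l. z \<in> PP ==> l \<in> lattice t ==> R (z + l) = R z"
  and loc: "\<And>a. a \<in> punctures t ==> \<exists>\<delta>>0. \<forall>w\<in>ball 0 \<delta> - {0}. R (a + w)"
 obtains s where "s > 0" "\<forall>z\<in>PP \<inter> near_punctures t s. R z"
proof -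
 obtain \<delta> where \<delta>: "\<And>a. a \<in> punctures t ==> \<delta> a > 0 \<and> (\<forall>w\<in>ball 0 (\<delta> a) - {0}. R (a + w))" using loc by metis
 define d where "d = Min (insert (1/2) (\<delta> ` punctures t))"
 have "d > 0" unfolding d_def using finite_punctures \<delta> by (subst Min_gr_iff) auto
 have d\<delta>: "d \<le> \<delta> a" if "a \<in> punctures t" for a unfolding d_def using that finite_punctures by (intro Min_le) auto
 have d2: "d \<le> 1/2" unfolding d_def using finite_punctures by (intro Min_le) auto
 obtain s where s: "s > 0" "\<And>u. bell t u < s ==> \<exists>l\<in>lattice t. norm (u - l) < d" using bell_small[OF t0 \<open>d > 0\<close>] by blast
 have "R z" if z: "z \<in> PP \<inter> near_punctures t s" for z
 proof -
  obtain a where a: "a \<in> punctures t" "bell t (z - a) < s" using z by (auto simp: near_punctures_def)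
  obtain l where l: "l \<in> lattice t" "norm (z - a - l) < d" using s(2)[OF a(2)] by blast
  have "z - a \<notin> lattice t" using z a(1) by (simp add: punctured_plane_alt)
  then have w: "z - a - l \<in> ball 0 d - {0}" using l by auto
  then have "R (a + (z - a - l))" using d\<delta>[OF a(1)] by (intro bspec[OF conjunct2[OF \<delta>[OF a(1)]]]) auto
  moreover have "a + (z - a - l) \<in> PP" using w d2 by (intro near_puncture_PP a) auto
  ultimately show "R z" using R[OF _ l(1), of "a + (z - a - l)"] by simp
 qed
 then show ?thesis using that s(1) by blast
qed

lemma compact_away: "s > 0 ==> compact (cbox 0 (Complex 1 t) - near_punctures t s)"
  "s > 0 ==> cbox 0 (Complex 1 t) - near_punctures t s \<subseteq> PP"
  "s > 0 ==> z \<in> PP ==> z \<notin> near_punctures t s ==> \<exists>l\<in>lattice t. z - l \<in> cbox 0 (Complex 1 t) - near_punctures t s"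
proof -
 assume s: "s > 0"
 show "compact (cbox 0 (Complex 1 t) - near_punctures t s)" by (intro compact_diff compact_cbox open_near_punctures)
 show "cbox 0 (Complex 1 t) - near_punctures t s \<subseteq> PP" using PP_Un[OF s] by auto
 assume z: "z \<in> PP" "z \<notin> near_punctures t s"
 obtain l where l: "l \<in> lattice t" "z - l \<in> fund_domain t" using fund_domain_cover[OF t0] .
 have "bell t (z - l - a) = bell t (z - a)" for a
  using bell_lattice[OF t0 lattice_minus[OF l(1)], of "z - a"] by (simp add: algebra_simps)
 then have "z - l \<notin> near_punctures t s" using z by (auto simp: near_punctures_def)
 moreover have "z - l \<in> cbox 0 (Complex 1 t)"
  using l(2) by (auto simp: fund_domain_def cbox_def Basis_complex_def inner_complex_def)
 ultimately show "\<exists>l\<in>lattice t. z - l \<in> cbox 0 (Complex 1 t) - near_punctures t s" using l(1) by blast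
qed

lemma periodic_bounded:
 fixes F :: "complex => 'a::real_normed_vector"
 assumes F: "continuous_on PP F" "\<And>z l. z \<in> PP ==> l \<in> lattice t ==> F (z + l) = F z"
  and loc: "\<And>a. a \<in> punctures t ==> \<exists>\<delta>>0. \<exists>C. \<forall>w\<in>ball 0 \<delta> - {0}. norm (F (a + w)) \<le> C"
 obtains M where "\<And>z. z \<in> PP ==> norm (F z) \<le> M"
proof -
 obtain C where C: "\<And>a. a \<in> punctures t ==> \<exists>\<delta>>0. \<forall>w\<in>ball 0 \<delta> - {0}. norm (F (a + w)) \<le> C a" using loc by metis
 define C0 where "C0 = Max (C ` punctures t)"
 have CC: "C a \<le> C0" if "a \<in> punctures t" for a unfolding C0_def using that finite_punctures by (intro Max_ge) auto
 obtain s where s: "s > 0" "\<forall>z\<in>PP \<inter> near_punctures t s. norm (F z) \<le> C0"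
 proof (rule near_punctures_uniform[of "%z. norm (F z) \<le> C0"])
  show "\<exists>\<delta>>0. \<forall>w\<in>ball 0 \<delta> - {0}. norm (F (a + w)) \<le> C0" if "a \<in> punctures t" for a
   using C[OF that] CC[OF that] by (meson order_trans)
 qed (use F(2) in auto)
 have "bounded (F ` (cbox 0 (Complex 1 t) - near_punctures t s))"
  using compact_away(1,2)[OF s(1)] continuous_on_subset[OF F(1)] by (intro compact_imp_bounded compact_continuous_image) auto
 then obtain M where M: "\<forall>z\<in>cbox 0 (Complex 1 t) - near_punctures t s. norm (F z) \<le> M" unfolding bounded_iff by auto
 have "norm (F z) \<le> max C0 M" if z: "z \<in> PP" for z
 proof (cases "z \<in> near_punctures t s")
  case False
  from compact_away(3)[OF s(1) z this] obtain l where l: "l \<in> lattice t" "z - l \<in> cbox 0 (Complex 1 t) - near_punctures t s" by blast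
  then have "F (z - l + l) = F (z - l)" using compact_away(2)[OF s(1)] by (intro F(2)) auto
  then show ?thesis using bspec[OF M l(2)] by simp
 qed (use s z in \<open>auto intro: max.coboundedI1\<close>)
 then show ?thesis using that by blast
qed

end

lemma integrable_translate:
 fixes F :: "complex => real"
 assumes "integrable lborel F" shows "integrable lborel (%w. F (w + c))"
proof -
 have "integrable (distr lborel borel ((+) c)) F" using assms by (simp add: lborel_distr_plus)
 from integrable_distr[OF _ this] show ?thesis by (simp add: add.commute)
qed

text \<open>The Weierstrass data of the surface in symmetric position. Completeness is recorded only
  for paths that converge to a puncture.\<close>

locale null_torus = puncture_torus +
 fixes \<phi> :: "3 => complex => complex"
 assumes hol: "\<And>k. \<phi> k holomorphic_on PP"
  and null: "\<forall>z\<in>PP. (\<Sum>k\<in>UNIV. (\<phi> k z)\<^sup>2) = 0"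
  and pos: "\<And>z. z \<in> PP ==> null_norm \<phi> z > 0"
  and per: "\<And>z l k. z \<in> PP ==> l \<in> lattice t ==> \<phi> k (z + l) = \<phi> k z"
  and sym1: "\<And>z k. z \<in> PP ==> \<phi> k (- cnj z) = of_real (sgn1 k) * cnj (\<phi> k z)"
  and sym2: "\<And>z k. z \<in> PP ==> \<phi> k (cnj z) = of_real (sgn2 k) * cnj (\<phi> k z)"
  and curv: "set_integrable lborel (PP \<inter> fund_domain t) (null_curv \<phi>)"
  and comp: "\<And>\<gamma> a. \<gamma> C1_differentiable_on {0..} ==> \<gamma> ` {0..} \<subseteq> PP ==> a \<in> punctures t ==> (\<gamma> \<longlongrightarrow> a) at_top ==>
   (\<integral>\<^sup>+s\<in>{0..}. ennreal (sqrt (null_norm \<phi> (\<gamma> s)) * norm (vector_derivative \<gamma> (at s))) \<partial>lborel) = \<infinity>"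
begin

lemma deriv_per: assumes "z \<in> PP" "l \<in> lattice t" shows "deriv (\<phi> k) (z + l) = deriv (\<phi> k) z"
proof -
 have "deriv (\<phi> k) (l + z) = deriv (%z. \<phi> k (l + z)) z" by (rule deriv_translate[symmetric])
 also have "\<dots> = deriv (\<phi> k) z"
  by (rule complex_derivative_transform_within_open[of _ PP])
   (use hol open_PP assms per punctured_plane_add in \<open>auto simp: add.commute[of l] intro!: holomorphic_on_compose_gen[OF _ hol, of "%z. z + l", unfolded o_def] holomorphic_intros\<close>)
 finally show ?thesis by (simp add: add.commute)
qed

lemma curv_per: assumes "z \<in> PP" "l \<in> lattice t" shows "null_curv \<phi> (z + l) = null_curv \<phi> z"
 unfolding null_curv_def null_norm_def null_dnorm_def null_mixed_def by (simp only: deriv_per[OF assms] per[OF assms])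

lemma curv_translate: "null_curv (%k w. \<phi> k (a + w)) w = null_curv \<phi> (a + w)"
 unfolding null_curv_def null_norm_def null_dnorm_def null_mixed_def deriv_translate ..

lemma null_end_at:
 assumes a: "a \<in> punctures t"
 shows "null_end (1/2) (%k w. \<phi> k (a + w))"
proof
 let ?A = "ball 0 (1/2) - {0::complex}"
 note PPa = near_puncture_PP[OF a]
 show "(%w. \<phi> k (a + w)) holomorphic_on ?A" for k
  by (rule holomorphic_on_compose_gen[OF _ hol, of "%w. a + w", unfolded o_def]) (rule image_subsetI[OF PPa] | intro holomorphic_intros)+
 show "\<forall>w\<in>?A. (\<Sum>k\<in>UNIV. (\<phi> k (a + w))\<^sup>2) = 0" using null PPa by blast
 show "null_norm (%k w. \<phi> k (a + w)) w > 0" if "w \<in> ?A" for w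
  using pos[OF PPa[OF that]] by (simp add: null_norm_def)
 show "\<phi> k (a + - cnj w) = of_real (sgn1 k) * cnj (\<phi> k (a + w))" if "w \<in> ?A" for w k
 proof -
  \<comment> \<open>Reflection about \<open>a\<close> differs from reflection about the origin by
    this lattice vector.\<close>
  have "2 * a + - (a - cnj a) \<in> lattice t" by (intro lattice_add lattice_minus punctures_double punctures_cnj a)
  then have "\<phi> k (- cnj (a + w) + (2 * a + - (a - cnj a))) = \<phi> k (- cnj (a + w))"
   by (intro per) (simp_all only: punctured_plane_reflect PPa[OF that])
  then show ?thesis using sym1[OF PPa[OF that]] by (simp add: algebra_simps)
 qed
 show "\<phi> k (a + cnj w) = of_real (sgn2 k) * cnj (\<phi> k (a + w))" if "w \<in> ?A" for w k
 proof -
  have "\<phi> k (cnj (a + w) + (a - cnj a)) = \<phi> k (cnj (a + w))"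
   by (intro per punctures_cnj a) (simp_all only: punctured_plane_reflect PPa[OF that])
  then show ?thesis using sym2[OF PPa[OF that]] by (simp add: algebra_simps)
 qed
 show "complete_end (1/2) (%w. sqrt (null_norm (%k w. \<phi> k (a + w)) w))"
  unfolding complete_end_def
 proof (intro allI impI)
  fix \<gamma> :: "real => complex" assume \<gamma>: "\<gamma> C1_differentiable_on {0..}" "\<gamma> ` {0..} \<subseteq> ?A" "(\<gamma> \<longlongrightarrow> 0) at_top"
  have "(\<integral>\<^sup>+s\<in>{0..}. ennreal (sqrt (null_norm \<phi> (a + \<gamma> s)) * norm (vector_derivative (%s. a + \<gamma> s) (at s))) \<partial>lborel) = \<infinity>"
  proof (rule comp[OF _ _ a])
   show "(%s. a + \<gamma> s) C1_differentiable_on {0..}" by (intro C1_differentiable_on_add C1_differentiable_on_const \<gamma>)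
   show "(%s. a + \<gamma> s) ` {0..} \<subseteq> PP" using \<gamma>(2) PPa by blast
   show "((%s. a + \<gamma> s) \<longlongrightarrow> a) at_top" using tendsto_add[OF tendsto_const \<gamma>(3), of a] by simp
  qed
  moreover have "vector_derivative (%s. a + \<gamma> s) (at s) = vector_derivative \<gamma> (at s)" if "s \<ge> 0" for s
  proof -
   have "\<gamma> differentiable at s" using \<gamma>(1) that unfolding C1_differentiable_on_eq by auto
   then show ?thesis by (simp add: vector_derivative_add_at)
  qed
  then have "ennreal (sqrt (null_norm \<phi> (a + \<gamma> s)) * norm (vector_derivative (%s. a + \<gamma> s) (at s))) * indicator {0..} s
   = ennreal (sqrt (null_norm (%k w. \<phi> k (a + w)) (\<gamma> s)) * norm (vector_derivative \<gamma> (at s))) * indicator {0..} s" for s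
   by (simp add: indicator_def null_norm_def)
  ultimately show "(\<integral>\<^sup>+s\<in>{0..}. ennreal (sqrt (null_norm (%k w. \<phi> k (a + w)) (\<gamma> s)) * norm (vector_derivative \<gamma> (at s))) \<partial>lborel) = \<infinity>"
   by simp
 qed
 show "set_integrable lborel ?A (null_curv (%k w. \<phi> k (a + w)))"
 proof -
  \<comment> \<open>The disc around a puncture can leave the period rectangle only across its left
    and lower sides, since both coordinates of a puncture are at most half of the periods; four
    translates therefore suffice.\<close>
  define L where "L = (%(m::int, n::int). of_int m + of_int n * (\<i> * of_real t)) ` ({-1, 0} \<times> {-1, 0})"
  have L: "finite L" by (simp add: L_def)
  have Ll: "L \<subseteq> lattice t" unfolding L_def lattice_def split_beta by blast
  define V where "V = (%z. indicator (PP \<inter> fund_domain t) z * null_curv \<phi> z)"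
  have Vi: "integrable lborel V" using curv by (simp add: set_integrable_def V_def)
  have "set_integrable lborel ?A (%w. null_curv \<phi> (a + w))"
   unfolding set_integrable_def
  proof (rule Bochner_Integration.integrable_bound)
   show "integrable lborel (%w. \<Sum>l\<in>L. V (w + (a - l)))"
    by (intro Bochner_Integration.integrable_sum integrable_translate Vi)
   have "continuous_on PP (null_curv \<phi>)" by (intro smooth_on_continuous smooth_on_null_curv open_PP hol pos)
   then have "continuous_on ?A (%w. null_curv \<phi> (a + w))"
    by (rule continuous_on_compose2[OF _ _ image_subsetI[OF PPa]]) (intro continuous_intros)
   then show "(%w. indicator ?A w *\<^sub>R null_curv \<phi> (a + w)) \<in> borel_measurable lborel"
    using borel_measurable_continuous_on_indicator[of ?A "%w. null_curv \<phi> (a + w)"] by (simp add: open_delete)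
   have V0: "V z \<ge> 0" for z by (simp add: V_def curv_nonneg)
   have "norm (indicator ?A w *\<^sub>R null_curv \<phi> (a + w)) \<le> norm (\<Sum>l\<in>L. V (w + (a - l)))" for w
   proof (cases "w \<in> ?A")
    case True
    define l where "l = of_int (if Re (a + w) < 0 then -1 else 0) + of_int (if Im (a + w) < 0 then -1 else 0) * (\<i> * of_real t)"
    have l: "l \<in> L" unfolding L_def l_def
     by (rule image_eqI[of _ _ "(if Re (a + w) < 0 then -1 else 0, if Im (a + w) < 0 then -1 else 0)"]) (simp_all only: prod.case, simp)
    have "\<forall>a\<in>punctures t. 0 \<le> Re a \<and> Re a \<le> 1/2 \<and> 0 \<le> Im a \<and> Im a \<le> t/2"
     unfolding punctures_def using t by simp
    moreover have "\<bar>Re w\<bar> < 1/2" "\<bar>Im w\<bar> < 1/2" using True abs_Re_le_cmod[of w] abs_Im_le_cmod[of w] by auto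
    ultimately have fd: "a + w - l \<in> fund_domain t" using a t by (auto simp: fund_domain_def l_def)
    have lm: "- l \<in> lattice t" using l Ll by (auto intro: lattice_minus)
    have "V (w + (a - l)) = null_curv \<phi> (a + w)"
     using curv_per[OF PPa[OF True] lm] punctured_plane_add[OF lm, of "a + w"] PPa[OF True] fd
     by (simp add: V_def algebra_simps)
    moreover have "V (w + (a - l)) \<le> (\<Sum>l\<in>L. V (w + (a - l)))" using V0 L l by (intro member_le_sum) auto
    ultimately show ?thesis using True curv_nonneg[of \<phi> "a + w"] by simp
   qed simp
   then show "AE w in lborel. norm (indicator ?A w *\<^sub>R null_curv \<phi> (a + w)) \<le> norm (\<Sum>l\<in>L. V (w + (a - l)))" by simp
  qed
  then show ?thesis unfolding curv_translate .
 qed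
qed simp

lemma puncture_growth:
 assumes a: "a \<in> punctures t"
 obtains \<epsilon> \<delta> C where "\<epsilon> = 1 \<or> \<epsilon> = -1" "0 < \<delta>" "\<delta> \<le> 1/2" "\<forall>w\<in>ball 0 \<delta> - {0}. null_f \<epsilon> \<phi> (a + w) \<noteq> 0"
  "(null_g \<epsilon> (%k w. \<phi> k (a + w)) \<longlongrightarrow> 0) (at 0)"
  "\<forall>w\<in>ball 0 \<delta> - {0}. norm (inverse (null_f \<epsilon> \<phi> (a + w))) \<le> C * (norm w)\<^sup>2"
 by (rule null_end.end_growth[OF null_end_at[OF a]]) (unfold null_f_def, blast)

lemma null_f_holomorphic: "null_f \<epsilon> \<phi> holomorphic_on PP"
 unfolding null_f_def[abs_def] by (intro holomorphic_intros hol)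

lemma null_f_per: "z \<in> PP ==> l \<in> lattice t ==> null_f \<epsilon> \<phi> (z + l) = null_f \<epsilon> \<phi> z"
 by (simp add: null_f_def per)

lemma norm_null_f_le: "\<epsilon> = 1 \<or> \<epsilon> = -1 ==> norm (null_f \<epsilon> \<phi> z) \<le> 2 * sqrt (null_norm \<phi> z)"
proof -
 assume e: "\<epsilon> = 1 \<or> \<epsilon> = -1"
 have "norm (\<phi> k z) \<le> sqrt (null_norm \<phi> z)" for k
  unfolding null_norm_def by (intro real_le_rsqrt member_le_sum) auto
 from this[of 1] this[of 2] show ?thesis
  using norm_triangle_ineq4[of "\<phi> 1 z" "\<epsilon> * \<i> * \<phi> 2 z"] e by (auto simp: null_f_def norm_mult)
qed

text \<open>The length of the dual field is at most a multiple of |h| divided by the square root of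
  \<open>null_norm\<close>, which by \<open>puncture_growth\<close> is at least of order |w|^-2. So
  a double pole is the borderline case.\<close>

lemma jvar_bound:
 assumes h: "h holomorphic_on PP" "\<And>z l. z \<in> PP ==> l \<in> lattice t ==> h (z + l) = h z"
  and ord: "\<And>a. a \<in> punctures t ==> order_at h a 2"
 obtains M where "\<And>z. z \<in> PP ==> norm (jvar \<phi> h j z) \<le> M"
proof (rule periodic_bounded)
 show "continuous_on PP (jvar \<phi> h j)" by (intro smooth_on_continuous smooth_on_jvar open_PP hol pos h(1))
 show "jvar \<phi> h j (z + l) = jvar \<phi> h j z" if "z \<in> PP" "l \<in> lattice t" for z l
  using that by (simp add: jvar_def null_norm_def per h)
 show "\<exists>\<delta>>0. \<exists>C. \<forall>w\<in>ball 0 \<delta> - {0}. norm (jvar \<phi> h j (a + w)) \<le> C" if a: "a \<in> punctures t" for a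
 proof -
  obtain \<epsilon> \<delta> C where e: "\<epsilon> = 1 \<or> \<epsilon> = -1" and \<delta>: "0 < \<delta>" "\<delta> \<le> 1/2" "\<forall>w\<in>ball 0 \<delta> - {0}. null_f \<epsilon> \<phi> (a + w) \<noteq> 0"
   "\<forall>w\<in>ball 0 \<delta> - {0}. norm (inverse (null_f \<epsilon> \<phi> (a + w))) \<le> C * (norm w)\<^sup>2"
   using puncture_growth[OF a] by metis
  obtain C' \<delta>' where \<delta>': "\<delta>' > 0" "\<forall>w\<in>ball 0 \<delta>' - {0}. norm (h (a + w)) * norm w ^ 2 \<le> C'"
   using ord[OF a] unfolding order_at_def by blast
  have "norm (jvar \<phi> h j (a + w)) \<le> 4 * C * C'" if w: "w \<in> ball 0 (min \<delta> \<delta>') - {0}" for w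
  proof -
   let ?z = "a + w"
   define N where "N = sqrt (null_norm \<phi> ?z)"
   have w1: "w \<in> ball 0 \<delta> - {0}" "w \<in> ball 0 \<delta>' - {0}" using w by auto
   have zPP: "?z \<in> PP" using w1(1) \<delta>(2) by (intro near_puncture_PP[OF a]) auto
   have N: "N > 0" "N * N = null_norm \<phi> ?z" using pos[OF zPP] by (simp_all add: N_def)
   have "1 = norm (inverse (null_f \<epsilon> \<phi> ?z)) * norm (null_f \<epsilon> \<phi> ?z)" using \<delta>(3) w1 by (simp flip: norm_mult)
   also have "\<dots> \<le> (C * (norm w)\<^sup>2) * (2 * N)"
    using \<delta>(4) w1 norm_null_f_le[OF e, of ?z] by (intro mult_mono) (auto simp: N_def intro: order_trans[OF norm_ge_zero])
   finally have c: "1 \<le> 2 * C * (norm w)\<^sup>2 * N" by (simp add: mult_ac)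
   have C: "C > 0"
   proof (rule ccontr)
    assume "\<not> ?thesis"
    then have "C * ((norm w)\<^sup>2 * N) \<le> 0" using N(1) by (intro mult_nonpos_nonneg) auto
    then show False using c by (simp add: mult_ac)
   qed
   have phi: "norm (\<phi> j ?z) \<le> N" unfolding N_def null_norm_def by (intro real_le_rsqrt member_le_sum) auto
   have "norm (jvar \<phi> h j ?z) \<le> norm (h ?z) * (2 * norm (\<phi> j ?z) * inverse (N * N))"
    unfolding jvar_def N(2) real_norm_def
    by (rule order_trans[OF abs_Re_le_cmod]) (use pos[OF zPP] in \<open>simp add: norm_mult norm_inverse\<close>)
   also have "\<dots> \<le> norm (h ?z) * (2 * N * inverse (N * N))" using phi N(1) by (intro mult_left_mono mult_right_mono) auto
   also have "\<dots> = norm (h ?z) * 2 * inverse N * 1" using N(1) by (simp add: field_simps)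
   also have "\<dots> \<le> norm (h ?z) * 2 * inverse N * (2 * C * (norm w)\<^sup>2 * N)" using c N(1) by (intro mult_left_mono) auto
   also have "\<dots> = 4 * C * (norm (h ?z) * (norm w)\<^sup>2)" using N(1) by (simp add: field_simps)
   also have "\<dots> \<le> 4 * C * C'" using \<delta>'(2) w1(2) C by (intro mult_left_mono) auto
   finally show ?thesis .
  qed
  then show ?thesis using \<delta>(1) \<delta>'(1) by (intro exI[of _ "min \<delta> \<delta>'"] exI[of _ "4 * C * C'"] conjI ballI) auto
 qed
qed (rule that)

lemma punctured_ball_ne: "0 < \<delta> ==> \<exists>w. w \<in> ball 0 \<delta> - {0::complex}"
 by (rule exI[of _ "of_real (\<delta>/2)"]) simp

lemma PP_ne: "PP \<noteq> {}" "a \<in> punctures t ==> 0 < \<delta> ==> \<delta> \<le> 1/2 ==> (+) a ` (ball 0 \<delta> - {0}) \<subseteq> PP \<and>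
  open ((+) a ` (ball 0 \<delta> - {0})) \<and> (+) a ` (ball 0 \<delta> - {0}) \<noteq> {}"
proof -
 show *: "(+) a ` (ball 0 \<delta> - {0}) \<subseteq> PP \<and> open ((+) a ` (ball 0 \<delta> - {0})) \<and> (+) a ` (ball 0 \<delta> - {0}) \<noteq> {}"
  if "a \<in> punctures t" "0 < \<delta>" "\<delta> \<le> 1/2" for a \<delta>
 proof (intro conjI)
  show "(+) a ` (ball 0 \<delta> - {0}) \<subseteq> PP" by (intro image_subsetI near_puncture_PP that(1)) (use that(3) in auto)
  show "open ((+) a ` (ball 0 \<delta> - {0}))" by (intro open_translation open_delete open_ball)
  show "(+) a ` (ball 0 \<delta> - {0}) \<noteq> {}" using punctured_ball_ne[OF that(2)] by blast
 qed
 show "PP \<noteq> {}" using *[of 0 "1/2"] by (auto simp: punctures_def)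
qed

text \<open>If the Gauss map were constant near a puncture, then everywhere; so \<open>1/f\<close> would be a periodic holomorphic function
 vanishing at all the punctures, contradicting the maximum principle.\<close>

lemma gauss_map_nonconstant:
 assumes a: "a \<in> punctures t" and d: "0 < \<delta>" "\<delta> \<le> 1/2"
 shows "\<exists>w\<in>ball 0 \<delta> - {0}. \<phi> 3 (a + w) \<noteq> 0"
proof (rule ccontr)
 assume "\<not> ?thesis"
 then have z: "\<phi> 3 z = 0" if "z \<in> (+) a ` (ball 0 \<delta> - {0})" for z using that by auto
 note conn = open_PP connected_punctured_plane[of t]
 have vanish: "F z = 0" if "F holomorphic_on PP" "\<And>z. z \<in> (+) b ` (ball 0 \<delta>' - {0}) ==> F z = 0"
  "b \<in> punctures t" "0 < \<delta>'" "\<delta>' \<le> 1/2" "z \<in> PP" for F b \<delta>' z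
  using analytic_continuation_open[of "(+) b ` (ball 0 \<delta>' - {0})" PP F "%z. 0"] PP_ne(2)[OF that(3-5)] conn that(1,2,6) by auto
 have p3: "\<phi> 3 z = 0" if "z \<in> PP" for z by (rule vanish[OF hol z a d that])
 \<comment> \<open>With \<open>\<phi> 3 = 0\<close> the null condition says that one of the two
   factors vanishes; by continuation from a puncture it vanishes identically.\<close>
 have prod: "null_f \<epsilon> \<phi> z * null_f (- \<epsilon>) \<phi> z = 0" if "z \<in> PP" "\<epsilon> = 1 \<or> \<epsilon> = -1" for z \<epsilon>
 proof -
  have "(\<phi> 1 z)\<^sup>2 + (\<phi> 2 z)\<^sup>2 = 0" using null that(1) p3[OF that(1)] by (force simp: sum_3)
  then show ?thesis using that(2) by (auto simp: null_f_def algebra_simps power2_eq_square)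
 qed
 have zero: "null_f (- \<epsilon>) \<phi> z = 0" if "b \<in> punctures t" "0 < \<delta>'" "\<delta>' \<le> 1/2" "\<epsilon> = 1 \<or> \<epsilon> = -1"
  "\<forall>w\<in>ball 0 \<delta>' - {0}. null_f \<epsilon> \<phi> (b + w) \<noteq> 0" "z \<in> PP" for b \<delta>' \<epsilon> z
 proof (rule vanish[OF null_f_holomorphic _ that(1-3,6)])
  fix z assume "z \<in> (+) b ` (ball 0 \<delta>' - {0})"
  then have "null_f \<epsilon> \<phi> z \<noteq> 0" "z \<in> PP" using that(5) PP_ne(2)[OF that(1-3)] by auto
  then show "null_f (- \<epsilon>) \<phi> z = 0" using prod[OF _ that(4)] by fastforce
 qed
 obtain \<epsilon> \<delta>1 where e: "\<epsilon> = 1 \<or> \<epsilon> = -1" and \<delta>1: "0 < \<delta>1" "\<delta>1 \<le> 1/2" "\<forall>w\<in>ball 0 \<delta>1 - {0}. null_f \<epsilon> \<phi> (a + w) \<noteq> 0"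
  using puncture_growth[OF a] by metis
 note fm0 = zero[OF a \<delta>1(1,2) e \<delta>1(3)]
 have f0: "null_f \<epsilon> \<phi> z \<noteq> 0" if "z \<in> PP" for z
 proof
  assume "null_f \<epsilon> \<phi> z = 0"
  with fm0[OF that] have "\<phi> 1 z = 0" "\<phi> 2 z = 0" using e by (auto simp: null_f_def)
  then show False using pos[OF that] p3[OF that] by (simp add: null_norm_def sum_3)
 qed
 define k where "k = (%z. inverse (null_f \<epsilon> \<phi> z))"
 have k: "k holomorphic_on PP" unfolding k_def by (intro holomorphic_intros null_f_holomorphic f0)
 have kper: "k (z + l) = k z" if "z \<in> PP" "l \<in> lattice t" for z l by (simp add: k_def null_f_per that)
 obtain z1 where z1: "z1 \<in> PP" using PP_ne(1) by blast
 have k1: "norm (k z1) > 0" using f0[OF z1] by (simp add: k_def)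
 have ksmall: "\<exists>\<delta>>0. \<forall>w\<in>ball 0 \<delta> - {0}. norm (k (b + w)) < norm (k z1)" if b: "b \<in> punctures t" for b
 proof -
  obtain \<epsilon>' \<delta>' C where e': "\<epsilon>' = 1 \<or> \<epsilon>' = -1" and \<delta>': "0 < \<delta>'" "\<delta>' \<le> 1/2" "\<forall>w\<in>ball 0 \<delta>' - {0}. null_f \<epsilon>' \<phi> (b + w) \<noteq> 0"
   "\<forall>w\<in>ball 0 \<delta>' - {0}. norm (inverse (null_f \<epsilon>' \<phi> (b + w))) \<le> C * (norm w)\<^sup>2"
   using puncture_growth[OF b] by metis
  \<comment> \<open>The chart at any other puncture has the same sign, since
    \<open>null_f (- \<epsilon>) \<phi>\<close> vanishes everywhere.\<close>
  have "\<epsilon>' = \<epsilon>"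
  proof (rule ccontr)
   assume "\<epsilon>' \<noteq> \<epsilon>"
   then have "\<epsilon>' = - \<epsilon>" using e e' by auto
   moreover obtain w where "w \<in> ball 0 \<delta>' - {0::complex}" using punctured_ball_ne[OF \<delta>'(1)] by blast
   moreover from this have "b + w \<in> PP" using \<delta>'(2) by (intro near_puncture_PP b) auto
   ultimately show False using bspec[OF \<delta>'(3), of w] fm0[of "b + w"] by auto
  qed
  then have bd: "norm (k (b + w)) \<le> C * (norm w)\<^sup>2" if "w \<in> ball 0 \<delta>' - {0}" for w using \<delta>'(4) that by (simp add: k_def)
  have "((%w::complex. C * (norm w)\<^sup>2) \<longlongrightarrow> C * (norm (0::complex))\<^sup>2) (at 0)" by (intro tendsto_intros)
  then have "\<forall>\<^sub>F w::complex in at 0. C * (norm w)\<^sup>2 < norm (k z1)" using k1 by (intro order_tendstoD(2)) auto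
  then obtain r where r: "r > 0" "\<And>w::complex. w \<noteq> 0 ==> norm w < r ==> C * (norm w)\<^sup>2 < norm (k z1)"
   unfolding eventually_at by (auto simp: dist_norm)
  have "norm (k (b + w)) < norm (k z1)" if "w \<in> ball 0 (min r \<delta>') - {0}" for w
   using bd[of w] r(2)[of w] that by auto
  then show ?thesis using r(1) \<delta>'(1) by (intro exI[of _ "min r \<delta>'"]) auto
 qed
 obtain s where s: "s > 0" "\<forall>z\<in>PP \<inter> near_punctures t s. norm (k z) < norm (k z1)"
  by (rule near_punctures_uniform[of "%z. norm (k z) < norm (k z1)"]) (use kper ksmall in auto)
 define K where "K = cbox 0 (Complex 1 t) - near_punctures t s"
 have K: "compact K" "K \<subseteq> PP" unfolding K_def using compact_away(1,2)[OF s(1)] by auto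
 have red: "\<exists>z'\<in>K. norm (k z) = norm (k z')" if "z \<in> PP" "z \<notin> near_punctures t s" for z
 proof -
  from compact_away(3)[OF s(1) that] obtain l where l: "l \<in> lattice t" "z - l \<in> K" unfolding K_def by blast
  then have "k (z - l + l) = k (z - l)" using K(2) by (intro kper) auto
  then show ?thesis using l(2) by (intro bexI[of _ "z - l"]) auto
 qed
 have z1n: "z1 \<notin> near_punctures t s" using s(2) z1 by force
 have "continuous_on K (%z. norm (k z))" using holomorphic_on_imp_continuous_on[OF k] K(2) by (intro continuous_on_norm) (rule continuous_on_subset)
 moreover have "K \<noteq> {}" using red[OF z1 z1n] by blast
 ultimately obtain z0 where z0: "z0 \<in> K" "\<And>z. z \<in> K ==> norm (k z) \<le> norm (k z0)"
  using continuous_attains_sup[OF K(1)] by blast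
 have far: "norm (k z) \<le> norm (k z0)" if "z \<in> PP" "z \<notin> near_punctures t s" for z
  using red[OF that] z0(2) by force
 have "norm (k z) \<le> norm (k z0)" if "z \<in> PP" for z
  using far[OF that] far[OF z1 z1n] s(2) that less_imp_le order_trans by (metis IntI)
 then have "k constant_on PP"
  using maximum_modulus_principle[OF k conn conn(1) order_refl, of z0] z0(1) K(2) by blast
 then have "k z = k z1" if "z \<in> PP" for z using z1 that unfolding constant_on_def by auto
 moreover obtain r where r: "r > 0" "\<forall>w\<in>ball 0 r - {0}. norm (k (a + w)) < norm (k z1)" using ksmall[OF a] by blast
 moreover obtain w where w: "w \<in> ball 0 (min r (1/2)) - {0::complex}" using punctured_ball_ne[of "min r (1/2)"] r(1) by auto
 moreover from w have "a + w \<in> PP" by (intro near_puncture_PP a) auto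
 ultimately show False using bspec[OF r(2), of w] by auto
qed

text \<open>At a puncture where h has at most a simple pole, the double zero of 1/f makes h/f tend
  to 0, as the local kernel theorem requires. Its conclusion then continues analytically.\<close>

lemma jacobi_kernel_global:
 assumes h: "h holomorphic_on PP" and a: "a \<in> punctures t" and ord: "order_at h a 1"
  and J: "\<And>z j. z \<in> PP ==> jac \<phi> (jvar \<phi> h j) z = 0"
 obtains b where "Re b = 0" "\<And>z. z \<in> PP ==> h z = b * \<phi> 3 z"
proof -
 obtain \<epsilon> \<delta> C where e: "\<epsilon> = 1 \<or> \<epsilon> = -1" and \<delta>: "0 < \<delta>" "\<delta> \<le> 1/2" "\<forall>w\<in>ball 0 \<delta> - {0}. null_f \<epsilon> \<phi> (a + w) \<noteq> 0"
  and glim: "(null_g \<epsilon> (%k w. \<phi> k (a + w)) \<longlongrightarrow> 0) (at 0)"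
  and fC: "\<forall>w\<in>ball 0 \<delta> - {0}. norm (inverse (null_f \<epsilon> \<phi> (a + w))) \<le> C * (norm w)\<^sup>2"
  by (rule puncture_growth[OF a])
 let ?A = "ball 0 \<delta> - {0::complex}"
 have PPa: "a + w \<in> PP" if "w \<in> ?A" for w using that \<delta>(2) by (intro near_puncture_PP a) auto
 have comp_hol: "(%w. F (a + w)) holomorphic_on ?A" if "F holomorphic_on PP" for F
  by (rule holomorphic_on_compose_gen[OF _ that, of "%w. a + w", unfolded o_def]) (rule image_subsetI[OF PPa] | intro holomorphic_intros)+
 obtain C' \<delta>' where \<delta>': "\<delta>' > 0" "\<forall>w\<in>ball 0 \<delta>' - {0}. norm (h (a + w)) * norm w ^ 1 \<le> C'"
  using ord unfolding order_at_def by blast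
 have "((%w. h (a + w) / null_f \<epsilon> \<phi> (a + w)) \<longlongrightarrow> 0) (at 0)"
 proof (rule Lim_null_comparison)
  have "norm (h (a + w) / null_f \<epsilon> \<phi> (a + w)) \<le> \<bar>C'\<bar> * \<bar>C\<bar> * norm w" if "w \<noteq> 0" "norm w < min \<delta> \<delta>'" for w
  proof -
   have "norm (h (a + w) / null_f \<epsilon> \<phi> (a + w)) \<le> norm (h (a + w)) * (C * (norm w)\<^sup>2)"
    unfolding divide_inverse norm_mult using fC that by (intro mult_left_mono) auto
   also have "\<dots> = (norm (h (a + w)) * norm w) * C * norm w" by (simp add: power2_eq_square)
   also have "\<dots> \<le> (\<bar>C'\<bar> * \<bar>C\<bar>) * norm w"
   proof (intro mult_right_mono)
    have "norm (h (a + w)) * norm w \<le> \<bar>C'\<bar>" using \<delta>'(2) that by force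
    then have "(norm (h (a + w)) * norm w) * \<bar>C\<bar> \<le> \<bar>C'\<bar> * \<bar>C\<bar>" by (rule mult_right_mono) simp
    moreover have "(norm (h (a + w)) * norm w) * C \<le> (norm (h (a + w)) * norm w) * \<bar>C\<bar>" by (intro mult_left_mono) auto
    ultimately show "norm (h (a + w)) * norm w * C \<le> \<bar>C'\<bar> * \<bar>C\<bar>" by linarith
   qed simp
   finally show ?thesis .
  qed
  then show "\<forall>\<^sub>F w in at 0. norm (h (a + w) / null_f \<epsilon> \<phi> (a + w)) \<le> \<bar>C'\<bar> * \<bar>C\<bar> * norm w"
   unfolding eventually_at using \<delta>(1) \<delta>'(1) by (intro exI[of _ "min \<delta> \<delta>'"]) (auto simp: dist_norm)
  show "((%w::complex. \<bar>C'\<bar> * \<bar>C\<bar> * norm w) \<longlongrightarrow> 0) (at 0)" by (auto intro!: tendsto_eq_intros)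
 qed
 then have qlim: "((%w. h (a + w) / null_f \<epsilon> (%k w. \<phi> k (a + w)) w) \<longlongrightarrow> 0) (at 0)" by (simp only: null_f_def)
 have Jw: "Re (jcoeff (%k w. \<phi> k (a + w)) (%w. h (a + w)) w * jnormal (%k w. \<phi> k (a + w)) j w) = 0" if w: "w \<in> ?A" for w j
 proof -
  define N where "N = null_norm \<phi> (a + w)"
  have "0 = Re (8 * jcoeff \<phi> h (a + w) * inverse (of_real N) ^ 2 * jnormal \<phi> j (a + w))"
   using jac_jvar[OF open_PP hol pos h PPa[OF w], of j] J[OF PPa[OF w], of j] by (simp add: N_def)
  also have "\<dots> = Re (of_real (8 * inverse N ^ 2) * (jcoeff \<phi> h (a + w) * jnormal \<phi> j (a + w)))" by (simp add: mult_ac)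
  also have "\<dots> = 8 * inverse N ^ 2 * Re (jcoeff \<phi> h (a + w) * jnormal \<phi> j (a + w))" by (simp del: of_real_mult of_real_power of_real_inverse)
  finally have "Re (jcoeff \<phi> h (a + w) * jnormal \<phi> j (a + w)) = 0" using pos[OF PPa[OF w]] by (simp add: N_def)
  then show ?thesis
   unfolding jcoeff_def jnormal_def null_norm_def null_mixed_def deriv_translate .
 qed
 have "\<exists>b. Re b = 0 \<and> (\<forall>w\<in>?A. h (a + w) = b * \<phi> 3 (a + w))"
 proof (rule jacobi_kernel[OF e \<delta>(1) comp_hol[OF hol] _ _ glim _ comp_hol[OF h] qlim Jw])
  show "\<forall>w\<in>?A. (\<Sum>k\<in>UNIV. (\<phi> k (a + w))\<^sup>2) = 0" using null PPa by blast
  show "\<forall>w\<in>?A. null_f \<epsilon> (%k w. \<phi> k (a + w)) w \<noteq> 0" using \<delta>(3) by (simp only: null_f_def)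
  show "\<exists>w\<in>?A. null_g \<epsilon> (%k w. \<phi> k (a + w)) w \<noteq> 0"
   using gauss_map_nonconstant[OF a \<delta>(1,2)] \<delta>(3) unfolding null_g_def null_f_def by (metis divide_eq_0_iff)
  show "\<exists>b. Re b = 0 \<and> (\<forall>w\<in>?A. h (a + w) = b * \<phi> 3 (a + w))"
   if "Re b = 0" "\<And>w. w \<in> ?A ==> h (a + w) = b * \<phi> 3 (a + w)" for b using that by blast
 qed
 then obtain b where b: "Re b = 0" "\<forall>w\<in>?A. h (a + w) = b * \<phi> 3 (a + w)" by blast
 have "h z = b * \<phi> 3 z" if "z \<in> PP" for z
 proof (rule analytic_continuation_open[of "(+) a ` ?A" PP h "%z. b * \<phi> 3 z"])
  show "open ((+) a ` ?A)" "(+) a ` ?A \<noteq> {}" "(+) a ` ?A \<subseteq> PP" using PP_ne(2)[OF a \<delta>(1,2)] by blast+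
  show "h z = b * \<phi> 3 z" if "z \<in> (+) a ` ?A" for z using that b(2) by auto
 qed (use that open_PP connected_punctured_plane h in \<open>auto intro!: holomorphic_intros hol\<close>)
 then show ?thesis using that b(1) by blast
qed

end

section \<open>Parities of the potential, of forms and of dual fields\<close>

lemma order_at_scale:
 assumes "order_at F a k" "c \<noteq> 0" shows "order_at (%z. F (z / c)) (c * a) k"
proof -
 obtain C \<delta> where \<delta>: "\<delta> > 0" "\<forall>w\<in>ball 0 \<delta> - {0}. norm (F (a + w)) * norm w ^ k \<le> C"
  using assms(1) unfolding order_at_def by blast
 have "norm (F ((c * a + w) / c)) * norm w ^ k \<le> norm c ^ k * C" if w: "w \<in> ball 0 (norm c * \<delta>) - {0}" for w
 proof -
  have "w / c \<in> ball 0 \<delta> - {0}" using w assms(2) by (auto simp: norm_divide field_simps)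
  then have "norm (F (a + w / c)) * norm (w / c) ^ k \<le> C" using \<delta>(2) by blast
  then have "norm c ^ k * (norm (F (a + w / c)) * norm (w / c) ^ k) \<le> norm c ^ k * C" by (intro mult_left_mono) auto
  moreover have "norm c ^ k * (norm (F (a + w / c)) * norm (w / c) ^ k) = norm (F (a + w / c)) * norm w ^ k"
   using assms(2) by (simp add: norm_divide power_divide)
  moreover have "(c * a + w) / c = a + w / c" using assms(2) by (simp add: add_divide_distrib)
  ultimately show ?thesis by simp
 qed
 then show ?thesis unfolding order_at_def using \<delta>(1) assms(2) by (intro exI[of _ "norm c ^ k * C"] exI[of _ "norm c * \<delta>"]) auto
qed

lemma deriv_reflect:
 assumes S: "open S" "z \<in> S" and F: "F holomorphic_on S"
  and \<sigma>: "s = 1 \<or> s = -1" "\<And>z. z \<in> S ==> of_real s * cnj z \<in> S" "\<And>z. z \<in> S ==> F (of_real s * cnj z) = of_real c * cnj (F z)"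
 shows "deriv F (of_real s * cnj z) = of_real (s * c) * cnj (deriv F z)"
proof -
 have "(F has_derivative (%v. deriv F z * v)) (at z)"
  using holomorphic_derivI[OF F S] by (simp add: has_field_derivative_def)
 then have 1: "((%z. of_real c * cnj (F z)) has_derivative (%v. of_real c * cnj (deriv F z * v))) (at z)"
  by (intro has_derivative_mult_right has_derivative_cnj)
 have "(F has_derivative (%v. deriv F (of_real s * cnj z) * v)) (at (of_real s * cnj z))"
  using holomorphic_derivI[OF F S(1) \<sigma>(2)[OF S(2)]] by (simp add: has_field_derivative_def)
 moreover have "((%z. of_real s * cnj z) has_derivative (%v. of_real s * cnj v)) (at z)"
  by (auto intro!: derivative_eq_intros)
 ultimately have 2: "((%z. F (of_real s * cnj z)) has_derivative (%v. deriv F (of_real s * cnj z) * (of_real s * cnj v))) (at z)"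
  by (rule has_derivative_compose[rotated])
 have e: "deriv F (of_real s * cnj z) * (of_real s * cnj 1) = of_real c * cnj (deriv F z * 1)"
  using pd_cong_open[OF S, of "%z. F (of_real s * cnj z)" "%z. of_real c * cnj (F z)" 1] \<sigma>(3) pd_eqI[OF 1, of 1] pd_eqI[OF 2, of 1] by simp
 have "deriv F (of_real s * cnj z) = (deriv F (of_real s * cnj z) * (of_real s * cnj 1)) * of_real s" using \<sigma>(1) by auto
 then show ?thesis unfolding e by (simp add: mult_ac)
qed

context puncture_torus
begin

lemma order_at_cong: "order_at F a k ==> a \<in> punctures t ==> (\<And>z. z \<in> PP ==> F z = G z) ==> order_at G a k"
proof -
 assume a: "order_at F a k" "a \<in> punctures t" "\<And>z. z \<in> PP ==> F z = G z"
 obtain C \<delta> where \<delta>: "\<delta> > 0" "\<forall>w\<in>ball 0 \<delta> - {0}. norm (F (a + w)) * norm w ^ k \<le> C"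
  using a(1) unfolding order_at_def by blast
 have "norm (G (a + w)) * norm w ^ k \<le> C" if "w \<in> ball 0 (min \<delta> (1/2)) - {0}" for w
  using bspec[OF \<delta>(2), of w] a(3)[OF near_puncture_PP[OF a(2)], of w] that by auto
 then show "order_at G a k" unfolding order_at_def using \<delta>(1) by (intro exI[of _ C] exI[of _ "min \<delta> (1/2)"]) auto
qed

lemma punctures_distinct: assumes "a \<in> punctures t" "b \<in> punctures t" "a - b \<in> lattice t" shows "a = b"
proof -
 have "\<forall>a\<in>punctures t. 0 \<le> Re a \<and> Re a \<le> 1/2 \<and> 0 \<le> Im a \<and> Im a \<le> t/2"
  unfolding punctures_def using t by simp
 from bspec[OF this assms(1)] bspec[OF this assms(2)]
 have *: "\<bar>Re (a - b)\<bar> \<le> 1/2" "\<bar>Im (a - b)\<bar> \<le> t / 2" by (auto simp: abs_if)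
 obtain m n where l: "a - b = of_int m + of_int n * (\<i> * of_real t)" using assms(3) by (auto simp: lattice_def)
 have "\<bar>of_int m :: real\<bar> \<le> 1/2" using *(1) by (simp add: l)
 then have m: "m = 0" by linarith
 have "\<bar>of_int n\<bar> * t \<le> 1/2 * t" using *(2) t by (simp add: l abs_mult)
 then have "\<bar>of_int n :: real\<bar> \<le> 1/2" using t0 by (simp only: mult_le_cancel_right_pos)
 then have "n = 0" by linarith
 then show ?thesis using l m by simp
qed

end

text \<open>Composing the two rules gives h(-z) = p q h(z) for real p and q: equal signs mean an
  even form, opposite signs an odd one.\<close>

definition form_parity :: "real => real => real => (complex => complex) => bool" where
 "form_parity t p q h \<longleftrightarrow> (\<forall>z\<in>punctured_plane t. h (- cnj z) = of_real p * cnj (h z) \<and> h (cnj z) = of_real q * cnj (h z))"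

definition periodic_form :: "real => (complex => complex) => bool" where
 "periodic_form t h \<longleftrightarrow> h holomorphic_on punctured_plane t \<and> (\<forall>z\<in>punctured_plane t. \<forall>l\<in>lattice t. h (z + l) = h z) \<and>
  (\<forall>a\<in>punctures t. order_at h a 2)"

context null_torus
begin

lemma curv_parity: "has_parity t 1 1 (null_curv \<phi>)"
proof -
 have *: "null_curv \<phi> w = null_curv \<phi> z"
  if s: "s = 1 \<or> s = -1" and c: "\<And>k. c k = 1 \<or> c k = -1" and w: "\<And>k. \<phi> k w = of_real (c k) * cnj (\<phi> k z)"
   "\<And>k. deriv (\<phi> k) w = of_real (s * c k) * cnj (deriv (\<phi> k) z)" for w z s and c :: "3 => real"
 proof -
  have "norm (\<phi> k w) = norm (\<phi> k z)" "norm (deriv (\<phi> k) w) = norm (deriv (\<phi> k) z)" for k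
   using s c[of k] by (auto simp: w norm_mult)
  moreover have "null_mixed \<phi> w = of_real s * cnj (null_mixed \<phi> z)"
  proof -
   have "\<phi> k w * cnj (deriv (\<phi> k) w) = of_real s * (cnj (\<phi> k z) * deriv (\<phi> k) z)" for k
    unfolding w using c[of k] by auto
   then show ?thesis by (simp add: null_mixed_def sum_distrib_left)
  qed
  then have "norm (null_mixed \<phi> w) = norm (null_mixed \<phi> z)" using s by (auto simp: norm_mult)
  ultimately show ?thesis by (simp add: null_curv_def null_norm_def null_dnorm_def)
 qed
 show ?thesis
  unfolding has_parity_def
 proof (intro ballI conjI)
  fix z assume z: "z \<in> PP"
  have "null_curv \<phi> (- cnj z) = null_curv \<phi> z"
   using deriv_reflect[OF open_PP z hol, of "-1"] sym1 punctured_plane_reflect z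
   by (intro *[of "-1" sgn1]) (auto simp: sgn1_def)
  then show "null_curv \<phi> (- cnj z) = 1 * null_curv \<phi> z" by simp
  have "null_curv \<phi> (cnj z) = null_curv \<phi> z"
   using deriv_reflect[OF open_PP z hol, of 1] sym2 punctured_plane_reflect z
   by (intro *[of 1 sgn2]) (auto simp: sgn2_def)
  then show "null_curv \<phi> (cnj z) = 1 * null_curv \<phi> z" by simp
 qed
qed

end

sublocale null_torus \<subseteq> torus_potential t "null_curv \<phi>"
proof
 show "periodic_smooth t (null_curv \<phi>)" unfolding periodic_smooth_def
  using smooth_on_null_curv[OF open_PP hol pos] curv_per by blast
 show "has_parity t 1 1 (null_curv \<phi>)" by (rule curv_parity)
qed

context null_torus
begin

lemma J_jac: "J u z = jac \<phi> u z" by (simp add: J_def jac_def)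

lemma periodic_smooth_jvar: "periodic_form t h ==> periodic_smooth t (jvar \<phi> h j)"
 unfolding periodic_smooth_def periodic_form_def
 using smooth_on_jvar[OF open_PP hol pos] by (auto simp: jvar_def null_norm_def per)

lemma has_parity_jvar:
 assumes "form_parity t p q h" shows "has_parity t (p * sgn1 j) (q * sgn2 j) (jvar \<phi> h j)"
proof -
 have s: "sgn1 k = 1 \<or> sgn1 k = -1" "sgn2 k = 1 \<or> sgn2 k = -1" for k by (simp_all add: sgn1_def sgn2_def)
 have n: "norm (complex_of_real (sgn1 k) * cnj w) = norm w" "norm (complex_of_real (sgn2 k) * cnj w) = norm w" for k w
  using s[of k] by (auto simp: norm_mult)
 have N: "null_norm \<phi> (- cnj z) = null_norm \<phi> z" "null_norm \<phi> (cnj z) = null_norm \<phi> z" if "z \<in> PP" for z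
  unfolding null_norm_def sym1[OF that] sym2[OF that] n by simp_all
 show ?thesis
  unfolding has_parity_def
 proof (intro ballI conjI)
  fix z assume z: "z \<in> PP"
  have h: "h (- cnj z) = of_real p * cnj (h z)" "h (cnj z) = of_real q * cnj (h z)" using assms z by (auto simp: form_parity_def)
  show "jvar \<phi> h j (- cnj z) = p * sgn1 j * jvar \<phi> h j z" "jvar \<phi> h j (cnj z) = q * sgn2 j * jvar \<phi> h j z"
   unfolding jvar_def N[OF z] sym1[OF z] sym2[OF z] h by (simp_all add: algebra_simps)
 qed
qed

text \<open>A component that is not a Jacobi field would extend the family by
  \<open>jacobi_sections_extend\<close>. Hence all of them are Jacobi fields, and one puncture with
  at most a simple pole suffices for the kernel theorem.\<close>

lemma form_in_kernel:
 assumes fam: "negative_family N \<psi> P Q" "\<not> extendable N \<psi>"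
  and h: "periodic_form t h" "form_parity t p q h" "p \<in> {1, -1}" "q \<in> {1, -1}"
  and orth: "\<And>i j. i < N ==> B (jvar \<phi> h j) (\<psi> i) = 0"
  and a: "a \<in> punctures t" "order_at h a 1"
 obtains b where "\<And>z. z \<in> PP ==> h z = b * \<phi> 3 z"
proof -
 have hh: "h holomorphic_on PP" using h(1) by (simp add: periodic_form_def)
 have "\<exists>M. \<forall>z\<in>PP. \<bar>jvar \<phi> h j z\<bar> \<le> M" for j
  using jvar_bound[of h j] h(1) unfolding periodic_form_def real_norm_def by metis
 then obtain M where M: "\<And>j z. z \<in> PP ==> \<bar>jvar \<phi> h j z\<bar> \<le> M j" by metis
 have M': "\<bar>jvar \<phi> h j z\<bar> \<le> Max (range M)" if "z \<in> PP" for j z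
  by (rule order_trans[OF M[OF that] Max_ge]) auto
 have "jac \<phi> (jvar \<phi> h k) z = 0" if z: "z \<in> PP" for z k
 proof (rule ccontr)
  assume "jac \<phi> (jvar \<phi> h k) z \<noteq> 0"
  then have "J (jvar \<phi> h k) z \<noteq> 0" by (simp add: J_jac)
  have "extendable N \<psi>"
  proof (rule jacobi_sections_extend[where u = "jvar \<phi> h" and r = "%j. p * sgn1 j" and s = "%j. q * sgn2 j", OF fam(1) periodic_smooth_jvar[OF h(1)] has_parity_jvar[OF h(2)] _ _ M' _ orth z \<open>J (jvar \<phi> h k) z \<noteq> 0\<close>])
   show "(\<Sum>j\<in>UNIV. jvar \<phi> h j z * J (jvar \<phi> h j) z) = 0" if "z \<in> PP" for z
    using sum_jvar_jac[OF open_PP hol pos hh that null] by (simp add: J_jac)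
   show "p * sgn1 j \<in> {1, -1}" "q * sgn2 j \<in> {1, -1}" for j using h(3,4) by (auto simp: sgn1_def sgn2_def)
  qed
  then show False using fam(2) by blast
 qed
 then show ?thesis using jacobi_kernel_global[OF hh a] that by blast
qed

text \<open>The map z -> -z preserves h and reverses the sign of \<open>\<phi> 3\<close>.\<close>

lemma even_form_in_kernel:
 assumes "form_parity t p p h" "p \<in> {1, -1}" "\<And>z. z \<in> PP ==> h z = b * \<phi> 3 z" "z \<in> PP"
 shows "h z = 0"
proof -
 have z: "cnj z \<in> PP" "- z \<in> PP" using assms(4) punctured_plane_reflect[of z t] punctured_plane_reflect(2)[of "cnj z" t] by auto
 have "h (- cnj (cnj z)) = of_real p * cnj (h (cnj z))" "h (cnj z) = of_real p * cnj (h z)"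
  using assms(1,4) z(1) unfolding form_parity_def by blast+
 then have "h (- z) = h z" using assms(2) by auto
 moreover have "\<phi> 3 (- z) = - \<phi> 3 z" using sym1[OF z(1), of 3] sym2[OF assms(4), of 3] by simp
 ultimately show ?thesis using assms(3)[OF assms(4)] assms(3)[OF z(2)] by simp
qed

lemma B_wrong_parity:
 assumes fam: "negative_family N \<psi> P Q" "i < N" and h: "periodic_form t h" "form_parity t p q h" "p \<in> {1, -1}" "q \<in> {1, -1}"
  and ne: "(P i, Q i) \<noteq> (p * sgn1 j, q * sgn2 j)"
 shows "B (jvar \<phi> h j) (\<psi> i) = 0"
proof (rule B_parity[OF periodic_smooth_jvar[OF h(1)] has_parity_jvar[OF h(2)]])
 have f: "tame t (\<psi> i) \<and> has_parity t (P i) (Q i) (\<psi> i) \<and> P i \<in> {1, -1} \<and> Q i \<in> {1, -1}"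
  using fam unfolding negative_family_def by blast
 then show "tame t (\<psi> i)" "has_parity t (P i) (Q i) (\<psi> i)" by auto
 show "p * sgn1 j * P i = -1 \<or> q * sgn2 j * Q i = -1"
  using f ne h(3,4) by (auto simp: sgn1_def sgn2_def split: if_splits)
qed

end

section \<open>Holomorphic forms with prescribed poles and parities\<close>

lemma solve_linear_relation:
 fixes a b c x y :: complex
 assumes "a + b * x + c * y = 0" "b \<noteq> 0" shows "(- a / b) * 1 + (- c / b) * y = x"
proof -
 have "b * x = - a - c * y" using assms(1) by algebra
 then have "x = (- a - c * y) / b" using assms(2) by (simp add: eq_divide_eq mult.commute)
 then show ?thesis by (simp add: diff_divide_distrib)
qed

context puncture_torus
begin

lemma PP_not_lattice: "z \<in> PP ==> z \<notin> lattice t" "z \<in> PP ==> z - 1/2 \<notin> lattice t" "z \<in> PP ==> z - \<i> * of_real t / 2 \<notin> lattice t"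
 by (simp_all add: punctured_plane_def)

lemma puncture_mem: "0 \<in> punctures t" "1/2 \<in> punctures t" "\<i> * of_real t / 2 \<in> punctures t"
 unfolding punctures_def by blast+

lemma puncture_diff: "1/2 \<notin> lattice t" "\<i> * of_real t / 2 \<notin> lattice t" "\<i> * of_real t / 2 - 1/2 \<notin> lattice t"
  "0 - 1/2 \<notin> lattice t" "1/2 - \<i> * of_real t / 2 \<notin> lattice t"
proof -
 have ne: "1/2 \<noteq> (0::complex)" "\<i> * of_real t / 2 \<noteq> 0" "\<i> * of_real t / 2 \<noteq> 1/2"
  using t by (auto simp: complex_eq_iff)
 show "1/2 \<notin> lattice t" "\<i> * of_real t / 2 \<notin> lattice t" "\<i> * of_real t / 2 - 1/2 \<notin> lattice t"
  "0 - 1/2 \<notin> lattice t" "1/2 - \<i> * of_real t / 2 \<notin> lattice t"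
  using punctures_distinct[OF puncture_mem(2) puncture_mem(1)] punctures_distinct[OF puncture_mem(3) puncture_mem(1)]
   punctures_distinct[OF puncture_mem(3) puncture_mem(2)] punctures_distinct[OF puncture_mem(1) puncture_mem(2)]
   punctures_distinct[OF puncture_mem(2) puncture_mem(3)] ne unfolding diff_0_right by metis+
qed

lemma periodic_formI:
 assumes "h holomorphic_on S" "PP \<subseteq> S" "\<And>z l. l \<in> lattice t ==> h (z + l) = h z"
  "order_at h 0 2" "order_at h (1/2) 2" "order_at h (\<i> * of_real t / 2) 2"
 shows "periodic_form t h"
 unfolding periodic_form_def punctures_def using assms holomorphic_on_subset[OF assms(1,2)] by (simp only: ball_simps) blast

lemma periodic_form_add: "periodic_form t h ==> periodic_form t k ==> periodic_form t (%z. h z + k z)"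
 unfolding periodic_form_def by (auto intro!: holomorphic_intros order_at_add)

lemma periodic_form_cmult: "periodic_form t h ==> periodic_form t (%z. c * h z)"
 unfolding periodic_form_def by (auto intro!: holomorphic_intros order_at_cmult)

lemma order_at_isCont_on: "F holomorphic_on S ==> open S ==> a \<in> S ==> order_at F a k"
 by (intro order_at_isCont continuous_on_interior[OF holomorphic_on_imp_continuous_on]) (auto simp: interior_open)

text \<open>The constant 1, the function with a double pole at the lattice points, and its translate
  by 1/2. All three are regular at the third puncture, where the kernel theorem can therefore be
  applied to every combination.\<close>

lemma double_pole_forms:
 obtains e :: "3 => complex => complex" where "\<And>k. periodic_form t (e k)" "\<And>k. form_parity t 1 1 (e k)"
  "\<And>k. order_at (e k) (\<i> * of_real t / 2) 0"
  "\<And>c :: real^3. (\<forall>z\<in>PP. (\<Sum>k\<in>UNIV. of_real (c $ k) * e k z) = 0) ==> c = 0"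
proof -
 obtain P where P: "P holomorphic_on - lattice t" "open (- lattice t)" "\<And>z l. l \<in> lattice t ==> P (z + l) = P z"
  "\<And>z. P (- z) = P z" "\<And>z. P (cnj z) = cnj (P z)" "order_at P 0 2" "\<not> order_at P 0 0"
  using elliptic_double_pole[OF t0] by blast
 define R where "R = (%z. P (z - 1/2))"
 define S where "S = {z. z - 1/2 \<notin> lattice t}"
 have S: "open S"
 proof -
  have "S = (%z. z - 1/2) -` (- lattice t)" by (auto simp: S_def)
  then show ?thesis using P(2) by (auto intro!: open_vimage continuous_intros)
 qed
 have Rh: "R holomorphic_on S" unfolding R_def
  by (rule holomorphic_on_compose_gen[OF _ P(1), of "%z. z - 1/2", unfolded o_def]) (auto intro!: holomorphic_intros simp: S_def)
 have PPs: "PP \<subseteq> - lattice t" "PP \<subseteq> S" using PP_not_lattice by (auto simp: S_def)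
 have Rper: "R (z + l) = R z" if "l \<in> lattice t" for z l
  using P(3)[OF that, of "z - 1/2"] by (simp add: R_def algebra_simps)
 have Rcnj: "R (cnj z) = cnj (R z)" for z using P(5)[of "z - 1/2"] by (simp add: R_def)
 have Rneg: "R (- z) = R z" for z
  using P(4)[of "z + 1/2"] P(3)[OF lattice_1, of "z - 1/2"] by (simp add: R_def add.commute)
 have R2: "order_at R (1/2) k \<longleftrightarrow> order_at P 0 k" for k by (simp add: order_at_def R_def)
 define e :: "3 => complex => complex" where "e k = (if k = 1 then (%z. 1) else if k = 2 then P else R)" for k
 have e: "e 1 = (%z. 1)" "e 2 = P" "e 3 = R" by (simp_all add: e_def)
 have ordP: "order_at P (1/2) k" "order_at P (\<i> * of_real t / 2) k" for k
  using puncture_diff by (intro order_at_isCont_on[OF P(1,2)]; simp)+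
 have ordR: "order_at R 0 k" "order_at R (\<i> * of_real t / 2) k" for k
  using puncture_diff by (intro order_at_isCont_on[OF Rh S]; simp add: S_def)+
 have ord1: "order_at (%z. 1) a k" for a k by (intro order_at_isCont) simp
 have per: "periodic_form t (%z. 1)" "periodic_form t P" "periodic_form t R"
 proof -
  show "periodic_form t (%z. 1)" by (rule periodic_formI[of _ UNIV]) (auto intro: ord1)
  show "periodic_form t P" by (rule periodic_formI[OF P(1) PPs(1) P(3) P(6) ordP])
  show "periodic_form t R" by (rule periodic_formI[OF Rh PPs(2) Rper ordR(1) iffD2[OF R2 P(6)] ordR(2)])
 qed
 have par: "form_parity t 1 1 (%z. 1)" "form_parity t 1 1 P" "form_parity t 1 1 R"
  unfolding form_parity_def by (simp_all add: P(4,5) Rneg Rcnj)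
 have 3: "k = 1 \<or> k = 2 \<or> k = 3" for k :: 3 by (rule exhaust_3)
 show ?thesis
 proof (rule that[of e])
  show "periodic_form t (e k)" "form_parity t 1 1 (e k)" "order_at (e k) (\<i> * of_real t / 2) 0" for k
   using 3[of k] per par ordP ordR ord1 e by auto
  fix c :: "real^3"
  assume c: "\<forall>z\<in>PP. (\<Sum>k\<in>UNIV. of_real (c $ k) * e k z) = 0"
  have c': "of_real (c $ 1) + of_real (c $ 2) * P z + of_real (c $ 3) * R z = 0" if "z \<in> PP" for z
   using c that by (simp add: sum_3 e)
  \<comment> \<open>Otherwise \<open>P\<close> would be a combination of functions bounded near 0;
    likewise for \<open>R\<close> at 1/2 below.\<close>
  have "c $ 2 = 0"
  proof (rule ccontr)
   assume n: "c $ 2 \<noteq> 0"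
   have "order_at (%z. (- of_real (c $ 1) / of_real (c $ 2)) * 1 + (- of_real (c $ 3) / of_real (c $ 2)) * R z) 0 0"
    by (intro order_at_add order_at_cmult ord1 ordR)
   moreover have "(- of_real (c $ 1) / of_real (c $ 2)) * 1 + (- of_real (c $ 3) / of_real (c $ 2)) * R z = P z" if "z \<in> PP" for z
    by (rule solve_linear_relation[OF c'[OF that]]) (simp add: n)
   ultimately show False using order_at_cong[OF _ puncture_mem(1)] P(7) by blast
  qed
  moreover have "c $ 3 = 0"
  proof (rule ccontr)
   assume n: "c $ 3 \<noteq> 0"
   have "order_at (%z. (- of_real (c $ 1) / of_real (c $ 3)) * 1 + (- of_real (c $ 2) / of_real (c $ 3)) * P z) (1/2) 0"
    by (intro order_at_add order_at_cmult ord1 ordP)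
   moreover have "(- of_real (c $ 1) / of_real (c $ 3)) * 1 + (- of_real (c $ 2) / of_real (c $ 3)) * P z = R z" if "z \<in> PP" for z
    using c'[OF that] n by (intro solve_linear_relation) (simp_all add: add.assoc add.commute[of "of_real (c $ 2) * P z"])
   ultimately have "order_at R (1/2) 0" using order_at_cong[OF _ puncture_mem(2)] by blast
   then show False using P(7) R2 by blast
  qed
  moreover obtain z0 where "z0 \<in> PP" using near_puncture_PP[OF puncture_mem(1), of "1/4"] by auto
  ultimately have "c $ 1 = 0" using c'[of z0] by simp
  with \<open>c $ 2 = 0\<close> \<open>c $ 3 = 0\<close> show "c = 0" by (simp add: vec_eq_iff forall_3)
 qed
qed

text \<open>One form has its poles at 0 and 1/2, the other at 0 and i t/2. They share the parity but
  not the pole pairs, so they cannot be proportional to the same function.\<close>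

lemma simple_pole_forms:
 obtains h k where "periodic_form t h" "periodic_form t k" "form_parity t 1 (-1) h" "form_parity t 1 (-1) k"
  "order_at h 0 1" "order_at k 0 1" "\<not> order_at h (1/2) 0" "order_at h (\<i> * of_real t / 2) 0" "\<not> order_at k (\<i> * of_real t / 2) 0"
proof -
 obtain Z where Z: "Z holomorphic_on {z. z \<notin> lattice t \<and> z - 1/2 \<notin> lattice t}" "open {z. z \<notin> lattice t \<and> z - 1/2 \<notin> lattice t}"
  "\<And>z l. l \<in> lattice t ==> Z (z + l) = Z z" "\<And>z. Z (- z) = - Z z" "\<And>z. Z (cnj z) = cnj (Z z)"
  "order_at Z 0 1" "order_at Z (1/2) 1" "\<not> order_at Z 0 0" "\<not> order_at Z (1/2) 0"
  by (rule elliptic_simple_poles[OF t0], rule that) (assumption | simp)+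
 \<comment> \<open>Division by i t carries \<open>lattice t\<close> to \<open>lattice t'\<close> and
   the puncture i t/2 to 1/2, so the second form comes from the first construction for the
   reciprocal modulus.\<close>
 define t' where "t' = 1 / t"
 have t': "t' > 0" using t0 by (simp add: t'_def)
 obtain W where W: "W holomorphic_on {z. z \<notin> lattice t' \<and> z - 1/2 \<notin> lattice t'}" "open {z. z \<notin> lattice t' \<and> z - 1/2 \<notin> lattice t'}"
  "\<And>z l. l \<in> lattice t' ==> W (z + l) = W z" "\<And>z. W (- z) = - W z" "\<And>z. W (cnj z) = cnj (W z)"
  "order_at W 0 1" "order_at W (1/2) 1" "\<not> order_at W 0 0" "\<not> order_at W (1/2) 0"
  by (rule elliptic_simple_poles[OF t'], rule that) (assumption | simp)+
 define c where "c = \<i> * complex_of_real t"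
 have c: "c \<noteq> 0" using t0 by (simp add: c_def)
 have ct: "c * (of_int m + of_int n * (\<i> * of_real t')) = of_int (- n) + of_int m * (\<i> * of_real t)" for m n
  using t0 by (simp add: c_def t'_def algebra_simps)
 have lat: "z / c \<in> lattice t' \<longleftrightarrow> z \<in> lattice t" for z
 proof
  assume "z / c \<in> lattice t'"
  then obtain m n where "z / c = of_int m + of_int n * (\<i> * of_real t')" by (auto simp: lattice_def)
  then have "z = c * (of_int m + of_int n * (\<i> * of_real t'))" using c by (simp add: divide_eq_eq mult.commute)
  then have "z = of_int (- n) + of_int m * (\<i> * of_real t)" unfolding ct .
  then show "z \<in> lattice t" unfolding lattice_def by blast
 next
  assume "z \<in> lattice t"
  then obtain m n where "z = of_int m + of_int n * (\<i> * of_real t)" by (auto simp: lattice_def)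
  then have "z = c * (of_int n + of_int (- m) * (\<i> * of_real t'))" unfolding ct by simp
  then have "z / c = of_int n + of_int (- m) * (\<i> * of_real t')" using c by simp
  then show "z / c \<in> lattice t'" unfolding lattice_def by blast
 qed
 define V where "V = (%z. W (z / c))"
 define U where "U = {z. z \<notin> lattice t \<and> z - \<i> * of_real t / 2 \<notin> lattice t}"
 have half: "z / c - 1/2 \<in> lattice t' \<longleftrightarrow> z - \<i> * of_real t / 2 \<in> lattice t" for z
  using lat[of "z - \<i> * of_real t / 2"] c by (simp add: diff_divide_distrib c_def)
 have UW: "U = (%z. z / c) -` {z. z \<notin> lattice t' \<and> z - 1/2 \<notin> lattice t'}" by (auto simp: U_def lat half)
 have U: "open U" unfolding UW using c W(2) by (intro open_vimage continuous_intros) auto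
 have Vh: "V holomorphic_on U" unfolding V_def
  by (rule holomorphic_on_compose_gen[OF _ W(1), of "%z. z / c", unfolded o_def]) (use c in \<open>auto intro!: holomorphic_intros simp: UW\<close>)
 have Vper: "V (z + l) = V z" if "l \<in> lattice t" for z l
  using W(3)[of "l / c" "z / c"] that lat by (simp add: V_def add_divide_distrib)
 have cc: "cnj z / c = - cnj (z / c)" for z by (simp add: c_def)
 have Vcnj: "V (cnj z) = - cnj (V z)" "V (- cnj z) = cnj (V z)" for z
  using W(4)[of "cnj (z / c)"] W(5)[of "z / c"] cc[of z] unfolding V_def by simp_all
 have V1: "order_at V 0 1" "order_at V (\<i> * of_real t / 2) 1"
  using order_at_scale[OF W(6) c] order_at_scale[OF W(7) c] by (simp_all add: V_def c_def)
 have V0: "\<not> order_at V (\<i> * of_real t / 2) 0"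
 proof
  assume "order_at V (\<i> * of_real t / 2) 0"
  from order_at_scale[OF this, of "1 / c"] c have "order_at (%z. V (z * c)) (1/2) 0" by (simp add: c_def)
  then show False using W(9) c by (simp add: V_def)
 qed
 have PPs: "PP \<subseteq> {z. z \<notin> lattice t \<and> z - 1/2 \<notin> lattice t}" "PP \<subseteq> U" using PP_not_lattice by (auto simp: U_def)
 have ordZ: "order_at Z (\<i> * of_real t / 2) k" for k
  using puncture_diff by (intro order_at_isCont_on[OF Z(1,2)]) simp
 have ordV: "order_at V (1/2) k" for k
  using puncture_diff by (intro order_at_isCont_on[OF Vh U]) (simp add: U_def)
 have m2: "order_at F a 1 ==> order_at F a 2" for F a using order_at_mono[of F a 1 2] by simp
 show ?thesis
 \<comment> \<open>The factor i reverses both signs of the parity of \<open>Z\<close>; the quarter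
   turn has already done so for \<open>V\<close>.\<close>
 proof (rule that[of "%z. \<i> * Z z" V])
  have "periodic_form t Z" by (rule periodic_formI[OF Z(1) PPs(1) Z(3) m2[OF Z(6)] m2[OF Z(7)] ordZ])
  then show "periodic_form t (%z. \<i> * Z z)" by (rule periodic_form_cmult)
  show "periodic_form t V" by (rule periodic_formI[OF Vh PPs(2) Vper m2[OF V1(1)] ordV m2[OF V1(2)]])
  show "form_parity t 1 (-1) (%z. \<i> * Z z)" "form_parity t 1 (-1) V"
   unfolding form_parity_def by (simp_all add: Z(4,5) Vcnj)
  show "order_at (%z. \<i> * Z z) 0 1" "order_at V 0 1" "order_at (%z. \<i> * Z z) (\<i> * of_real t / 2) 0"
   by (intro order_at_cmult Z V1 ordZ)+
  show "\<not> order_at (%z. \<i> * Z z) (1/2) 0"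
   using order_at_cmult[of "%z. \<i> * Z z" "1/2" 0 "- \<i>"] Z(9) by (auto simp: mult.assoc[symmetric])
 qed (rule V0)
qed

end

section \<open>Counting parity classes\<close>

context torus_potential
begin

lemma B_sum_left:
 assumes "finite I" "\<And>k. k \<in> I ==> periodic_smooth t (u k)" "tame t f"
 shows "periodic_smooth t (%z. \<Sum>k\<in>I. c k * u k z) \<and> B (%z. \<Sum>k\<in>I. c k * u k z) f = (\<Sum>k\<in>I. c k * B (u k) f)"
 using assms(1,2)
proof (induction I)
 case empty
 then show ?case by (simp add: B_def pd_eqI[OF has_derivative_const] fint_def periodic_smooth_def smooth_on_const)
next
 case (insert k I)
 have e: "(%z. \<Sum>k\<in>insert k I. c k * u k z) = (%z. (\<Sum>k\<in>I. c k * u k z) + c k * u k z)"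
  using insert(1,2) by (simp add: add.commute)
 have i: "periodic_smooth t (u k)" "periodic_smooth t (%z. \<Sum>k\<in>I. c k * u k z)"
  "B (%z. \<Sum>k\<in>I. c k * u k z) f = (\<Sum>k\<in>I. c k * B (u k) f)" using insert by auto
 show ?case unfolding e B_lincomb_left[OF i(2,1) assms(3)] i(3)
  using periodic_smooth_lincomb[OF i(2,1)] insert(1,2) by (simp add: add.commute)
qed

end

context null_torus
begin

text \<open>Apart from one class, each member of the family imposes one linear condition on the three-dimensional space of forms
 with double poles at two punctures, as only one component of the Jacobi section lies in its class.\<close>

lemma card_other_classes:
 assumes fam: "negative_family N \<psi> P Q" "\<not> extendable N \<psi>" and p: "p \<in> {1, -1}"
 shows "card {i. i < N \<and> (P i, Q i) \<noteq> (p, - p)} \<ge> 3"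
proof (rule ccontr)
 define I where "I = {i. i < N \<and> (P i, Q i) \<noteq> (p, - p)}"
 assume "\<not> card {i. i < N \<and> (P i, Q i) \<noteq> (p, - p)} \<ge> 3"
 then have I: "finite I" "card I \<le> 2" by (auto simp: I_def)
 obtain e :: "3 => complex => complex" where e: "\<And>k. periodic_form t (e k)" "\<And>k. form_parity t 1 1 (e k)"
  "\<And>k. order_at (e k) (\<i> * of_real t / 2) 0"
  "\<And>c :: real^3. (\<forall>z\<in>PP. (\<Sum>k\<in>UNIV. of_real (c $ k) * e k z) = 0) ==> c = 0"
  using double_pole_forms by blast
 \<comment> \<open>Multiplication by i reverses both signs of a parity, so the even forms of parity
   (1, 1) also supply those of parity (-1, -1).\<close>
 define \<omega> where "\<omega> = (if p = 1 then 1 else \<i>)"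
 have \<omega>: "\<omega> \<noteq> 0" "of_real p * cnj \<omega> = \<omega>" using p by (auto simp: \<omega>_def)
 \<comment> \<open>At most one component j shares the parity of \<open>\<psi> i\<close>, and the
   other pairings vanish. The sum over j is thus a single condition that takes care of all
   components; two such vectors leave a nonzero orthogonal \<open>c\<close>.\<close>
 define v :: "nat => real^3" where "v i = (\<chi> k. \<Sum>j\<in>UNIV. B (jvar \<phi> (%z. \<omega> * e k z) j) (\<psi> i))" for i
 have "dim (v ` I) \<le> card (v ` I)" using I(1) by (intro dim_le_card') auto
 also have "\<dots> \<le> 2" using card_image_le[OF I(1), of v] I(2) by linarith
 finally have "dim (v ` I) < DIM(real^3)" by simp
 then obtain c where c: "c \<noteq> 0" "\<And>y. y \<in> span (v ` I) ==> orthogonal c y" using orthogonal_to_subspace_exists by blast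
 have c0: "(\<Sum>k\<in>UNIV. c $ k * v i $ k) = 0" if "i \<in> I" for i
  using c(2)[OF span_base, of "v i"] that by (simp add: orthogonal_def inner_vec_def)
 define h where "h = (%z. \<omega> * (\<Sum>k\<in>UNIV. of_real (c $ k) * e k z))"
 have h3: "h = (%z. (of_real (c $ 1) * \<omega>) * e 1 z + (of_real (c $ 2) * \<omega>) * e 2 z + (of_real (c $ 3) * \<omega>) * e 3 z)"
  by (simp add: h_def sum_3 algebra_simps)
 have h: "periodic_form t h" unfolding h3 by (intro periodic_form_add periodic_form_cmult e)
 have hpar: "form_parity t p p h"
  unfolding form_parity_def
 proof (intro ballI conjI)
  fix z assume "z \<in> PP"
  then have ek: "e k (- cnj z) = cnj (e k z)" "e k (cnj z) = cnj (e k z)" for k using e(2)[of k] by (auto simp: form_parity_def)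
  have "\<omega> * cnj s = of_real p * cnj (\<omega> * s)" for s using \<omega>(2) by (simp add: mult.assoc[symmetric])
  then show "h (- cnj z) = of_real p * cnj (h z)" "h (cnj z) = of_real p * cnj (h z)"
   unfolding h_def ek by (simp_all flip: cnj_sum add: sum_3)
 qed
 have ekpar: "form_parity t p p (%z. \<omega> * e k z)" for k
  using e(2)[of k] \<omega>(2) unfolding form_parity_def by (simp add: mult.assoc[symmetric])
 have jv: "jvar \<phi> h j = (%z. \<Sum>k\<in>UNIV. c $ k * jvar \<phi> (%z. \<omega> * e k z) j z)" for j
  by (rule ext) (simp add: jvar_def h_def sum_3 algebra_simps)
 have orth: "B (jvar \<phi> h j) (\<psi> i) = 0" if i: "i < N" for i j
 proof (cases "(P i, Q i) = (p * sgn1 j, p * sgn2 j)")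
  case True
  have "(p * sgn1 j, p * sgn2 j) \<noteq> (p, - p)" using p by (auto simp: sgn1_def sgn2_def split: if_splits)
  then have iI: "i \<in> I" unfolding I_def mem_Collect_eq True using i by blast
  have tm: "tame t (\<psi> i)" using fam(1) i by (simp add: negative_family_def)
  have s: "B (jvar \<phi> h j') (\<psi> i) = (\<Sum>k\<in>UNIV. c $ k * B (jvar \<phi> (%z. \<omega> * e k z) j') (\<psi> i))" for j'
   unfolding jv using B_sum_left[of UNIV "%k. jvar \<phi> (%z. \<omega> * e k z) j'" "\<psi> i" "%k. c $ k"] periodic_smooth_jvar[OF periodic_form_cmult[OF e(1)]] tm
   by simp
  have "0 = (\<Sum>j'\<in>UNIV. B (jvar \<phi> h j') (\<psi> i))"
   using c0[OF iI] unfolding s v_def vec_lambda_beta sum_distrib_left by (subst (asm) sum.swap) simp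
  also have "\<dots> = (\<Sum>j'\<in>UNIV. if j' = j then B (jvar \<phi> h j) (\<psi> i) else 0)"
  proof (intro sum.cong refl)
   fix j' :: 3
   have "(sgn1 j, sgn2 j) \<noteq> (sgn1 j', sgn2 j')" if "j' \<noteq> j"
    using that exhaust_3[of j] exhaust_3[of j'] by auto
   then have "j' \<noteq> j ==> (P i, Q i) \<noteq> (p * sgn1 j', p * sgn2 j')" using True p by auto
   then show "B (jvar \<phi> h j') (\<psi> i) = (if j' = j then B (jvar \<phi> h j) (\<psi> i) else 0)"
    using B_wrong_parity[OF fam(1) i h hpar p p] by auto
  qed
  finally show ?thesis by simp
 qed (rule B_wrong_parity[OF fam(1) i h hpar p p])
 have "order_at h (\<i> * of_real t / 2) 0" unfolding h3 by (intro order_at_add order_at_cmult e)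
 then have "order_at h (\<i> * of_real t / 2) 1" by (rule order_at_mono) simp
 from form_in_kernel[OF fam h hpar p p orth puncture_mem(3) this]
 obtain b where b: "\<And>z. z \<in> PP ==> h z = b * \<phi> 3 z" by blast
 then have "h z = 0" if "z \<in> PP" for z using even_form_in_kernel[OF hpar p _ that] by blast
 then have "c = 0" using \<omega>(1) by (intro e(4)) (simp add: h_def)
 then show False using c(1) by simp
qed

lemma negative_family_step:
 assumes fam: "negative_family N \<psi> P Q" and N: "N \<le> 3"
 shows "extendable N \<psi>"
proof (rule ccontr)
 assume ne: "\<not> extendable N \<psi>"
 \<comment> \<open>A member of the exempt class would leave at most two members outside it.\<close>
 have all: "(P i, Q i) \<noteq> (p, - p)" if "p \<in> {1, -1}" "i < N" for p i
 proof
  assume "(P i, Q i) = (p, - p)"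
  then have "{i. i < N \<and> (P i, Q i) \<noteq> (p, - p)} \<subseteq> {..<N} - {i}" by auto
  then have "card {i. i < N \<and> (P i, Q i) \<noteq> (p, - p)} \<le> card ({..<N} - {i})" by (intro card_mono) auto
  then show False using card_other_classes[OF fam ne that(1)] that(2) N by simp
 qed
 have fi: "tame t (\<psi> i)" "has_parity t (P i) (Q i) (\<psi> i)" "P i \<in> {1, -1}" "Q i \<in> {1, -1}" "B (\<psi> i) (\<psi> i) < 0" if "i < N" for i
  using fam that unfolding negative_family_def by auto
 have cls: "P i = 1 \<and> Q i = 1 \<or> P i = -1 \<and> Q i = -1" if "i < N" for i
  using all[of 1 i] all[of "-1" i] fi(3,4)[OF that] that by auto
 show False
 proof (cases "\<exists>i<N. P i = -1")
  case True
  then obtain i where i: "i < N" "P i = -1" "Q i = -1" using cls by force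
  then obtain g where g: "tame t g" "has_parity t 1 (-1) g" "B g g < 0"
   using parity_flip[of "\<psi> i"] fi[OF i(1)] by auto
  \<comment> \<open>The parity (1, -1) differs in exactly one sign from each of the two classes that
    occur.\<close>
  have "B g (\<psi> k) = 0" if "k < N" for k
   using cls[OF that] by (intro B_parity[OF tame_periodic_smooth[OF g(1)] g(2) fi(1,2)[OF that]]) auto
  then show False using ne g unfolding extendable_def by blast
 next
  case False
  then have P1: "P i = 1" "Q i = 1" if "i < N" for i using cls that by auto
  obtain h k where hk: "periodic_form t h" "periodic_form t k" "form_parity t 1 (-1) h" "form_parity t 1 (-1) k"
   "order_at h 0 1" "order_at k 0 1" "\<not> order_at h (1/2) 0" "order_at h (\<i> * of_real t / 2) 0" "\<not> order_at k (\<i> * of_real t / 2) 0"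
   by (rule simple_pole_forms)
  have orth: "B (jvar \<phi> l j) (\<psi> i) = 0" if "periodic_form t l" "form_parity t 1 (-1) l" "i < N" for l j i
   using P1[OF that(3)] by (intro B_wrong_parity[OF fam that(3,1,2)]) (auto simp: sgn1_def sgn2_def)
  obtain b where b: "\<And>z. z \<in> PP ==> h z = b * \<phi> 3 z"
   using form_in_kernel[OF fam ne hk(1,3) _ _ orth[OF hk(1,3)] puncture_mem(1) hk(5)] by auto
  obtain d where d: "\<And>z. z \<in> PP ==> k z = d * \<phi> 3 z"
   using form_in_kernel[OF fam ne hk(2,4) _ _ orth[OF hk(2,4)] puncture_mem(1) hk(6)] by auto
  \<comment> \<open>Either h vanishes, against its pole at 1/2, or k is a multiple of h and thus
    regular at i t/2, against its pole there.\<close>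
  show False
  proof (cases "b = 0")
   case True
   have "order_at (%z. 0) (1/2) 0" by (intro order_at_isCont) simp
   then show False using hk(7) order_at_cong[OF _ puncture_mem(2), of "%z. 0" 0 h] b True by simp
  next
   case False
   have "order_at (%z. (d / b) * h z) (\<i> * of_real t / 2) 0" by (intro order_at_cmult hk)
   moreover have "(d / b) * h z = k z" if "z \<in> PP" for z using b[OF that] d[OF that] False by simp
   ultimately show False using hk(9) order_at_cong[OF _ puncture_mem(3)] by blast
  qed
 qed
qed

theorem four_negative_directions: "\<exists>\<psi> P Q. negative_family 4 \<psi> P Q"
proof -
 have "\<exists>\<psi> P Q. negative_family N \<psi> P Q" if "N \<le> 4" for N
  using that
 proof (induction N)
  case 0
  show ?case by (simp add: negative_family_def)
 next
  case (Suc N)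
  then obtain \<psi> P Q where fam: "negative_family N \<psi> P Q" by auto
  have "N \<le> 3" using Suc.prems by simp
  from negative_family_extend[OF fam negative_family_step[OF fam this]] show ?case .
 qed
 then show ?thesis by simp
qed

end

section \<open>Minimal surfaces and null curves\<close>

text \<open>Pythagoras for the orthogonal frame a, b, a x b, obtained by evaluating |v x (a x b)|^2
  in two ways.\<close>

lemma frame_norm:
 fixes a b v :: "real^3"
 assumes "a \<bullet> a = e" "b \<bullet> b = e" "a \<bullet> b = 0" "e > 0"
 shows "v \<bullet> v = ((v \<bullet> a)\<^sup>2 + (v \<bullet> b)\<^sup>2) / e + (v \<bullet> sgn (cross3 a b))\<^sup>2"
proof -
 define c where "c = cross3 a b"
 have "(norm c)\<^sup>2 = e\<^sup>2" using assms unfolding c_def norm_cross unfolding power2_norm_eq_inner by (simp add: power2_eq_square)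
 then have nc: "norm c = e" using assms(4) by (simp add: power2_eq_iff_nonneg)
 have l: "cross3 v c = (v \<bullet> b) *\<^sub>R a - (v \<bullet> a) *\<^sub>R b" unfolding c_def by (rule Lagrange)
 have "(norm (cross3 v c))\<^sup>2 = e * ((v \<bullet> a)\<^sup>2 + (v \<bullet> b)\<^sup>2)"
  unfolding l power2_norm_eq_inner using assms by (simp add: inner_diff_left inner_diff_right inner_commute[of b a] power2_eq_square algebra_simps)
 then have "e * ((v \<bullet> a)\<^sup>2 + (v \<bullet> b)\<^sup>2) = (v \<bullet> v) * e\<^sup>2 - (v \<bullet> c)\<^sup>2"
  unfolding norm_cross nc by (simp add: power2_norm_eq_inner)
 moreover have vc: "v \<bullet> c = e * (v \<bullet> sgn c)" using assms(4) by (simp add: sgn_div_norm nc)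
 ultimately have "e * ((v \<bullet> a)\<^sup>2 + (v \<bullet> b)\<^sup>2 + e * (v \<bullet> sgn c)\<^sup>2) = e * (e * (v \<bullet> v))"
  unfolding vc by (simp add: power2_eq_square algebra_simps)
 then have "(v \<bullet> a)\<^sup>2 + (v \<bullet> b)\<^sup>2 + e * (v \<bullet> sgn c)\<^sup>2 = e * (v \<bullet> v)" using assms(4) by simp
 then show ?thesis using assms(4) unfolding c_def[symmetric] by (simp add: field_simps)
qed

lemma pd_inner:
 fixes f g :: "complex => 'a::euclidean_space"
 assumes "f differentiable (at z)" "g differentiable (at z)"
 shows "pd v (%z. f z \<bullet> g z) z = f z \<bullet> pd v g z + pd v f z \<bullet> g z"
 by (rule pd_eqI, intro has_derivative_inner differentiable_has_pd assms)

section \<open>The Weierstrass data of a minimal immersion\<close>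

locale minimal_torus = puncture_torus +
 fixes X :: "complex => real^3"
 assumes cmi: "conformal_minimal_immersion t X"
begin

lemma X_smooth: "smooth_on PP X" using cmi by (simp add: conformal_minimal_immersion_def)

lemma E_props:
 assumes "z \<in> PP"
 shows "ffE X z > 0" "ffG X z = ffE X z" "ffF X z = 0" "ff_det X z = (ffE X z)\<^sup>2" "area_density X z = ffE X z" "mean_curvature X z = 0"
proof -
 have c: "ff_det X z > 0" "ffE X z = ffG X z" "ffF X z = 0" "mean_curvature X z = 0"
  using cmi assms unfolding conformal_minimal_immersion_def by auto
 then show "ffG X z = ffE X z" "ffF X z = 0" "mean_curvature X z = 0" by auto
 show d: "ff_det X z = (ffE X z)\<^sup>2" using c by (simp add: ff_det_def power2_eq_square)
 have "ffE X z \<ge> 0" by (simp add: ffE_def)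
 moreover have "ffE X z \<noteq> 0" using c(1) d by auto
 ultimately show "ffE X z > 0" by simp
 then show "area_density X z = ffE X z" by (simp add: area_density_def d)
qed

lemma dX: "z \<in> PP ==> X differentiable (at z)" "z \<in> PP ==> pd v X differentiable (at z)"
 using X_smooth smooth_on_differentiable smooth_on_pd by blast+

text \<open>Differentiating the conformality relations determines the tangential components of the
  second derivatives, and vanishing mean curvature the normal one. Together they say that the
  coordinate functions are harmonic.\<close>

lemma second_order:
 assumes z: "z \<in> PP"
 defines "A \<equiv> pd 1 (pd 1 X) z" and "M \<equiv> pd \<i> (pd 1 X) z" and "C \<equiv> pd \<i> (pd \<i> X) z"
 shows "A \<bullet> pd \<i> X z = - (M \<bullet> pd 1 X z)" "A \<bullet> pd 1 X z = M \<bullet> pd \<i> X z" "A + C = 0" "pd 1 (pd \<i> X) z = M"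
proof -
 show M: "pd 1 (pd \<i> X) z = M" unfolding M_def by (rule pd_symmetric[OF open_PP X_smooth z])
 have dE: "pd v (%z. pd 1 X z \<bullet> pd 1 X z) z = pd v (%z. pd \<i> X z \<bullet> pd \<i> X z) z" for v
  using E_props(2) by (intro pd_cong_open[OF open_PP z]) (simp add: ffE_def ffG_def)
 have dF: "pd v (%z. pd 1 X z \<bullet> pd \<i> X z) z = 0" for v
 proof -
  have "pd v (%z. pd 1 X z \<bullet> pd \<i> X z) z = pd v (%z. 0) z"
   using E_props(3) by (intro pd_cong_open[OF open_PP z]) (simp add: ffF_def)
  then show ?thesis by (simp add: pd_eqI[OF has_derivative_const])
 qed
 note p = pd_inner[OF dX(2)[OF z] dX(2)[OF z]]
 have 1: "A \<bullet> pd 1 X z = M \<bullet> pd \<i> X z" using dE[of 1] unfolding p M A_def by (simp add: inner_commute)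
 have 2: "M \<bullet> pd 1 X z = C \<bullet> pd \<i> X z" using dE[of \<i>] unfolding p M_def[symmetric] C_def by (simp add: inner_commute)
 have 3: "A \<bullet> pd \<i> X z + M \<bullet> pd 1 X z = 0" using dF[of 1] unfolding p M A_def by (simp add: inner_commute)
 have 4: "M \<bullet> pd \<i> X z + C \<bullet> pd 1 X z = 0" using dF[of \<i>] unfolding p M_def[symmetric] C_def by (simp add: inner_commute)
 show "A \<bullet> pd \<i> X z = - (M \<bullet> pd 1 X z)" "A \<bullet> pd 1 X z = M \<bullet> pd \<i> X z" using 1 3 by auto
 have "(sfL X z + sfN X z) * ffE X z = 0"
  using E_props[OF z] by (simp add: mean_curvature_def algebra_simps)
 then have "(A + C) \<bullet> sgn (cross3 (pd 1 X z) (pd \<i> X z)) = 0"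
  using E_props(1)[OF z] by (simp add: sfL_def sfN_def unit_normal_def A_def C_def inner_add_left)
 moreover have "(A + C) \<bullet> pd 1 X z = 0" "(A + C) \<bullet> pd \<i> X z = 0" using 1 2 3 4 by (simp_all add: inner_add_left)
 ultimately have "(A + C) \<bullet> (A + C) = 0"
  using frame_norm[of "pd 1 X z" "ffE X z" "pd \<i> X z" "A + C"] E_props(1-3)[OF z] by (simp add: ffE_def ffF_def ffG_def)
 then show "A + C = 0" by simp
qed

end

text \<open>\<open>L\<close> is the linear part of the rigid motion that puts the surface into
  symmetric position. It may reverse orientation; the formulas below involve only inner
  products.\<close>

locale rotated_minimal_torus = minimal_torus +
 fixes L :: "real^3 => real^3"
 assumes L: "orthogonal_transformation L"
begin

definition wdata :: "3 => complex => complex" where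
 "wdata k z = of_real (L (pd 1 X z) $ k) - \<i> * of_real (L (pd \<i> X z) $ k)"

lemma L_inner: "L u \<bullet> L v = u \<bullet> v" and L_linear: "bounded_linear L"
 using L linear_conv_bounded_linear unfolding orthogonal_transformation_def by auto

lemma L_sum: "(\<Sum>k\<in>UNIV. L u $ k * L v $ k) = u \<bullet> v"
 using L_inner[of u v] by (simp add: inner_vec_def)

lemma L_component: "bounded_linear (%p. L p $ k)"
 using bounded_linear_compose[OF bounded_linear_vec_nth L_linear] .

lemma wdata_deriv:
 assumes z: "z \<in> PP"
 shows "(wdata k has_field_derivative (of_real (L (pd 1 (pd 1 X) z) $ k) - \<i> * of_real (L (pd \<i> (pd 1 X) z) $ k))) (at z)"
proof -
 let ?A = "L (pd 1 (pd 1 X) z) $ k" and ?M = "L (pd \<i> (pd 1 X) z) $ k"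
 note s = second_order[OF z]
 have C: "L (pd \<i> (pd \<i> X) z) $ k = - ?A"
 proof -
  have "pd \<i> (pd \<i> X) z = - pd 1 (pd 1 X) z" using s(3) by (simp add: eq_neg_iff_add_eq_0 add.commute)
  then show ?thesis using linear_neg[OF bounded_linear.linear[OF L_component[of k]], of "pd 1 (pd 1 X) z"] by simp
 qed
 have lin: "pd v (pd w X) z = Re v *\<^sub>R pd 1 (pd w X) z + Im v *\<^sub>R pd \<i> (pd w X) z" for v w
 proof -
  note l = has_derivative_linear[OF differentiable_has_pd[OF dX(2)[OF z, of w]]]
  have "v = Re v *\<^sub>R 1 + Im v *\<^sub>R \<i>" by (simp add: complex_eq_iff)
  then have "pd v (pd w X) z = pd (Re v *\<^sub>R 1 + Im v *\<^sub>R \<i>) (pd w X) z" by simp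
  then show ?thesis unfolding linear_add[OF l] linear_scale[OF l] .
 qed
 have Lv: "L (pd v (pd w X) z) $ k = Re v * L (pd 1 (pd w X) z) $ k + Im v * L (pd \<i> (pd w X) z) $ k" for v w
  unfolding lin[of v]
  by (simp add: linear_add[OF bounded_linear.linear[OF L_component[of k]]] linear_scale[OF bounded_linear.linear[OF L_component[of k]]])
 have "(wdata k has_derivative (%v. of_real (L (pd v (pd 1 X) z) $ k) - \<i> * of_real (L (pd v (pd \<i> X) z) $ k))) (at z)"
  unfolding wdata_def[abs_def]
  by (intro has_derivative_diff has_derivative_mult_right has_derivative_of_real
    bounded_linear.has_derivative[OF L_component] differentiable_has_pd dX z)
 moreover have "of_real (L (pd v (pd 1 X) z) $ k) - \<i> * of_real (L (pd v (pd \<i> X) z) $ k) = (of_real ?A - \<i> * of_real ?M) * v" for v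
  unfolding Lv[of v] C s(4) by (simp add: complex_eq_iff algebra_simps)
 ultimately show ?thesis by (simp add: has_field_derivative_def)
qed

lemma wdata_holomorphic: "wdata k holomorphic_on PP"
 using wdata_deriv open_PP by (auto simp: holomorphic_on_open)

lemma wdata_null: assumes "z \<in> PP" shows "(\<Sum>k\<in>UNIV. (wdata k z)\<^sup>2) = 0"
proof -
 have "(wdata k z)\<^sup>2 = of_real (L (pd 1 X z) $ k * L (pd 1 X z) $ k) - of_real (L (pd \<i> X z) $ k * L (pd \<i> X z) $ k)
  - 2 * \<i> * of_real (L (pd 1 X z) $ k * L (pd \<i> X z) $ k)" for k
  by (simp add: wdata_def power2_eq_square algebra_simps)
 then have "(\<Sum>k\<in>UNIV. (wdata k z)\<^sup>2) = of_real (\<Sum>k\<in>UNIV. L (pd 1 X z) $ k * L (pd 1 X z) $ k)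
  - of_real (\<Sum>k\<in>UNIV. L (pd \<i> X z) $ k * L (pd \<i> X z) $ k) - 2 * \<i> * of_real (\<Sum>k\<in>UNIV. L (pd 1 X z) $ k * L (pd \<i> X z) $ k)"
  by (simp add: sum_subtractf sum_distrib_left)
 then show ?thesis unfolding L_sum using E_props(2,3)[OF assms] by (simp add: ffE_def ffF_def ffG_def)
qed

lemma norm_sum_components: "(\<Sum>k\<in>UNIV. (norm (complex_of_real (L u $ k) - \<i> * of_real (L v $ k)))\<^sup>2) = u \<bullet> u + v \<bullet> v"
 unfolding cmod_power2 by (simp add: sum.distrib power2_eq_square L_sum)

lemma wdata_norm: "z \<in> PP ==> null_norm wdata z = 2 * ffE X z"
 using E_props(2)[of z] unfolding null_norm_def wdata_def norm_sum_components by (simp add: ffE_def ffG_def)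

text \<open>The tangential parts of the second derivatives, isolated by \<open>frame_norm\<close>,
  cancel against \<open>null_mixed\<close>. The normal parts are the entries of the second
  fundamental form, which is trace-free by minimality.\<close>

lemma wdata_curv:
 assumes z: "z \<in> PP" shows "null_curv wdata z = - 2 * (gauss_curvature X z * area_density X z)"
proof -
 define e where "e = ffE X z"
 define a where "a = pd 1 X z"
 define b where "b = pd \<i> X z"
 define A where "A = pd 1 (pd 1 X) z"
 define M where "M = pd \<i> (pd 1 X) z"
 define n where "n = sgn (cross3 a b)"
 define p where "p = A \<bullet> a"
 define q where "q = M \<bullet> a"
 note s = second_order[OF z, folded A_def M_def a_def b_def]
 have e: "e > 0" "a \<bullet> a = e" "b \<bullet> b = e" "a \<bullet> b = 0"
  using E_props(1-3)[OF z] by (simp_all add: e_def a_def b_def ffE_def ffF_def ffG_def)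
 note d = wdata_deriv[OF z, THEN DERIV_imp_deriv, folded A_def M_def]
 have AA: "A \<bullet> A = (p\<^sup>2 + q\<^sup>2) / e + (A \<bullet> n)\<^sup>2"
  using frame_norm[OF e(2-4,1), of A] s(1) unfolding n_def p_def q_def by simp
 have MM: "M \<bullet> M = (q\<^sup>2 + p\<^sup>2) / e + (M \<bullet> n)\<^sup>2"
  using frame_norm[OF e(2-4,1), of M] s(2) unfolding n_def p_def q_def by simp
 have T: "null_dnorm wdata z = A \<bullet> A + M \<bullet> M"
  unfolding null_dnorm_def d norm_sum_components ..
 have "null_mixed wdata z = of_real (\<Sum>k\<in>UNIV. L a $ k * L A $ k) + of_real (\<Sum>k\<in>UNIV. L b $ k * L M $ k)
  + \<i> * of_real (\<Sum>k\<in>UNIV. L a $ k * L M $ k) - \<i> * of_real (\<Sum>k\<in>UNIV. L b $ k * L A $ k)"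
  unfolding null_mixed_def d wdata_def a_def[symmetric] b_def[symmetric]
  by (simp add: sum_3 algebra_simps)
 then have "null_mixed wdata z = of_real (2 * p) + \<i> * of_real (2 * q)"
  unfolding L_sum using s(1,2) by (simp add: inner_commute p_def q_def)
 then have S: "(norm (null_mixed wdata z))\<^sup>2 = 4 * (p\<^sup>2 + q\<^sup>2)" by (simp add: cmod_power2 power_mult_distrib)
 have curv: "null_curv wdata z = 4 * ((A \<bullet> A + M \<bullet> M) * (2 * e) - 4 * (p\<^sup>2 + q\<^sup>2)) / (2 * e)\<^sup>2"
  unfolding null_curv_def T S wdata_norm[OF z] e_def ..
 have "(A \<bullet> A + M \<bullet> M) * (2 * e) - 4 * (p\<^sup>2 + q\<^sup>2) = 2 * e * ((A \<bullet> n)\<^sup>2 + (M \<bullet> n)\<^sup>2)"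
  unfolding AA MM using e(1) by (simp add: field_simps)
 then have 1: "null_curv wdata z = 2 * ((A \<bullet> n)\<^sup>2 + (M \<bullet> n)\<^sup>2) / e"
  unfolding curv using e(1) by (simp add: field_simps power2_eq_square)
 have "pd \<i> (pd \<i> X) z = - A" using s(3) by (simp add: eq_neg_iff_add_eq_0 add.commute)
 then have "gauss_curvature X z = (- (A \<bullet> n)\<^sup>2 - (M \<bullet> n)\<^sup>2) / e\<^sup>2"
  unfolding gauss_curvature_def E_props(4)[OF z] sfL_def sfM_def sfN_def unit_normal_def e_def[symmetric]
   A_def[symmetric] M_def[symmetric] a_def[symmetric] b_def[symmetric] n_def[symmetric]
  by (simp add: power2_eq_square)
 then show ?thesis unfolding 1 E_props(5)[OF z] e_def[symmetric] using e(1) by (simp add: field_simps power2_eq_square)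
qed

lemma wdata_per:
 assumes "embedded t X" "z \<in> PP" "l \<in> lattice t" shows "wdata k (z + l) = wdata k z"
proof -
 have X: "X (w + l) = X w" if "w \<in> PP" for w
  using assms(1,3) that punctured_plane_add[OF assms(3), of w] unfolding embedded_def by simp
 have "pd v X (z + l) = pd v X z" for v
  by (rule pd_shift[OF differentiable_has_pd[OF dX(1)] open_PP assms(2) X]) (simp_all only: punctured_plane_add[OF assms(3)] assms(2))
 then show ?thesis by (simp add: wdata_def)
qed

lemma wdata_reflect:
 assumes z: "z \<in> PP" and s: "s = 1 \<or> s = -1" and c: "c = 1 \<or> c = -1"
  and par: "\<And>w. w \<in> PP ==> L (X (of_real s * cnj w)) $ k = s * c * L (X w) $ k + d"
 shows "wdata k (of_real s * cnj z) = of_real c * cnj (wdata k z)"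
proof -
 have \<sigma>: "of_real s * cnj z \<in> PP" using s z punctured_plane_reflect by auto
 have D: "((%w. L (X w) $ k) has_derivative (%v. L (pd v X w) $ k)) (at w)" if "w \<in> PP" for w
  by (rule bounded_linear.has_derivative[OF L_component differentiable_has_pd[OF dX(1)[OF that]]])
 have r: "((%w. of_real s * cnj w) has_derivative (%v. of_real s * cnj v)) (at z)"
  by (auto intro!: derivative_eq_intros)
 have "L (pd (of_real s * cnj v) X (of_real s * cnj z)) $ k = s * c * L (pd v X z) $ k" for v
 proof -
  have 1: "((%w. L (X (of_real s * cnj w)) $ k) has_derivative (%v. L (pd (of_real s * cnj v) X (of_real s * cnj z)) $ k)) (at z)"
   by (rule has_derivative_compose[OF r D[OF \<sigma>]])
  have 2: "((%w. s * c * L (X w) $ k + d) has_derivative (%v. s * c * L (pd v X z) $ k)) (at z)"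
   by (rule has_derivative_add_const[OF has_derivative_mult_right[OF D[OF z]]])
  show ?thesis
   using pd_cong_open[OF open_PP z, of "%w. L (X (of_real s * cnj w)) $ k" "%w. s * c * L (X w) $ k + d" v] par unfolding pd_eqI[OF 1] pd_eqI[OF 2] by simp
 qed
 note h = this
 have lin: "L (pd (- v) X w) $ k = - (L (pd v X w) $ k)" if "w \<in> PP" for v w
  using linear_neg[OF has_derivative_linear[OF differentiable_has_pd[OF dX(1)[OF that]]], of v]
   linear_neg[OF bounded_linear.linear[OF L_component[of k]], of "pd v X w"] by simp
 from s show ?thesis
 proof
  assume s1: "s = 1"
  then show ?thesis using h[of 1] h[of "- \<i>"] lin[OF z, of \<i>] c unfolding wdata_def by (auto simp: complex_eq_iff)
 next
  assume s1: "s = -1"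
  then show ?thesis using h[of "-1"] h[of \<i>] lin[OF z, of 1] c unfolding wdata_def by (auto simp: complex_eq_iff)
 qed
qed

end

section \<open>Completeness, symmetry and index form in terms of the Weierstrass data\<close>

context puncture_torus
begin

text \<open>On a compact set and on its translates \<open>bell t (z - a)\<close> is bounded below by
  a positive constant, whereas along the path it tends to 0.\<close>

lemma divergent_path_puncture:
 assumes \<gamma>: "\<gamma> C1_differentiable_on {0..}" "\<gamma> ` {0..} \<subseteq> PP" and a: "a \<in> punctures t" and lim: "(\<gamma> \<longlongrightarrow> a) at_top"
 shows "divergent_path t \<gamma>"
 unfolding divergent_path_def
proof (intro conjI allI impI \<gamma>)
 fix K assume K: "compact K \<and> K \<subseteq> PP"
 have c: "continuous_on S (%z. bell t (z - a))" for S unfolding bell_def by (intro continuous_intros)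
 obtain s where s: "s > 0" "\<forall>z\<in>K. s \<le> bell t (z - a)"
 proof (cases "K = {}")
  case False
  then obtain z0 where z0: "z0 \<in> K" "\<forall>z\<in>K. bell t (z0 - a) \<le> bell t (z - a)"
   using continuous_attains_inf[OF _ _ c, of K] K by blast
  have "z0 - a \<notin> lattice t" using z0(1) K a by (auto simp: punctured_plane_alt)
  then show ?thesis using that[of "bell t (z0 - a)"] z0(2) bell_pos[OF t0] by blast
 qed (use that[of 1] in simp)
 have "((%x. bell t (\<gamma> x - a)) \<longlongrightarrow> bell t (a - a)) at_top"
  unfolding bell_def by (intro tendsto_intros lim)
 then have "\<forall>\<^sub>F x in at_top. bell t (\<gamma> x - a) < s" by (rule order_tendstoD(2)) (simp add: bell_def s)
 then show "\<forall>\<^sub>F x in at_top. \<gamma> x \<notin> lattice_translates t K"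
 proof eventually_elim
  case (elim x)
  show ?case
  proof
   assume "\<gamma> x \<in> lattice_translates t K"
   then obtain z l where zl: "\<gamma> x = z + l" "z \<in> K" "l \<in> lattice t" by (auto simp: lattice_translates_def)
   then have "bell t (\<gamma> x - a) = bell t (z - a)" using bell_lattice[OF t0 zl(3), of "z - a"] by (simp add: algebra_simps)
   then show False using elim s(2) zl(2) by force
  qed
 qed
qed

end

context rotated_minimal_torus
begin

lemma wdata_complete:
 assumes comp: "complete_surface t X"
  and \<gamma>: "\<gamma> C1_differentiable_on {0..}" "\<gamma> ` {0..} \<subseteq> PP" "a \<in> punctures t" "(\<gamma> \<longlongrightarrow> a) at_top"
 shows "(\<integral>\<^sup>+s\<in>{0..}. ennreal (sqrt (null_norm wdata (\<gamma> s)) * norm (vector_derivative \<gamma> (at s))) \<partial>lborel) = \<infinity>"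
proof -
 have "\<infinity> = (\<integral>\<^sup>+s\<in>{0..}. ennreal (norm (vector_derivative (X \<circ> \<gamma>) (at s))) \<partial>lborel)"
  using comp divergent_path_puncture[OF \<gamma>] unfolding complete_surface_def by simp
 also have "\<dots> \<le> (\<integral>\<^sup>+s\<in>{0..}. ennreal (sqrt (null_norm wdata (\<gamma> s)) * norm (vector_derivative \<gamma> (at s))) \<partial>lborel)"
 proof (rule nn_integral_mono)
  fix s :: real
  have "norm (vector_derivative (X \<circ> \<gamma>) (at s)) \<le> sqrt (null_norm wdata (\<gamma> s)) * norm (vector_derivative \<gamma> (at s))" if s: "s \<ge> 0"
  proof -
   define z where "z = \<gamma> s"
   define v where "v = vector_derivative \<gamma> (at s)"
   have z: "z \<in> PP" using \<gamma>(2) s by (auto simp: z_def)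
   have "\<gamma> differentiable (at s)" using \<gamma>(1) s unfolding C1_differentiable_on_eq by auto
   then have dv: "(\<gamma> has_derivative (%h. h *\<^sub>R v)) (at s)"
    unfolding v_def vector_derivative_works has_vector_derivative_def .
   note dXz = differentiable_has_pd[OF dX(1)[OF z]] and l = has_derivative_linear[OF differentiable_has_pd[OF dX(1)[OF z]]]
   have "((%s. X (\<gamma> s)) has_derivative (%h. pd (h *\<^sub>R v) X z)) (at s)"
    by (rule has_derivative_compose[OF dv]) (use dXz in \<open>simp add: z_def\<close>)
   then have "((X \<circ> \<gamma>) has_vector_derivative pd v X z) (at s)"
    unfolding has_vector_derivative_def linear_scale[OF l] o_def .
   then have vd: "vector_derivative (X \<circ> \<gamma>) (at s) = pd v X z" by (rule vector_derivative_at)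
   have "v = Re v *\<^sub>R 1 + Im v *\<^sub>R \<i>" by (simp add: complex_eq_iff)
   then have "pd v X z = pd (Re v *\<^sub>R 1 + Im v *\<^sub>R \<i>) X z" by simp
   then have pv: "pd v X z = Re v *\<^sub>R pd 1 X z + Im v *\<^sub>R pd \<i> X z" unfolding linear_add[OF l] linear_scale[OF l] .
   have "(norm (pd v X z))\<^sup>2 = ffE X z * (norm v)\<^sup>2"
    using E_props(2,3)[OF z] unfolding cmod_power2[of v] unfolding power2_norm_eq_inner pv
    by (simp add: inner_add_left inner_add_right inner_commute[of "pd \<i> X z" "pd 1 X z"] ffE_def ffF_def ffG_def power2_eq_square algebra_simps)
   also have "\<dots> \<le> null_norm wdata z * (norm v)\<^sup>2"
    using E_props(1)[OF z] by (intro mult_right_mono) (simp_all add: wdata_norm[OF z])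
   finally have "norm (pd v X z) \<le> sqrt (null_norm wdata z * (norm v)\<^sup>2)" by (rule real_le_rsqrt)
   then show ?thesis unfolding vd by (simp add: real_sqrt_mult z_def v_def)
  qed
  then show "ennreal (norm (vector_derivative (X \<circ> \<gamma>) (at s))) * indicator {0..} s
    \<le> ennreal (sqrt (null_norm wdata (\<gamma> s)) * norm (vector_derivative \<gamma> (at s))) * indicator {0..} s"
   by (auto simp: indicator_def intro!: ennreal_leI)
 qed
 finally show ?thesis by (simp add: top_unique)
qed

lemma null_torus_wdata:
 assumes emb: "embedded t X" and comp: "complete_surface t X" and ftc: "finite_total_curvature t X"
  and sym: "\<And>z. z \<in> PP ==> d + L (X (1 - cnj z)) = \<tau>1 (d + L (X z))"
   "\<And>z. z \<in> PP ==> d + L (X (cnj z + \<i> * of_real t)) = \<tau>2 (d + L (X z))"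
 shows "null_torus t wdata"
proof
 show "\<forall>z\<in>PP. (\<Sum>k\<in>UNIV. (wdata k z)\<^sup>2) = 0" using wdata_null by blast
 show "null_norm wdata z > 0" if "z \<in> PP" for z using wdata_norm[OF that] E_props(1)[OF that] by simp
 have Xp: "X (w + l) = X w" if "w \<in> PP" "l \<in> lattice t" for w l
  using emb that punctured_plane_add[OF that(2), of w] unfolding embedded_def by simp
 show "wdata k (- cnj z) = of_real (sgn1 k) * cnj (wdata k z)" if z: "z \<in> PP" for z k
 proof -
  \<comment> \<open>The translation part of the rigid motion survives only in the reflected
    coordinate, and differentiation removes it.\<close>
  define c where "c = (if k = 1 then - 2 * d $ 1 else 0)"
  have "L (X (of_real (-1) * cnj w)) $ k = (-1) * sgn1 k * L (X w) $ k + c" if w: "w \<in> PP" for w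
  proof -
   have "X (- cnj w + 1) = X (- cnj w)" using w punctured_plane_reflect by (intro Xp lattice_1) auto
   then have "d + L (X (- cnj w)) = \<tau>1 (d + L (X w))" using sym(1)[OF w] by simp
   then have "(d + L (X (- cnj w))) $ k = \<tau>1 (d + L (X w)) $ k" by simp
   then show ?thesis using exhaust_3[of k] by (auto simp: \<tau>1_def c_def)
  qed
  from wdata_reflect[OF z _ _ this] show ?thesis by (auto simp: sgn1_def)
 qed
 show "wdata k (cnj z) = of_real (sgn2 k) * cnj (wdata k z)" if z: "z \<in> PP" for z k
 proof -
  define c where "c = (if k = 2 then - 2 * d $ 2 else 0)"
  have "L (X (of_real 1 * cnj w)) $ k = 1 * sgn2 k * L (X w) $ k + c" if w: "w \<in> PP" for w
  proof -
   have "X (cnj w + \<i> * of_real t) = X (cnj w)" using w punctured_plane_reflect by (intro Xp lattice_it) auto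
   then have "d + L (X (cnj w)) = \<tau>2 (d + L (X w))" using sym(2)[OF w] by simp
   then have "(d + L (X (cnj w))) $ k = \<tau>2 (d + L (X w)) $ k" by simp
   then show ?thesis using exhaust_3[of k] by (auto simp: \<tau>2_def c_def)
  qed
  from wdata_reflect[OF z _ _ this] show ?thesis by (auto simp: sgn2_def)
 qed
 have "set_integrable lborel (PP \<inter> fund_domain t) (%z. - 2 * (gauss_curvature X z * area_density X z))"
 proof (rule set_integrable_mult_right)
  have m: "PP \<inter> fund_domain t \<in> sets lborel" using open_PP fund_domain_measurable by auto
  show "set_integrable lborel (PP \<inter> fund_domain t) (%z. gauss_curvature X z * area_density X z)"
   using ftc unfolding finite_total_curvature_def by (rule set_integrable_subset[OF _ m]) auto
 qed
 then show "set_integrable lborel (PP \<inter> fund_domain t) (null_curv wdata)"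
  by (rule set_integrable_cong[THEN iffD1, rotated 3]) (simp_all add: wdata_curv)
qed (use wdata_holomorphic wdata_per[OF emb] wdata_complete[OF comp] in blast)+

lemma index_form_wdata:
 assumes "null_torus t wdata" "tame t f"
 shows "index_form t X f = torus_potential.B t (null_curv wdata) f f"
proof -
 interpret null_torus t wdata by fact
 have "(grad_sq X f z + 2 * gauss_curvature X z * (f z)\<^sup>2) * area_density X z
   = pd 1 f z * pd 1 f z + pd \<i> f z * pd \<i> f z - f z * (null_curv wdata z * f z)" for z
 proof (cases "z \<in> PP")
  case True
  note E = E_props[OF True]
  have "grad_sq X f z * ffE X z = (pd 1 f z)\<^sup>2 + (pd \<i> f z)\<^sup>2"
   unfolding grad_sq_def E(2-4) using E(1) by (simp add: field_simps power2_eq_square)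
  then show ?thesis unfolding wdata_curv[OF True] E(5) by (simp add: power2_eq_square algebra_simps)
 next
  case False
  then show ?thesis using tame_0[OF assms(2)] tame_0[OF tame_pd[OF assms(2)]] by (simp add: grad_sq_def)
 qed
 then show ?thesis by (simp add: index_form_def B_def fint_def)
qed

end

theorem mainTheorem8:
  fixes t :: real and X :: "complex \<Rightarrow> real^3"
  assumes "t \<ge> 1" and "hoffman_meeks_surface t X"
  shows "morse_index t X \<ge> 4"
proof -
 have hm: "conformal_minimal_immersion t X" "embedded t X" "complete_surface t X" "finite_total_curvature t X" "reflection_symmetric t X"
  using assms(2) by (simp_all add: hoffman_meeks_surface_def)
 obtain R where R: "\<forall>p q. dist (R p) (R q) = dist p q" "\<forall>z\<in>punctured_plane t.
  R (X (1 - cnj z)) = \<tau>1 (R (X z)) \<and> R (X (cnj z + \<i> * of_real t)) = \<tau>2 (R (X z))"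
  using hm(5) unfolding reflection_symmetric_def by blast
 \<comment> \<open>A distance-preserving map of Euclidean space that fixes the origin is linear, so
   subtracting the image of the origin leaves an orthogonal map.\<close>
 define L where "L = (%p. R p - R 0)"
 have L: "orthogonal_transformation L"
  unfolding orthogonal_transformation_isometry L_def using R(1) by (simp add: dist_norm)
 interpret rotated_minimal_torus t X L by unfold_locales (rule assms hm L)+
 have RL: "R p = R 0 + L p" for p by (simp add: L_def)
 have nt: "null_torus t wdata"
  by (rule null_torus_wdata[OF hm(2-4), of "R 0"]) (use R(2) in \<open>simp_all only: RL[symmetric]\<close>)
 interpret null_torus t wdata by (rule nt)
 obtain \<psi> P Q where fam: "negative_family 4 \<psi> P Q" using four_negative_directions by blast
 have "negative_definite_basis t X 4 \<psi>"
  unfolding negative_definite_basis_def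
 proof (intro conjI allI impI)
  show "\<psi> i \<in> test_functions t" if "i < 4" for i
   using fam that by (intro tame_test_functions) (auto simp: negative_family_def)
  show "index_form t X (%z. \<Sum>i<4. c i * \<psi> i z) < 0" if "\<exists>i<4. c i \<noteq> 0" for c
   using negative_family_definite[OF fam that] index_form_wdata[OF nt] by simp
 qed
 then have "enat 4 \<le> morse_index t X" unfolding morse_index_def by (intro Sup_upper) blast
 then show ?thesis by (simp add: numeral_eq_enat)
qed

end
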